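(* Let $G$ and $H$ be finite isocategorical groups. Then $\mathrm{Rep}\,D(G)$ and $\mathrm{Rep}\,D(H)$ are equivalent as braided monoidal categories, and there is an isomorphism of abelian groups $W(\mathrm{Rep}\,D(G))\cong W(\mathrm{Rep}\,D(H))$.
   Context: For a finite group $G$, $\mathrm{Rep}\,G$ is the $\mathbb{C}$-linear monoidal category of finite-dimensional complex representations of $G$. Finite groups $G$ and $H$ are called isocategorical if $\mathrm{Rep}\,G$ and $\mathrm{Rep}\,H$ are equivalent as $\mathbb{C}$-linear monoidal categories (the equivalence is not required to respect the symmetries). $\mathrm{Rep}\,D(G)$ denotes the category of finite-dimensional complex representations of the Drinfeld double $D(G)$ of $G$: its objects are finite-dimensional $G$-graded vector spaces $V=\bigoplus_{g\in G}V_g$ with a $G$-action such that $g\cdot V_h\subseteq V_{ghg^{-1}}$; morphisms are $G$-equivariant grading-preserving linear maps; the tensor product is the usual one (with diagonal action and product grading); the braiding is $c_{V,W}(v\otimes w)=gw\otimes v$ for $v\in V_g$. Witt group. Let $\mathcal{C}$ be a $k$-linear rigid braided monoidal category with finite direct sums, braiding $c$ and unit $I$, where $k$ is a commutative ring with $\frac12\in k$. For each object $M$ fix a dual $M^*$ with $\mathrm{ev}_M:M^*\otimes M\to I$ and $\mathrm{coev}_M:I\to M\otimes M^*$ satisfying the duality (triangle) identities. A bilinear form $b:M\otimes M\to I$ is symmetric if $b\circ c_{M,M}=b$, and non-singular if $h_M(b):=(b\otimes 1_{M^*})\circ(1_M\otimes \mathrm{coev}_M):M\to M^*$ is an isomorphism.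 A non-singular quadratic object is a pair $(M,b)$ with $b$ symmetric and non-singular; an isometry $(M,b)\to(M',b')$ is an isomorphism $f:M\to M'$ with $b'\circ(f\otimes f)=b$. The orthogonal sum is $(M,b)\perp(M',b')=(M\oplus M',b\oplus b')$ (zero on the cross terms). $\mathcal{Q}$ is the category of non-singular quadratic objects with isometries as morphisms. An object $M$ is weakly symmetric if $\mathrm{ev}_M=\mathrm{ev}_M\circ c_{M,M^*}\circ c_{M^*,M}$; $\mathcal{D}$ is the category of weakly symmetric objects with isomorphisms as morphisms. For $M\in\mathcal{D}$ the hyperbolic object is $\mathcal{H}(M)=(M\oplus M^*,b_M)$, where $b_M$ vanishes on $M\otimes M$ and on $M^*\otimes M^*$, equals $\mathrm{ev}_M$ on $M^*\otimes M$, and equals $\mathrm{ev}_M\circ c_{M,M^*}$ on $M\otimes M^*$. The Witt group is $W(\mathcal{C})=K_0(\mathcal{Q})/\mathrm{Im}(K_0(\mathcal{H}):K_0(\mathcal{D})\to K_0(\mathcal{Q}))$, where $K_0$ denotes the Grothendieck group of the commutative monoid of isomorphism classes under $\perp$ (resp. $\oplus$). *)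

theory Defs
  imports
    "HOL-Algebra.Coset"
    "Jordan_Normal_Form.VS_Connect"
begin

section \<open>Linear monoidal categories, functors and equivalences\<close>

text \<open>
  The records carry only the data of a \<open>'k\<close>-linear (braided) monoidal category. One value of
  type \<open>'m\<close> may be a morphism between several pairs of objects (a matrix can intertwine
  different representations), so functors act on morphisms with explicit source and target.
\<close>

record ('o, 'm, 'k) linear_moncat =
  obj :: "'o set"
  mor :: "'o \<Rightarrow> 'o \<Rightarrow> 'm set"
  idm :: "'o \<Rightarrow> 'm"
  cmp :: "'m \<Rightarrow> 'm \<Rightarrow> 'm"  (infixr "\<cdot>\<index>" 68)
  zerom :: "'o \<Rightarrow> 'o \<Rightarrow> 'm"
  addm :: "'m \<Rightarrow> 'm \<Rightarrow> 'm"  (infixl "\<oplus>\<^sub>m\<index>" 65)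
  scalem :: "'k \<Rightarrow> 'm \<Rightarrow> 'm"
  unito :: "'o"
  teno :: "'o \<Rightarrow> 'o \<Rightarrow> 'o"  (infixl "\<otimes>\<^sub>o\<index>" 72)
  tenm :: "'m \<Rightarrow> 'm \<Rightarrow> 'm"  (infixl "\<otimes>\<^sub>m\<index>" 72)
  assoc :: "'o \<Rightarrow> 'o \<Rightarrow> 'o \<Rightarrow> 'm"  \<comment> \<open>\<open>(X \<otimes> Y) \<otimes> Z \<rightarrow> X \<otimes> (Y \<otimes> Z)\<close>\<close>
  lunit :: "'o \<Rightarrow> 'm"  \<comment> \<open>\<open>I \<otimes> X \<rightarrow> X\<close>\<close>
  runit :: "'o \<Rightarrow> 'm"  \<comment> \<open>\<open>X \<otimes> I \<rightarrow> X\<close>\<close>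

record ('o, 'm, 'k) braided_linear_moncat = "('o, 'm, 'k) linear_moncat" +
  braid :: "'o \<Rightarrow> 'o \<Rightarrow> 'm"  \<comment> \<open>\<open>X \<otimes> Y \<rightarrow> Y \<otimes> X\<close>\<close>

definition inverse_mor ::
  "('o, 'm, 'k, 'x) linear_moncat_scheme \<Rightarrow> 'o \<Rightarrow> 'o \<Rightarrow> 'm \<Rightarrow> 'm \<Rightarrow> bool" where
  "inverse_mor C X Y f g \<longleftrightarrow> f \<in> mor C X Y \<and> g \<in> mor C Y X \<and>
     g \<cdot>\<^bsub>C\<^esub> f = idm C X \<and> f \<cdot>\<^bsub>C\<^esub> g = idm C Y"

definition iso_mor :: "('o, 'm, 'k, 'x) linear_moncat_scheme \<Rightarrow> 'o \<Rightarrow> 'o \<Rightarrow> 'm \<Rightarrow> bool" where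
  "iso_mor C X Y f \<longleftrightarrow> (\<exists>g. inverse_mor C X Y f g)"

definition inv_mor :: "('o, 'm, 'k, 'x) linear_moncat_scheme \<Rightarrow> 'o \<Rightarrow> 'o \<Rightarrow> 'm \<Rightarrow> 'm" where
  "inv_mor C X Y f = (THE g. inverse_mor C X Y f g)"

record ('o, 'm, 'p, 'n) funct =
  fobj :: "'o \<Rightarrow> 'p"
  fmor :: "'o \<Rightarrow> 'o \<Rightarrow> 'm \<Rightarrow> 'n"

definition id_funct :: "('o, 'm, 'o, 'm) funct" where
  "id_funct = \<lparr>fobj = (\<lambda>X. X), fmor = (\<lambda>X Y f. f)\<rparr>"

definition comp_funct ::
  "('p, 'n, 'q, 'l) funct \<Rightarrow> ('o, 'm, 'p, 'n) funct \<Rightarrow> ('o, 'm, 'q, 'l) funct" where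
  "comp_funct K F = \<lparr>fobj = (\<lambda>X. fobj K (fobj F X)),
     fmor = (\<lambda>X Y f. fmor K (fobj F X) (fobj F Y) (fmor F X Y f))\<rparr>"

locale is_functor =
  fixes C :: "('o, 'm, 'k, 'x) linear_moncat_scheme"
    and D :: "('p, 'n, 'k, 'y) linear_moncat_scheme"
    and F :: "('o, 'm, 'p, 'n) funct"
  assumes fobj_closed: "X \<in> obj C \<Longrightarrow> fobj F X \<in> obj D"
    and fmor_closed: "\<lbrakk>X \<in> obj C; Y \<in> obj C; f \<in> mor C X Y\<rbrakk>
      \<Longrightarrow> fmor F X Y f \<in> mor D (fobj F X) (fobj F Y)"
    and fmor_id: "X \<in> obj C \<Longrightarrow> fmor F X X (idm C X) = idm D (fobj F X)"
    and fmor_comp: "\<lbrakk>X \<in> obj C; Y \<in> obj C; Z \<in> obj C; f \<in> mor C X Y; g \<in> mor C Y Z\<rbrakk>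
      \<Longrightarrow> fmor F X Z (g \<cdot>\<^bsub>C\<^esub> f) = fmor F Y Z g \<cdot>\<^bsub>D\<^esub> fmor F X Y f"

locale is_linear_functor = is_functor C D F
  for C :: "('o, 'm, 'k, 'x) linear_moncat_scheme"
    and D :: "('p, 'n, 'k, 'y) linear_moncat_scheme"
    and F :: "('o, 'm, 'p, 'n) funct" +
  assumes fmor_add: "\<lbrakk>X \<in> obj C; Y \<in> obj C; f \<in> mor C X Y; g \<in> mor C X Y\<rbrakk>
      \<Longrightarrow> fmor F X Y (f \<oplus>\<^sub>m\<^bsub>C\<^esub> g) = fmor F X Y f \<oplus>\<^sub>m\<^bsub>D\<^esub> fmor F X Y g"
    and fmor_scale: "\<lbrakk>X \<in> obj C; Y \<in> obj C; f \<in> mor C X Y\<rbrakk>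
      \<Longrightarrow> fmor F X Y (scalem C a f) = scalem D a (fmor F X Y f)"

definition natural_iso ::
  "('o, 'm, 'k, 'x) linear_moncat_scheme \<Rightarrow> ('p, 'n, 'k, 'y) linear_moncat_scheme \<Rightarrow>
   ('o, 'm, 'p, 'n) funct \<Rightarrow> ('o, 'm, 'p, 'n) funct \<Rightarrow> ('o \<Rightarrow> 'n) \<Rightarrow> bool" where
  "natural_iso C D F K \<eta> \<longleftrightarrow>
     (\<forall>X\<in>obj C. iso_mor D (fobj F X) (fobj K X) (\<eta> X)) \<and>
     (\<forall>X\<in>obj C. \<forall>Y\<in>obj C. \<forall>f\<in>mor C X Y.
        fmor K X Y f \<cdot>\<^bsub>D\<^esub> \<eta> X = \<eta> Y \<cdot>\<^bsub>D\<^esub> fmor F X Y f)"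

definition equivalence_functor ::
  "('o, 'm, 'k, 'x) linear_moncat_scheme \<Rightarrow> ('p, 'n, 'k, 'y) linear_moncat_scheme \<Rightarrow>
   ('o, 'm, 'p, 'n) funct \<Rightarrow> bool" where
  "equivalence_functor C D F \<longleftrightarrow> is_functor C D F \<and>
     (\<exists>K \<eta> \<theta>. is_functor D C K \<and>
        natural_iso C C id_funct (comp_funct K F) \<eta> \<and>
        natural_iso D D (comp_funct F K) id_funct \<theta>)"

text \<open>A strong monoidal functor, with structure isomorphisms
  \<open>J X Y : F X \<otimes> F Y \<rightarrow> F (X \<otimes> Y)\<close> and \<open>e : I \<rightarrow> F I\<close>.\<close>

locale is_linear_monoidal_functor = is_linear_functor C D F
  for C :: "('o, 'm, 'k, 'x) linear_moncat_scheme"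
    and D :: "('p, 'n, 'k, 'y) linear_moncat_scheme"
    and F :: "('o, 'm, 'p, 'n) funct"
    and J :: "'o \<Rightarrow> 'o \<Rightarrow> 'n"
    and e :: "'n" +
  assumes J_iso: "\<lbrakk>X \<in> obj C; Y \<in> obj C\<rbrakk>
      \<Longrightarrow> iso_mor D (fobj F X \<otimes>\<^sub>o\<^bsub>D\<^esub> fobj F Y) (fobj F (X \<otimes>\<^sub>o\<^bsub>C\<^esub> Y)) (J X Y)"
    and e_iso: "iso_mor D (unito D) (fobj F (unito C)) e"
    and J_natural: "\<lbrakk>X \<in> obj C; X' \<in> obj C; Y \<in> obj C; Y' \<in> obj C; f \<in> mor C X X'; g \<in> mor C Y Y'\<rbrakk>
      \<Longrightarrow> fmor F (X \<otimes>\<^sub>o\<^bsub>C\<^esub> Y) (X' \<otimes>\<^sub>o\<^bsub>C\<^esub> Y') (f \<otimes>\<^sub>m\<^bsub>C\<^esub> g) \<cdot>\<^bsub>D\<^esub> J X Y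
          = J X' Y' \<cdot>\<^bsub>D\<^esub> (fmor F X X' f \<otimes>\<^sub>m\<^bsub>D\<^esub> fmor F Y Y' g)"
    and J_assoc: "\<lbrakk>X \<in> obj C; Y \<in> obj C; Z \<in> obj C\<rbrakk>
      \<Longrightarrow> fmor F (X \<otimes>\<^sub>o\<^bsub>C\<^esub> Y \<otimes>\<^sub>o\<^bsub>C\<^esub> Z) (X \<otimes>\<^sub>o\<^bsub>C\<^esub> (Y \<otimes>\<^sub>o\<^bsub>C\<^esub> Z)) (assoc C X Y Z)
            \<cdot>\<^bsub>D\<^esub> J (X \<otimes>\<^sub>o\<^bsub>C\<^esub> Y) Z \<cdot>\<^bsub>D\<^esub> (J X Y \<otimes>\<^sub>m\<^bsub>D\<^esub> idm D (fobj F Z))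
          = J X (Y \<otimes>\<^sub>o\<^bsub>C\<^esub> Z) \<cdot>\<^bsub>D\<^esub> (idm D (fobj F X) \<otimes>\<^sub>m\<^bsub>D\<^esub> J Y Z)
            \<cdot>\<^bsub>D\<^esub> assoc D (fobj F X) (fobj F Y) (fobj F Z)"
    and J_lunit: "X \<in> obj C
      \<Longrightarrow> fmor F (unito C \<otimes>\<^sub>o\<^bsub>C\<^esub> X) X (lunit C X) \<cdot>\<^bsub>D\<^esub> J (unito C) X
            \<cdot>\<^bsub>D\<^esub> (e \<otimes>\<^sub>m\<^bsub>D\<^esub> idm D (fobj F X)) = lunit D (fobj F X)"
    and J_runit: "X \<in> obj C
      \<Longrightarrow> fmor F (X \<otimes>\<^sub>o\<^bsub>C\<^esub> unito C) X (runit C X) \<cdot>\<^bsub>D\<^esub> J X (unito C)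
            \<cdot>\<^bsub>D\<^esub> (idm D (fobj F X) \<otimes>\<^sub>m\<^bsub>D\<^esub> e) = runit D (fobj F X)"

locale is_linear_braided_functor = is_linear_monoidal_functor C D F J e
  for C :: "('o, 'm, 'k, 'x) braided_linear_moncat_scheme"
    and D :: "('p, 'n, 'k, 'y) braided_linear_moncat_scheme"
    and F :: "('o, 'm, 'p, 'n) funct"
    and J :: "'o \<Rightarrow> 'o \<Rightarrow> 'n"
    and e :: "'n" +
  assumes J_braid: "\<lbrakk>X \<in> obj C; Y \<in> obj C\<rbrakk>
      \<Longrightarrow> fmor F (X \<otimes>\<^sub>o\<^bsub>C\<^esub> Y) (Y \<otimes>\<^sub>o\<^bsub>C\<^esub> X) (braid C X Y) \<cdot>\<^bsub>D\<^esub> J X Y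
          = J Y X \<cdot>\<^bsub>D\<^esub> braid D (fobj F X) (fobj F Y)"

definition monoidally_equivalent ::
  "('o, 'm, 'k, 'x) linear_moncat_scheme \<Rightarrow> ('p, 'n, 'k, 'y) linear_moncat_scheme \<Rightarrow> bool" where
  "monoidally_equivalent C D \<longleftrightarrow>
     (\<exists>F J e. is_linear_monoidal_functor C D F J e \<and> equivalence_functor C D F)"

definition braided_equivalent ::
  "('o, 'm, 'k, 'x) braided_linear_moncat_scheme \<Rightarrow>
   ('p, 'n, 'k, 'y) braided_linear_moncat_scheme \<Rightarrow> bool" where
  "braided_equivalent C D \<longleftrightarrow>
     (\<exists>F J e. is_linear_braided_functor C D F J e \<and> equivalence_functor C D F)"


section \<open>Grothendieck groups\<close>

text \<open>The monoid of \<open>R\<close>-classes of \<open>A\<close>, with the operation and unit induced by \<open>s\<close> and \<open>z\<close>.\<close>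

definition class_monoid :: "'a set \<Rightarrow> ('a \<times> 'a) set \<Rightarrow> ('a \<Rightarrow> 'a \<Rightarrow> 'a) \<Rightarrow> 'a \<Rightarrow> 'a set monoid" where
  "class_monoid A R s z =
     \<lparr>carrier = A // R,
      mult = (\<lambda>P Q. \<Union>x\<in>P. \<Union>y\<in>Q. R `` {s x y}),
      one = R `` {z}\<rparr>"

definition class_map :: "('b \<times> 'b) set \<Rightarrow> ('a \<Rightarrow> 'b) \<Rightarrow> 'a set \<Rightarrow> 'b set" where
  "class_map R f P = (\<Union>x\<in>P. R `` {f x})"

definition groth_rel :: "('a, 'x) monoid_scheme \<Rightarrow> (('a \<times> 'a) \<times> ('a \<times> 'a)) set" where
  "groth_rel M = {((a, b), (c, d)) | a b c d.
     a \<in> carrier M \<and> b \<in> carrier M \<and> c \<in> carrier M \<and> d \<in> carrier M \<and>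
     (\<exists>e\<in>carrier M. a \<otimes>\<^bsub>M\<^esub> d \<otimes>\<^bsub>M\<^esub> e = c \<otimes>\<^bsub>M\<^esub> b \<otimes>\<^bsub>M\<^esub> e)}"

definition K0 :: "('a, 'x) monoid_scheme \<Rightarrow> ('a \<times> 'a) set monoid" where
  "K0 M = class_monoid (carrier M \<times> carrier M) (groth_rel M)
     (\<lambda>(a, b) (c, d). (a \<otimes>\<^bsub>M\<^esub> c, b \<otimes>\<^bsub>M\<^esub> d)) (\<one>\<^bsub>M\<^esub>, \<one>\<^bsub>M\<^esub>)"

definition K0_map ::
  "('b, 'y) monoid_scheme \<Rightarrow> ('a \<Rightarrow> 'b) \<Rightarrow> ('a \<times> 'a) set \<Rightarrow> ('b \<times> 'b) set" where
  "K0_map N f = class_map (groth_rel N) (\<lambda>(a, b). (f a, f b))"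


section \<open>Witt groups of braided linear monoidal categories\<close>

definition is_dual ::
  "('o, 'm, 'k, 'x) linear_moncat_scheme \<Rightarrow> 'o \<Rightarrow> 'o \<Rightarrow> 'm \<Rightarrow> 'm \<Rightarrow> bool" where
  "is_dual C M M' ev coev \<longleftrightarrow> M' \<in> obj C \<and>
     ev \<in> mor C (M' \<otimes>\<^sub>o\<^bsub>C\<^esub> M) (unito C) \<and> coev \<in> mor C (unito C) (M \<otimes>\<^sub>o\<^bsub>C\<^esub> M') \<and>
     runit C M \<cdot>\<^bsub>C\<^esub> (idm C M \<otimes>\<^sub>m\<^bsub>C\<^esub> ev) \<cdot>\<^bsub>C\<^esub> assoc C M M' M \<cdot>\<^bsub>C\<^esub> (coev \<otimes>\<^sub>m\<^bsub>C\<^esub> idm C M) = lunit C M \<and>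
     lunit C M' \<cdot>\<^bsub>C\<^esub> (ev \<otimes>\<^sub>m\<^bsub>C\<^esub> idm C M')
       \<cdot>\<^bsub>C\<^esub> inv_mor C (M' \<otimes>\<^sub>o\<^bsub>C\<^esub> M \<otimes>\<^sub>o\<^bsub>C\<^esub> M') (M' \<otimes>\<^sub>o\<^bsub>C\<^esub> (M \<otimes>\<^sub>o\<^bsub>C\<^esub> M')) (assoc C M' M M')
       \<cdot>\<^bsub>C\<^esub> (idm C M' \<otimes>\<^sub>m\<^bsub>C\<^esub> coev) = runit C M'"

definition dual_choice :: "('o, 'm, 'k, 'x) linear_moncat_scheme \<Rightarrow> 'o \<Rightarrow> 'o \<times> 'm \<times> 'm" where
  "dual_choice C M = (SOME (M', ev, coev). is_dual C M M' ev coev)"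

definition dual :: "('o, 'm, 'k, 'x) linear_moncat_scheme \<Rightarrow> 'o \<Rightarrow> 'o" where
  "dual C M = fst (dual_choice C M)"

definition ev :: "('o, 'm, 'k, 'x) linear_moncat_scheme \<Rightarrow> 'o \<Rightarrow> 'm" where
  "ev C M = fst (snd (dual_choice C M))"

definition coev :: "('o, 'm, 'k, 'x) linear_moncat_scheme \<Rightarrow> 'o \<Rightarrow> 'm" where
  "coev C M = snd (snd (dual_choice C M))"

definition is_zero_obj :: "('o, 'm, 'k, 'x) linear_moncat_scheme \<Rightarrow> 'o \<Rightarrow> bool" where
  "is_zero_obj C Z \<longleftrightarrow> Z \<in> obj C \<and> idm C Z = zerom C Z Z"

definition zero_obj :: "('o, 'm, 'k, 'x) linear_moncat_scheme \<Rightarrow> 'o" where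
  "zero_obj C = (SOME Z. is_zero_obj C Z)"

definition is_direct_sum ::
  "('o, 'm, 'k, 'x) linear_moncat_scheme \<Rightarrow> 'o \<Rightarrow> 'o \<Rightarrow> 'o \<Rightarrow> 'm \<Rightarrow> 'm \<Rightarrow> 'm \<Rightarrow> 'm \<Rightarrow> bool" where
  "is_direct_sum C M N S i1 i2 p1 p2 \<longleftrightarrow> S \<in> obj C \<and>
     i1 \<in> mor C M S \<and> i2 \<in> mor C N S \<and> p1 \<in> mor C S M \<and> p2 \<in> mor C S N \<and>
     p1 \<cdot>\<^bsub>C\<^esub> i1 = idm C M \<and> p2 \<cdot>\<^bsub>C\<^esub> i2 = idm C N \<and>
     p1 \<cdot>\<^bsub>C\<^esub> i2 = zerom C N M \<and> p2 \<cdot>\<^bsub>C\<^esub> i1 = zerom C M N \<and>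
     i1 \<cdot>\<^bsub>C\<^esub> p1 \<oplus>\<^sub>m\<^bsub>C\<^esub> i2 \<cdot>\<^bsub>C\<^esub> p2 = idm C S"

definition dsum_choice ::
  "('o, 'm, 'k, 'x) linear_moncat_scheme \<Rightarrow> 'o \<Rightarrow> 'o \<Rightarrow> 'o \<times> 'm \<times> 'm \<times> 'm \<times> 'm" where
  "dsum_choice C M N = (SOME (S, i1, i2, p1, p2). is_direct_sum C M N S i1 i2 p1 p2)"

definition dsum :: "('o, 'm, 'k, 'x) linear_moncat_scheme \<Rightarrow> 'o \<Rightarrow> 'o \<Rightarrow> 'o" where
  "dsum C M N = (case dsum_choice C M N of (S, i1, i2, p1, p2) \<Rightarrow> S)"

definition dproj1 :: "('o, 'm, 'k, 'x) linear_moncat_scheme \<Rightarrow> 'o \<Rightarrow> 'o \<Rightarrow> 'm" where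
  "dproj1 C M N = (case dsum_choice C M N of (S, i1, i2, p1, p2) \<Rightarrow> p1)"

definition dproj2 :: "('o, 'm, 'k, 'x) linear_moncat_scheme \<Rightarrow> 'o \<Rightarrow> 'o \<Rightarrow> 'm" where
  "dproj2 C M N = (case dsum_choice C M N of (S, i1, i2, p1, p2) \<Rightarrow> p2)"

text \<open>\<open>M \<cong> M \<otimes> I \<rightarrow> M \<otimes> (M \<otimes> M*) \<cong> (M \<otimes> M) \<otimes> M* \<rightarrow> I \<otimes> M* \<cong> M*\<close>\<close>

definition form_adjoint :: "('o, 'm, 'k, 'x) linear_moncat_scheme \<Rightarrow> 'o \<Rightarrow> 'm \<Rightarrow> 'm" where
  "form_adjoint C M b =
     lunit C (dual C M) \<cdot>\<^bsub>C\<^esub> (b \<otimes>\<^sub>m\<^bsub>C\<^esub> idm C (dual C M))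
     \<cdot>\<^bsub>C\<^esub> inv_mor C (M \<otimes>\<^sub>o\<^bsub>C\<^esub> M \<otimes>\<^sub>o\<^bsub>C\<^esub> dual C M) (M \<otimes>\<^sub>o\<^bsub>C\<^esub> (M \<otimes>\<^sub>o\<^bsub>C\<^esub> dual C M)) (assoc C M M (dual C M))
     \<cdot>\<^bsub>C\<^esub> (idm C M \<otimes>\<^sub>m\<^bsub>C\<^esub> coev C M)
     \<cdot>\<^bsub>C\<^esub> inv_mor C (M \<otimes>\<^sub>o\<^bsub>C\<^esub> unito C) M (runit C M)"

definition quad_objs :: "('o, 'm, 'k, 'x) braided_linear_moncat_scheme \<Rightarrow> ('o \<times> 'm) set" where
  "quad_objs C = {(M, b). M \<in> obj C \<and> b \<in> mor C (M \<otimes>\<^sub>o\<^bsub>C\<^esub> M) (unito C) \<and>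
     b \<cdot>\<^bsub>C\<^esub> braid C M M = b \<and> iso_mor C M (dual C M) (form_adjoint C M b)}"

definition isometry_rel ::
  "('o, 'm, 'k, 'x) braided_linear_moncat_scheme \<Rightarrow> (('o \<times> 'm) \<times> ('o \<times> 'm)) set" where
  "isometry_rel C = {((M, b), (M', b')) | M b M' b'.
     (M, b) \<in> quad_objs C \<and> (M', b') \<in> quad_objs C \<and>
     (\<exists>f. iso_mor C M M' f \<and> b' \<cdot>\<^bsub>C\<^esub> (f \<otimes>\<^sub>m\<^bsub>C\<^esub> f) = b)}"

fun orth_sum ::
  "('o, 'm, 'k, 'x) braided_linear_moncat_scheme \<Rightarrow> 'o \<times> 'm \<Rightarrow> 'o \<times> 'm \<Rightarrow> 'o \<times> 'm" where
  "orth_sum C (M, b) (M', b') =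
     (dsum C M M',
      b \<cdot>\<^bsub>C\<^esub> (dproj1 C M M' \<otimes>\<^sub>m\<^bsub>C\<^esub> dproj1 C M M')
        \<oplus>\<^sub>m\<^bsub>C\<^esub> b' \<cdot>\<^bsub>C\<^esub> (dproj2 C M M' \<otimes>\<^sub>m\<^bsub>C\<^esub> dproj2 C M M'))"

definition quad_monoid :: "('o, 'm, 'k, 'x) braided_linear_moncat_scheme \<Rightarrow> ('o \<times> 'm) set monoid" where
  "quad_monoid C = class_monoid (quad_objs C) (isometry_rel C) (orth_sum C)
     (zero_obj C, zerom C (zero_obj C \<otimes>\<^sub>o\<^bsub>C\<^esub> zero_obj C) (unito C))"

definition wsym_objs :: "('o, 'm, 'k, 'x) braided_linear_moncat_scheme \<Rightarrow> 'o set" where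
  "wsym_objs C = {M \<in> obj C.
     ev C M = ev C M \<cdot>\<^bsub>C\<^esub> braid C M (dual C M) \<cdot>\<^bsub>C\<^esub> braid C (dual C M) M}"

definition wsym_iso_rel :: "('o, 'm, 'k, 'x) braided_linear_moncat_scheme \<Rightarrow> ('o \<times> 'o) set" where
  "wsym_iso_rel C = {(M, N). M \<in> wsym_objs C \<and> N \<in> wsym_objs C \<and> (\<exists>f. iso_mor C M N f)}"

definition wsym_monoid :: "('o, 'm, 'k, 'x) braided_linear_moncat_scheme \<Rightarrow> 'o set monoid" where
  "wsym_monoid C = class_monoid (wsym_objs C) (wsym_iso_rel C) (dsum C) (zero_obj C)"

definition hyperbolic :: "('o, 'm, 'k, 'x) braided_linear_moncat_scheme \<Rightarrow> 'o \<Rightarrow> 'o \<times> 'm" where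
  "hyperbolic C M =
     (let p = dproj1 C M (dual C M); q = dproj2 C M (dual C M) in
      (dsum C M (dual C M),
       ev C M \<cdot>\<^bsub>C\<^esub> (q \<otimes>\<^sub>m\<^bsub>C\<^esub> p)
         \<oplus>\<^sub>m\<^bsub>C\<^esub> ev C M \<cdot>\<^bsub>C\<^esub> braid C M (dual C M) \<cdot>\<^bsub>C\<^esub> (p \<otimes>\<^sub>m\<^bsub>C\<^esub> q)))"

definition K0_hyperbolic ::
  "('o, 'm, 'k, 'x) braided_linear_moncat_scheme \<Rightarrow> ('o set \<times> 'o set) set \<Rightarrow>
   (('o \<times> 'm) set \<times> ('o \<times> 'm) set) set" where
  "K0_hyperbolic C = K0_map (quad_monoid C) (class_map (isometry_rel C) (hyperbolic C))"

definition Witt ::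
  "('o, 'm, 'k, 'x) braided_linear_moncat_scheme \<Rightarrow>
   (('o \<times> 'm) set \<times> ('o \<times> 'm) set) set set monoid" where
  "Witt C = K0 (quad_monoid C) Mod (K0_hyperbolic C ` carrier (K0 (wsym_monoid C)))"


section \<open>Representations of a finite group and of its Drinfeld double\<close>

text \<open>
  Underlying spaces are the spaces \<open>\<complex>\<^sup>n\<close>, represented by \<^term>\<open>carrier_vec n :: complex vec set\<close>,
  and linear maps are matrices. The space \<open>\<complex>\<^sup>n \<otimes> \<complex>\<^sup>m\<close> is \<open>\<complex>\<^sup>n\<^sup>m\<close> with the basis
  \<open>e\<^sub>i \<otimes> e\<^sub>j = e\<^sub>k\<close>, \<open>k = i * m + j\<close>; with this lexicographic numbering the canonical maps
  \<open>(u \<otimes> v) \<otimes> w \<mapsto> u \<otimes> (v \<otimes> w)\<close>, \<open>1 \<otimes> v \<mapsto> v\<close> and \<open>v \<otimes> 1 \<mapsto> v\<close> are identity matrices.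
\<close>

definition tensor_vec :: "complex vec \<Rightarrow> complex vec \<Rightarrow> complex vec" where
  "tensor_vec v w = vec (dim_vec v * dim_vec w)
     (\<lambda>k. v $ (k div dim_vec w) * w $ (k mod dim_vec w))"

definition tensor_mat :: "complex mat \<Rightarrow> complex mat \<Rightarrow> complex mat" where
  "tensor_mat A B = mat (dim_row A * dim_row B) (dim_col A * dim_col B)
     (\<lambda>(k, l). A $$ (k div dim_row B, l div dim_col B) * B $$ (k mod dim_row B, l mod dim_col B))"

definition GL :: "nat \<Rightarrow> complex mat monoid" where
  "GL n = units_of (ring_mat TYPE(complex) n ())"

record 'a rep =
  rdim :: nat
  ract :: "'a \<Rightarrow> complex mat"

definition is_rep :: "('a, 'c) monoid_scheme \<Rightarrow> ('a, 'x) rep_scheme \<Rightarrow> bool" where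
  "is_rep G V \<longleftrightarrow> ract V \<in> hom G (GL (rdim V)) \<and> ract V \<in> extensional (carrier G)"

definition intertwiners ::
  "('a, 'c) monoid_scheme \<Rightarrow> ('a, 'x) rep_scheme \<Rightarrow> ('a, 'x) rep_scheme \<Rightarrow> complex mat set" where
  "intertwiners G V W = {A \<in> carrier_mat (rdim W) (rdim V).
     \<forall>g\<in>carrier G. A * ract V g = ract W g * A}"

definition Rep :: "('a, 'c) monoid_scheme \<Rightarrow> ('a rep, complex mat, complex) linear_moncat" where
  "Rep G =
     \<lparr>obj = {V. is_rep G V},
      mor = intertwiners G,
      idm = (\<lambda>V. 1\<^sub>m (rdim V)),
      cmp = (*),
      zerom = (\<lambda>V W. 0\<^sub>m (rdim W) (rdim V)),
      addm = (+),
      scalem = (\<cdot>\<^sub>m),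
      unito = \<lparr>rdim = 1, ract = (\<lambda>g\<in>carrier G. 1\<^sub>m 1)\<rparr>,
      teno = (\<lambda>V W. \<lparr>rdim = rdim V * rdim W,
        ract = (\<lambda>g\<in>carrier G. tensor_mat (ract V g) (ract W g))\<rparr>),
      tenm = tensor_mat,
      assoc = (\<lambda>U V W. 1\<^sub>m (rdim U * rdim V * rdim W)),
      lunit = (\<lambda>V. 1\<^sub>m (rdim V)),
      runit = (\<lambda>V. 1\<^sub>m (rdim V))\<rparr>"

definition isocategorical :: "('a, 'c) monoid_scheme \<Rightarrow> ('b, 'd) monoid_scheme \<Rightarrow> bool" where
  "isocategorical G H \<longleftrightarrow> monoidally_equivalent (Rep G) (Rep H)"

record 'a graded_rep = "'a rep" +
  rgrd :: "'a \<Rightarrow> complex vec set"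

definition is_grading :: "'a set \<Rightarrow> nat \<Rightarrow> ('a \<Rightarrow> complex vec set) \<Rightarrow> bool" where
  "is_grading I n V \<longleftrightarrow>
     V \<in> extensional I \<and>
     (\<forall>g\<in>I. subspace class_ring (V g) (module_vec TYPE(complex) n)) \<and>
     (\<forall>v\<in>carrier_vec n. \<exists>!u. u \<in> (\<Pi>\<^sub>E g\<in>I. V g) \<and> v = finsum (module_vec TYPE(complex) n) u I)"

definition is_graded_rep :: "('a, 'c) monoid_scheme \<Rightarrow> 'a graded_rep \<Rightarrow> bool" where
  "is_graded_rep G V \<longleftrightarrow> is_rep G V \<and> is_grading (carrier G) (rdim V) (rgrd V) \<and>
     (\<forall>g\<in>carrier G. \<forall>h\<in>carrier G. \<forall>v\<in>rgrd V h.
        ract V g *\<^sub>v v \<in> rgrd V (g \<otimes>\<^bsub>G\<^esub> h \<otimes>\<^bsub>G\<^esub> inv\<^bsub>G\<^esub> g))"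

definition tensor_grading ::
  "('a, 'c) monoid_scheme \<Rightarrow> 'a graded_rep \<Rightarrow> 'a graded_rep \<Rightarrow> 'a \<Rightarrow> complex vec set" where
  "tensor_grading G V W = (\<lambda>g\<in>carrier G.
     LinearCombinations.module.span class_ring (module_vec TYPE(complex) (rdim V * rdim W))
       {tensor_vec v w | v w h k. h \<in> carrier G \<and> k \<in> carrier G \<and> h \<otimes>\<^bsub>G\<^esub> k = g \<and>
          v \<in> rgrd V h \<and> w \<in> rgrd W k})"

text \<open>The matrix of the linear map with \<open>v \<otimes> w \<mapsto> g w \<otimes> v\<close> for \<open>v \<in> V\<^sub>g\<close>.\<close>

definition double_braiding ::
  "('a, 'c) monoid_scheme \<Rightarrow> 'a graded_rep \<Rightarrow> 'a graded_rep \<Rightarrow> complex mat" where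
  "double_braiding G V W = (THE A. A \<in> carrier_mat (rdim W * rdim V) (rdim V * rdim W) \<and>
     (\<forall>g\<in>carrier G. \<forall>v\<in>rgrd V g. \<forall>w\<in>carrier_vec (rdim W).
        A *\<^sub>v tensor_vec v w = tensor_vec (ract W g *\<^sub>v w) v))"

definition RepD ::
  "('a, 'c) monoid_scheme \<Rightarrow> ('a graded_rep, complex mat, complex) braided_linear_moncat" where
  "RepD G =
     \<lparr>obj = {V. is_graded_rep G V},
      mor = (\<lambda>V W. {A \<in> intertwiners G V W.
        \<forall>g\<in>carrier G. \<forall>v\<in>rgrd V g. A *\<^sub>v v \<in> rgrd W g}),
      idm = (\<lambda>V. 1\<^sub>m (rdim V)),
      cmp = (*),
      zerom = (\<lambda>V W. 0\<^sub>m (rdim W) (rdim V)),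
      addm = (+),
      scalem = (\<cdot>\<^sub>m),
      unito = \<lparr>rdim = 1, ract = (\<lambda>g\<in>carrier G. 1\<^sub>m 1),
        rgrd = (\<lambda>g\<in>carrier G. if g = \<one>\<^bsub>G\<^esub> then carrier_vec 1 else {0\<^sub>v 1})\<rparr>,
      teno = (\<lambda>V W. \<lparr>rdim = rdim V * rdim W,
        ract = (\<lambda>g\<in>carrier G. tensor_mat (ract V g) (ract W g)),
        rgrd = tensor_grading G V W\<rparr>),
      tenm = tensor_mat,
      assoc = (\<lambda>U V W. 1\<^sub>m (rdim U * rdim V * rdim W)),
      lunit = (\<lambda>V. 1\<^sub>m (rdim V)),
      runit = (\<lambda>V. 1\<^sub>m (rdim V)),
      braid = double_braiding G\<rparr>"

end

theory Submission
  imports Defs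
begin

text \<open>
  A grading of a representation \<open>V\<close> of \<open>G\<close> compatible with the action is the same as a half braiding on \<open>V\<close>:
  a natural family \<open>V \<otimes> W \<rightarrow> W \<otimes> V\<close>, for all representations \<open>W\<close>, compatible with tensor products
  (the grading is read off from the value at the unit element of the regular representation).
  Half braidings only involve the monoidal structure of \<open>Rep G\<close>, so a monoidal equivalence
  \<open>Rep G \<simeq> Rep H\<close> carries them back and forth and lifts to a functor \<open>Rep D(G) \<rightarrow> Rep D(H)\<close>, which
  is again an equivalence and is braided because the braiding is the half braiding itself.
  The Witt group in turn is built from duals, direct sums and the braiding, all of which a
  braided equivalence preserves up to isomorphism.
\<close>

section \<open>Tensor products of matrices\<close>

text \<open>Coherence data are removed at the outset: with lexicographic bases and extensional
  actions, both \<open>Rep G\<close> and \<open>RepD G\<close> are strictly associative and unital,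
  so string diagram arguments become identities between matrices. The first obstacle is that a half
  braiding on X yields maps \<open>F X \<otimes> F A \<rightarrow> F A \<otimes> F X\<close> only
  for objects in the image of F. It is extended to every W by conjugating with an isomorphism
  \<open>F A \<rightarrow> W\<close>; naturality together with fullness of F makes the result
  independent of the choice. The regular representation of H need not lie in the image of F either,
  so gradings are compared on an isomorphic test object. The second obstacle is that duals and
  direct sums in the Witt group are arbitrary choices, which F need not respect. Hence
  non-singularity is restated as \<open>b\<close> being the evaluation of a self-duality of M, weak
  symmetry and hyperbolic forms are treated for arbitrary duals and arbitrary direct sums, and only
  isometry classes are compared.\<close>

notation tensor_mat (infixr "**" 75)

text \<open>The range splits into \<open>a\<close> blocks of length \<open>b\<close>. As basis
  vectors of a tensor product are numbered by \<open>i * b + j\<close>, sums over such a basis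
  become double sums in this way.\<close>

lemma sum_div_mod:
  fixes f :: "nat \<Rightarrow> nat \<Rightarrow> 'a :: comm_monoid_add"
  shows "(\<Sum>k\<in>{0..<a * b}. f (k div b) (k mod b)) = (\<Sum>i\<in>{0..<a}. \<Sum>j\<in>{0..<b}. f i j)"
proof -
  have "(\<Sum>i\<in>{0..<a}. \<Sum>j\<in>{0..<b}. f i j)
      = (\<Sum>i<a. \<Sum>k\<in>{i * b..<i * b + b}. f (k div b) (k mod b))"
    unfolding lessThan_atLeast0
  proof (rule sum.cong[OF refl])
    fix i
    show "(\<Sum>j\<in>{0..<b}. f i j) = (\<Sum>k\<in>{i * b..<i * b + b}. f (k div b) (k mod b))"
    proof (rule sum.reindex_bij_witness[of _ "\<lambda>k. k - i * b" "\<lambda>j. i * b + j"])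
      fix j
      assume "j \<in> {0..<b}"
      then show "f ((i * b + j) div b) ((i * b + j) mod b) = f i j"
        by simp
    qed auto
  qed
  also have "\<dots> = (\<Sum>k<a * b. f (k div b) (k mod b))"
    by (rule sum.nat_group)
  finally show ?thesis
    by (simp add: lessThan_atLeast0)
qed

lemma div_less_of_mult: "k < a * b \<Longrightarrow> k div b < (a::nat)"
  by (simp add: less_mult_imp_div_less)

lemma mod_less_of_mult: "k < a * b \<Longrightarrow> k mod b < (b::nat)"
  by (cases "b = 0") auto

lemma dim_tensor_mat [simp]:
  "dim_row (A ** B) = dim_row A * dim_row B" "dim_col (A ** B) = dim_col A * dim_col B"
  by (simp_all add: tensor_mat_def)

lemma index_tensor_mat:
  "k < dim_row A * dim_row B \<Longrightarrow> l < dim_col A * dim_col B \<Longrightarrow>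
    (A ** B) $$ (k, l) = A $$ (k div dim_row B, l div dim_col B) * B $$ (k mod dim_row B, l mod dim_col B)"
  by (simp add: tensor_mat_def)

lemma tensor_mat_carrier:
  "A \<in> carrier_mat a b \<Longrightarrow> B \<in> carrier_mat c d \<Longrightarrow> A ** B \<in> carrier_mat (a * c) (b * d)"
  by (intro carrier_matI) auto

text \<open>The lexicographic numbering does not depend on the bracketing: dividing by
  \<open>p * q\<close> is dividing by \<open>q\<close> and then by \<open>p\<close>. This literal
  equality is what makes the categories below strict.\<close>

lemma tensor_mat_assoc: "(A ** B) ** C = A ** B ** C"
proof (rule eq_matI)
  fix k l
  assume "k < dim_row (A ** B ** C)" "l < dim_col (A ** B ** C)"
  then have k: "k < dim_row A * dim_row B * dim_row C" "k < dim_row A * (dim_row B * dim_row C)"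
    and l: "l < dim_col A * dim_col B * dim_col C" "l < dim_col A * (dim_col B * dim_col C)"
    by (simp_all add: mult.assoc)
  have a: "m mod (p * q) div q = m div q mod p" "m mod (p * q) mod q = m mod q" for m p q :: nat
    by (cases "q = 0"; simp add: mod_mult2_eq mult.commute[of p q])+
  have d: "m div (p * q) = m div q div p" for m p q :: nat
    by (metis div_mult2_eq mult.commute)
  show "((A ** B) ** C) $$ (k, l) = (A ** B ** C) $$ (k, l)"
    using k l div_less_of_mult[OF k(1)] div_less_of_mult[OF l(1)]
      mod_less_of_mult[OF k(2)] mod_less_of_mult[OF l(2)]
    by (simp add: index_tensor_mat a d mult.assoc)
qed (simp_all add: mult.assoc)

lemma tensor_mat_mult:
  assumes "dim_col A = dim_row C" "dim_col B = dim_row D"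
  shows "(A ** B) * (C ** D) = (A * C) ** (B * D)"
proof (rule eq_matI)
  fix k l
  assume "k < dim_row ((A * C) ** (B * D))" "l < dim_col ((A * C) ** (B * D))"
  then have kl: "k < dim_row A * dim_row B" "l < dim_col C * dim_col D"
    by simp_all
  note b = div_less_of_mult[OF kl(1)] div_less_of_mult[OF kl(2)]
    mod_less_of_mult[OF kl(1)] mod_less_of_mult[OF kl(2)]
  have "((A ** B) * (C ** D)) $$ (k, l)
    = (\<Sum>i\<in>{0..<dim_row C * dim_row D}. (A ** B) $$ (k, i) * (C ** D) $$ (i, l))"
    using kl assms by (simp add: scalar_prod_def)
  also have "\<dots> = (\<Sum>i\<in>{0..<dim_row C * dim_row D}.
      (A $$ (k div dim_row B, i div dim_row D) * C $$ (i div dim_row D, l div dim_col D)) *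
      (B $$ (k mod dim_row B, i mod dim_row D) * D $$ (i mod dim_row D, l mod dim_col D)))"
    using kl assms by (intro sum.cong) (auto simp: index_tensor_mat)
  also have "\<dots> = (\<Sum>i\<in>{0..<dim_row C}. \<Sum>j\<in>{0..<dim_row D}.
      (A $$ (k div dim_row B, i) * C $$ (i, l div dim_col D)) *
      (B $$ (k mod dim_row B, j) * D $$ (j, l mod dim_col D)))"
    by (rule sum_div_mod[where f = "\<lambda>i j. (A $$ (k div dim_row B, i) * C $$ (i, l div dim_col D)) *
      (B $$ (k mod dim_row B, j) * D $$ (j, l mod dim_col D))"])
  also have "\<dots> = ((A * C) ** (B * D)) $$ (k, l)"
  proof -
    have "(A * C) $$ (k div dim_row B, l div dim_col D)
        = (\<Sum>i\<in>{0..<dim_row C}. A $$ (k div dim_row B, i) * C $$ (i, l div dim_col D))"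
      "(B * D) $$ (k mod dim_row B, l mod dim_col D)
        = (\<Sum>j\<in>{0..<dim_row D}. B $$ (k mod dim_row B, j) * D $$ (j, l mod dim_col D))"
      using b assms by (auto simp: scalar_prod_def)
    moreover have "((A * C) ** (B * D)) $$ (k, l)
        = (A * C) $$ (k div dim_row B, l div dim_col D) * (B * D) $$ (k mod dim_row B, l mod dim_col D)"
      using kl by (subst index_tensor_mat) simp_all
    ultimately show ?thesis
      by (simp only: sum_product)
  qed
  finally show "((A ** B) * (C ** D)) $$ (k, l) = ((A * C) ** (B * D)) $$ (k, l)" .
qed simp_all

lemma tensor_one_mat: "1\<^sub>m a ** 1\<^sub>m b = 1\<^sub>m (a * b)"
proof (rule eq_matI)
  fix k l
  assume "k < dim_row (1\<^sub>m (a * b) :: complex mat)" "l < dim_col (1\<^sub>m (a * b) :: complex mat)"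
  then have kl: "k < a * b" "l < a * b"
    by simp_all
  moreover have "k div b = l div b \<and> k mod b = l mod b \<longleftrightarrow> k = l"
    by (metis div_mult_mod_eq)
  ultimately show "(1\<^sub>m a ** 1\<^sub>m b) $$ (k, l) = (1\<^sub>m (a * b) :: complex mat) $$ (k, l)"
    using div_less_of_mult[OF kl(1)] div_less_of_mult[OF kl(2)]
      mod_less_of_mult[OF kl(1)] mod_less_of_mult[OF kl(2)]
    by (auto simp: index_tensor_mat)
qed simp_all

lemma one_tensor_mat [simp]: "1\<^sub>m 1 ** A = A" "1\<^sub>m (Suc 0) ** A = A"
  by (rule eq_matI, auto simp: index_tensor_mat)+

lemma tensor_mat_one [simp]: "A ** 1\<^sub>m 1 = A" "A ** 1\<^sub>m (Suc 0) = A"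
  by (rule eq_matI, auto simp: index_tensor_mat)+

lemma add_tensor_mat:
  "dim_row A = dim_row B \<Longrightarrow> dim_col A = dim_col B \<Longrightarrow> (A + B) ** C = A ** C + B ** C"
  by (rule eq_matI) (auto simp: index_tensor_mat div_less_of_mult distrib_right)

lemma tensor_add_mat:
  "dim_row A = dim_row B \<Longrightarrow> dim_col A = dim_col B \<Longrightarrow> C ** (A + B) = C ** A + C ** B"
  by (rule eq_matI) (auto simp: index_tensor_mat mod_less_of_mult distrib_left)

lemma zero_tensor_mat [simp]: "0\<^sub>m a b ** A = 0\<^sub>m (a * dim_row A) (b * dim_col A)"
  by (rule eq_matI) (auto simp: index_tensor_mat div_less_of_mult)

lemma tensor_zero_mat [simp]: "A ** 0\<^sub>m a b = 0\<^sub>m (dim_row A * a) (dim_col A * b)"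
  by (rule eq_matI) (auto simp: index_tensor_mat mod_less_of_mult)

text \<open>The library's versions of these laws have hypotheses of the form \<^term>\<open>A \<in> carrier_mat n m\<close>,
  whose dimensions the simplifier cannot guess.\<close>

lemma mat_mult_assoc:
  "dim_col A = dim_row B \<Longrightarrow> dim_col B = dim_row C \<Longrightarrow> (A * B) * C = A * (B * (C :: 'a :: semiring_0 mat))"
  by (rule assoc_mult_mat[of _ "dim_row A" "dim_col A" _ "dim_col B" _ "dim_col C"]) auto

lemma mat_add_mult:
  "dim_row A = dim_row B \<Longrightarrow> dim_col A = dim_col B \<Longrightarrow> dim_col B = dim_row C \<Longrightarrow>
    (A + B) * C = A * C + B * (C :: 'a :: semiring_0 mat)"
  by (rule add_mult_distrib_mat[of _ "dim_row A" "dim_col A" _ _ "dim_col C"]) auto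

lemma mat_mult_add:
  "dim_row A = dim_row B \<Longrightarrow> dim_col A = dim_col B \<Longrightarrow> dim_col C = dim_row B \<Longrightarrow>
    C * (A + B) = C * A + C * (B :: 'a :: semiring_0 mat)"
  by (rule mult_add_distrib_mat[of _ "dim_row C" "dim_col C" _ "dim_col A"]) auto

lemma mat_smult_mult: "dim_col A = dim_row B \<Longrightarrow> (c \<cdot>\<^sub>m A) * B = c \<cdot>\<^sub>m (A * (B :: 'a :: comm_semiring_0 mat))"
  by (rule mult_smult_assoc_mat[of _ "dim_row A" "dim_col A" _ "dim_col B"]) auto

lemma mat_mult_smult: "dim_col A = dim_row B \<Longrightarrow> A * (c \<cdot>\<^sub>m B) = c \<cdot>\<^sub>m (A * (B :: 'a :: comm_semiring_0 mat))"
  by (rule mult_smult_distrib[of _ "dim_row A" "dim_col A" _ "dim_col B"]) auto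

text \<open>In string diagrams, two boxes on parallel strands slide past each other.\<close>

lemma tensor_mat_exchange:
  "a = dim_row A \<Longrightarrow> b = dim_row B \<Longrightarrow> a' = dim_col A \<Longrightarrow> b' = dim_col B \<Longrightarrow>
    (1\<^sub>m a ** B) * (A ** 1\<^sub>m b') = (A ** 1\<^sub>m b) * (1\<^sub>m a' ** B)"
  by (simp add: tensor_mat_mult)

text \<open>Tensors of standard basis vectors are exactly the standard basis vectors of the product,
  so each column is the value at a pure tensor. Vectors are taken as one-column matrices in order to
  stay within matrix products.\<close>

lemma mat_eq_tensorI:
  assumes "dim_row A = dim_row B" "dim_col A = n * m" "dim_col B = n * m"
    and eq: "\<And>v w. v \<in> carrier_mat n 1 \<Longrightarrow> w \<in> carrier_mat m 1 \<Longrightarrow> A * (v ** w) = B * (v ** w)"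
  shows "A = B"
proof (rule eq_matI)
  fix k l
  assume "k < dim_row B" "l < dim_col B"
  then have l: "l < n * m" and k: "k < dim_row A" "k < dim_row B"
    using assms by simp_all
  define u :: "nat \<Rightarrow> nat \<Rightarrow> complex mat" where "u = (\<lambda>p i. mat p 1 (\<lambda>(j, _). if j = i then 1 else 0))"
  have e: "u n (l div m) ** u m (l mod m) = u (n * m) l"
  proof (rule eq_matI)
    fix i j
    assume "i < dim_row (u (n * m) l)" "j < dim_col (u (n * m) l)"
    then have i: "i < n * m" "j = 0"
      by (simp_all add: u_def)
    have "i div m = l div m \<and> i mod m = l mod m \<longleftrightarrow> i = l"
      by (metis div_mult_mod_eq)
    then show "(u n (l div m) ** u m (l mod m)) $$ (i, j) = u (n * m) l $$ (i, j)"
      using i div_less_of_mult[OF i(1)] mod_less_of_mult[OF i(1)]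
      by (auto simp: index_tensor_mat u_def)
  qed (simp_all add: u_def)
  have c: "(X * u (n * m) l) $$ (k, 0) = X $$ (k, l)" if "k < dim_row X" "dim_col X = n * m" for X
    using that l by (simp add: scalar_prod_def u_def if_distrib sum.delta cong: if_cong)
  have "A * u (n * m) l = B * u (n * m) l"
    using eq[of "u n (l div m)" "u m (l mod m)"] unfolding e by (simp add: u_def)
  then show "A $$ (k, l) = B $$ (k, l)"
    using c[of A] c[of B] k assms by simp
qed (use assms in simp_all)

text \<open>The flip \<open>v \<otimes> w \<mapsto> w \<otimes> v\<close>: column
  \<open>i * m + j\<close> has its only 1 in row \<open>j * n + i\<close>.\<close>

definition swap_mat :: "nat \<Rightarrow> nat \<Rightarrow> complex mat" where
  "swap_mat n m = mat (m * n) (n * m) (\<lambda>(k, l). if k div n = l mod m \<and> k mod n = l div m then 1 else 0)"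

lemma dim_swap_mat [simp]: "dim_row (swap_mat n m) = m * n" "dim_col (swap_mat n m) = n * m"
  by (simp_all add: swap_mat_def)

text \<open>On both sides the entry is a sum in which the flip leaves exactly one term;
  \<open>delta\<close> evaluates such a double sum.\<close>

lemma swap_mat_tensor:
  assumes "a = dim_row A" "b = dim_col A" "c = dim_row B" "d = dim_col B"
  shows "swap_mat a c * (A ** B) = (B ** A) * swap_mat b d"
proof (rule eq_matI)
  fix k l
  assume "k < dim_row ((B ** A) * swap_mat b d)" "l < dim_col ((B ** A) * swap_mat b d)"
  then have kl: "k < c * a" "l < b * d"
    using assms by simp_all
  note bb = div_less_of_mult[OF kl(1)] div_less_of_mult[OF kl(2)]
    mod_less_of_mult[OF kl(1)] mod_less_of_mult[OF kl(2)]
  have delta: "(\<Sum>i\<in>{0..<p}. \<Sum>j\<in>{0..<q}. if x = j \<and> y = i then h i j else 0) = (h y x :: complex)"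
    if "y < p" "x < q" for p q x y :: nat and h
  proof -
    have "(\<Sum>j\<in>{0..<q}. if x = j \<and> y = i then h i j else 0) = (if y = i then h i x else 0)" for i
      using that by (cases "y = i") (simp_all add: sum.delta')
    then show ?thesis
      using that by (simp add: sum.delta')
  qed
  have "(swap_mat a c * (A ** B)) $$ (k, l)
    = (\<Sum>i\<in>{0..<a * c}. if k div a = i mod c \<and> k mod a = i div c
        then A $$ (i div c, l div d) * B $$ (i mod c, l mod d) else 0)"
    using kl assms
    by (simp add: scalar_prod_def swap_mat_def index_tensor_mat) (intro sum.cong, auto)
  also have "\<dots> = A $$ (k mod a, l div d) * B $$ (k div a, l mod d)"
    by (subst sum_div_mod[where f = "\<lambda>i j. if k div a = j \<and> k mod a = i
        then A $$ (i, l div d) * B $$ (j, l mod d) else 0"]) (rule delta[OF bb(3,1)])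
  also have "\<dots> = (\<Sum>i\<in>{0..<d * b}. if l div d = i mod b \<and> l mod d = i div b
        then B $$ (k div a, i div b) * A $$ (k mod a, i mod b) else 0)"
    by (subst sum_div_mod[where f = "\<lambda>i j. if l div d = j \<and> l mod d = i
        then B $$ (k div a, i) * A $$ (k mod a, j) else 0"], subst delta[OF bb(4,2)]) simp
  also have "\<dots> = ((B ** A) * swap_mat b d) $$ (k, l)"
    using kl assms
    by (simp add: scalar_prod_def swap_mat_def index_tensor_mat) (intro sum.cong, auto)
  finally show "(swap_mat a c * (A ** B)) $$ (k, l) = ((B ** A) * swap_mat b d) $$ (k, l)" .
qed (use assms in simp_all)

lemma swap_mat_one [simp]:
  "swap_mat n 1 = 1\<^sub>m n" "swap_mat 1 n = 1\<^sub>m n" "swap_mat n (Suc 0) = 1\<^sub>m n" "swap_mat (Suc 0) n = 1\<^sub>m n"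
  by (rule eq_matI, auto simp: swap_mat_def)+

lemma swap_mat_col:
  assumes "v \<in> carrier_mat n 1" "w \<in> carrier_mat m 1"
  shows "swap_mat n m * (v ** w) = w ** v"
  using swap_mat_tensor[of n v 1 m w 1] assms by auto

lemma swap_mat_swap_mat: "swap_mat m n * swap_mat n m = 1\<^sub>m (n * m)"
  by (rule mat_eq_tensorI[of _ _ n m])
    (auto simp: mat_mult_assoc swap_mat_col[unfolded One_nat_def] tensor_mat_carrier)

lemma mat_eq_tensor3I:
  assumes "dim_row A = dim_row B" "dim_col A = n * m * p" "dim_col B = n * m * p"
    and eq: "\<And>u v w. u \<in> carrier_mat n 1 \<Longrightarrow> v \<in> carrier_mat m 1 \<Longrightarrow> w \<in> carrier_mat p 1 \<Longrightarrow>
      A * (u ** v ** w) = B * (u ** v ** w)"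
  shows "A = B"
proof (rule mat_eq_tensorI[of _ _ n "m * p"])
  fix v :: "complex mat" and w :: "complex mat"
  assume v: "v \<in> carrier_mat n 1" and w: "w \<in> carrier_mat (m * p) 1"
  \<comment> \<open>Splitting off \<open>v ** 1\<close> reduces the claim to the two-factor
    criterion: the first vector is kept fixed and only the last two factors vary.\<close>
  have *: "X * (v ** w) = (X * (v ** 1\<^sub>m (m * p))) * w" if "dim_col X = n * m * p" for X
  proof -
    have "(v ** w) = (v ** 1\<^sub>m (m * p)) * (1\<^sub>m 1 ** w)"
      by (subst tensor_mat_mult) (use v w in auto)
    then show ?thesis
      using v w that by (simp add: mat_mult_assoc mult.assoc)
  qed
  have "A * (v ** 1\<^sub>m (m * p)) = B * (v ** 1\<^sub>m (m * p))"
  proof (rule mat_eq_tensorI[of _ _ m p])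
    fix a :: "complex mat" and b :: "complex mat"
    assume ab: "a \<in> carrier_mat m 1" "b \<in> carrier_mat p 1"
    have "(v ** 1\<^sub>m (m * p)) * (a ** b) = (v ** 1\<^sub>m (m * p)) * (1\<^sub>m 1 ** (a ** b))"
      by simp
    also have "\<dots> = v ** a ** b"
      by (subst tensor_mat_mult) (use v ab in auto)
    finally show "A * (v ** 1\<^sub>m (m * p)) * (a ** b) = B * (v ** 1\<^sub>m (m * p)) * (a ** b)"
      using v ab assms eq[OF v ab] by (simp add: mat_mult_assoc mult.assoc)
  qed (use v assms in auto)
  then show "A * (v ** w) = B * (v ** w)"
    using * assms by simp
qed (use assms in \<open>simp_all add: mult.assoc\<close>)

text \<open>The dimensions are arguments, so that the empty sum is the zero matrix of the intended
  shape.\<close>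

definition msum :: "nat \<Rightarrow> nat \<Rightarrow> ('i \<Rightarrow> complex mat) \<Rightarrow> 'i set \<Rightarrow> complex mat" where
  "msum n m f I = mat n m (\<lambda>ij. \<Sum>k\<in>I. f k $$ ij)"

lemma dim_msum [simp]: "dim_row (msum n m f I) = n" "dim_col (msum n m f I) = m"
  by (simp_all add: msum_def)

lemma msum_carrier [simp]: "msum n m f I \<in> carrier_mat n m"
  by (intro carrier_matI) simp_all

lemma index_msum: "i < n \<Longrightarrow> j < m \<Longrightarrow> msum n m f I $$ (i, j) = (\<Sum>k\<in>I. f k $$ (i, j))"
  by (simp add: msum_def)

lemma msum_cong: "I = I' \<Longrightarrow> (\<And>k. k \<in> I' \<Longrightarrow> f k = g k) \<Longrightarrow> msum n m f I = msum n m g I'"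
  by (auto simp: msum_def)

lemma mult_msum:
  assumes "\<And>k. k \<in> I \<Longrightarrow> f k \<in> carrier_mat n m" "dim_col A = n"
  shows "A * msum n m f I = msum (dim_row A) m (\<lambda>k. A * f k) I"
proof (rule eq_matI)
  fix i j
  assume "i < dim_row (msum (dim_row A) m (\<lambda>k. A * f k) I)" "j < dim_col (msum (dim_row A) m (\<lambda>k. A * f k) I)"
  then have ij: "i < dim_row A" "j < m"
    by simp_all
  have "(\<Sum>k\<in>I. (A * f k) $$ (i, j)) = (\<Sum>k\<in>I. \<Sum>l\<in>{0..<n}. A $$ (i, l) * f k $$ (l, j))"
    using ij assms by (intro sum.cong refl) (auto simp: scalar_prod_def carrier_matD[OF assms(1)])
  also have "\<dots> = (\<Sum>l\<in>{0..<n}. \<Sum>k\<in>I. A $$ (i, l) * f k $$ (l, j))"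
    by (rule sum.swap)
  finally show "(A * msum n m f I) $$ (i, j) = msum (dim_row A) m (\<lambda>k. A * f k) I $$ (i, j)"
    using ij assms by (simp add: index_msum scalar_prod_def sum_distrib_left)
qed simp_all

lemma msum_mult:
  assumes "\<And>k. k \<in> I \<Longrightarrow> f k \<in> carrier_mat n m" "dim_row A = m"
  shows "msum n m f I * A = msum n (dim_col A) (\<lambda>k. f k * A) I"
proof (rule eq_matI)
  fix i j
  assume "i < dim_row (msum n (dim_col A) (\<lambda>k. f k * A) I)" "j < dim_col (msum n (dim_col A) (\<lambda>k. f k * A) I)"
  then have ij: "i < n" "j < dim_col A"
    by simp_all
  have "(\<Sum>k\<in>I. (f k * A) $$ (i, j)) = (\<Sum>k\<in>I. \<Sum>l\<in>{0..<m}. f k $$ (i, l) * A $$ (l, j))"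
    using ij assms by (intro sum.cong refl) (auto simp: scalar_prod_def carrier_matD[OF assms(1)])
  also have "\<dots> = (\<Sum>l\<in>{0..<m}. \<Sum>k\<in>I. f k $$ (i, l) * A $$ (l, j))"
    by (rule sum.swap)
  finally show "(msum n m f I * A) $$ (i, j) = msum n (dim_col A) (\<lambda>k. f k * A) I $$ (i, j)"
    using ij assms by (simp add: index_msum scalar_prod_def sum_distrib_right)
qed simp_all

lemma tensor_msum:
  assumes "\<And>k. k \<in> I \<Longrightarrow> f k \<in> carrier_mat n m"
  shows "A ** msum n m f I = msum (dim_row A * n) (dim_col A * m) (\<lambda>k. A ** f k) I"
proof (rule eq_matI)
  fix i j
  assume "i < dim_row (msum (dim_row A * n) (dim_col A * m) (\<lambda>k. A ** f k) I)"
    "j < dim_col (msum (dim_row A * n) (dim_col A * m) (\<lambda>k. A ** f k) I)"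
  then have ij: "i < dim_row A * n" "j < dim_col A * m"
    by simp_all
  have "(\<Sum>k\<in>I. (A ** f k) $$ (i, j)) = (\<Sum>k\<in>I. A $$ (i div n, j div m) * f k $$ (i mod n, j mod m))"
    using ij assms by (intro sum.cong refl) (auto simp: index_tensor_mat carrier_matD[OF assms(1)])
  then show "(A ** msum n m f I) $$ (i, j) = msum (dim_row A * n) (dim_col A * m) (\<lambda>k. A ** f k) I $$ (i, j)"
    using ij by (simp add: index_msum index_tensor_mat mod_less_of_mult sum_distrib_left)
qed simp_all

lemma msum_tensor:
  assumes "\<And>k. k \<in> I \<Longrightarrow> f k \<in> carrier_mat n m"
  shows "msum n m f I ** A = msum (n * dim_row A) (m * dim_col A) (\<lambda>k. f k ** A) I"
proof (rule eq_matI)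
  fix i j
  assume "i < dim_row (msum (n * dim_row A) (m * dim_col A) (\<lambda>k. f k ** A) I)"
    "j < dim_col (msum (n * dim_row A) (m * dim_col A) (\<lambda>k. f k ** A) I)"
  then have ij: "i < n * dim_row A" "j < m * dim_col A"
    by simp_all
  have "(\<Sum>k\<in>I. (f k ** A) $$ (i, j))
      = (\<Sum>k\<in>I. f k $$ (i div dim_row A, j div dim_col A) * A $$ (i mod dim_row A, j mod dim_col A))"
    using ij assms by (intro sum.cong refl) (auto simp: index_tensor_mat carrier_matD[OF assms(1)])
  then show "(msum n m f I ** A) $$ (i, j) = msum (n * dim_row A) (m * dim_col A) (\<lambda>k. f k ** A) I $$ (i, j)"
    using ij by (simp add: index_msum index_tensor_mat div_less_of_mult sum_distrib_right)
qed simp_all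

lemma msum_reindex: "bij_betw h I J \<Longrightarrow> msum n m f J = msum n m (\<lambda>i. f (h i)) I"
  by (rule eq_matI) (auto simp: index_msum sum.reindex_bij_betw[of h I J, symmetric])

lemma msum_delta:
  assumes "finite I" "a \<in> I" "f a \<in> carrier_mat n m" "\<And>i. i \<in> I \<Longrightarrow> i \<noteq> a \<Longrightarrow> f i = 0\<^sub>m n m"
  shows "msum n m f I = f a"
proof (rule eq_matI)
  fix i j
  assume ij: "i < dim_row (f a)" "j < dim_col (f a)"
  have "(\<Sum>k\<in>I. f k $$ (i, j)) = (\<Sum>k\<in>I. if k = a then f a $$ (i, j) else 0)"
    using assms ij by (intro sum.cong) auto
  then show "msum n m f I $$ (i, j) = f a $$ (i, j)"
    using assms ij by (auto simp: index_msum)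
qed (use assms in auto)

section \<open>Classes, Grothendieck groups and quotients\<close>

lemma class_map_class:
  assumes R: "equiv A R" and R': "equiv A' R'"
    and f: "\<And>x y. (x, y) \<in> R \<Longrightarrow> (f x, f y) \<in> R'" and x: "x \<in> A"
  shows "class_map R' f (R `` {x}) = R' `` {f x}"
proof -
  have xx: "x \<in> R `` {x}"
    by (rule equiv_class_self[OF R x])
  have "R' `` {f y} = R' `` {f x}" if "y \<in> R `` {x}" for y
    using that f[of x y] equiv_class_eq[OF R', of "f x" "f y"] by auto
  then show ?thesis
    unfolding class_map_def using xx by blast
qed

lemma class_monoid_mult_class:
  assumes R: "equiv A R" and x: "x \<in> A" "y \<in> A"
    and s: "\<And>x x' y y'. (x, x') \<in> R \<Longrightarrow> (y, y') \<in> R \<Longrightarrow> (s x y, s x' y') \<in> R"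
  shows "mult (class_monoid A R s z) (R `` {x}) (R `` {y}) = R `` {s x y}"
proof -
  have xx: "x \<in> R `` {x}" "y \<in> R `` {y}"
    by (rule equiv_class_self[OF R], fact)+
  have "R `` {s x' y'} = R `` {s x y}" if "x' \<in> R `` {x}" "y' \<in> R `` {y}" for x' y'
    using that s[of x x' y y'] equiv_class_eq[OF R, of "s x y" "s x' y'"] by auto
  then have "(\<Union>x'\<in>R `` {x}. \<Union>y'\<in>R `` {y}. R `` {s x' y'}) = (\<Union>x'\<in>R `` {x}. \<Union>y'\<in>R `` {y}. R `` {s x y})"
    by blast
  also have "\<dots> = R `` {s x y}"
    using xx by blast
  finally show ?thesis
    by (simp add: class_monoid_def)
qed

text \<open>The operations of the quotients in question need not be known to be group operations: an
  isomorphism of the ingredients is transported through the set-theoretic constructions by taking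
  images. Hence only closure and compatibility with the operation are recorded here.\<close>

definition mult_iso :: "('a, 'x) monoid_scheme \<Rightarrow> ('b, 'y) monoid_scheme \<Rightarrow> ('a \<Rightarrow> 'b) \<Rightarrow> bool" where
  "mult_iso M N \<phi> \<longleftrightarrow> bij_betw \<phi> (carrier M) (carrier N) \<and>
     (\<forall>x\<in>carrier M. \<forall>y\<in>carrier M. x \<otimes>\<^bsub>M\<^esub> y \<in> carrier M \<and> \<phi> (x \<otimes>\<^bsub>M\<^esub> y) = \<phi> x \<otimes>\<^bsub>N\<^esub> \<phi> y)"

text \<open>The map \<open>f\<close> hits every class and respects the operation up to
  \<open>R'\<close>; since it also reflects the relation, the induced map on classes is bijective
  and multiplicative. This is the form in which an equivalence of categories acts on isomorphism
  classes.\<close>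

lemma mult_iso_class_monoid:
  assumes R: "equiv A R" and R': "equiv A' R'" and f: "\<And>x. x \<in> A \<Longrightarrow> f x \<in> A'"
    and fR: "\<And>x y. x \<in> A \<Longrightarrow> y \<in> A \<Longrightarrow> (f x, f y) \<in> R' \<longleftrightarrow> (x, y) \<in> R"
    and surj: "\<And>y. y \<in> A' \<Longrightarrow> \<exists>x\<in>A. (f x, y) \<in> R'"
    and s: "\<And>x x' y y'. (x, x') \<in> R \<Longrightarrow> (y, y') \<in> R \<Longrightarrow> (s x y, s x' y') \<in> R"
    and s': "\<And>x x' y y'. (x, x') \<in> R' \<Longrightarrow> (y, y') \<in> R' \<Longrightarrow> (s' x y, s' x' y') \<in> R'"
    and fs: "\<And>x y. x \<in> A \<Longrightarrow> y \<in> A \<Longrightarrow> (f (s x y), s' (f x) (f y)) \<in> R'"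
  shows "mult_iso (class_monoid A R s z) (class_monoid A' R' s' z') (class_map R' f)"
proof -
  have RA: "x \<in> A" "y \<in> A" if "(x, y) \<in> R" for x y
    using equivE[OF R] that by (auto simp: refl_on_def)
  have RA': "x \<in> A'" "y \<in> A'" if "(x, y) \<in> R'" for x y
    using equivE[OF R'] that by (auto simp: refl_on_def)
  have cm: "class_map R' f (R `` {x}) = R' `` {f x}" if "x \<in> A" for x
    by (rule class_map_class[OF R R' _ that]) (use RA fR in blast)
  have sA: "s x y \<in> A" if "x \<in> A" "y \<in> A" for x y
    using s[of x x y y] equivE[OF R] that RA by (auto simp: refl_on_def)
  have "inj_on (class_map R' f) (A // R)"
  proof (rule inj_onI)
    fix P Q
    assume PQ: "P \<in> A // R" "Q \<in> A // R" "class_map R' f P = class_map R' f Q"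
    then obtain x y where xy: "x \<in> A" "P = R `` {x}" "y \<in> A" "Q = R `` {y}"
      by (auto simp: quotient_def)
    then have "R' `` {f x} = R' `` {f y}"
      using PQ cm by simp
    then have "(f x, f y) \<in> R'"
      using eq_equiv_class[OF _ R'] f xy by blast
    then show "P = Q"
      using fR xy equiv_class_eq[OF R] by blast
  qed
  moreover have "class_map R' f ` (A // R) = A' // R'"
  proof (rule subset_antisym; rule subsetI)
    fix P
    assume "P \<in> class_map R' f ` (A // R)"
    then show "P \<in> A' // R'"
      using cm f by (auto simp: quotient_def)
  next
    fix P
    assume "P \<in> A' // R'"
    then obtain y where y: "y \<in> A'" "P = R' `` {y}"
      by (auto simp: quotient_def)
    obtain x where x: "x \<in> A" "(f x, y) \<in> R'"
      using surj[OF y(1)] by blast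
    have "P = class_map R' f (R `` {x})"
      using cm x y equiv_class_eq[OF R' x(2)] by simp
    then show "P \<in> class_map R' f ` (A // R)"
      using x by (auto simp: quotient_def)
  qed
  moreover have "mult (class_monoid A R s z) P Q \<in> A // R \<and>
    class_map R' f (mult (class_monoid A R s z) P Q)
      = mult (class_monoid A' R' s' z') (class_map R' f P) (class_map R' f Q)"
    if PQ: "P \<in> A // R" "Q \<in> A // R" for P Q
  proof -
    obtain x y where xy: "x \<in> A" "P = R `` {x}" "y \<in> A" "Q = R `` {y}"
      using PQ by (auto simp: quotient_def)
    have "mult (class_monoid A R s z) P Q = R `` {s x y}"
      using class_monoid_mult_class[OF R xy(1,3) s] xy by simp
    moreover have "mult (class_monoid A' R' s' z') (R' `` {f x}) (R' `` {f y}) = R' `` {s' (f x) (f y)}"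
      by (rule class_monoid_mult_class[OF R' f[OF xy(1)] f[OF xy(3)] s'])
    ultimately show ?thesis
      using cm sA xy equiv_class_eq[OF R' fs[OF xy(1,3)]] by (auto simp: quotient_def)
  qed
  ultimately show ?thesis
    unfolding mult_iso_def bij_betw_def by (simp add: class_monoid_def)
qed

lemma groth_rel_subset: "groth_rel M \<subseteq> (carrier M \<times> carrier M) \<times> (carrier M \<times> carrier M)"
  by (auto simp: groth_rel_def)

text \<open>The witness \<open>e\<close> in \<open>groth_rel\<close> ranges over the whole carrier,
  so the bijection moves it in both directions; injectivity turns the image of the stabilised
  equation back into the equation itself.\<close>

lemma image_groth_rel_class:
  assumes \<phi>: "mult_iso M N \<phi>" and ab: "a \<in> carrier M" "b \<in> carrier M"
  shows "map_prod \<phi> \<phi> ` (groth_rel M `` {(a, b)}) = groth_rel N `` {(\<phi> a, \<phi> b)}"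
proof -
  have bij: "inj_on \<phi> (carrier M)" "\<phi> ` carrier M = carrier N"
    and m: "\<And>x y. x \<in> carrier M \<Longrightarrow> y \<in> carrier M \<Longrightarrow> x \<otimes>\<^bsub>M\<^esub> y \<in> carrier M"
      "\<And>x y. x \<in> carrier M \<Longrightarrow> y \<in> carrier M \<Longrightarrow> \<phi> (x \<otimes>\<^bsub>M\<^esub> y) = \<phi> x \<otimes>\<^bsub>N\<^esub> \<phi> y"
    using \<phi> by (auto simp: mult_iso_def bij_betw_def)
  have rel: "((a, b), (c, d)) \<in> groth_rel M \<longleftrightarrow> ((\<phi> a, \<phi> b), (\<phi> c, \<phi> d)) \<in> groth_rel N"
    if cd: "c \<in> carrier M" "d \<in> carrier M" for c d
  proof -
    have "a \<otimes>\<^bsub>M\<^esub> d \<otimes>\<^bsub>M\<^esub> e = c \<otimes>\<^bsub>M\<^esub> b \<otimes>\<^bsub>M\<^esub> e \<longleftrightarrow>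
        \<phi> a \<otimes>\<^bsub>N\<^esub> \<phi> d \<otimes>\<^bsub>N\<^esub> \<phi> e = \<phi> c \<otimes>\<^bsub>N\<^esub> \<phi> b \<otimes>\<^bsub>N\<^esub> \<phi> e"
      if "e \<in> carrier M" for e
      using inj_on_eq_iff[OF bij(1), of "a \<otimes>\<^bsub>M\<^esub> d \<otimes>\<^bsub>M\<^esub> e" "c \<otimes>\<^bsub>M\<^esub> b \<otimes>\<^bsub>M\<^esub> e"] m ab cd that
      by simp
    then have "(\<exists>e\<in>carrier M. a \<otimes>\<^bsub>M\<^esub> d \<otimes>\<^bsub>M\<^esub> e = c \<otimes>\<^bsub>M\<^esub> b \<otimes>\<^bsub>M\<^esub> e) \<longleftrightarrow>
        (\<exists>e\<in>carrier N. \<phi> a \<otimes>\<^bsub>N\<^esub> \<phi> d \<otimes>\<^bsub>N\<^esub> e = \<phi> c \<otimes>\<^bsub>N\<^esub> \<phi> b \<otimes>\<^bsub>N\<^esub> e)"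
      unfolding bij(2)[symmetric] by auto
    then show ?thesis
      using ab cd bij by (auto simp: groth_rel_def)
  qed
  show ?thesis
  proof (rule subset_antisym; rule subsetI)
    fix p
    assume "p \<in> map_prod \<phi> \<phi> ` (groth_rel M `` {(a, b)})"
    then obtain c d where cd: "((a, b), (c, d)) \<in> groth_rel M" "p = (\<phi> c, \<phi> d)"
      by auto
    then have "c \<in> carrier M" "d \<in> carrier M"
      using groth_rel_subset[of M] by auto
    then show "p \<in> groth_rel N `` {(\<phi> a, \<phi> b)}"
      using rel cd by auto
  next
    fix p
    assume p: "p \<in> groth_rel N `` {(\<phi> a, \<phi> b)}"
    then have "fst p \<in> carrier N" "snd p \<in> carrier N"
      by (auto simp: groth_rel_def)
    then obtain c d where cd: "c \<in> carrier M" "d \<in> carrier M" "p = (\<phi> c, \<phi> d)"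
      unfolding bij(2)[symmetric] by (metis imageE prod.collapse)
    then have "((a, b), (c, d)) \<in> groth_rel M"
      using rel p by auto
    then show "p \<in> map_prod \<phi> \<phi> ` (groth_rel M `` {(a, b)})"
      using cd by force
  qed
qed

lemma carrier_K0: "carrier (K0 M) = (carrier M \<times> carrier M) // groth_rel M"
  by (simp add: K0_def class_monoid_def)

lemma mult_K0: "mult (K0 M) P Q = (\<Union>(a, b)\<in>P. \<Union>(c, d)\<in>Q. groth_rel M `` {(a \<otimes>\<^bsub>M\<^esub> c, b \<otimes>\<^bsub>M\<^esub> d)})"
  by (auto simp: K0_def class_monoid_def split_beta)

lemma carrier_K0_subset: "carrier (K0 M) \<subseteq> Pow (carrier M \<times> carrier M)"
  unfolding carrier_K0 quotient_def using groth_rel_subset[of M] by blast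

lemma mult_K0_subset: "mult (K0 M) P Q \<subseteq> carrier M \<times> carrier M"
  unfolding mult_K0 using groth_rel_subset[of M] by blast

text \<open>The product is a union of classes over members, and images commute with unions;
  therefore arbitrary sets of pairs can be treated, not only classes.\<close>

lemma image_mult_K0:
  assumes \<phi>: "mult_iso M N \<phi>" and PQ: "P \<subseteq> carrier M \<times> carrier M" "Q \<subseteq> carrier M \<times> carrier M"
  shows "map_prod \<phi> \<phi> ` (mult (K0 M) P Q) = mult (K0 N) (map_prod \<phi> \<phi> ` P) (map_prod \<phi> \<phi> ` Q)"
proof -
  have "map_prod \<phi> \<phi> ` (groth_rel M `` {(a \<otimes>\<^bsub>M\<^esub> c, b \<otimes>\<^bsub>M\<^esub> d)})
      = groth_rel N `` {(\<phi> a \<otimes>\<^bsub>N\<^esub> \<phi> c, \<phi> b \<otimes>\<^bsub>N\<^esub> \<phi> d)}"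
    if "(a, b) \<in> P" "(c, d) \<in> Q" for a b c d
  proof -
    have "a \<in> carrier M" "b \<in> carrier M" "c \<in> carrier M" "d \<in> carrier M"
      using that PQ by auto
    then show ?thesis
      using \<phi> image_groth_rel_class[OF \<phi>] by (simp add: mult_iso_def)
  qed
  then have "(\<Union>(a, b)\<in>P. \<Union>(c, d)\<in>Q. map_prod \<phi> \<phi> ` (groth_rel M `` {(a \<otimes>\<^bsub>M\<^esub> c, b \<otimes>\<^bsub>M\<^esub> d)}))
      = (\<Union>(a, b)\<in>P. \<Union>(c, d)\<in>Q. groth_rel N `` {(\<phi> a \<otimes>\<^bsub>N\<^esub> \<phi> c, \<phi> b \<otimes>\<^bsub>N\<^esub> \<phi> d)})"
    by (intro SUP_cong refl) (auto simp: split_beta intro!: SUP_cong)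
  then show ?thesis
    unfolding mult_K0 by (simp add: image_UN split_beta)
qed

lemma image_carrier_K0:
  assumes \<phi>: "mult_iso M N \<phi>"
  shows "(\<lambda>P. map_prod \<phi> \<phi> ` P) ` carrier (K0 M) = carrier (K0 N)"
proof -
  have bij: "\<phi> ` carrier M = carrier N"
    using \<phi> by (auto simp: mult_iso_def bij_betw_def)
  have "(\<lambda>P. map_prod \<phi> \<phi> ` P) ` carrier (K0 M)
      = (\<lambda>(a, b). map_prod \<phi> \<phi> ` (groth_rel M `` {(a, b)})) ` (carrier M \<times> carrier M)"
    by (auto simp: carrier_K0 quotient_def)
  also have "\<dots> = (\<lambda>(a, b). groth_rel N `` {(\<phi> a, \<phi> b)}) ` (carrier M \<times> carrier M)"
    using image_groth_rel_class[OF \<phi>] by (intro image_cong) auto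
  also have "\<dots> = (\<lambda>(a, b). groth_rel N `` {(a, b)}) ` (carrier N \<times> carrier N)"
    unfolding bij[symmetric] by (auto simp: image_iff)
  also have "\<dots> = carrier (K0 N)"
    by (auto simp: carrier_K0 quotient_def)
  finally show ?thesis .
qed

text \<open>Cosets and their products are assembled elementwise inside \<open>U\<close>, where the
  map is injective and multiplicative; taking direct images is then injective on subsets of
  \<open>U\<close> and commutes with both constructions.\<close>

lemma FactGroup_iso_image:
  assumes U: "carrier K \<subseteq> U" "S \<subseteq> U" "inj_on \<Phi> U" "\<And>x y. x \<in> U \<Longrightarrow> y \<in> U \<Longrightarrow> x \<otimes>\<^bsub>K\<^esub> y \<in> U"
    and m: "\<And>x y. x \<in> U \<Longrightarrow> y \<in> U \<Longrightarrow> \<Phi> (x \<otimes>\<^bsub>K\<^esub> y) = \<Phi> x \<otimes>\<^bsub>L\<^esub> \<Phi> y"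
    and c: "\<Phi> ` carrier K = carrier L" and S: "\<Phi> ` S = T"
  shows "K Mod S \<cong> L Mod T"
proof -
  have coset: "\<Phi> ` (S #>\<^bsub>K\<^esub> a) = T #>\<^bsub>L\<^esub> \<Phi> a" if "a \<in> carrier K" for a
  proof -
    have "\<Phi> ` (S #>\<^bsub>K\<^esub> a) = (\<Union>h\<in>S. {\<Phi> (h \<otimes>\<^bsub>K\<^esub> a)})"
      by (auto simp: r_coset_def)
    also have "\<dots> = (\<Union>h\<in>S. {\<Phi> h \<otimes>\<^bsub>L\<^esub> \<Phi> a})"
      using m U that by (intro SUP_cong refl) auto
    finally show ?thesis
      by (auto simp: r_coset_def S[symmetric])
  qed
  have subU: "X \<subseteq> U" if "X \<in> rcosets\<^bsub>K\<^esub> S" for X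
    using that U by (auto simp: RCOSETS_def r_coset_def)
  have bij: "bij_betw ((`) \<Phi>) (rcosets\<^bsub>K\<^esub> S) (rcosets\<^bsub>L\<^esub> T)"
    unfolding bij_betw_def
  proof
    show "inj_on ((`) \<Phi>) (rcosets\<^bsub>K\<^esub> S)"
      by (rule inj_on_subset[OF inj_on_image_Pow[OF U(3)]]) (use subU in blast)
    have "(`) \<Phi> ` (rcosets\<^bsub>K\<^esub> S) = (\<lambda>a. \<Phi> ` (S #>\<^bsub>K\<^esub> a)) ` carrier K"
      unfolding RCOSETS_def by blast
    also have "\<dots> = (\<lambda>a. T #>\<^bsub>L\<^esub> \<Phi> a) ` carrier K"
      using coset by (intro image_cong) auto
    also have "\<dots> = rcosets\<^bsub>L\<^esub> T"
      unfolding RCOSETS_def c[symmetric] by blast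
    finally show "(`) \<Phi> ` (rcosets\<^bsub>K\<^esub> S) = rcosets\<^bsub>L\<^esub> T" .
  qed
  have "\<Phi> ` (X <#>\<^bsub>K\<^esub> Y) = \<Phi> ` X <#>\<^bsub>L\<^esub> \<Phi> ` Y" if "X \<subseteq> U" "Y \<subseteq> U" for X Y
  proof -
    have "\<Phi> ` (X <#>\<^bsub>K\<^esub> Y) = (\<Union>h\<in>X. \<Union>k\<in>Y. {\<Phi> (h \<otimes>\<^bsub>K\<^esub> k)})"
      by (auto simp: set_mult_def)
    also have "\<dots> = (\<Union>h\<in>X. \<Union>k\<in>Y. {\<Phi> h \<otimes>\<^bsub>L\<^esub> \<Phi> k})"
      using m that by (intro SUP_cong refl) auto
    finally show ?thesis
      by (auto simp: set_mult_def)
  qed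
  then have "(`) \<Phi> \<in> iso (K Mod S) (L Mod T)"
    using bij subU by (auto simp: iso_def hom_def FactGroup_def bij_betw_def)
  then show ?thesis
    by (auto simp: is_iso_def)
qed

text \<open>All cosets occurring here live in the power set of pairs of classes, on which the operation of
  \<open>K\<^sub>0\<close> is transported even where it is not known to be well defined on classes.\<close>

lemma K0_quotient_iso:
  assumes \<phi>: "mult_iso Q Q' \<phi>" and \<psi>: "mult_iso W W' \<psi>"
    and h: "\<And>a. a \<in> carrier W \<Longrightarrow> h a \<in> carrier Q" "\<And>a. a \<in> carrier W \<Longrightarrow> \<phi> (h a) = h' (\<psi> a)"
  shows "K0 Q Mod (K0_map Q h ` carrier (K0 W)) \<cong> K0 Q' Mod (K0_map Q' h' ` carrier (K0 W'))"
proof (rule FactGroup_iso_image[where U = "Pow (carrier Q \<times> carrier Q)" and \<Phi> = "\<lambda>P. map_prod \<phi> \<phi> ` P"])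
  show "K0_map Q h ` carrier (K0 W) \<subseteq> Pow (carrier Q \<times> carrier Q)"
    using groth_rel_subset[of Q] by (auto simp: K0_map_def class_map_def)
  have inj: "inj_on (map_prod \<phi> \<phi>) (carrier Q \<times> carrier Q)"
    using \<phi> by (intro map_prod_inj_on) (auto simp: mult_iso_def bij_betw_def)
  then show "inj_on ((`) (map_prod \<phi> \<phi>)) (Pow (carrier Q \<times> carrier Q))"
    by (rule inj_on_image_Pow)
  show "P \<otimes>\<^bsub>K0 Q\<^esub> P' \<in> Pow (carrier Q \<times> carrier Q)" for P P'
    using mult_K0_subset[of Q] by auto
  show "map_prod \<phi> \<phi> ` (P \<otimes>\<^bsub>K0 Q\<^esub> P') = map_prod \<phi> \<phi> ` P \<otimes>\<^bsub>K0 Q'\<^esub> map_prod \<phi> \<phi> ` P'"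
    if "P \<in> Pow (carrier Q \<times> carrier Q)" "P' \<in> Pow (carrier Q \<times> carrier Q)" for P P'
    using that by (intro image_mult_K0[OF \<phi>]) auto
  \<comment> \<open>The square \<open>\<phi> \<circ> h = h' \<circ> \<psi>\<close> passes to
    Grothendieck groups, so the subsets to be divided out correspond.\<close>
  have *: "map_prod \<phi> \<phi> ` K0_map Q h P = K0_map Q' h' (map_prod \<psi> \<psi> ` P)" if "P \<in> carrier (K0 W)" for P
  proof -
    have P: "P \<subseteq> carrier W \<times> carrier W"
      using that carrier_K0_subset[of W] by auto
    have "map_prod \<phi> \<phi> ` K0_map Q h P = (\<Union>(a, b)\<in>P. map_prod \<phi> \<phi> ` (groth_rel Q `` {(h a, h b)}))"
      by (auto simp: K0_map_def class_map_def split_beta)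
    also have "\<dots> = (\<Union>(a, b)\<in>P. groth_rel Q' `` {(h' (\<psi> a), h' (\<psi> b))})"
    proof (rule SUP_cong[OF refl])
      fix p
      assume "p \<in> P"
      then have "fst p \<in> carrier W" "snd p \<in> carrier W"
        using P by auto
      then show "(case p of (a, b) \<Rightarrow> map_prod \<phi> \<phi> ` (groth_rel Q `` {(h a, h b)}))
          = (case p of (a, b) \<Rightarrow> groth_rel Q' `` {(h' (\<psi> a), h' (\<psi> b))})"
        using image_groth_rel_class[OF \<phi> h(1) h(1)] h(2) by (simp add: split_beta)
    qed
    also have "\<dots> = K0_map Q' h' (map_prod \<psi> \<psi> ` P)"
      by (auto simp: K0_map_def class_map_def split_beta)
    finally show ?thesis .
  qed
  have "(\<lambda>P. map_prod \<phi> \<phi> ` P) ` K0_map Q h ` carrier (K0 W)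
      = K0_map Q' h' ` (\<lambda>P. map_prod \<psi> \<psi> ` P) ` carrier (K0 W)"
    unfolding image_image using * by (intro image_cong) auto
  then show "(\<lambda>P. map_prod \<phi> \<phi> ` P) ` K0_map Q h ` carrier (K0 W) = K0_map Q' h' ` carrier (K0 W')"
    by (simp add: image_carrier_K0[OF \<psi>])
qed (use carrier_K0_subset[of Q] image_carrier_K0[OF \<phi>] in auto)

lemma mat_add_zero [simp]:
  "n = dim_row A \<Longrightarrow> m = dim_col A \<Longrightarrow> A + 0\<^sub>m n m = (A :: 'a :: monoid_add mat)"
  "n = dim_row A \<Longrightarrow> m = dim_col A \<Longrightarrow> 0\<^sub>m n m + A = (A :: 'a :: monoid_add mat)"
  by (rule right_add_zero_mat left_add_zero_mat, auto)+

lemma mat_cancel: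
  assumes "A * B = 1\<^sub>m n" "dim_col A = dim_row B" "dim_col B = dim_row X"
  shows "A * (B * X) = (X :: 'a :: semiring_1 mat)"
proof -
  have "dim_col B = n"
    using arg_cong[OF assms(1), of dim_col] by simp
  then show ?thesis
    using assms by (subst mat_mult_assoc[symmetric]) auto
qed

section \<open>Zigzag identities for matrices\<close>

lemma mult_tensor_one: "dim_col A = dim_row B \<Longrightarrow> (A * B) ** 1\<^sub>m n = (A ** 1\<^sub>m n) * (B ** 1\<^sub>m n)"
  by (simp add: tensor_mat_mult)

lemma one_tensor_mult: "dim_col A = dim_row B \<Longrightarrow> 1\<^sub>m n ** (A * B) = (1\<^sub>m n ** A) * (1\<^sub>m n ** B)"
  by (simp add: tensor_mat_mult)

text \<open>Two functionals on neighbouring factors may be evaluated in either order.\<close>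

lemma row_mult_tensor:
  assumes "dim_row e = 1" "dim_row f = 1"
  shows "f * (e ** 1\<^sub>m (dim_col f)) = e ** f" "e * (1\<^sub>m (dim_col e) ** f) = e ** f"
proof -
  have "(1\<^sub>m 1 ** f) * (e ** 1\<^sub>m (dim_col f)) = e ** f"
    using assms by (subst tensor_mat_mult) auto
  then show "f * (e ** 1\<^sub>m (dim_col f)) = e ** f"
    by simp
  have "(e ** 1\<^sub>m 1) * (1\<^sub>m (dim_col e) ** f) = e ** f"
    using assms by (subst tensor_mat_mult) auto
  then show "e * (1\<^sub>m (dim_col e) ** f) = e ** f"
    by simp
qed

text \<open>The inner map compares two duals of the same object. Exchanging the order in which the
  functionals \<open>e\<close> and \<open>e'\<close> are applied brings \<open>e'\<close> next to
  \<open>c\<close>, where hypothesis \<open>z\<close> straightens the bend.\<close>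

lemma zigzag_left:
  assumes c: "dim_row c = a * b'" "dim_col c = 1" and e': "dim_row e' = 1" "dim_col e' = b' * a"
    and e: "dim_row e = 1" "dim_col e = b * a" and z: "(1\<^sub>m a ** e') * (c ** 1\<^sub>m a) = 1\<^sub>m a"
  shows "e' * (((e ** 1\<^sub>m b') * (1\<^sub>m b ** c)) ** 1\<^sub>m a) = e"
proof -
  have "((e ** 1\<^sub>m b') * (1\<^sub>m b ** c)) ** 1\<^sub>m a = (e ** 1\<^sub>m (b' * a)) * (1\<^sub>m b ** c ** 1\<^sub>m a)"
    using assms by (simp add: mult_tensor_one tensor_mat_assoc tensor_one_mat mult_ac)
  then have "e' * (((e ** 1\<^sub>m b') * (1\<^sub>m b ** c)) ** 1\<^sub>m a)
      = (e' * (e ** 1\<^sub>m (dim_col e'))) * (1\<^sub>m b ** c ** 1\<^sub>m a)"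
    using assms by (simp add: mat_mult_assoc mult_ac)
  also have "\<dots> = e * (1\<^sub>m (dim_col e) ** e') * (1\<^sub>m b ** c ** 1\<^sub>m a)"
    by (simp only: row_mult_tensor[OF assms(5,3)])
  also have "\<dots> = e * ((1\<^sub>m b ** (1\<^sub>m a ** e')) * (1\<^sub>m b ** (c ** 1\<^sub>m a)))"
    using assms by (subst mat_mult_assoc) (auto simp: tensor_one_mat[symmetric] tensor_mat_assoc)
  also have "\<dots> = e * (1\<^sub>m b ** ((1\<^sub>m a ** e') * (c ** 1\<^sub>m a)))"
    using assms by (subst one_tensor_mult) auto
  also have "\<dots> = e"
    using assms by (simp add: tensor_one_mat)
  finally show ?thesis .
qed

text \<open>The box \<open>u\<close> is pulled past \<open>c\<close> onto the left leg of
  \<open>e\<close>. Combined with \<open>zigzag_left\<close> this shows that the two comparisons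
  between a pair of duals are mutually inverse.\<close>

lemma zigzag_slide:
  assumes "dim_row e = 1" "dim_col e = b * a" "dim_col c = 1" "dim_row c = a * b'" "dim_row u = b" "dim_col u = n"
  shows "(e ** 1\<^sub>m b') * (1\<^sub>m b ** c) * u = ((e * (u ** 1\<^sub>m a)) ** 1\<^sub>m b') * (1\<^sub>m n ** c)"
proof -
  have "(1\<^sub>m b ** c) * (u ** 1\<^sub>m 1) = (u ** 1\<^sub>m (a * b')) * (1\<^sub>m n ** c)"
    using assms by (subst tensor_mat_exchange) auto
  then show ?thesis
    using assms
    by (simp add: mat_mult_assoc mult_tensor_one tensor_mat_assoc tensor_one_mat[symmetric] mult_ac)
qed

text \<open>One summand of the zigzag for a direct sum: \<open>p\<close> and \<open>i\<close> move
  out of the diagram and only \<open>q * j\<close> stays inside. If it is an identity, the inner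
  zigzag can be straightened; if it is zero, the whole term vanishes. With identities for some of
  the maps, the lemma also describes transport of duals along isomorphisms.\<close>

lemma dual_sum_term_left:
  assumes "dim_row e = 1" "dim_col e = b * a" "dim_row q = b" "dim_col q = t" "dim_row p = a" "dim_col p = s"
    "dim_row i = s" "dim_col i = a'" "dim_row j = t" "dim_col j = b'" "dim_row c = a' * b'" "dim_col c = 1"
  shows "(1\<^sub>m s ** (e * (q ** p))) * (((i ** j) * c) ** 1\<^sub>m s)
    = i * ((1\<^sub>m a' ** (e * ((q * j) ** 1\<^sub>m a))) * (c ** 1\<^sub>m a)) * p"
proof -
  have 1: "(c ** 1\<^sub>m a) * p = ((1\<^sub>m a' ** 1\<^sub>m b') ** p) * (c ** 1\<^sub>m s)"
    using assms tensor_mat_exchange[of "a' * b'" c a p 1 s] by (simp add: tensor_one_mat)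
  have 2: "i * (1\<^sub>m a' ** e) = (1\<^sub>m s ** e) * (i ** (1\<^sub>m b ** 1\<^sub>m a))"
    using assms tensor_mat_exchange[of s i 1 e a' "b * a"] by (simp add: tensor_one_mat)
  have "i * ((1\<^sub>m a' ** (e * ((q * j) ** 1\<^sub>m a))) * (c ** 1\<^sub>m a)) * p
      = (i * (1\<^sub>m a' ** e)) * ((1\<^sub>m a' ** (q * j) ** 1\<^sub>m a) * ((c ** 1\<^sub>m a) * p))"
    using assms by (simp add: mat_mult_assoc one_tensor_mult)
  also have "\<dots> = (1\<^sub>m s ** e) * ((i ** (1\<^sub>m b ** 1\<^sub>m a)) *
      ((1\<^sub>m a' ** (q * j) ** 1\<^sub>m a) * ((1\<^sub>m a' ** 1\<^sub>m b' ** p) * (c ** 1\<^sub>m s))))"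
    unfolding 1 2 using assms by (simp add: mat_mult_assoc tensor_mat_assoc)
  also have "\<dots> = (1\<^sub>m s ** e) * ((i ** (q * j) ** p) * (c ** 1\<^sub>m s))"
    using assms
    by (simp add: mat_mult_assoc[symmetric] tensor_mat_mult mult.assoc del: assoc_mult_mat)
  also have "(i ** (q * j) ** p) = (1\<^sub>m s ** q ** p) * (i ** j ** 1\<^sub>m s)"
    using assms by (simp add: tensor_mat_mult)
  also have "(1\<^sub>m s ** e) * ((1\<^sub>m s ** q ** p) * (i ** j ** 1\<^sub>m s) * (c ** 1\<^sub>m s))
      = (1\<^sub>m s ** (e * (q ** p))) * (((i ** j) * c) ** 1\<^sub>m s)"
    using assms by (simp add: mat_mult_assoc one_tensor_mult mult_tensor_one tensor_mat_assoc mult.assoc)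
  finally show ?thesis ..
qed

text \<open>Mirror image of the previous computation: \<open>q\<close> and \<open>j\<close> move
  out, and \<open>p * i\<close> decides.\<close>

lemma dual_sum_term_right:
  assumes "dim_row e = 1" "dim_col e = b * a" "dim_row q = b" "dim_col q = t" "dim_row p = a" "dim_col p = s"
    "dim_row i = s" "dim_col i = a'" "dim_row j = t" "dim_col j = b'" "dim_row c = a' * b'" "dim_col c = 1"
  shows "((e * (q ** p)) ** 1\<^sub>m t) * (1\<^sub>m t ** ((i ** j) * c))
    = j * (((e * (1\<^sub>m b ** (p * i))) ** 1\<^sub>m b') * (1\<^sub>m b ** c)) * q"
proof -
  have 1: "(1\<^sub>m b ** c) * q = (q ** (1\<^sub>m a' ** 1\<^sub>m b')) * (1\<^sub>m t ** c)"
    using assms tensor_mat_exchange[of b q "a' * b'" c t 1] by (simp add: tensor_one_mat)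
  have 2: "j * (e ** 1\<^sub>m b') = (e ** 1\<^sub>m t) * ((1\<^sub>m b ** 1\<^sub>m a) ** j)"
    using assms tensor_mat_exchange[of 1 e t j "b * a" b'] by (simp add: tensor_one_mat)
  have "j * (((e * (1\<^sub>m b ** (p * i))) ** 1\<^sub>m b') * (1\<^sub>m b ** c)) * q
      = (j * (e ** 1\<^sub>m b')) * ((1\<^sub>m b ** (p * i) ** 1\<^sub>m b') * ((1\<^sub>m b ** c) * q))"
    using assms by (simp add: mat_mult_assoc mult_tensor_one tensor_mat_assoc mult.assoc)
  also have "\<dots> = (e ** 1\<^sub>m t) * ((1\<^sub>m b ** 1\<^sub>m a ** j) *
      ((1\<^sub>m b ** (p * i) ** 1\<^sub>m b') * ((q ** 1\<^sub>m a' ** 1\<^sub>m b') * (1\<^sub>m t ** c))))"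
    unfolding 1 2 using assms by (simp add: mat_mult_assoc tensor_mat_assoc mult.assoc)
  also have "\<dots> = (e ** 1\<^sub>m t) * ((q ** (p * i) ** j) * (1\<^sub>m t ** c))"
    using assms
    by (simp add: mat_mult_assoc[symmetric] tensor_mat_mult mult.assoc del: assoc_mult_mat)
  also have "(q ** (p * i) ** j) = (q ** p ** 1\<^sub>m t) * (1\<^sub>m t ** i ** j)"
    using assms by (simp add: tensor_mat_mult)
  also have "(e ** 1\<^sub>m t) * ((q ** p ** 1\<^sub>m t) * (1\<^sub>m t ** i ** j) * (1\<^sub>m t ** c))
      = ((e * (q ** p)) ** 1\<^sub>m t) * (1\<^sub>m t ** ((i ** j) * c))"
    using assms by (simp add: mat_mult_assoc one_tensor_mult mult_tensor_one tensor_mat_assoc mult.assoc)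
  finally show ?thesis ..
qed

section \<open>Strict monoidal categories of matrices\<close>

text \<open>A strict monoidal category whose morphisms are matrices, \<open>d\<close> being the
  dimension of the underlying space. Associators and unitors are identity matrices between equal
  objects, so they disappear from later equations. \<open>Rep G\<close> and \<open>RepD G\<close>
  are both instances.\<close>

locale matcat =
  fixes C :: "('o, complex mat, complex, 'x) linear_moncat_scheme" and d :: "'o \<Rightarrow> nat"
  assumes cmp_eq [simp]: "cmp C = (*)" and idm_eq [simp]: "idm C X = 1\<^sub>m (d X)"
    and zerom_eq [simp]: "zerom C X Y = 0\<^sub>m (d Y) (d X)" and addm_eq [simp]: "addm C = (+)"
    and scalem_eq [simp]: "scalem C = (\<cdot>\<^sub>m)" and tenm_eq [simp]: "tenm C = tensor_mat"
    and assoc_eq [simp]: "assoc C X Y Z = 1\<^sub>m (d X * d Y * d Z)"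
    and lunit_eq [simp]: "lunit C X = 1\<^sub>m (d X)" and runit_eq [simp]: "runit C X = 1\<^sub>m (d X)"
    and d_ten [simp]: "d (teno C X Y) = d X * d Y" and d_unit [simp]: "d (unito C) = 1"
    and unit_obj [simp]: "unito C \<in> obj C"
    and ten_obj [simp]: "X \<in> obj C \<Longrightarrow> Y \<in> obj C \<Longrightarrow> teno C X Y \<in> obj C"
    and ten_assoc: "X \<in> obj C \<Longrightarrow> Y \<in> obj C \<Longrightarrow> Z \<in> obj C \<Longrightarrow>
      teno C (teno C X Y) Z = teno C X (teno C Y Z)"
    and unit_ten [simp]: "X \<in> obj C \<Longrightarrow> teno C (unito C) X = X"
    and ten_unit [simp]: "X \<in> obj C \<Longrightarrow> teno C X (unito C) = X"
    and mor_carrier: "f \<in> mor C X Y \<Longrightarrow> f \<in> carrier_mat (d Y) (d X)"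
    and one_mor [simp]: "X \<in> obj C \<Longrightarrow> 1\<^sub>m (d X) \<in> mor C X X"
    and zero_mor [simp]: "X \<in> obj C \<Longrightarrow> Y \<in> obj C \<Longrightarrow> 0\<^sub>m (d Y) (d X) \<in> mor C X Y"
    and mult_mor: "\<lbrakk>X \<in> obj C; Y \<in> obj C; Z \<in> obj C; g \<in> mor C Y Z; f \<in> mor C X Y\<rbrakk>
      \<Longrightarrow> g * f \<in> mor C X Z"
    and add_mor: "\<lbrakk>X \<in> obj C; Y \<in> obj C; f \<in> mor C X Y; g \<in> mor C X Y\<rbrakk> \<Longrightarrow> f + g \<in> mor C X Y"
    and smult_mor: "\<lbrakk>X \<in> obj C; Y \<in> obj C; f \<in> mor C X Y\<rbrakk> \<Longrightarrow> a \<cdot>\<^sub>m f \<in> mor C X Y"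
    and ten_mor: "\<lbrakk>X \<in> obj C; Y \<in> obj C; X' \<in> obj C; Y' \<in> obj C; f \<in> mor C X X'; g \<in> mor C Y Y'\<rbrakk>
      \<Longrightarrow> f ** g \<in> mor C (teno C X Y) (teno C X' Y')"
begin

lemma mor_dim: "f \<in> mor C X Y \<Longrightarrow> dim_row f = d Y" "f \<in> mor C X Y \<Longrightarrow> dim_col f = d X"
  using mor_carrier by blast+

lemma one_ten_mor: "\<lbrakk>X \<in> obj C; Y \<in> obj C; Z \<in> obj C; f \<in> mor C X Y\<rbrakk>
    \<Longrightarrow> 1\<^sub>m (d Z) ** f \<in> mor C (teno C Z X) (teno C Z Y)"
  by (intro ten_mor) auto

lemma ten_one_mor: "\<lbrakk>X \<in> obj C; Y \<in> obj C; Z \<in> obj C; f \<in> mor C X Y\<rbrakk>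
    \<Longrightarrow> f ** 1\<^sub>m (d Z) \<in> mor C (teno C X Z) (teno C Y Z)"
  by (intro ten_mor) auto

lemma inverse_mor_iff: "inverse_mor C X Y f g \<longleftrightarrow>
    f \<in> mor C X Y \<and> g \<in> mor C Y X \<and> g * f = 1\<^sub>m (d X) \<and> f * g = 1\<^sub>m (d Y)"
  by (simp add: inverse_mor_def)

lemma inverse_mor_sym: "inverse_mor C X Y f g \<longleftrightarrow> inverse_mor C Y X g f"
  by (auto simp: inverse_mor_iff)

lemma inverse_mor_one: "X \<in> obj C \<Longrightarrow> inverse_mor C X X (1\<^sub>m (d X)) (1\<^sub>m (d X))"
  by (simp add: inverse_mor_iff)

lemma inverse_mor_comp:
  assumes "X \<in> obj C" "Y \<in> obj C" "Z \<in> obj C" "inverse_mor C X Y f f'" "inverse_mor C Y Z g g'"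
  shows "inverse_mor C X Z (g * f) (f' * g')"
proof -
  note m = assms(4,5)[unfolded inverse_mor_iff]
  note dims = mor_dim[OF conjunct1[OF m(1)]] mor_dim[OF conjunct1[OF m(2)]]
    mor_dim[of f' Y X] mor_dim[of g' Z Y]
  show ?thesis
    using m dims mat_cancel[of g' g "d Y" f] mat_cancel[of f f' "d Y" g'] mult_mor[OF assms(1-3)] mult_mor[OF assms(3,2,1)] by (simp add: inverse_mor_iff mat_mult_assoc)
qed

text \<open>Removes the inverse structural isomorphisms from the definitions of duals and of the
  adjoint of a form.\<close>

lemma inv_mor_one:
  assumes "X \<in> obj C"
  shows "inv_mor C X X (1\<^sub>m (d X)) = 1\<^sub>m (d X)"
  unfolding inv_mor_def
proof (rule the_equality)
  show "inverse_mor C X X (1\<^sub>m (d X)) (1\<^sub>m (d X))"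
    using assms by (rule inverse_mor_one)
  show "g = 1\<^sub>m (d X)" if "inverse_mor C X X (1\<^sub>m (d X)) g" for g
    using that mor_dim[of g X X] by (simp add: inverse_mor_iff)
qed

lemma is_dual_iff:
  assumes M: "M \<in> obj C"
  shows "is_dual C M M' e c \<longleftrightarrow> M' \<in> obj C \<and> e \<in> mor C (teno C M' M) (unito C) \<and>
    c \<in> mor C (unito C) (teno C M M') \<and>
    (1\<^sub>m (d M) ** e) * (c ** 1\<^sub>m (d M)) = 1\<^sub>m (d M) \<and> (e ** 1\<^sub>m (d M')) * (1\<^sub>m (d M') ** c) = 1\<^sub>m (d M')"
proof -
  have "inv_mor C (teno C (teno C M' M) M') (teno C M' (teno C M M')) (1\<^sub>m (d M' * d M * d M'))
      = 1\<^sub>m (d M' * d M * d M')" if "M' \<in> obj C"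
    using inv_mor_one[of "teno C (teno C M' M) M'"] M that by (simp add: ten_assoc mult.assoc)
  then show ?thesis
    unfolding is_dual_def
    using mor_dim[of e "teno C M' M" "unito C"] mor_dim[of c "unito C" "teno C M M'"]
    by (auto simp: mult_ac)
qed

lemma is_dualD:
  assumes "M \<in> obj C" "is_dual C M M' e c"
  shows "M' \<in> obj C" "e \<in> mor C (teno C M' M) (unito C)" "c \<in> mor C (unito C) (teno C M M')"
    "(1\<^sub>m (d M) ** e) * (c ** 1\<^sub>m (d M)) = 1\<^sub>m (d M)" "(e ** 1\<^sub>m (d M')) * (1\<^sub>m (d M') ** c) = 1\<^sub>m (d M')"
    "dim_row e = 1" "dim_col e = d M' * d M" "dim_row c = d M * d M'" "dim_col c = 1"
  using assms mor_dim[of e "teno C M' M" "unito C"] mor_dim[of c "unito C" "teno C M M'"]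
  by (auto simp: is_dual_iff)

lemma dual_comparison:
  assumes M: "M \<in> obj C" and 1: "is_dual C M M' e c" and 2: "is_dual C M M'' e' c'"
  defines "u \<equiv> (e ** 1\<^sub>m (d M'')) * (1\<^sub>m (d M') ** c')"
  shows "u \<in> mor C M' M''" "e' * (u ** 1\<^sub>m (d M)) = e"
proof -
  note d1 = is_dualD[OF M 1] and d2 = is_dualD[OF M 2]
  have "e ** 1\<^sub>m (d M'') \<in> mor C (teno C (teno C M' M) M'') M''"
    using ten_one_mor[OF _ _ d2(1) d1(2)] M d1 d2 by simp
  moreover have "1\<^sub>m (d M') ** c' \<in> mor C M' (teno C (teno C M' M) M'')"
    using one_ten_mor[OF _ _ d1(1) d2(3)] M d1 d2 by (simp add: ten_assoc)
  ultimately show "u \<in> mor C M' M''"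
    unfolding u_def using M d1(1) d2(1)
    by (intro mult_mor[of M' "teno C (teno C M' M) M''" M'']) auto
  show "e' * (u ** 1\<^sub>m (d M)) = e"
    unfolding u_def by (rule zigzag_left) (use d1 d2 in auto)
qed

text \<open>By \<open>zigzag_slide\<close> and \<open>dual_comparison\<close>, the composite of the
  two comparisons has the form \<open>(e \<otimes> 1)(1 \<otimes> c)\<close> with both halves from
  one and the same dual, and the zigzag identity applies.\<close>

lemma dual_unique:
  assumes M: "M \<in> obj C" and 1: "is_dual C M M' e c" and 2: "is_dual C M M'' e' c'"
  shows "inverse_mor C M' M'' ((e ** 1\<^sub>m (d M'')) * (1\<^sub>m (d M') ** c')) ((e' ** 1\<^sub>m (d M')) * (1\<^sub>m (d M'') ** c))"
proof -
  note d1 = is_dualD[OF M 1] and d2 = is_dualD[OF M 2]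
  note u = dual_comparison[OF M 1 2] and w = dual_comparison[OF M 2 1]
  have "(e' ** 1\<^sub>m (d M')) * (1\<^sub>m (d M'') ** c) * ((e ** 1\<^sub>m (d M'')) * (1\<^sub>m (d M') ** c')) = 1\<^sub>m (d M')"
    using d1 d2 u(2) mor_dim[OF u(1)] by (subst zigzag_slide[where n = "d M'" and a = "d M"]) auto
  moreover have "(e ** 1\<^sub>m (d M'')) * (1\<^sub>m (d M') ** c') * ((e' ** 1\<^sub>m (d M')) * (1\<^sub>m (d M'') ** c)) = 1\<^sub>m (d M'')"
    using d1 d2 w(2) mor_dim[OF w(1)] by (subst zigzag_slide[where n = "d M''" and a = "d M"]) auto
  ultimately show ?thesis
    using u w by (simp add: inverse_mor_iff)
qed

text \<open>The two zigzags are single terms of the direct sum computation, with \<open>h\<close>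
  and its inverse in the place of a projection and an injection.\<close>

lemma is_dual_transport:
  assumes M: "M \<in> obj C" and 1: "is_dual C M M' e c" and N: "N \<in> obj C" and h: "inverse_mor C N M' h k"
  shows "is_dual C M N (e * (h ** 1\<^sub>m (d M))) ((1\<^sub>m (d M) ** k) * c)"
proof -
  note d1 = is_dualD[OF M 1] and h' = h[unfolded inverse_mor_iff]
  have dims: "dim_row h = d M'" "dim_col h = d N" "dim_row k = d N" "dim_col k = d M'"
    using h' mor_dim by blast+
  have m1: "e * (h ** 1\<^sub>m (d M)) \<in> mor C (teno C N M) (unito C)"
    by (rule mult_mor[of _ "teno C M' M"]) (use M N d1 h' in \<open>auto intro!: ten_one_mor\<close>)
  have m2: "(1\<^sub>m (d M) ** k) * c \<in> mor C (unito C) (teno C M N)"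
    by (rule mult_mor[of _ "teno C M M'"]) (use M N d1 h' in \<open>auto intro!: one_ten_mor\<close>)
  have "(1\<^sub>m (d M) ** (e * (h ** 1\<^sub>m (d M)))) * (((1\<^sub>m (d M) ** k) * c) ** 1\<^sub>m (d M))
      = 1\<^sub>m (d M) * ((1\<^sub>m (d M) ** (e * ((h * k) ** 1\<^sub>m (d M)))) * (c ** 1\<^sub>m (d M))) * 1\<^sub>m (d M)"
    by (rule dual_sum_term_left) (use d1 dims in auto)
  moreover have "((e * (h ** 1\<^sub>m (d M))) ** 1\<^sub>m (d N)) * (1\<^sub>m (d N) ** ((1\<^sub>m (d M) ** k) * c))
      = k * (((e * (1\<^sub>m (d M') ** (1\<^sub>m (d M) * 1\<^sub>m (d M)))) ** 1\<^sub>m (d M')) * (1\<^sub>m (d M') ** c)) * h"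
    by (rule dual_sum_term_right) (use d1 dims in auto)
  ultimately show ?thesis
    using M N m1 m2 d1 h' dims by (simp add: is_dual_iff tensor_one_mat)
qed

lemma is_dual_transport_left:
  assumes M: "M \<in> obj C" and 1: "is_dual C M M' e c" and N: "N \<in> obj C" and h: "inverse_mor C N M h k"
  shows "is_dual C N M' (e * (1\<^sub>m (d M') ** h)) ((k ** 1\<^sub>m (d M')) * c)"
proof -
  note d1 = is_dualD[OF M 1] and h' = h[unfolded inverse_mor_iff]
  have dims: "dim_row h = d M" "dim_col h = d N" "dim_row k = d N" "dim_col k = d M"
    using h' mor_dim by blast+
  have m1: "e * (1\<^sub>m (d M') ** h) \<in> mor C (teno C M' N) (unito C)"
    by (rule mult_mor[of _ "teno C M' M"]) (use M N d1 h' in \<open>auto intro!: one_ten_mor\<close>)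
  have m2: "(k ** 1\<^sub>m (d M')) * c \<in> mor C (unito C) (teno C N M')"
    by (rule mult_mor[of _ "teno C M M'"]) (use M N d1 h' in \<open>auto intro!: ten_one_mor\<close>)
  have "(1\<^sub>m (d N) ** (e * (1\<^sub>m (d M') ** h))) * (((k ** 1\<^sub>m (d M')) * c) ** 1\<^sub>m (d N))
      = k * ((1\<^sub>m (d M) ** (e * ((1\<^sub>m (d M') * 1\<^sub>m (d M')) ** 1\<^sub>m (d M)))) * (c ** 1\<^sub>m (d M))) * h"
    by (rule dual_sum_term_left) (use d1 dims in auto)
  moreover have "((e * (1\<^sub>m (d M') ** h)) ** 1\<^sub>m (d M')) * (1\<^sub>m (d M') ** ((k ** 1\<^sub>m (d M')) * c))
      = 1\<^sub>m (d M') * (((e * (1\<^sub>m (d M') ** (h * k))) ** 1\<^sub>m (d M')) * (1\<^sub>m (d M') ** c)) * 1\<^sub>m (d M')"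
    by (rule dual_sum_term_right) (use d1 dims in auto)
  ultimately show ?thesis
    using M N m1 m2 d1 h' dims by (simp add: is_dual_iff tensor_one_mat)
qed

lemma is_direct_sum_iff:
  "is_direct_sum C M N S i1 i2 p1 p2 \<longleftrightarrow> S \<in> obj C \<and>
     i1 \<in> mor C M S \<and> i2 \<in> mor C N S \<and> p1 \<in> mor C S M \<and> p2 \<in> mor C S N \<and>
     p1 * i1 = 1\<^sub>m (d M) \<and> p2 * i2 = 1\<^sub>m (d N) \<and> p1 * i2 = 0\<^sub>m (d M) (d N) \<and> p2 * i1 = 0\<^sub>m (d N) (d M) \<and>
     i1 * p1 + i2 * p2 = 1\<^sub>m (d S)"
  by (simp add: is_direct_sum_def)

lemma is_direct_sumD:
  assumes "is_direct_sum C M N S i1 i2 p1 p2"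
  shows "S \<in> obj C" "i1 \<in> mor C M S" "i2 \<in> mor C N S" "p1 \<in> mor C S M" "p2 \<in> mor C S N"
    "p1 * i1 = 1\<^sub>m (d M)" "p2 * i2 = 1\<^sub>m (d N)" "p1 * i2 = 0\<^sub>m (d M) (d N)" "p2 * i1 = 0\<^sub>m (d N) (d M)"
    "i1 * p1 + i2 * p2 = 1\<^sub>m (d S)"
    "dim_row i1 = d S" "dim_col i1 = d M" "dim_row i2 = d S" "dim_col i2 = d N"
    "dim_row p1 = d M" "dim_col p1 = d S" "dim_row p2 = d N" "dim_col p2 = d S"
  using assms mor_dim by (auto simp: is_direct_sum_iff)

lemma is_direct_sum_swap:
  assumes "is_direct_sum C M N S i1 i2 p1 p2"
  shows "is_direct_sum C N M S i2 i1 p2 p1"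
proof -
  note s = is_direct_sumD[OF assms]
  have "i2 * p2 + i1 * p1 = i1 * p1 + i2 * p2"
    by (rule comm_add_mat[of _ "d S" "d S"]) (use s in auto)
  then show ?thesis
    using s by (simp add: is_direct_sum_iff)
qed

lemma direct_sum_map:
  assumes obj: "M \<in> obj C" "N \<in> obj C" "M' \<in> obj C" "N' \<in> obj C"
    and S: "is_direct_sum C M N S i1 i2 p1 p2" and T: "is_direct_sum C M' N' T j1 j2 q1 q2"
    and f: "f1 \<in> mor C M M'" "f2 \<in> mor C N N'"
  defines "f \<equiv> j1 * (f1 * p1) + j2 * (f2 * p2)"
  shows "f \<in> mor C S T" "q1 * f = f1 * p1" "q2 * f = f2 * p2" "f * i1 = j1 * f1" "f * i2 = j2 * f2"
proof -
  note s = is_direct_sumD[OF S] and t = is_direct_sumD[OF T]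
  have dims: "dim_row f1 = d M'" "dim_col f1 = d M" "dim_row f2 = d N'" "dim_col f2 = d N"
    using f mor_dim by blast+
  show "f \<in> mor C S T"
    unfolding f_def
    by (intro add_mor mult_mor[of S M' T] mult_mor[of S N' T] mult_mor[of S M M'] mult_mor[of S N N'])
      (use obj s t f in auto)
  have 1: "q1 * (j1 * X) = X" if "dim_row X = d M'" for X
    using t that by (simp add: mat_mult_assoc[symmetric])
  have 2: "q2 * (j2 * X) = X" if "dim_row X = d N'" for X
    using t that by (simp add: mat_mult_assoc[symmetric])
  have 3: "q1 * (j2 * X) = 0\<^sub>m (d M') (dim_col X)" if "dim_row X = d N'" for X
    using t that by (simp add: mat_mult_assoc[symmetric])
  have 4: "q2 * (j1 * X) = 0\<^sub>m (d N') (dim_col X)" if "dim_row X = d M'" for X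
    using t that by (simp add: mat_mult_assoc[symmetric])
  show "q1 * f = f1 * p1" "q2 * f = f2 * p2" "f * i1 = j1 * f1" "f * i2 = j2 * f2"
    unfolding f_def using s t dims
    by (simp_all add: mat_mult_add mat_add_mult 1 2 3 4 mat_mult_assoc)
qed

lemma direct_sum_iso:
  assumes obj: "M \<in> obj C" "N \<in> obj C" "M' \<in> obj C" "N' \<in> obj C"
    and S: "is_direct_sum C M N S i1 i2 p1 p2" and T: "is_direct_sum C M' N' T j1 j2 q1 q2"
    and f: "iso_mor C M M' f1" "iso_mor C N N' f2"
  obtains f where "iso_mor C S T f" "q1 * f = f1 * p1" "q2 * f = f2 * p2"
proof -
  note s = is_direct_sumD[OF S] and t = is_direct_sumD[OF T]
  obtain g1 g2 where g: "inverse_mor C M M' f1 g1" "inverse_mor C N N' f2 g2"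
    using f by (auto simp: iso_mor_def)
  note g' = g[unfolded inverse_mor_iff]
  have dims: "dim_row f1 = d M'" "dim_col f1 = d M" "dim_row f2 = d N'" "dim_col f2 = d N"
    "dim_row g1 = d M" "dim_col g1 = d M'" "dim_row g2 = d N" "dim_col g2 = d N'"
    using g' mor_dim by blast+
  define f where "f = j1 * (f1 * p1) + j2 * (f2 * p2)"
  define g where "g = i1 * (g1 * q1) + i2 * (g2 * q2)"
  note F = direct_sum_map[OF obj S T, of f1 f2, folded f_def]
  note G = direct_sum_map[OF obj(3,4,1,2) T S, of g1 g2, folded g_def]
  have c1: "g1 * (f1 * X) = X" if "dim_row X = d M" for X
    by (rule mat_cancel[of _ _ "d M"]) (use g' that dims in auto)
  have c2: "g2 * (f2 * X) = X" if "dim_row X = d N" for X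
    by (rule mat_cancel[of _ _ "d N"]) (use g' that dims in auto)
  have c3: "f1 * (g1 * X) = X" if "dim_row X = d M'" for X
    by (rule mat_cancel[of _ _ "d M'"]) (use g' that dims in auto)
  have c4: "f2 * (g2 * X) = X" if "dim_row X = d N'" for X
    by (rule mat_cancel[of _ _ "d N'"]) (use g' that dims in auto)
  have fm: "f \<in> mor C S T" "g \<in> mor C T S"
    using F G g' by auto
  have "g * f = i1 * (g1 * (q1 * f)) + i2 * (g2 * (q2 * f))"
    unfolding g_def using s t dims mor_dim[OF fm(1)] by (simp add: mat_add_mult mat_mult_assoc)
  also have "\<dots> = 1\<^sub>m (d S)"
    using F g' c1 c2 s by simp
  finally have 1: "g * f = 1\<^sub>m (d S)" .
  have "f * g = j1 * (f1 * (p1 * g)) + j2 * (f2 * (p2 * g))"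
    unfolding f_def using s t dims mor_dim[OF fm(2)] by (simp add: mat_add_mult mat_mult_assoc)
  also have "\<dots> = 1\<^sub>m (d T)"
    using G g' c3 c4 t by simp
  finally have "f * g = 1\<^sub>m (d T)" .
  then have "iso_mor C S T f"
    using 1 fm by (auto simp: iso_mor_def inverse_mor_iff)
  then show thesis
    using that F g' by blast
qed

text \<open>Each zigzag expands into four terms. The mixed ones contain an injection followed by the
  projection to the other summand and vanish; the other two add up to
  \<open>i1 * p1 + i2 * p2\<close> on \<open>S\<close> and to \<open>j1 * q1 + j2 * q2\<close> on
  \<open>T\<close>, hence to identities.\<close>

lemma is_dual_direct_sum:
  assumes obj: "M \<in> obj C" "N \<in> obj C" and M: "is_dual C M M' e c" and N: "is_dual C N N' e' c'"
    and S: "is_direct_sum C M N S i1 i2 p1 p2" and T: "is_direct_sum C M' N' T j1 j2 q1 q2"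
  shows "is_dual C S T (e * (q1 ** p1) + e' * (q2 ** p2)) ((i1 ** j1) * c + (i2 ** j2) * c')"
proof -
  note s = is_direct_sumD[OF S] and t = is_direct_sumD[OF T]
  note dM = is_dualD[OF obj(1) M] and dN = is_dualD[OF obj(2) N]
  have qp: "q1 ** p1 \<in> mor C (teno C T S) (teno C M' M)" "q2 ** p2 \<in> mor C (teno C T S) (teno C N' N)"
    "i1 ** j1 \<in> mor C (teno C M M') (teno C S T)" "i2 ** j2 \<in> mor C (teno C N N') (teno C S T)"
    by (rule ten_mor; use obj s(1-5) t(1-5) dM(1) dN(1) in simp)+
  have "e * (q1 ** p1) \<in> mor C (teno C T S) (unito C)" "e' * (q2 ** p2) \<in> mor C (teno C T S) (unito C)"
    "(i1 ** j1) * c \<in> mor C (unito C) (teno C S T)" "(i2 ** j2) * c' \<in> mor C (unito C) (teno C S T)"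
    using mult_mor[OF _ _ _ dM(2) qp(1)] mult_mor[OF _ _ _ dN(2) qp(2)]
      mult_mor[OF _ _ _ qp(3) dM(3)] mult_mor[OF _ _ _ qp(4) dN(3)] obj s(1) t(1) dM(1) dN(1)
    by simp_all
  then have m1: "e * (q1 ** p1) + e' * (q2 ** p2) \<in> mor C (teno C T S) (unito C)"
    and m2: "(i1 ** j1) * c + (i2 ** j2) * c' \<in> mor C (unito C) (teno C S T)"
    using s(1) t(1) by (simp_all add: add_mor)
  note dims = s(11-18) t(11-18) dM(6-9) dN(6-9)
  have tl: "(1\<^sub>m (d S) ** (e * (q1 ** p1))) * (((i1 ** j1) * c) ** 1\<^sub>m (d S)) = i1 * p1"
    "(1\<^sub>m (d S) ** (e' * (q2 ** p2))) * (((i2 ** j2) * c') ** 1\<^sub>m (d S)) = i2 * p2"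
    "(1\<^sub>m (d S) ** (e * (q1 ** p1))) * (((i2 ** j2) * c') ** 1\<^sub>m (d S)) = 0\<^sub>m (d S) (d S)"
    "(1\<^sub>m (d S) ** (e' * (q2 ** p2))) * (((i1 ** j1) * c) ** 1\<^sub>m (d S)) = 0\<^sub>m (d S) (d S)"
    using dims s(6-9) t(6-9) dM(4) dN(4)
    by (simp_all add: dual_sum_term_left[of e "d M'" "d M" q1 "d T" p1 "d S" i1 "d M" j1 "d M'" c]
        dual_sum_term_left[of e' "d N'" "d N" q2 "d T" p2 "d S" i2 "d N" j2 "d N'" c']
        dual_sum_term_left[of e "d M'" "d M" q1 "d T" p1 "d S" i2 "d N" j2 "d N'" c']
        dual_sum_term_left[of e' "d N'" "d N" q2 "d T" p2 "d S" i1 "d M" j1 "d M'" c] tensor_one_mat)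
  have tr: "((e * (q1 ** p1)) ** 1\<^sub>m (d T)) * (1\<^sub>m (d T) ** ((i1 ** j1) * c)) = j1 * q1"
    "((e' * (q2 ** p2)) ** 1\<^sub>m (d T)) * (1\<^sub>m (d T) ** ((i2 ** j2) * c')) = j2 * q2"
    "((e * (q1 ** p1)) ** 1\<^sub>m (d T)) * (1\<^sub>m (d T) ** ((i2 ** j2) * c')) = 0\<^sub>m (d T) (d T)"
    "((e' * (q2 ** p2)) ** 1\<^sub>m (d T)) * (1\<^sub>m (d T) ** ((i1 ** j1) * c)) = 0\<^sub>m (d T) (d T)"
    using dims s(6-9) t(6-9) dM(5) dN(5)
    by (simp_all add: dual_sum_term_right[of e "d M'" "d M" q1 "d T" p1 "d S" i1 "d M" j1 "d M'" c]
        dual_sum_term_right[of e' "d N'" "d N" q2 "d T" p2 "d S" i2 "d N" j2 "d N'" c']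
        dual_sum_term_right[of e "d M'" "d M" q1 "d T" p1 "d S" i2 "d N" j2 "d N'" c']
        dual_sum_term_right[of e' "d N'" "d N" q2 "d T" p2 "d S" i1 "d M" j1 "d M'" c] tensor_one_mat)
  have "(1\<^sub>m (d S) ** (e * (q1 ** p1) + e' * (q2 ** p2))) * (((i1 ** j1) * c + (i2 ** j2) * c') ** 1\<^sub>m (d S))
      = i1 * p1 + 0\<^sub>m (d S) (d S) + (0\<^sub>m (d S) (d S) + i2 * p2)"
    using dims by (simp add: add_tensor_mat tensor_add_mat mat_mult_add mat_add_mult tl)
  moreover have "((e * (q1 ** p1) + e' * (q2 ** p2)) ** 1\<^sub>m (d T)) * (1\<^sub>m (d T) ** ((i1 ** j1) * c + (i2 ** j2) * c'))
      = j1 * q1 + 0\<^sub>m (d T) (d T) + (0\<^sub>m (d T) (d T) + j2 * q2)"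
    using dims by (simp add: add_tensor_mat tensor_add_mat mat_mult_add mat_add_mult tr)
  moreover have "i1 * p1 + 0\<^sub>m (d S) (d S) + (0\<^sub>m (d S) (d S) + i2 * p2) = i1 * p1 + i2 * p2"
    "j1 * q1 + 0\<^sub>m (d T) (d T) + (0\<^sub>m (d T) (d T) + j2 * q2) = j1 * q1 + j2 * q2"
    using dims by simp_all
  ultimately show ?thesis
    using m1 m2 s t by (simp add: is_dual_iff)
qed

end

section \<open>Equivalences of matrix categories\<close>

locale matcat_pair = C: matcat C d + D: matcat D d'
  for C :: "('o, complex mat, complex, 'x) linear_moncat_scheme" and d
    and D :: "('p, complex mat, complex, 'y) linear_moncat_scheme" and d'
begin

text \<open>A morphism is recovered from its image under \<open>K\<close> after \<open>F\<close>, to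
  which it is conjugate by the invertible \<open>\<eta>\<close>.\<close>

lemma equivalence_functor_faithful:
  assumes F: "equivalence_functor C D F" and obj: "X \<in> obj C" "Y \<in> obj C"
    and f: "f \<in> mor C X Y" "g \<in> mor C X Y" "fmor F X Y f = fmor F X Y g"
  shows "f = g"
proof -
  obtain K \<eta> where \<eta>: "natural_iso C C id_funct (comp_funct K F) \<eta>"
    using F by (auto simp: equivalence_functor_def)
  have nat: "fmor K (fobj F X) (fobj F Y) (fmor F X Y h) * \<eta> X = \<eta> Y * h" if "h \<in> mor C X Y" for h
    using \<eta> obj that by (simp add: natural_iso_def comp_funct_def id_funct_def)
  have "iso_mor C Y (fobj K (fobj F Y)) (\<eta> Y)"
    using \<eta> obj by (simp add: natural_iso_def comp_funct_def id_funct_def)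
  then obtain k where k: "k \<in> mor C (fobj K (fobj F Y)) Y" "\<eta> Y \<in> mor C Y (fobj K (fobj F Y))"
      "k * \<eta> Y = 1\<^sub>m (d Y)"
    by (auto simp: iso_mor_def C.inverse_mor_iff)
  have "k * (\<eta> Y * f) = k * (\<eta> Y * g)"
    using nat[OF f(1)] nat[OF f(2)] f(3) by simp
  then show ?thesis
    using mat_cancel[OF k(3), of f] mat_cancel[OF k(3), of g] C.mor_dim k f by auto
qed

text \<open>The preimage \<open>f\<close> is the \<open>K\<close>-image of \<open>g\<close>
  conjugated by \<open>\<eta>\<close>, so \<open>F f\<close> and \<open>g\<close> have the same
  image under \<open>K\<close>. Naturality of the invertible \<open>\<theta>\<close> then identifies
  them.\<close>

lemma equivalence_functor_full:
  assumes F: "equivalence_functor C D F" and obj: "X \<in> obj C" "Y \<in> obj C"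
    and g: "g \<in> mor D (fobj F X) (fobj F Y)"
  obtains f where "f \<in> mor C X Y" "fmor F X Y f = g"
proof -
  obtain K \<eta> \<theta> where K: "is_functor D C K" and \<eta>: "natural_iso C C id_funct (comp_funct K F) \<eta>"
    and \<theta>: "natural_iso D D (comp_funct F K) id_funct \<theta>" and FF: "is_functor C D F"
    using F by (auto simp: equivalence_functor_def)
  have FX: "fobj F X \<in> obj D" "fobj F Y \<in> obj D" "fobj K (fobj F X) \<in> obj C" "fobj K (fobj F Y) \<in> obj C"
    using obj K FF by (auto simp: is_functor_def)
  have nat: "fmor K (fobj F X) (fobj F Y) (fmor F X Y h) * \<eta> X = \<eta> Y * h" if "h \<in> mor C X Y" for h
    using \<eta> obj that by (simp add: natural_iso_def comp_funct_def id_funct_def)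
  have "iso_mor C X (fobj K (fobj F X)) (\<eta> X)" "iso_mor C Y (fobj K (fobj F Y)) (\<eta> Y)"
    using \<eta> obj by (simp_all add: natural_iso_def comp_funct_def id_funct_def)
  then obtain k l where k: "inverse_mor C X (fobj K (fobj F X)) (\<eta> X) k"
      and l: "inverse_mor C Y (fobj K (fobj F Y)) (\<eta> Y) l"
    by (auto simp: iso_mor_def)
  note k' = k[unfolded C.inverse_mor_iff] and l' = l[unfolded C.inverse_mor_iff]
  have Kg: "fmor K (fobj F X) (fobj F Y) g \<in> mor C (fobj K (fobj F X)) (fobj K (fobj F Y))"
    using K FX g by (simp add: is_functor_def)
  define f where "f = l * (fmor K (fobj F X) (fobj F Y) g * \<eta> X)"
  have f: "f \<in> mor C X Y"
    unfolding f_def using C.mult_mor[OF obj(1) FX(4) obj(2)] C.mult_mor[OF obj(1) FX(3,4) Kg] k' l' by blast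
  have dims: "dim_row (\<eta> X) = d (fobj K (fobj F X))" "dim_col (\<eta> X) = d X"
    "dim_row (\<eta> Y) = d (fobj K (fobj F Y))" "dim_col (\<eta> Y) = d Y"
    "dim_row k = d X" "dim_col k = d (fobj K (fobj F X))" "dim_row l = d Y" "dim_col l = d (fobj K (fobj F Y))"
    using k' l' C.mor_dim by blast+
  have Ff: "fmor F X Y f \<in> mor D (fobj F X) (fobj F Y)"
    using FF obj f by (simp add: is_functor_def)
  have KFf: "fmor K (fobj F X) (fobj F Y) (fmor F X Y f) \<in> mor C (fobj K (fobj F X)) (fobj K (fobj F Y))"
    using K FX Ff by (simp add: is_functor_def)
  have "fmor K (fobj F X) (fobj F Y) (fmor F X Y f) * \<eta> X = fmor K (fobj F X) (fobj F Y) g * \<eta> X"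
    unfolding nat[OF f] unfolding f_def
    by (rule mat_cancel) (use l' dims C.mor_dim[OF Kg] in auto)
  then have "fmor K (fobj F X) (fobj F Y) (fmor F X Y f) * \<eta> X * k = fmor K (fobj F X) (fobj F Y) g * \<eta> X * k"
    by simp
  then have e: "fmor K (fobj F X) (fobj F Y) (fmor F X Y f) = fmor K (fobj F X) (fobj F Y) g"
    using k' dims C.mor_dim[OF KFf] C.mor_dim[OF Kg] by (simp add: mat_mult_assoc)
  have nat': "\<theta> (fobj F Y) * fmor F (fobj K (fobj F X)) (fobj K (fobj F Y)) (fmor K (fobj F X) (fobj F Y) h)
      = h * \<theta> (fobj F X)" if "h \<in> mor D (fobj F X) (fobj F Y)" for h
    using \<theta> FX that by (simp add: natural_iso_def comp_funct_def id_funct_def)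
  have "iso_mor D (fobj F (fobj K (fobj F X))) (fobj F X) (\<theta> (fobj F X))"
    using \<theta> FX by (simp add: natural_iso_def comp_funct_def id_funct_def)
  then obtain t where t: "inverse_mor D (fobj F (fobj K (fobj F X))) (fobj F X) (\<theta> (fobj F X)) t"
    by (auto simp: iso_mor_def)
  note t' = t[unfolded D.inverse_mor_iff]
  have tdims: "dim_row (\<theta> (fobj F X)) = d' (fobj F X)" "dim_row t = dim_col (\<theta> (fobj F X))"
    using t' D.mor_dim[of t] D.mor_dim[of "\<theta> (fobj F X)"] by auto
  have "fmor F X Y f * \<theta> (fobj F X) * t = g * \<theta> (fobj F X) * t"
    using nat'[OF Ff] nat'[OF g] e by simp
  then have "fmor F X Y f = g"
    using t' tdims D.mor_dim[OF Ff] D.mor_dim[OF g] by (simp add: mat_mult_assoc)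
  then show thesis
    using f that by blast
qed

lemma equivalence_functor_surj:
  assumes F: "equivalence_functor C D F" and Y: "Y \<in> obj D"
  obtains X u where "X \<in> obj C" "iso_mor D (fobj F X) Y u"
proof -
  obtain K \<theta> where K: "is_functor D C K" and \<theta>: "natural_iso D D (comp_funct F K) id_funct \<theta>"
    using F by (auto simp: equivalence_functor_def)
  show thesis
    by (rule that[of "fobj K Y" "\<theta> Y"]) (use K \<theta> Y in \<open>auto simp: is_functor_def natural_iso_def comp_funct_def id_funct_def\<close>)
qed

text \<open>The quasi-inverse sends an object to a chosen preimage up to isomorphism, and a morphism
  to the lift of its conjugate by the chosen isomorphisms \<open>\<theta>\<close>. Every equation
  between lifts is checked after applying \<open>F\<close>, which faithfulness permits.\<close>

lemma equivalence_functorI: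
  assumes F: "is_functor C D F"
    and faithful: "\<And>X Y f g. \<lbrakk>X \<in> obj C; Y \<in> obj C; f \<in> mor C X Y; g \<in> mor C X Y;
      fmor F X Y f = fmor F X Y g\<rbrakk> \<Longrightarrow> f = g"
    and full: "\<And>X Y g. \<lbrakk>X \<in> obj C; Y \<in> obj C; g \<in> mor D (fobj F X) (fobj F Y)\<rbrakk>
      \<Longrightarrow> \<exists>f\<in>mor C X Y. fmor F X Y f = g"
    and surj: "\<And>Y. Y \<in> obj D \<Longrightarrow> \<exists>X\<in>obj C. \<exists>u. iso_mor D (fobj F X) Y u"
  shows "equivalence_functor C D F"
proof -
  interpret F: is_functor C D F
    by (rule F)
  define K where "K = (\<lambda>Y. SOME X. X \<in> obj C \<and> (\<exists>u. iso_mor D (fobj F X) Y u))"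
  have K: "K Y \<in> obj C \<and> (\<exists>u. iso_mor D (fobj F (K Y)) Y u)" if "Y \<in> obj D" for Y
    unfolding K_def by (rule someI_ex) (use surj[OF that] in blast)
  define \<theta> where "\<theta> = (\<lambda>Y. SOME u. iso_mor D (fobj F (K Y)) Y u)"
  have \<theta>: "iso_mor D (fobj F (K Y)) Y (\<theta> Y)" if "Y \<in> obj D" for Y
    unfolding \<theta>_def by (rule someI_ex) (use K[OF that] in blast)
  define \<theta>i where "\<theta>i = (\<lambda>Y. SOME v. inverse_mor D (fobj F (K Y)) Y (\<theta> Y) v)"
  have \<theta>i: "inverse_mor D (fobj F (K Y)) Y (\<theta> Y) (\<theta>i Y)" if "Y \<in> obj D" for Y
    unfolding \<theta>i_def by (rule someI_ex) (use \<theta>[OF that] in \<open>auto simp: iso_mor_def\<close>)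
  have FK: "fobj F (K Y) \<in> obj D" if "Y \<in> obj D" for Y
    using K[OF that] F.fobj_closed by blast
  have \<theta>m: "\<theta> Y \<in> mor D (fobj F (K Y)) Y" "\<theta>i Y \<in> mor D Y (fobj F (K Y))"
    "\<theta>i Y * \<theta> Y = 1\<^sub>m (d' (fobj F (K Y)))" "\<theta> Y * \<theta>i Y = 1\<^sub>m (d' Y)"
    "dim_row (\<theta> Y) = d' Y" "dim_col (\<theta> Y) = d' (fobj F (K Y))"
    "dim_row (\<theta>i Y) = d' (fobj F (K Y))" "dim_col (\<theta>i Y) = d' Y"
    if "Y \<in> obj D" for Y
    using \<theta>i[OF that] D.mor_dim by (auto simp: D.inverse_mor_iff)
  define L where "L = (\<lambda>X Y g. SOME f. f \<in> mor C X Y \<and> fmor F X Y f = g)"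
  have L: "L X Y g \<in> mor C X Y \<and> fmor F X Y (L X Y g) = g"
    if "X \<in> obj C" "Y \<in> obj C" "g \<in> mor D (fobj F X) (fobj F Y)" for X Y g
    unfolding L_def by (rule someI_ex) (use full[OF that] in blast)
  define KK where "KK = \<lparr>fobj = K, fmor = \<lambda>X Y g. L (K X) (K Y) (\<theta>i Y * (g * \<theta> X))\<rparr>"
  have conj: "\<theta>i Y * (g * \<theta> X) \<in> mor D (fobj F (K X)) (fobj F (K Y))"
    if "X \<in> obj D" "Y \<in> obj D" "g \<in> mor D X Y" for X Y g
    by (rule D.mult_mor[of _ Y _ , OF _ _ _ _ D.mult_mor[of _ X]]) (use that \<theta>m FK in auto)
  have KL: "L (K X) (K Y) (\<theta>i Y * (g * \<theta> X)) \<in> mor C (K X) (K Y)"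
    "fmor F (K X) (K Y) (L (K X) (K Y) (\<theta>i Y * (g * \<theta> X))) = \<theta>i Y * (g * \<theta> X)"
    if "X \<in> obj D" "Y \<in> obj D" "g \<in> mor D X Y" for X Y g
    using L[OF _ _ conj[OF that]] K that by auto
  have functK: "is_functor D C KK"
  proof
    show "fobj KK X \<in> obj C" if "X \<in> obj D" for X
      using K that by (simp add: KK_def)
    show "fmor KK X Y f \<in> mor C (fobj KK X) (fobj KK Y)" if "X \<in> obj D" "Y \<in> obj D" "f \<in> mor D X Y" for X Y f
      using KL that by (simp add: KK_def)
    show "fmor KK X X (idm D X) = idm C (fobj KK X)" if X: "X \<in> obj D" for X
    proof -
      have "fmor F (K X) (K X) (L (K X) (K X) (\<theta>i X * (1\<^sub>m (d' X) * \<theta> X))) = fmor F (K X) (K X) (1\<^sub>m (d (K X)))"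
        using KL(2)[OF X X D.one_mor[OF X]] \<theta>m[OF X] F.fmor_id[of "K X"] K[OF X] by simp
      then show ?thesis
        using faithful[OF _ _ KL(1)[OF X X D.one_mor[OF X]] C.one_mor] K[OF X] by (simp add: KK_def)
    qed
    show "fmor KK X Z (g \<cdot>\<^bsub>D\<^esub> f) = fmor KK Y Z g \<cdot>\<^bsub>C\<^esub> fmor KK X Y f"
      if obj: "X \<in> obj D" "Y \<in> obj D" "Z \<in> obj D" and f: "f \<in> mor D X Y" and g: "g \<in> mor D Y Z" for X Y Z f g
    proof -
      have gf: "g * f \<in> mor D X Z"
        using D.mult_mor obj f g by blast
      have "fmor F (K X) (K Z) (L (K Y) (K Z) (\<theta>i Z * (g * \<theta> Y)) * L (K X) (K Y) (\<theta>i Y * (f * \<theta> X)))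
          = \<theta>i Z * (g * \<theta> Y) * (\<theta>i Y * (f * \<theta> X))"
        using F.fmor_comp[of "K X" "K Y" "K Z"] KL(1)[OF obj(1,2) f] KL(1)[OF obj(2,3) g]
          KL(2)[OF obj(1,2) f] KL(2)[OF obj(2,3) g] K obj by simp
      also have "\<dots> = \<theta>i Z * (g * f * \<theta> X)"
        using \<theta>m[OF obj(1)] \<theta>m[OF obj(2)] \<theta>m[OF obj(3)] D.mor_dim[OF f] D.mor_dim[OF g]
        by (simp add: mat_mult_assoc mat_cancel)
      also have "\<dots> = fmor F (K X) (K Z) (L (K X) (K Z) (\<theta>i Z * (g * f * \<theta> X)))"
        using KL(2)[OF obj(1,3) gf] by simp
      finally have "L (K Y) (K Z) (\<theta>i Z * (g * \<theta> Y)) * L (K X) (K Y) (\<theta>i Y * (f * \<theta> X))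
          = L (K X) (K Z) (\<theta>i Z * (g * f * \<theta> X))"
        using faithful[of "K X" "K Z"] C.mult_mor[of "K X" "K Y" "K Z"] KL(1)[OF obj(1,2) f]
          KL(1)[OF obj(2,3) g] KL(1)[OF obj(1,3) gf] K obj by blast
      then show ?thesis
        by (simp add: KK_def)
    qed
  qed
  have nat\<theta>: "natural_iso D D (comp_funct F KK) id_funct \<theta>"
    unfolding natural_iso_def
  proof (intro conjI ballI)
    show "iso_mor D (fobj (comp_funct F KK) X) (fobj id_funct X) (\<theta> X)" if "X \<in> obj D" for X
      using \<theta>[OF that] by (simp add: comp_funct_def id_funct_def KK_def)
    fix X Y f
    assume obj: "X \<in> obj D" "Y \<in> obj D" and f: "f \<in> mor D X Y"
    have "\<theta> Y * (\<theta>i Y * (f * \<theta> X)) = f * \<theta> X"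
      by (rule mat_cancel) (use \<theta>m[OF obj(1)] \<theta>m[OF obj(2)] D.mor_dim[OF f] in auto)
    then show "fmor id_funct X Y f \<cdot>\<^bsub>D\<^esub> \<theta> X = \<theta> Y \<cdot>\<^bsub>D\<^esub> fmor (comp_funct F KK) X Y f"
      using KL(2)[OF obj f] by (simp add: comp_funct_def id_funct_def KK_def)
  qed
  \<comment> \<open>The unit is the lift of the inverse of \<open>\<theta>\<close>, so that its
    image under \<open>F\<close> cancels the counit.\<close>
  define \<eta> where "\<eta> = (\<lambda>X. L X (K (fobj F X)) (\<theta>i (fobj F X)))"
  have \<eta>: "\<eta> X \<in> mor C X (K (fobj F X))" "fmor F X (K (fobj F X)) (\<eta> X) = \<theta>i (fobj F X)" if X: "X \<in> obj C" for X
    unfolding \<eta>_def using L[OF X _ \<theta>m(2)] K F.fobj_closed[OF X] by auto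
  have nat\<eta>: "natural_iso C C id_funct (comp_funct KK F) \<eta>"
    unfolding natural_iso_def
  proof (intro conjI ballI)
    fix X
    assume X: "X \<in> obj C"
    note FX = F.fobj_closed[OF X]
    define k where "k = L (K (fobj F X)) X (\<theta> (fobj F X))"
    have k: "k \<in> mor C (K (fobj F X)) X" "fmor F (K (fobj F X)) X k = \<theta> (fobj F X)"
      unfolding k_def using L[OF _ X \<theta>m(1)[OF FX]] K FX by auto
    note KFX = conjunct1[OF K[OF FX]]
    have "k * \<eta> X = 1\<^sub>m (d X)"
    proof (rule faithful[OF X X])
      show "fmor F X X (k * \<eta> X) = fmor F X X (1\<^sub>m (d X))"
        using F.fmor_comp[OF X KFX X \<eta>(1)[OF X] k(1)] F.fmor_id[OF X] \<eta>[OF X] k \<theta>m[OF FX] by simp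
    qed (use C.mult_mor[OF X KFX X k(1) \<eta>(1)[OF X]] X in auto)
    moreover have "\<eta> X * k = 1\<^sub>m (d (K (fobj F X)))"
    proof (rule faithful[OF KFX KFX])
      show "fmor F (K (fobj F X)) (K (fobj F X)) (\<eta> X * k)
          = fmor F (K (fobj F X)) (K (fobj F X)) (1\<^sub>m (d (K (fobj F X))))"
        using F.fmor_comp[OF KFX X KFX k(1) \<eta>(1)[OF X]] F.fmor_id[OF KFX] \<eta>[OF X] k \<theta>m[OF FX] by simp
    qed (use C.mult_mor[OF KFX X KFX \<eta>(1)[OF X] k(1)] KFX in auto)
    ultimately show "iso_mor C (fobj id_funct X) (fobj (comp_funct KK F) X) (\<eta> X)"
      using \<eta>[OF X] k by (auto simp: iso_mor_def C.inverse_mor_iff comp_funct_def id_funct_def KK_def)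
  next
    fix X Y f
    assume obj: "X \<in> obj C" "Y \<in> obj C" and f: "f \<in> mor C X Y"
    note FX = F.fobj_closed[OF obj(1)] and FY = F.fobj_closed[OF obj(2)]
    note KFX = conjunct1[OF K[OF FX]] and KFY = conjunct1[OF K[OF FY]]
    have Ff: "fmor F X Y f \<in> mor D (fobj F X) (fobj F Y)"
      using F.fmor_closed obj f by blast
    let ?g = "L (K (fobj F X)) (K (fobj F Y)) (\<theta>i (fobj F Y) * (fmor F X Y f * \<theta> (fobj F X)))"
    have "?g * \<eta> X = \<eta> Y * f"
    proof (rule faithful[OF obj(1) KFY])
      have "fmor F X (K (fobj F Y)) (?g * \<eta> X)
          = \<theta>i (fobj F Y) * (fmor F X Y f * \<theta> (fobj F X)) * \<theta>i (fobj F X)"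
        using F.fmor_comp[OF obj(1) KFX KFY \<eta>(1)[OF obj(1)] KL(1)[OF FX FY Ff]]
          KL(2)[OF FX FY Ff] \<eta>(2)[OF obj(1)] by simp
      also have "\<dots> = \<theta>i (fobj F Y) * fmor F X Y f"
        using \<theta>m[OF FX] \<theta>m[OF FY] D.mor_dim[OF Ff] by (simp add: mat_mult_assoc)
      also have "\<dots> = fmor F X (K (fobj F Y)) (\<eta> Y * f)"
        using F.fmor_comp[OF obj KFY f \<eta>(1)[OF obj(2)]] \<eta>(2)[OF obj(2)] by simp
      finally show "fmor F X (K (fobj F Y)) (?g * \<eta> X) = fmor F X (K (fobj F Y)) (\<eta> Y * f)" .
    qed (use C.mult_mor[OF obj(1) KFX KFY KL(1)[OF FX FY Ff] \<eta>(1)[OF obj(1)]]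
        C.mult_mor[OF obj KFY \<eta>(1)[OF obj(2)] f] in auto)
    then show "fmor (comp_funct KK F) X Y f \<cdot>\<^bsub>C\<^esub> \<eta> X = \<eta> Y \<cdot>\<^bsub>C\<^esub> fmor id_funct X Y f"
      by (simp add: comp_funct_def id_funct_def KK_def)
  qed
  show ?thesis
    unfolding equivalence_functor_def using F functK nat\<eta> nat\<theta> by blast
qed

end

locale matcat_equivalence = matcat_pair C d D d' + is_linear_monoidal_functor C D F J e
  for C :: "('o, complex mat, complex, 'x) linear_moncat_scheme" and d
    and D :: "('p, complex mat, complex, 'y) linear_moncat_scheme" and d' and F J e +
  assumes equiv: "equivalence_functor C D F"
begin

lemmas faithful = equivalence_functor_faithful[OF equiv]
lemmas full = equivalence_functor_full[OF equiv]
lemmas ess_surj = equivalence_functor_surj[OF equiv]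

declare fobj_closed [simp]

lemma fmor_one [simp]: "X \<in> obj C \<Longrightarrow> fmor F X X (1\<^sub>m (d X)) = 1\<^sub>m (d' (fobj F X))"
  using fmor_id[of X] by simp

lemma fmor_mult: "\<lbrakk>X \<in> obj C; Y \<in> obj C; Z \<in> obj C; f \<in> mor C X Y; g \<in> mor C Y Z\<rbrakk>
    \<Longrightarrow> fmor F X Z (g * f) = fmor F Y Z g * fmor F X Y f"
  using fmor_comp[of X Y Z f g] by simp

lemma fmor_dim:
  assumes "X \<in> obj C" "Y \<in> obj C" "f \<in> mor C X Y"
  shows "dim_row (fmor F X Y f) = d' (fobj F Y)" "dim_col (fmor F X Y f) = d' (fobj F X)"
  using D.mor_dim[OF fmor_closed[OF assms]] by auto

lemma fmor_inverse:
  assumes "X \<in> obj C" "Y \<in> obj C" "inverse_mor C X Y f g"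
  shows "inverse_mor D (fobj F X) (fobj F Y) (fmor F X Y f) (fmor F Y X g)"
  using assms fmor_mult[of X Y X f g] fmor_mult[of Y X Y g f]
  by (simp add: D.inverse_mor_iff C.inverse_mor_iff fmor_closed)

lemma fmor_iso_reflect:
  assumes obj: "X \<in> obj C" "Y \<in> obj C" and u: "inverse_mor D (fobj F X) (fobj F Y) u v"
  obtains f g where "inverse_mor C X Y f g" "fmor F X Y f = u" "fmor F Y X g = v"
proof -
  note u' = u[unfolded D.inverse_mor_iff]
  obtain f where f: "f \<in> mor C X Y" "fmor F X Y f = u"
    using full[OF obj] u' by blast
  obtain g where g: "g \<in> mor C Y X" "fmor F Y X g = v"
    using full[OF obj(2,1)] u' by blast
  have "g * f = 1\<^sub>m (d X)" "f * g = 1\<^sub>m (d Y)"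
    using faithful[OF obj(1,1) C.mult_mor[OF obj(1,2,1) g(1) f(1)] C.one_mor[OF obj(1)]]
      faithful[OF obj(2,2) C.mult_mor[OF obj(2,1,2) f(1) g(1)] C.one_mor[OF obj(2)]]
      fmor_mult[OF obj(1,2,1) f(1) g(1)] fmor_mult[OF obj(2,1,2) g(1) f(1)] f g u' obj by simp_all
  then show thesis
    using that f g by (auto simp: C.inverse_mor_iff)
qed

definition Ji :: "'o \<Rightarrow> 'o \<Rightarrow> complex mat" where
  "Ji X Y = (SOME g. inverse_mor D (teno D (fobj F X) (fobj F Y)) (fobj F (teno C X Y)) (J X Y) g)"

definition ei :: "complex mat" where
  "ei = (SOME g. inverse_mor D (unito D) (fobj F (unito C)) e g)"

lemma Ji_inverse:
  assumes "X \<in> obj C" "Y \<in> obj C"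
  shows "inverse_mor D (teno D (fobj F X) (fobj F Y)) (fobj F (teno C X Y)) (J X Y) (Ji X Y)"
  unfolding Ji_def by (rule someI_ex) (use J_iso[OF assms] in \<open>auto simp: iso_mor_def\<close>)

lemma ei_inverse: "inverse_mor D (unito D) (fobj F (unito C)) e ei"
  unfolding ei_def by (rule someI_ex) (use e_iso in \<open>auto simp: iso_mor_def\<close>)

lemma J_facts:
  assumes "X \<in> obj C" "Y \<in> obj C"
  shows "J X Y \<in> mor D (teno D (fobj F X) (fobj F Y)) (fobj F (teno C X Y))"
    "Ji X Y \<in> mor D (fobj F (teno C X Y)) (teno D (fobj F X) (fobj F Y))"
    "Ji X Y * J X Y = 1\<^sub>m (d' (fobj F X) * d' (fobj F Y))" "J X Y * Ji X Y = 1\<^sub>m (d' (fobj F (teno C X Y)))"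
    "dim_row (J X Y) = d' (fobj F (teno C X Y))" "dim_col (J X Y) = d' (fobj F X) * d' (fobj F Y)"
    "dim_row (Ji X Y) = d' (fobj F X) * d' (fobj F Y)" "dim_col (Ji X Y) = d' (fobj F (teno C X Y))"
  using Ji_inverse[OF assms] D.mor_dim[of "J X Y"] D.mor_dim[of "Ji X Y"]
  by (auto simp: D.inverse_mor_iff)

lemma e_facts:
  "e \<in> mor D (unito D) (fobj F (unito C))" "ei \<in> mor D (fobj F (unito C)) (unito D)"
  "ei * e = 1\<^sub>m 1" "e * ei = 1\<^sub>m (d' (fobj F (unito C)))"
  "dim_row e = d' (fobj F (unito C))" "dim_col e = 1" "dim_row ei = 1" "dim_col ei = d' (fobj F (unito C))"
  using ei_inverse D.mor_dim[of e] D.mor_dim[of ei] by (auto simp: D.inverse_mor_iff)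

lemma J_nat: "\<lbrakk>X \<in> obj C; X' \<in> obj C; Y \<in> obj C; Y' \<in> obj C; f \<in> mor C X X'; g \<in> mor C Y Y'\<rbrakk>
    \<Longrightarrow> fmor F (teno C X Y) (teno C X' Y') (f ** g) * J X Y = J X' Y' * (fmor F X X' f ** fmor F Y Y' g)"
  using J_natural[of X X' Y Y' f g] by simp

lemma J_nat_left: "\<lbrakk>X \<in> obj C; X' \<in> obj C; Y \<in> obj C; f \<in> mor C X X'\<rbrakk>
    \<Longrightarrow> fmor F (teno C X Y) (teno C X' Y) (f ** 1\<^sub>m (d Y)) * J X Y = J X' Y * (fmor F X X' f ** 1\<^sub>m (d' (fobj F Y)))"
  using J_nat[of X X' Y Y f "1\<^sub>m (d Y)"] by simp

lemma J_nat_right: "\<lbrakk>X \<in> obj C; Y' \<in> obj C; Y \<in> obj C; f \<in> mor C Y Y'\<rbrakk>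
    \<Longrightarrow> fmor F (teno C X Y) (teno C X Y') (1\<^sub>m (d X) ** f) * J X Y = J X Y' * (1\<^sub>m (d' (fobj F X)) ** fmor F Y Y' f)"
  using J_nat[of X X Y Y' "1\<^sub>m (d X)" f] by simp

lemma J_ass:
  assumes obj: "X \<in> obj C" "Y \<in> obj C" "Z \<in> obj C"
  shows "J (teno C X Y) Z * (J X Y ** 1\<^sub>m (d' (fobj F Z))) = J X (teno C Y Z) * (1\<^sub>m (d' (fobj F X)) ** J Y Z)"
proof -
  note j = J_facts[OF C.ten_obj[OF obj(1,2)] obj(3)] J_facts[OF obj(1) C.ten_obj[OF obj(2,3)]]
    J_facts[OF obj(1,2)] J_facts[OF obj(2,3)]
  show ?thesis
    using J_assoc[OF obj] obj j fmor_one[of "teno C X (teno C Y Z)"]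
    by (simp add: C.ten_assoc mult.assoc)
qed

text \<open>Unitors being identities, the unit axiom makes \<open>J\<close> at the unit object a
  left inverse of \<open>e ** 1\<close>; as \<open>e\<close> is invertible, this determines
  it.\<close>

lemma J_unit_left:
  assumes "X \<in> obj C"
  shows "J (unito C) X * (e ** 1\<^sub>m (d' (fobj F X))) = 1\<^sub>m (d' (fobj F X))"
    "J (unito C) X = ei ** 1\<^sub>m (d' (fobj F X))"
proof -
  note j = J_facts[OF C.unit_obj assms] e_facts
  show 1: "J (unito C) X * (e ** 1\<^sub>m (d' (fobj F X))) = 1\<^sub>m (d' (fobj F X))"
    using J_lunit[OF assms] assms j by simp
  have "J (unito C) X * ((e ** 1\<^sub>m (d' (fobj F X))) * (ei ** 1\<^sub>m (d' (fobj F X)))) = ei ** 1\<^sub>m (d' (fobj F X))"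
    by (subst mat_mult_assoc[symmetric]) (use j 1 in auto)
  then show "J (unito C) X = ei ** 1\<^sub>m (d' (fobj F X))"
    using j by (simp add: tensor_mat_mult tensor_one_mat)
qed

lemma J_unit_right:
  assumes "X \<in> obj C"
  shows "J X (unito C) * (1\<^sub>m (d' (fobj F X)) ** e) = 1\<^sub>m (d' (fobj F X))"
    "J X (unito C) = 1\<^sub>m (d' (fobj F X)) ** ei"
proof -
  note j = J_facts[OF assms C.unit_obj] e_facts
  show 1: "J X (unito C) * (1\<^sub>m (d' (fobj F X)) ** e) = 1\<^sub>m (d' (fobj F X))"
    using J_runit[OF assms] assms j by simp
  have "J X (unito C) * ((1\<^sub>m (d' (fobj F X)) ** e) * (1\<^sub>m (d' (fobj F X)) ** ei)) = 1\<^sub>m (d' (fobj F X)) ** ei"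
    by (subst mat_mult_assoc[symmetric]) (use j 1 in auto)
  then show "J X (unito C) = 1\<^sub>m (d' (fobj F X)) ** ei"
    using j by (simp add: tensor_mat_mult tensor_one_mat)
qed

end

section \<open>Pairings and duals under a monoidal equivalence\<close>

context matcat_equivalence
begin

text \<open>The zero morphism is a scalar multiple by 0 and linearity preserves it.\<close>

lemma fmor_zero [simp]:
  assumes "X \<in> obj C" "Y \<in> obj C"
  shows "fmor F X Y (0\<^sub>m (d Y) (d X)) = 0\<^sub>m (d' (fobj F Y)) (d' (fobj F X))"
proof -
  have z: "0 \<cdot>\<^sub>m f = 0\<^sub>m (dim_row f) (dim_col f)" for f :: "complex mat"
    by (rule eq_matI) auto
  show ?thesis
    using fmor_scale[OF assms C.zero_mor[OF assms], of 0] fmor_dim[OF assms C.zero_mor[OF assms]]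
    by (simp add: z)
qed

lemma fmor_plus: "\<lbrakk>X \<in> obj C; Y \<in> obj C; f \<in> mor C X Y; g \<in> mor C X Y\<rbrakk>
    \<Longrightarrow> fmor F X Y (f + g) = fmor F X Y f + fmor F X Y g"
  using fmor_add[of X Y f g] by simp

lemma fmor_direct_sum:
  assumes obj: "M \<in> obj C" "N \<in> obj C" and S: "is_direct_sum C M N S i1 i2 p1 p2"
  shows "is_direct_sum D (fobj F M) (fobj F N) (fobj F S) (fmor F M S i1) (fmor F N S i2) (fmor F S M p1) (fmor F S N p2)"
proof -
  note s = C.is_direct_sumD[OF S]
  note m = fmor_mult[OF obj(1) s(1) obj(1) s(2,4)] fmor_mult[OF obj(1) s(1) obj(2) s(2,5)]
    fmor_mult[OF obj(2) s(1) obj(1) s(3,4)] fmor_mult[OF obj(2) s(1) obj(2) s(3,5)]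
    fmor_mult[OF s(1) obj(1) s(1) s(4,2)] fmor_mult[OF s(1) obj(2) s(1) s(5,3)]
  have "fmor F S S (i1 * p1 + i2 * p2) = fmor F S S (i1 * p1) + fmor F S S (i2 * p2)"
    by (rule fmor_plus) (use s obj C.mult_mor in auto)
  then show ?thesis
    using s obj by (simp add: D.is_direct_sum_iff fmor_closed flip: m)
qed

text \<open>The pairing \<open>F X \<otimes> F Y \<rightarrow> F (X \<otimes> Y) \<rightarrow> F I
  \<rightarrow> I\<close>.\<close>

definition trans :: "'o \<Rightarrow> 'o \<Rightarrow> complex mat \<Rightarrow> complex mat" where
  "trans X Y b = ei * (fmor F (teno C X Y) (unito C) b * J X Y)"

definition cotrans :: "'o \<Rightarrow> 'o \<Rightarrow> complex mat \<Rightarrow> complex mat" where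
  "cotrans X Y c = Ji X Y * (fmor F (unito C) (teno C X Y) c * e)"

lemma trans_mor:
  assumes "X \<in> obj C" "Y \<in> obj C" "b \<in> mor C (teno C X Y) (unito C)"
  shows "trans X Y b \<in> mor D (teno D (fobj F X) (fobj F Y)) (unito D)"
  unfolding trans_def
  by (rule D.mult_mor[OF _ _ _ e_facts(2) D.mult_mor[OF _ _ _ fmor_closed J_facts(1)]]) (use assms in auto)

lemma cotrans_mor:
  assumes "X \<in> obj C" "Y \<in> obj C" "c \<in> mor C (unito C) (teno C X Y)"
  shows "cotrans X Y c \<in> mor D (unito D) (teno D (fobj F X) (fobj F Y))"
  unfolding cotrans_def
  by (rule D.mult_mor[OF _ _ _ J_facts(2) D.mult_mor[OF _ _ _ fmor_closed e_facts(1)]]) (use assms in auto)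

lemma trans_nat:
  assumes obj: "X \<in> obj C" "Y \<in> obj C" "X' \<in> obj C" "Y' \<in> obj C"
    and m: "f \<in> mor C X X'" "g \<in> mor C Y Y'" "b \<in> mor C (teno C X' Y') (unito C)"
  shows "trans X Y (b * (f ** g)) = trans X' Y' b * (fmor F X X' f ** fmor F Y Y' g)"
proof -
  note dims = fmor_dim[OF obj(1,3) m(1)] fmor_dim[OF obj(2,4) m(2)] J_facts(5,6)[OF obj(1,2)] J_facts(5,6)[OF obj(3,4)]
    fmor_dim[OF _ _ m(3)] fmor_dim[OF _ _ C.ten_mor[OF obj m(1,2)]] e_facts(7,8)
  have "fmor F (teno C X Y) (unito C) (b * (f ** g))
      = fmor F (teno C X' Y') (unito C) b * fmor F (teno C X Y) (teno C X' Y') (f ** g)"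
    by (rule fmor_mult) (use obj m C.ten_mor[OF obj m(1,2)] in auto)
  then show ?thesis
    unfolding trans_def using obj dims J_nat[OF obj(1,3,2,4) m(1,2)] by (simp add: mat_mult_assoc)
qed

lemma trans_add:
  assumes obj: "X \<in> obj C" "Y \<in> obj C"
    and m: "b \<in> mor C (teno C X Y) (unito C)" "b' \<in> mor C (teno C X Y) (unito C)"
  shows "trans X Y (b + b') = trans X Y b + trans X Y b'"
  unfolding trans_def using obj m J_facts(5,6)[OF obj] fmor_dim[OF _ _ m(1)] fmor_dim[OF _ _ m(2)] e_facts(7,8)
  by (simp add: fmor_plus mat_add_mult mat_mult_add)

lemma trans_inj:
  assumes obj: "X \<in> obj C" "Y \<in> obj C"
    and m: "b \<in> mor C (teno C X Y) (unito C)" "b' \<in> mor C (teno C X Y) (unito C)"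
    and eq: "trans X Y b = trans X Y b'"
  shows "b = b'"
proof (rule faithful[OF _ _ m])
  have *: "e * (trans X Y h * Ji X Y) = fmor F (teno C X Y) (unito C) h" if "h \<in> mor C (teno C X Y) (unito C)" for h
    unfolding trans_def
    using obj J_facts[OF obj] e_facts fmor_dim[OF _ _ that]
    by (simp add: mat_mult_assoc mat_cancel[OF e_facts(4)])
  show "fmor F (teno C X Y) (unito C) b = fmor F (teno C X Y) (unito C) b'"
    using *[OF m(1)] *[OF m(2)] eq by simp
qed (use obj in auto)

lemma trans_surj:
  assumes obj: "X \<in> obj C" "Y \<in> obj C" and b: "b \<in> mor D (teno D (fobj F X) (fobj F Y)) (unito D)"
  obtains h where "h \<in> mor C (teno C X Y) (unito C)" "trans X Y h = b"
proof -
  have "e * (b * Ji X Y) \<in> mor D (fobj F (teno C X Y)) (fobj F (unito C))"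
    by (rule D.mult_mor[OF _ _ _ e_facts(1) D.mult_mor[OF _ _ _ b J_facts(2)]]) (use obj in auto)
  then obtain h where h: "h \<in> mor C (teno C X Y) (unito C)" "fmor F (teno C X Y) (unito C) h = e * (b * Ji X Y)"
    using full[of "teno C X Y" "unito C"] obj by auto
  have "trans X Y h = b"
    unfolding trans_def h(2)
    using J_facts[OF obj] e_facts D.mor_dim[OF b]
    by (simp add: mat_mult_assoc mat_cancel[OF e_facts(3)])
  then show thesis
    using h that by blast
qed

lemma cotrans_surj:
  assumes obj: "X \<in> obj C" "Y \<in> obj C" and c: "c \<in> mor D (unito D) (teno D (fobj F X) (fobj F Y))"
  obtains h where "h \<in> mor C (unito C) (teno C X Y)" "cotrans X Y h = c"
proof -
  have "J X Y * (c * ei) \<in> mor D (fobj F (unito C)) (fobj F (teno C X Y))"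
    by (rule D.mult_mor[OF _ _ _ J_facts(1) D.mult_mor[OF _ _ _ c e_facts(2)]]) (use obj in auto)
  then obtain h where h: "h \<in> mor C (unito C) (teno C X Y)" "fmor F (unito C) (teno C X Y) h = J X Y * (c * ei)"
    using full[of "unito C" "teno C X Y"] obj by auto
  have "cotrans X Y h = c"
    unfolding cotrans_def h(2)
    using J_facts[OF obj] e_facts D.mor_dim[OF c]
    by (simp add: mat_mult_assoc mat_cancel[OF J_facts(3)[OF obj]])
  then show thesis
    using h that by blast
qed

text \<open>Naturality of \<open>J\<close> moves the image of \<open>b\<close> outwards; the factor
  with \<open>ei\<close> that is left over is \<open>J\<close> at the unit object, and the two
  nested \<open>J\<close> are rebracketed by \<open>J_ass\<close>. In the rebracketed form they meet
  the \<open>Ji\<close> of a transported copairing.\<close>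

lemma trans_one_left:
  assumes obj: "X \<in> obj C" "Y \<in> obj C" "Z \<in> obj C" and b: "b \<in> mor C (teno C X Y) (unito C)"
  shows "trans X Y b ** 1\<^sub>m (d' (fobj F Z))
    = fmor F (teno C (teno C X Y) Z) Z (b ** 1\<^sub>m (d Z)) * (J X (teno C Y Z) * (1\<^sub>m (d' (fobj F X)) ** J Y Z))"
proof -
  note XY = C.ten_obj[OF obj(1,2)]
  note dims = J_facts[OF obj(1,2)] J_facts[OF XY obj(3)] e_facts fmor_dim[OF XY C.unit_obj b]
  have "fmor F (teno C (teno C X Y) Z) Z (b ** 1\<^sub>m (d Z)) * J (teno C X Y) Z
      = J (unito C) Z * (fmor F (teno C X Y) (unito C) b ** 1\<^sub>m (d' (fobj F Z)))"
    using J_nat_left[OF XY C.unit_obj obj(3) b] obj by simp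
  moreover have "dim_col (fmor F (teno C (teno C X Y) Z) Z (b ** 1\<^sub>m (d Z))) = d' (fobj F (teno C (teno C X Y) Z))"
    using fmor_dim[OF _ _ C.ten_one_mor[OF XY C.unit_obj obj(3) b]] obj by simp
  ultimately have "fmor F (teno C (teno C X Y) Z) Z (b ** 1\<^sub>m (d Z)) * (J (teno C X Y) Z * (J X Y ** 1\<^sub>m (d' (fobj F Z))))
      = J (unito C) Z * ((fmor F (teno C X Y) (unito C) b ** 1\<^sub>m (d' (fobj F Z))) * (J X Y ** 1\<^sub>m (d' (fobj F Z))))"
    using dims J_facts(5,6)[OF C.unit_obj obj(3)] obj by (simp flip: mat_mult_assoc)
  then show ?thesis
    unfolding trans_def using dims
    by (simp add: J_ass[OF obj, symmetric] J_unit_left[OF obj(3)] mult_tensor_one)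
qed

lemma trans_one_right:
  assumes obj: "X \<in> obj C" "Y \<in> obj C" "Z \<in> obj C" and b: "b \<in> mor C (teno C X Y) (unito C)"
  shows "1\<^sub>m (d' (fobj F Z)) ** trans X Y b
    = fmor F (teno C Z (teno C X Y)) Z (1\<^sub>m (d Z) ** b) * (J (teno C Z X) Y * (J Z X ** 1\<^sub>m (d' (fobj F Y))))"
proof -
  note XY = C.ten_obj[OF obj(1,2)]
  note dims = J_facts[OF obj(1,2)] J_facts[OF obj(3) XY] e_facts fmor_dim[OF XY C.unit_obj b]
  have "fmor F (teno C Z (teno C X Y)) Z (1\<^sub>m (d Z) ** b) * J Z (teno C X Y)
      = J Z (unito C) * (1\<^sub>m (d' (fobj F Z)) ** fmor F (teno C X Y) (unito C) b)"
    using J_nat_right[OF obj(3) C.unit_obj XY b] obj by simp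
  moreover have "dim_col (fmor F (teno C Z (teno C X Y)) Z (1\<^sub>m (d Z) ** b)) = d' (fobj F (teno C Z (teno C X Y)))"
    using fmor_dim[OF _ _ C.one_ten_mor[OF XY C.unit_obj obj(3) b]] obj by simp
  ultimately have "fmor F (teno C Z (teno C X Y)) Z (1\<^sub>m (d Z) ** b) * (J Z (teno C X Y) * (1\<^sub>m (d' (fobj F Z)) ** J X Y))
      = J Z (unito C) * ((1\<^sub>m (d' (fobj F Z)) ** fmor F (teno C X Y) (unito C) b) * (1\<^sub>m (d' (fobj F Z)) ** J X Y))"
    using dims J_facts(5,6)[OF obj(3) C.unit_obj] obj by (simp flip: mat_mult_assoc)
  then show ?thesis
    unfolding trans_def using dims
    by (simp add: J_ass[OF obj(3,1,2)] J_unit_right[OF obj(3)] one_tensor_mult)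
qed

text \<open>The inner \<open>J\<close> and \<open>Ji\<close> cancel, naturality of \<open>J\<close>
  moves the image of \<open>c\<close> outwards, and the remaining \<open>J\<close> at the unit is
  absorbed by \<open>e\<close>.\<close>

lemma trans_zigzag_left:
  assumes obj: "M \<in> obj C" "M' \<in> obj C"
    and b: "b \<in> mor C (teno C M' M) (unito C)" and c: "c \<in> mor C (unito C) (teno C M M')"
  shows "(1\<^sub>m (d' (fobj F M)) ** trans M' M b) * (cotrans M M' c ** 1\<^sub>m (d' (fobj F M)))
    = fmor F M M ((1\<^sub>m (d M) ** b) * (c ** 1\<^sub>m (d M)))"
proof -
  note MM = C.ten_obj[OF obj(1,2)] C.ten_obj[OF obj(2,1)] C.ten_obj[OF obj(1) C.ten_obj[OF obj(2,1)]]
  have bm: "1\<^sub>m (d M) ** b \<in> mor C (teno C M (teno C M' M)) M"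
    using C.one_ten_mor[OF MM(2) C.unit_obj obj(1) b] obj by simp
  have cm: "c ** 1\<^sub>m (d M) \<in> mor C M (teno C M (teno C M' M))"
    using C.ten_one_mor[OF C.unit_obj MM(1) obj(1) c] obj by (simp add: C.ten_assoc)
  note dims = J_facts[OF MM(1) obj(1)] J_facts[OF obj] fmor_dim[OF C.unit_obj MM(1) c] e_facts
    fmor_dim[OF MM(3) obj(1) bm] fmor_dim[OF obj(1) MM(3) cm] J_facts(5,6)[OF C.unit_obj obj(1)]
  have 1: "fmor F M (teno C M (teno C M' M)) (c ** 1\<^sub>m (d M)) * J (unito C) M
      = J (teno C M M') M * (fmor F (unito C) (teno C M M') c ** 1\<^sub>m (d' (fobj F M)))"
    using J_nat_left[OF C.unit_obj MM(1) obj(1) c] obj by (simp add: C.ten_assoc)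
  have "(1\<^sub>m (d' (fobj F M)) ** trans M' M b) * (cotrans M M' c ** 1\<^sub>m (d' (fobj F M)))
      = fmor F (teno C M (teno C M' M)) M (1\<^sub>m (d M) ** b) * (J (teno C M M') M *
        (((J M M' * Ji M M') ** 1\<^sub>m (d' (fobj F M))) * ((fmor F (unito C) (teno C M M') c ** 1\<^sub>m (d' (fobj F M)))
        * (e ** 1\<^sub>m (d' (fobj F M))))))"
    unfolding trans_one_right[OF obj(2,1,1) b] cotrans_def
    using dims(5-8,13-18,23-) obj by (simp add: mult_tensor_one mat_mult_assoc C.ten_assoc)
  also have "\<dots> = fmor F (teno C M (teno C M' M)) M (1\<^sub>m (d M) ** b) *
      ((J (teno C M M') M * (fmor F (unito C) (teno C M M') c ** 1\<^sub>m (d' (fobj F M)))) * (e ** 1\<^sub>m (d' (fobj F M))))"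
    using dims obj by (simp add: tensor_one_mat mat_mult_assoc C.ten_assoc)
  also have "\<dots> = fmor F (teno C M (teno C M' M)) M (1\<^sub>m (d M) ** b) *
      (fmor F M (teno C M (teno C M' M)) (c ** 1\<^sub>m (d M)) * (J (unito C) M * (e ** 1\<^sub>m (d' (fobj F M)))))"
    unfolding 1[symmetric] using dims obj by (simp add: mat_mult_assoc)
  also have "\<dots> = fmor F M M ((1\<^sub>m (d M) ** b) * (c ** 1\<^sub>m (d M)))"
    using dims obj fmor_mult[OF obj(1) MM(3) obj(1) cm bm] by (simp add: J_unit_left(1)[OF obj(1)])
  finally show ?thesis .
qed

lemma trans_zigzag_right:
  assumes obj: "M \<in> obj C" "M' \<in> obj C"
    and b: "b \<in> mor C (teno C M' M) (unito C)" and c: "c \<in> mor C (unito C) (teno C M M')"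
  shows "(trans M' M b ** 1\<^sub>m (d' (fobj F M'))) * (1\<^sub>m (d' (fobj F M')) ** cotrans M M' c)
    = fmor F M' M' ((b ** 1\<^sub>m (d M')) * (1\<^sub>m (d M') ** c))"
proof -
  note MM = C.ten_obj[OF obj(1,2)] C.ten_obj[OF obj(2,1)] C.ten_obj[OF obj(2) C.ten_obj[OF obj(1,2)]]
  have bm: "b ** 1\<^sub>m (d M') \<in> mor C (teno C M' (teno C M M')) M'"
    using C.ten_one_mor[OF MM(2) C.unit_obj obj(2) b] obj by (simp add: C.ten_assoc)
  have cm: "1\<^sub>m (d M') ** c \<in> mor C M' (teno C M' (teno C M M'))"
    using C.one_ten_mor[OF C.unit_obj MM(1) obj(2) c] obj by simp
  note dims = J_facts[OF obj(2) MM(1)] J_facts[OF obj] fmor_dim[OF C.unit_obj MM(1) c] e_facts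
    fmor_dim[OF MM(3) obj(2) bm] fmor_dim[OF obj(2) MM(3) cm] J_facts(5,6)[OF obj(2) C.unit_obj]
  have 1: "fmor F M' (teno C M' (teno C M M')) (1\<^sub>m (d M') ** c) * J M' (unito C)
      = J M' (teno C M M') * (1\<^sub>m (d' (fobj F M')) ** fmor F (unito C) (teno C M M') c)"
    using J_nat_right[OF obj(2) MM(1) C.unit_obj c] obj by simp
  have "(trans M' M b ** 1\<^sub>m (d' (fobj F M'))) * (1\<^sub>m (d' (fobj F M')) ** cotrans M M' c)
      = fmor F (teno C M' (teno C M M')) M' (b ** 1\<^sub>m (d M')) * (J M' (teno C M M') *
        ((1\<^sub>m (d' (fobj F M')) ** (J M M' * Ji M M')) * ((1\<^sub>m (d' (fobj F M')) ** fmor F (unito C) (teno C M M') c)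
        * (1\<^sub>m (d' (fobj F M')) ** e))))"
    unfolding trans_one_left[OF obj(2,1,2) b] cotrans_def
    using dims(5-8,13-18,23-) obj by (simp add: one_tensor_mult mat_mult_assoc C.ten_assoc)
  also have "\<dots> = fmor F (teno C M' (teno C M M')) M' (b ** 1\<^sub>m (d M')) *
      ((J M' (teno C M M') * (1\<^sub>m (d' (fobj F M')) ** fmor F (unito C) (teno C M M') c)) * (1\<^sub>m (d' (fobj F M')) ** e))"
    using dims obj by (simp add: tensor_one_mat mat_mult_assoc C.ten_assoc)
  also have "\<dots> = fmor F (teno C M' (teno C M M')) M' (b ** 1\<^sub>m (d M')) *
      (fmor F M' (teno C M' (teno C M M')) (1\<^sub>m (d M') ** c) * (J M' (unito C) * (1\<^sub>m (d' (fobj F M')) ** e)))"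
    unfolding 1[symmetric] using dims obj by (simp add: mat_mult_assoc)
  also have "\<dots> = fmor F M' M' ((b ** 1\<^sub>m (d M')) * (1\<^sub>m (d M') ** c))"
    using dims obj fmor_mult[OF obj(2) MM(3) obj(2) cm bm] by (simp add: J_unit_right(1)[OF obj(2)])
  finally show ?thesis .
qed

text \<open>Each zigzag in \<open>D\<close> is the image of the corresponding one in
  \<open>C\<close>, so one direction is functoriality and the other is faithfulness. The latter
  recovers non-singular forms from their images.\<close>

lemma is_dual_trans_iff:
  assumes obj: "M \<in> obj C" "M' \<in> obj C"
    and b: "b \<in> mor C (teno C M' M) (unito C)" and c: "c \<in> mor C (unito C) (teno C M M')"
  shows "is_dual D (fobj F M) (fobj F M') (trans M' M b) (cotrans M M' c) \<longleftrightarrow> is_dual C M M' b c"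
proof -
  have 1: "(1\<^sub>m (d M) ** b) * (c ** 1\<^sub>m (d M)) \<in> mor C M M"
    by (rule C.mult_mor[of _ "teno C M (teno C M' M)"])
      (use C.one_ten_mor[OF _ _ obj(1) b] C.ten_one_mor[OF _ _ obj(1) c] obj in \<open>auto simp: C.ten_assoc\<close>)
  have 2: "(b ** 1\<^sub>m (d M')) * (1\<^sub>m (d M') ** c) \<in> mor C M' M'"
    by (rule C.mult_mor[of _ "teno C M' (teno C M M')"])
      (use C.ten_one_mor[OF _ _ obj(2) b] C.one_ten_mor[OF _ _ obj(2) c] obj in \<open>auto simp: C.ten_assoc\<close>)
  show ?thesis
    using faithful[OF obj(1,1) 1 C.one_mor[OF obj(1)]] faithful[OF obj(2,2) 2 C.one_mor[OF obj(2)]]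
      trans_mor[OF obj(2,1) b] cotrans_mor[OF obj c] obj b c
      trans_zigzag_left[OF obj b c] trans_zigzag_right[OF obj b c]
    by (auto simp: C.is_dual_iff D.is_dual_iff)
qed

end

section \<open>Braided categories\<close>

text \<open>Strictness turns the hexagon axioms into the two product formulas.\<close>

locale braided_matcat = matcat C d
  for C :: "('o, complex mat, complex, 'x) braided_linear_moncat_scheme" and d +
  assumes braid_inverse: "X \<in> obj C \<Longrightarrow> Y \<in> obj C \<Longrightarrow>
      \<exists>g. inverse_mor C (teno C X Y) (teno C Y X) (braid C X Y) g"
    and braid_nat: "\<lbrakk>X \<in> obj C; X' \<in> obj C; Y \<in> obj C; Y' \<in> obj C; f \<in> mor C X X'; g \<in> mor C Y Y'\<rbrakk>
      \<Longrightarrow> (g ** f) * braid C X Y = braid C X' Y' * (f ** g)"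
    and hexagon_right: "\<lbrakk>X \<in> obj C; Y \<in> obj C; Z \<in> obj C\<rbrakk> \<Longrightarrow>
      braid C X (teno C Y Z) = (1\<^sub>m (d Y) ** braid C X Z) * (braid C X Y ** 1\<^sub>m (d Z))"
    and hexagon_left: "\<lbrakk>X \<in> obj C; Y \<in> obj C; Z \<in> obj C\<rbrakk> \<Longrightarrow>
      braid C (teno C X Y) Z = (braid C X Z ** 1\<^sub>m (d Y)) * (1\<^sub>m (d X) ** braid C Y Z)"
    and braid_unit [simp]: "X \<in> obj C \<Longrightarrow> braid C (unito C) X = 1\<^sub>m (d X)"
      "X \<in> obj C \<Longrightarrow> braid C X (unito C) = 1\<^sub>m (d X)"
begin

lemma braid_facts:
  assumes "X \<in> obj C" "Y \<in> obj C"
  shows "braid C X Y \<in> mor C (teno C X Y) (teno C Y X)"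
    "dim_row (braid C X Y) = d Y * d X" "dim_col (braid C X Y) = d X * d Y"
  using braid_inverse[OF assms] mor_dim[of "braid C X Y"] by (auto simp: inverse_mor_iff)

text \<open>In a braided category a left dual is also a right dual; strands are slid past \<open>ev\<close> and \<open>coev\<close>
  by naturality of the braiding.\<close>

lemma is_dual_braid:
  assumes M: "M \<in> obj C" and A: "is_dual C M A b c"
  shows "\<exists>c'. is_dual C A M (b * braid C M A) c'"
proof -
  note dd = is_dualD[OF M A]
  note A' = dd(1)
  note AM = ten_obj[OF A' M] and MA = ten_obj[OF M A']
  note bf = braid_facts[OF M A'] braid_facts[OF A' M] braid_facts[OF A' A'] braid_facts[OF M M]
    braid_facts[OF MA A'] braid_facts[OF A' AM] braid_facts[OF M MA] braid_facts[OF AM M]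
  \<comment> \<open>Rewriting the evaluation \<open>b * braid C M A\<close> in \<open>c1\<close> and
    \<open>c2\<close> produces a factor \<open>braid C A M\<close>; the coevaluation
    \<open>g * c\<close> is chosen so that this factor cancels.\<close>
  obtain g where "inverse_mor C (teno C A M) (teno C M A) (braid C A M) g"
    using braid_inverse[OF A' M] by blast
  then have g: "g \<in> mor C (teno C M A) (teno C A M)" "braid C A M * g = 1\<^sub>m (d M * d A)"
      "dim_row g = d A * d M" "dim_col g = d M * d A"
    using mor_dim[of g "teno C M A" "teno C A M"] by (simp_all add: inverse_mor_iff)
  note dims = dd(6-9) bf(2,3,5,6,8,9,11,12,14,15,17,18,20,21,23,24) g(3,4)
  have N1: "(1\<^sub>m (d A) ** braid C A M) * braid C (teno C A M) A = braid C (teno C M A) A * (braid C A M ** 1\<^sub>m (d A))"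
    by (rule braid_nat) (use bf A' M in auto)
  have N2: "(b ** 1\<^sub>m (d A)) * braid C A (teno C A M) = 1\<^sub>m (d A) ** b"
    using braid_nat[OF A' A' AM unit_obj one_mor[OF A'] dd(2)] A' dims by simp
  have N3: "(braid C A M ** 1\<^sub>m (d M)) * braid C M (teno C A M) = braid C M (teno C M A) * (1\<^sub>m (d M) ** braid C A M)"
    by (rule braid_nat) (use bf A' M in auto)
  have N4: "(1\<^sub>m (d M) ** b) * braid C (teno C A M) M = b ** 1\<^sub>m (d M)"
    using braid_nat[OF AM unit_obj M M dd(2) one_mor[OF M]] M dims by simp
  have N5: "braid C (teno C M A) A * (c ** 1\<^sub>m (d A)) = 1\<^sub>m (d A) ** c"
    using braid_nat[OF unit_obj MA A' A' dd(3) one_mor[OF A']] A' dims by simp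
  have N6: "braid C M (teno C M A) * (1\<^sub>m (d M) ** c) = c ** 1\<^sub>m (d M)"
    using braid_nat[OF M M unit_obj MA one_mor[OF M] dd(3)] M dims by simp
  have "(1\<^sub>m (d A) ** b) * (1\<^sub>m (d A) ** braid C M A)
      = (b ** 1\<^sub>m (d A)) * (((1\<^sub>m (d A) ** braid C A M) * (braid C A A ** 1\<^sub>m (d M))) * (1\<^sub>m (d A) ** braid C M A))"
    unfolding hexagon_right[OF A' A' M, symmetric] N2[symmetric]
    by (rule mat_mult_assoc) (use dims in \<open>auto simp: mult_ac\<close>)
  also have "\<dots> = (b ** 1\<^sub>m (d A)) * ((1\<^sub>m (d A) ** braid C A M) * braid C (teno C A M) A)"
    unfolding hexagon_left[OF A' M A'] using dims by (subst mat_mult_assoc) (auto simp: mult_ac)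
  also have "\<dots> = (b ** 1\<^sub>m (d A)) * (braid C (teno C M A) A * (braid C A M ** 1\<^sub>m (d A)))"
    by (simp only: N1)
  finally have c1: "1\<^sub>m (d A) ** (b * braid C M A)
      = (b ** 1\<^sub>m (d A)) * (braid C (teno C M A) A * (braid C A M ** 1\<^sub>m (d A)))"
    using dims by (simp add: one_tensor_mult)
  have "(b ** 1\<^sub>m (d M)) * (braid C M A ** 1\<^sub>m (d M))
      = (1\<^sub>m (d M) ** b) * (((braid C A M ** 1\<^sub>m (d M)) * (1\<^sub>m (d A) ** braid C M M)) * (braid C M A ** 1\<^sub>m (d M)))"
    unfolding hexagon_left[OF A' M M, symmetric] N4[symmetric]
    by (rule mat_mult_assoc) (use dims in \<open>auto simp: mult_ac\<close>)
  also have "\<dots> = (1\<^sub>m (d M) ** b) * ((braid C A M ** 1\<^sub>m (d M)) * braid C M (teno C A M))"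
    unfolding hexagon_right[OF M A' M] using dims by (subst mat_mult_assoc) (auto simp: mult_ac)
  also have "\<dots> = (1\<^sub>m (d M) ** b) * (braid C M (teno C M A) * (1\<^sub>m (d M) ** braid C A M))"
    by (simp only: N3)
  finally have c2: "(b * braid C M A) ** 1\<^sub>m (d M)
      = (1\<^sub>m (d M) ** b) * (braid C M (teno C M A) * (1\<^sub>m (d M) ** braid C A M))"
    using dims by (simp add: mult_tensor_one)
  have "(1\<^sub>m (d A) ** (b * braid C M A)) * ((g * c) ** 1\<^sub>m (d A))
      = (b ** 1\<^sub>m (d A)) * (braid C (teno C M A) A * (((braid C A M * g) ** 1\<^sub>m (d A)) * (c ** 1\<^sub>m (d A))))"
    unfolding c1 using dims by (simp add: mat_mult_assoc mult_tensor_one mult_ac)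
  also have "\<dots> = 1\<^sub>m (d A)"
    using dims dd(5) g(2) by (simp add: tensor_one_mat N5)
  finally have t1: "(1\<^sub>m (d A) ** (b * braid C M A)) * ((g * c) ** 1\<^sub>m (d A)) = 1\<^sub>m (d A)" .
  have "((b * braid C M A) ** 1\<^sub>m (d M)) * (1\<^sub>m (d M) ** (g * c))
      = (1\<^sub>m (d M) ** b) * (braid C M (teno C M A) * ((1\<^sub>m (d M) ** (braid C A M * g)) * (1\<^sub>m (d M) ** c)))"
    unfolding c2 using dims by (simp add: mat_mult_assoc one_tensor_mult mult_ac)
  also have "\<dots> = 1\<^sub>m (d M)"
    using dims dd(4) g(2) by (simp add: tensor_one_mat N6)
  finally have t2: "((b * braid C M A) ** 1\<^sub>m (d M)) * (1\<^sub>m (d M) ** (g * c)) = 1\<^sub>m (d M)" .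
  have "is_dual C A M (b * braid C M A) (g * c)"
    using M A' t1 t2 mult_mor[OF MA AM unit_obj dd(2) bf(1)] mult_mor[OF unit_obj MA AM g(1) dd(3)]
    by (simp add: is_dual_iff)
  then show ?thesis
    by blast
qed

end

section \<open>Invariance of the Witt group\<close>

locale witt_matcat = braided_matcat C d
  for C :: "('o, complex mat, complex, 'x) braided_linear_moncat_scheme" and d +
  assumes dual_exists: "M \<in> obj C \<Longrightarrow> \<exists>M' b c. is_dual C M M' b c"
    and direct_sum_exists: "M \<in> obj C \<Longrightarrow> N \<in> obj C \<Longrightarrow> \<exists>S i1 i2 p1 p2. is_direct_sum C M N S i1 i2 p1 p2"
begin

lemma dual_spec:
  assumes "M \<in> obj C"
  shows "is_dual C M (dual C M) (ev C M) (coev C M)"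
proof -
  have "\<exists>x. case x of (M', b, c) \<Rightarrow> is_dual C M M' b c"
    using dual_exists[OF assms] by auto
  then have "case dual_choice C M of (M', b, c) \<Rightarrow> is_dual C M M' b c"
    unfolding dual_choice_def by (rule someI_ex)
  then show ?thesis
    by (simp add: dual_def ev_def coev_def split_beta)
qed

lemma dsum_spec:
  assumes "M \<in> obj C" "N \<in> obj C"
  obtains i1 i2 where "is_direct_sum C M N (dsum C M N) i1 i2 (dproj1 C M N) (dproj2 C M N)"
proof -
  have "\<exists>x. case x of (S, i1, i2, p1, p2) \<Rightarrow> is_direct_sum C M N S i1 i2 p1 p2"
    using direct_sum_exists[OF assms] by auto
  then have "case dsum_choice C M N of (S, i1, i2, p1, p2) \<Rightarrow> is_direct_sum C M N S i1 i2 p1 p2"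
    unfolding dsum_choice_def by (rule someI_ex)
  then show thesis
    using that by (simp add: dsum_def dproj1_def dproj2_def split_beta)
qed

lemma form_adjoint_eq:
  assumes M: "M \<in> obj C" and b: "b \<in> mor C (teno C M M) (unito C)"
  shows "form_adjoint C M b = (b ** 1\<^sub>m (d (dual C M))) * (1\<^sub>m (d M) ** coev C M)"
proof -
  note dd = is_dualD[OF M dual_spec[OF M]]
  have 1: "inv_mor C (teno C (teno C M M) (dual C M)) (teno C M (teno C M (dual C M))) (1\<^sub>m (d M * d M * d (dual C M)))
      = 1\<^sub>m (d M * d M * d (dual C M))"
    using inv_mor_one[of "teno C (teno C M M) (dual C M)"] M dd(1) by (simp add: ten_assoc mult.assoc)
  have 2: "inv_mor C (teno C M (unito C)) M (1\<^sub>m (d M)) = 1\<^sub>m (d M)"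
    using inv_mor_one[OF M] M by simp
  show ?thesis
    unfolding form_adjoint_def using dd(6-9) mor_dim[OF b] by (simp add: 1[unfolded mult.assoc] 2 mult.assoc)
qed

text \<open>The adjoint of \<open>b\<close> is the comparison from \<open>M\<close>, paired with
  itself by \<open>b\<close>, to the chosen dual. If it is invertible, the chosen duality is
  transported along it and its evaluation becomes \<open>b\<close> by \<open>zigzag_left\<close>;
  conversely, comparisons of duals are invertible. Non-singularity thus no longer mentions the
  chosen dual.\<close>

lemma quad_objs_iff: "(M, b) \<in> quad_objs C \<longleftrightarrow> M \<in> obj C \<and> b \<in> mor C (teno C M M) (unito C) \<and>
    b * braid C M M = b \<and> (\<exists>c. is_dual C M M b c)"
proof -
  have "iso_mor C M (dual C M) (form_adjoint C M b) \<longleftrightarrow> (\<exists>c. is_dual C M M b c)"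
    if M: "M \<in> obj C" and b: "b \<in> mor C (teno C M M) (unito C)"
  proof
    assume "iso_mor C M (dual C M) (form_adjoint C M b)"
    then obtain k where k: "inverse_mor C M (dual C M) (form_adjoint C M b) k"
      by (auto simp: iso_mor_def)
    have "ev C M * (form_adjoint C M b ** 1\<^sub>m (d M)) = b"
      unfolding form_adjoint_eq[OF M b]
      by (rule zigzag_left) (use is_dualD[OF M dual_spec[OF M]] mor_dim[OF b] in auto)
    then show "\<exists>c. is_dual C M M b c"
      using is_dual_transport[OF M dual_spec[OF M] M k] by auto
  next
    assume "\<exists>c. is_dual C M M b c"
    then show "iso_mor C M (dual C M) (form_adjoint C M b)"
      using dual_unique[OF M _ dual_spec[OF M]] unfolding form_adjoint_eq[OF M b] iso_mor_def by blast
  qed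
  then show ?thesis
    by (auto simp: quad_objs_def)
qed

lemma quad_objsD:
  assumes "(M, b) \<in> quad_objs C"
  shows "M \<in> obj C" "b \<in> mor C (teno C M M) (unito C)" "b * braid C M M = b" "\<exists>c. is_dual C M M b c"
    "dim_row b = 1" "dim_col b = d M * d M"
  using assms mor_dim[of b "teno C M M" "unito C"] by (auto simp: quad_objs_iff)

lemma isometry_rel_iff: "((M, b), (N, b')) \<in> isometry_rel C \<longleftrightarrow> (M, b) \<in> quad_objs C \<and>
    (N, b') \<in> quad_objs C \<and> (\<exists>f. iso_mor C M N f \<and> b' * (f ** f) = b)"
  by (simp add: isometry_rel_def)

section \<open>Isometry classes of quadratic objects\<close>

lemma iso_mor_inverse:
  assumes "iso_mor C M N f"
  obtains g where "inverse_mor C M N f g" "f \<in> mor C M N" "g \<in> mor C N M" "g * f = 1\<^sub>m (d M)" "f * g = 1\<^sub>m (d N)"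
    "dim_row f = d N" "dim_col f = d M" "dim_row g = d M" "dim_col g = d N"
  using assms mor_dim by (auto simp: iso_mor_def inverse_mor_iff)

lemma equiv_isometry_rel: "equiv (quad_objs C) (isometry_rel C)"
proof (rule equivI)
  show "isometry_rel C \<subseteq> quad_objs C \<times> quad_objs C"
    by (auto simp: isometry_rel_def)
  show "refl_on (quad_objs C) (isometry_rel C)"
  proof (rule refl_onI)
    fix x
    assume x: "x \<in> quad_objs C"
    obtain M b where Mb: "x = (M, b)"
      by (cases x)
    note q = quad_objsD[OF x[unfolded Mb]]
    have "iso_mor C M M (1\<^sub>m (d M))" "b * (1\<^sub>m (d M) ** 1\<^sub>m (d M)) = b"
      using q inverse_mor_one[OF q(1)] by (auto simp: iso_mor_def tensor_one_mat)
    then show "(x, x) \<in> isometry_rel C"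
      using x unfolding Mb isometry_rel_iff by blast
  qed
  show "sym (isometry_rel C)"
  proof (rule symI)
    fix x y
    assume xy: "(x, y) \<in> isometry_rel C"
    obtain M b N b' where e: "x = (M, b)" "y = (N, b')"
      by (cases x, cases y)
    obtain f where q: "(M, b) \<in> quad_objs C" "(N, b') \<in> quad_objs C" "iso_mor C M N f" "b' * (f ** f) = b"
      using xy unfolding e isometry_rel_iff by blast
    note qM = quad_objsD[OF q(1)] and qN = quad_objsD[OF q(2)]
    obtain g where g: "inverse_mor C M N f g" "f \<in> mor C M N" "g \<in> mor C N M" "g * f = 1\<^sub>m (d M)" "f * g = 1\<^sub>m (d N)"
      "dim_row f = d N" "dim_col f = d M" "dim_row g = d M" "dim_col g = d N"
      using iso_mor_inverse[OF q(3)] .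
    have "b * (g ** g) = b' * ((f ** f) * (g ** g))"
      unfolding q(4)[symmetric] by (rule mat_mult_assoc) (use g qN in auto)
    also have "\<dots> = b'"
      using g qN by (simp add: tensor_mat_mult tensor_one_mat)
    finally have "b * (g ** g) = b'" .
    moreover have "iso_mor C N M g"
      using g(1) unfolding iso_mor_def by (subst (asm) inverse_mor_sym) blast
    ultimately show "(y, x) \<in> isometry_rel C"
      using q unfolding e isometry_rel_iff by blast
  qed
  show "trans (isometry_rel C)"
  proof (rule transI)
    fix x y z
    assume xyz: "(x, y) \<in> isometry_rel C" "(y, z) \<in> isometry_rel C"
    obtain M b N b' L b'' where e: "x = (M, b)" "y = (N, b')" "z = (L, b'')"
      by (cases x, cases y, cases z)
    obtain f g where q: "(M, b) \<in> quad_objs C" "(N, b') \<in> quad_objs C" "(L, b'') \<in> quad_objs C"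
      "iso_mor C M N f" "b' * (f ** f) = b" "iso_mor C N L g" "b'' * (g ** g) = b'"
      using xyz unfolding e isometry_rel_iff by blast
    note o = quad_objsD(1)[OF q(1)] quad_objsD(1)[OF q(2)] quad_objsD(1)[OF q(3)]
    obtain f' g' where i: "inverse_mor C M N f f'" "inverse_mor C N L g g'"
      using q(4,6) by (auto simp: iso_mor_def)
    have dims: "dim_row f = d N" "dim_col f = d M" "dim_row g = d L" "dim_col g = d N"
      using i mor_dim by (auto simp: inverse_mor_iff)
    have "b'' * ((g * f) ** (g * f)) = b'' * ((g ** g) * (f ** f))"
      using dims by (simp add: tensor_mat_mult)
    also have "\<dots> = b'' * (g ** g) * (f ** f)"
      by (rule mat_mult_assoc[symmetric]) (use dims quad_objsD[OF q(3)] in auto)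
    finally have "b'' * ((g * f) ** (g * f)) = b"
      using q by simp
    moreover have "iso_mor C M L (g * f)"
      using inverse_mor_comp[OF o i] by (auto simp: iso_mor_def)
    ultimately show "(x, z) \<in> isometry_rel C"
      using q unfolding e isometry_rel_iff by blast
  qed
qed

text \<open>The self-duality of \<open>N\<close> is transported along \<open>f\<close> in one tensor
  factor at a time.\<close>

lemma quad_objs_pullback:
  assumes N: "(N, b) \<in> quad_objs C" and M: "M \<in> obj C" and f: "iso_mor C M N f"
  shows "(M, b * (f ** f)) \<in> quad_objs C"
proof -
  note q = quad_objsD[OF N]
  obtain g where g: "inverse_mor C M N f g" "f \<in> mor C M N" "g \<in> mor C N M" "g * f = 1\<^sub>m (d M)" "f * g = 1\<^sub>m (d N)"
    "dim_row f = d N" "dim_col f = d M" "dim_row g = d M" "dim_col g = d N"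
    using iso_mor_inverse[OF f] .
  obtain c where c: "is_dual C N N b c"
    using q by blast
  have e: "b * (f ** f) = b * (1\<^sub>m (d N) ** f) * (f ** 1\<^sub>m (d M))"
    using g q by (simp add: mat_mult_assoc tensor_mat_mult)
  obtain c' where "is_dual C M M (b * (f ** f)) c'"
    using is_dual_transport[OF M is_dual_transport_left[OF q(1) c M g(1)] M g(1)] unfolding e by blast
  moreover have "b * (f ** f) * braid C M M = b * (f ** f)"
  proof -
    have "b * (f ** f) * braid C M M = b * ((f ** f) * braid C M M)"
      by (rule mat_mult_assoc) (use g q braid_facts[OF M M] in auto)
    also have "\<dots> = b * braid C N N * (f ** f)"
      unfolding braid_nat[OF M q(1) M q(1) g(2,2)]
      by (rule mat_mult_assoc[symmetric]) (use g q braid_facts[OF q(1,1)] in auto)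
    finally show ?thesis
      using q by simp
  qed
  moreover have "b * (f ** f) \<in> mor C (teno C M M) (unito C)"
    using mult_mor[OF _ _ _ q(2) ten_mor[OF M M q(1,1) g(2,2)]] M q(1) by simp
  ultimately show ?thesis
    using M by (auto simp: quad_objs_iff)
qed

lemma quad_objs_direct_sum:
  assumes M: "(M, b) \<in> quad_objs C" and N: "(N, b') \<in> quad_objs C" and S: "is_direct_sum C M N S i1 i2 p1 p2"
  shows "(S, b * (p1 ** p1) + b' * (p2 ** p2)) \<in> quad_objs C"
proof -
  note qM = quad_objsD[OF M] and qN = quad_objsD[OF N] and s = is_direct_sumD[OF S]
  obtain c c' where c: "is_dual C M M b c" "is_dual C N N b' c'"
    using qM qN by blast
  have *: "is_dual C S S (b * (p1 ** p1) + b' * (p2 ** p2)) ((i1 ** i1) * c + (i2 ** i2) * c')"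
    by (rule is_dual_direct_sum[OF qM(1) qN(1) c S S])
  note br = braid_facts[OF s(1,1)] braid_facts[OF qM(1,1)] braid_facts[OF qN(1,1)]
  have "b * (p1 ** p1) * braid C S S = b * braid C M M * (p1 ** p1)"
    using mat_mult_assoc[of b "p1 ** p1" "braid C S S"] mat_mult_assoc[of b "braid C M M" "p1 ** p1"]
      braid_nat[OF s(1) qM(1) s(1) qM(1) s(4,4)] br s qM(5,6) by simp
  moreover have "b' * (p2 ** p2) * braid C S S = b' * braid C N N * (p2 ** p2)"
    using mat_mult_assoc[of b' "p2 ** p2" "braid C S S"] mat_mult_assoc[of b' "braid C N N" "p2 ** p2"]
      braid_nat[OF s(1) qN(1) s(1) qN(1) s(5,5)] br s qN(5,6) by simp
  moreover have "(b * (p1 ** p1) + b' * (p2 ** p2)) * braid C S S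
      = b * (p1 ** p1) * braid C S S + b' * (p2 ** p2) * braid C S S"
    by (rule mat_add_mult) (use br s qM(5,6) qN(5,6) in auto)
  ultimately have "(b * (p1 ** p1) + b' * (p2 ** p2)) * braid C S S = b * (p1 ** p1) + b' * (p2 ** p2)"
    using qM(3) qN(3) by simp
  then show ?thesis
    using * is_dualD[OF s(1) *] by (auto simp: quad_objs_iff)
qed

text \<open>Stated for arbitrary direct sums in place of the chosen ones: the image of a chosen sum
  under a functor is a direct sum, but need not be the chosen one.\<close>

lemma isometry_direct_sum:
  assumes M: "((M, b), (M', x)) \<in> isometry_rel C" and N: "((N, b'), (N', x')) \<in> isometry_rel C"
    and S: "is_direct_sum C M N S i1 i2 p1 p2" and T: "is_direct_sum C M' N' T j1 j2 q1 q2"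
  shows "((S, b * (p1 ** p1) + b' * (p2 ** p2)), (T, x * (q1 ** q1) + x' * (q2 ** q2))) \<in> isometry_rel C"
proof -
  obtain f g where q: "(M, b) \<in> quad_objs C" "(M', x) \<in> quad_objs C" "iso_mor C M M' f" "x * (f ** f) = b"
    "(N, b') \<in> quad_objs C" "(N', x') \<in> quad_objs C" "iso_mor C N N' g" "x' * (g ** g) = b'"
    using M N unfolding isometry_rel_iff by blast
  note qs = quad_objsD[OF q(1)] quad_objsD[OF q(2)] quad_objsD[OF q(5)] quad_objsD[OF q(6)]
  note s = is_direct_sumD[OF S] and t = is_direct_sumD[OF T]
  obtain h where h: "iso_mor C S T h" "q1 * h = f * p1" "q2 * h = g * p2"
    using direct_sum_iso[OF qs(1,13,7,19) S T q(3,7)] .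
  have dims: "dim_row f = d M'" "dim_col f = d M" "dim_row g = d N'" "dim_col g = d N" "dim_row h = d T" "dim_col h = d S"
    using q(3,7) h(1) mor_dim by (auto simp: iso_mor_def inverse_mor_iff)
  have "(x * (q1 ** q1) + x' * (q2 ** q2)) * (h ** h) = x * ((q1 * h) ** (q1 * h)) + x' * ((q2 * h) ** (q2 * h))"
    using dims qs s t by (simp add: mat_add_mult mat_mult_assoc tensor_mat_mult)
  also have "\<dots> = x * ((f ** f) * (p1 ** p1)) + x' * ((g ** g) * (p2 ** p2))"
    unfolding h using dims s by (simp add: tensor_mat_mult)
  also have "\<dots> = x * (f ** f) * (p1 ** p1) + x' * (g ** g) * (p2 ** p2)"
    using dims qs s by (simp add: mat_mult_assoc)
  finally have "(x * (q1 ** q1) + x' * (q2 ** q2)) * (h ** h) = b * (p1 ** p1) + b' * (p2 ** p2)"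
    using q by simp
  then show ?thesis
    unfolding isometry_rel_iff
    using h(1) quad_objs_direct_sum[OF q(1,5) S] quad_objs_direct_sum[OF q(2,6) T] by blast
qed

lemma orth_sum_cong:
  assumes "(x, x') \<in> isometry_rel C" "(y, y') \<in> isometry_rel C"
  shows "(orth_sum C x y, orth_sum C x' y') \<in> isometry_rel C"
proof -
  obtain M b M' b' N c N' c' where e: "x = (M, b)" "x' = (M', b')" "y = (N, c)" "y' = (N', c')"
    by (cases x, cases x', cases y, cases y')
  have o: "M \<in> obj C" "M' \<in> obj C" "N \<in> obj C" "N' \<in> obj C"
    using assms unfolding e isometry_rel_iff by (auto dest: quad_objsD)
  obtain i1 i2 where S: "is_direct_sum C M N (dsum C M N) i1 i2 (dproj1 C M N) (dproj2 C M N)"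
    using dsum_spec[OF o(1,3)] .
  obtain j1 j2 where T: "is_direct_sum C M' N' (dsum C M' N') j1 j2 (dproj1 C M' N') (dproj2 C M' N')"
    using dsum_spec[OF o(2,4)] .
  show ?thesis
    using isometry_direct_sum[OF assms[unfolded e] S T] by (simp add: e)
qed

section \<open>Weakly symmetric objects and hyperbolic forms\<close>

lemma wsym_dual_indep:
  assumes M: "M \<in> obj C" and 1: "is_dual C M M' b c" and 2: "is_dual C M M'' b' c'"
    and w: "b * (braid C M M' * braid C M' M) = b"
  shows "b' * (braid C M M'' * braid C M'' M) = b'"
proof -
  note d1 = is_dualD[OF M 1] and d2 = is_dualD[OF M 2]
  \<comment> \<open>The evaluation \<open>b'\<close> is \<open>b\<close> composed with the
    comparison \<open>u\<close> of the two duals, and naturality slides \<open>u\<close> through the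
    double braiding.\<close>
  define u where "u = (b' ** 1\<^sub>m (d M')) * (1\<^sub>m (d M'') ** c)"
  note u = dual_comparison[OF M 2 1, folded u_def]
  note br = braid_facts[OF M d1(1)] braid_facts[OF d1(1) M] braid_facts[OF M d2(1)] braid_facts[OF d2(1) M]
  note dims = d1(6-9) d2(6-9) mor_dim[OF u(1)] br(2,3,5,6,8,9,11,12)
  have n1: "(u ** 1\<^sub>m (d M)) * braid C M M'' = braid C M M' * (1\<^sub>m (d M) ** u)"
    by (rule braid_nat) (use M d1 d2 u in auto)
  have n2: "(1\<^sub>m (d M) ** u) * braid C M'' M = braid C M' M * (u ** 1\<^sub>m (d M))"
    by (rule braid_nat) (use M d1 d2 u in auto)
  have "b' * (braid C M M'' * braid C M'' M) = b * (((u ** 1\<^sub>m (d M)) * braid C M M'') * braid C M'' M)"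
    unfolding u(2)[symmetric] using dims by (simp add: mat_mult_assoc)
  also have "\<dots> = b * (braid C M M' * ((1\<^sub>m (d M) ** u) * braid C M'' M))"
    unfolding n1 using dims by (simp add: mat_mult_assoc)
  also have "\<dots> = b * (braid C M M' * braid C M' M) * (u ** 1\<^sub>m (d M))"
    unfolding n2 using dims by (simp add: mat_mult_assoc)
  also have "\<dots> = b'"
    by (simp only: w u(2))
  finally show ?thesis .
qed

lemma wsym_objs_iff:
  assumes M: "M \<in> obj C" and 1: "is_dual C M M' b c"
  shows "M \<in> wsym_objs C \<longleftrightarrow> b * (braid C M M' * braid C M' M) = b"
proof -
  have "M \<in> wsym_objs C \<longleftrightarrow> ev C M * (braid C M (dual C M) * braid C (dual C M) M) = ev C M"
    using M by (auto simp: wsym_objs_def)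
  then show ?thesis
    using wsym_dual_indep[OF M 1 dual_spec[OF M]] wsym_dual_indep[OF M dual_spec[OF M] 1] by blast
qed

lemma wsym_objs_obj: "M \<in> wsym_objs C \<Longrightarrow> M \<in> obj C"
  by (simp add: wsym_objs_def)

text \<open>The dual of \<open>M\<close> also serves as a dual of \<open>N\<close>, with evaluation
  composed with \<open>f\<close>; again \<open>f\<close> slides through the double braiding.\<close>

lemma wsym_objs_iso:
  assumes M: "M \<in> wsym_objs C" and N: "N \<in> obj C" and f: "iso_mor C N M f"
  shows "N \<in> wsym_objs C"
proof -
  note M' = wsym_objs_obj[OF M]
  note dM = dual_spec[OF M'] and dd = is_dualD[OF M' dual_spec[OF M']]
  obtain g where g: "inverse_mor C N M f g" "f \<in> mor C N M" "g \<in> mor C M N" "g * f = 1\<^sub>m (d N)" "f * g = 1\<^sub>m (d M)"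
    "dim_row f = d M" "dim_col f = d N" "dim_row g = d N" "dim_col g = d M"
    using iso_mor_inverse[OF f] .
  let ?A = "dual C M" and ?b = "ev C M"
  note br = braid_facts[OF M' dd(1)] braid_facts[OF dd(1) M'] braid_facts[OF N dd(1)] braid_facts[OF dd(1) N]
  note dims = dd(6-9) g(6-9) br(2,3,5,6,8,9,11,12)
  have n1: "(1\<^sub>m (d ?A) ** f) * braid C N ?A = braid C M ?A * (f ** 1\<^sub>m (d ?A))"
    by (rule braid_nat) (use M' N dd g in auto)
  have n2: "(f ** 1\<^sub>m (d ?A)) * braid C ?A N = braid C ?A M * (1\<^sub>m (d ?A) ** f)"
    by (rule braid_nat) (use M' N dd g in auto)
  have "?b * (1\<^sub>m (d ?A) ** f) * (braid C N ?A * braid C ?A N) = ?b * ((1\<^sub>m (d ?A) ** f) * braid C N ?A * braid C ?A N)"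
    using dims by (simp add: mat_mult_assoc)
  also have "\<dots> = ?b * (braid C M ?A * ((f ** 1\<^sub>m (d ?A)) * braid C ?A N))"
    unfolding n1 using dims by (simp add: mat_mult_assoc)
  also have "\<dots> = ?b * (braid C M ?A * braid C ?A M) * (1\<^sub>m (d ?A) ** f)"
    unfolding n2 using dims by (simp add: mat_mult_assoc)
  also have "\<dots> = ?b * (1\<^sub>m (d ?A) ** f)"
    using M wsym_objs_iff[OF M' dM] by simp
  finally show ?thesis
    using wsym_objs_iff[OF N is_dual_transport_left[OF M' dM N g(1)]] by simp
qed

lemma equiv_wsym_iso_rel: "equiv (wsym_objs C) (wsym_iso_rel C)"
proof (rule equivI)
  show "wsym_iso_rel C \<subseteq> wsym_objs C \<times> wsym_objs C"
    by (auto simp: wsym_iso_rel_def)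
  show "refl_on (wsym_objs C) (wsym_iso_rel C)"
    using inverse_mor_one wsym_objs_obj by (intro refl_onI) (auto simp: wsym_iso_rel_def iso_mor_def)
  show "sym (wsym_iso_rel C)"
    by (rule symI) (use inverse_mor_sym in \<open>unfold wsym_iso_rel_def iso_mor_def, blast\<close>)
  show "trans (wsym_iso_rel C)"
  proof (rule transI)
    fix X Y Z
    assume xyz: "(X, Y) \<in> wsym_iso_rel C" "(Y, Z) \<in> wsym_iso_rel C"
    then obtain f f' g g' where "inverse_mor C X Y f f'" "inverse_mor C Y Z g g'"
      unfolding wsym_iso_rel_def iso_mor_def by blast
    moreover have "X \<in> obj C" "Y \<in> obj C" "Z \<in> obj C"
      using xyz wsym_objs_obj by (auto simp: wsym_iso_rel_def)
    ultimately have "inverse_mor C X Z (g * f) (f' * g')"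
      using inverse_mor_comp by blast
    then show "(X, Z) \<in> wsym_iso_rel C"
      using xyz unfolding wsym_iso_rel_def iso_mor_def by blast
  qed
qed

text \<open>The evaluation of a direct sum has two terms, and naturality carries the double braiding
  of each to the corresponding summand, where it is absorbed.\<close>

lemma wsym_objs_direct_sum:
  assumes M: "M \<in> wsym_objs C" and N: "N \<in> wsym_objs C" and S: "is_direct_sum C M N S i1 i2 p1 p2"
  shows "S \<in> wsym_objs C"
proof -
  note M' = wsym_objs_obj[OF M] and N' = wsym_objs_obj[OF N] and s = is_direct_sumD[OF S]
  note dM = dual_spec[OF M'] and dN = dual_spec[OF N']
  note ddM = is_dualD[OF M' dM] and ddN = is_dualD[OF N' dN]
  obtain T j1 j2 q1 q2 where T: "is_direct_sum C (dual C M) (dual C N) T j1 j2 q1 q2"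
    using direct_sum_exists[OF ddM(1) ddN(1)] by blast
  note t = is_direct_sumD[OF T]
  note dS = is_dual_direct_sum[OF M' N' dM dN S T]
  have *: "b * (q ** p) * (braid C S T * braid C T S) = b * (q ** p)"
    if "X \<in> wsym_objs C" "is_dual C X Y b c" "q \<in> mor C T Y" "p \<in> mor C S X" for X Y b c q p
  proof -
    note X = wsym_objs_obj[OF that(1)]
    note Y = is_dualD[OF X that(2)]
    note br = braid_facts[OF X Y(1)] braid_facts[OF Y(1) X] braid_facts[OF s(1) t(1)] braid_facts[OF t(1) s(1)]
    note dims = Y(6-9) br(2,3,5,6,8,9,11,12) mor_dim[OF that(3)] mor_dim[OF that(4)]
    have n1: "(q ** p) * braid C S T = braid C X Y * (p ** q)"
      by (rule braid_nat) (use s t X Y that in auto)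
    have n2: "(p ** q) * braid C T S = braid C Y X * (q ** p)"
      by (rule braid_nat) (use s t X Y that in auto)
    have "b * (q ** p) * (braid C S T * braid C T S) = b * ((q ** p) * braid C S T * braid C T S)"
      using dims by (simp add: mat_mult_assoc)
    also have "\<dots> = b * (braid C X Y * ((p ** q) * braid C T S))"
      unfolding n1 using dims by (simp add: mat_mult_assoc)
    also have "\<dots> = b * (braid C X Y * braid C Y X) * (q ** p)"
      unfolding n2 using dims by (simp add: mat_mult_assoc)
    finally show ?thesis
      using wsym_objs_iff[OF X that(2)] that(1) by simp
  qed
  note br = braid_facts[OF s(1) t(1)] braid_facts[OF t(1) s(1)]
  have "(ev C M * (q1 ** p1) + ev C N * (q2 ** p2)) * (braid C S T * braid C T S)
      = ev C M * (q1 ** p1) * (braid C S T * braid C T S) + ev C N * (q2 ** p2) * (braid C S T * braid C T S)"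
    by (rule mat_add_mult) (use br s t ddM(6-9) ddN(6-9) in auto)
  also have "\<dots> = ev C M * (q1 ** p1) + ev C N * (q2 ** p2)"
    using *[OF M dM t(4) s(4)] *[OF N dN t(5) s(5)] by simp
  finally show ?thesis
    using wsym_objs_iff[OF s(1) dS] by simp
qed

lemma dsum_cong:
  assumes "(M, M') \<in> wsym_iso_rel C" "(N, N') \<in> wsym_iso_rel C"
  shows "(dsum C M N, dsum C M' N') \<in> wsym_iso_rel C"
proof -
  obtain f g where w: "M \<in> wsym_objs C" "M' \<in> wsym_objs C" "N \<in> wsym_objs C" "N' \<in> wsym_objs C"
    "iso_mor C M M' f" "iso_mor C N N' g"
    using assms by (auto simp: wsym_iso_rel_def)
  note o = w(1-4)[THEN wsym_objs_obj]
  obtain i1 i2 where S: "is_direct_sum C M N (dsum C M N) i1 i2 (dproj1 C M N) (dproj2 C M N)"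
    using dsum_spec[OF o(1,3)] .
  obtain j1 j2 where T: "is_direct_sum C M' N' (dsum C M' N') j1 j2 (dproj1 C M' N') (dproj2 C M' N')"
    using dsum_spec[OF o(2,4)] .
  show ?thesis
    using direct_sum_iso[OF o(1,3,2,4) S T w(5,6)] wsym_objs_direct_sum[OF w(1,3) S]
      wsym_objs_direct_sum[OF w(2,4) T] by (auto simp: wsym_iso_rel_def)
qed

text \<open>The hyperbolic form for an arbitrary dual \<open>M'\<close> with evaluation
  \<open>b\<close> and an arbitrary direct sum with projections \<open>p\<close> and
  \<open>q\<close>, since a functor need not preserve the chosen ones.\<close>

definition hyp_form :: "'o \<Rightarrow> 'o \<Rightarrow> complex mat \<Rightarrow> complex mat \<Rightarrow> complex mat \<Rightarrow> complex mat" where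
  "hyp_form M M' b p q = b * (q ** p) + b * (braid C M M' * (p ** q))"

text \<open>\<open>M'\<close> is dual to \<open>M\<close> by \<open>b\<close>, and \<open>M\<close>
  is dual to \<open>M'\<close> by the braided evaluation, so \<open>M \<oplus> M'\<close> is dual to
  the same sum with the summands exchanged; this gives non-singularity. The braiding exchanges the
  two terms of the form, and on the second one a double braiding appears, which weak symmetry
  removes.\<close>

lemma hyp_form_quad:
  assumes M: "M \<in> wsym_objs C" and b: "is_dual C M M' b c" and S: "is_direct_sum C M M' S i j p q"
  shows "(S, hyp_form M M' b p q) \<in> quad_objs C"
proof -
  note M' = wsym_objs_obj[OF M]
  note dd = is_dualD[OF M' b] and s = is_direct_sumD[OF S]
  note br = braid_facts[OF M' dd(1)] braid_facts[OF dd(1) M'] braid_facts[OF s(1,1)]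
  note dims = dd(6-9) s(11-18) br(2,3,5,6,8,9)
  obtain c' where c': "is_dual C M' M (b * braid C M M') c'"
    using is_dual_braid[OF M' b] by blast
  have e: "hyp_form M M' b p q = b * (q ** p) + (b * braid C M M') * (p ** q)"
    unfolding hyp_form_def using dims by (simp add: mat_mult_assoc)
  obtain c'' where c'': "is_dual C S S (hyp_form M M' b p q) c''"
    using is_dual_direct_sum[OF M' dd(1) b c' S is_direct_sum_swap[OF S]] unfolding e by blast
  have n1: "(q ** p) * braid C S S = braid C M M' * (p ** q)"
    by (rule braid_nat) (use M' dd s in auto)
  have n2: "(p ** q) * braid C S S = braid C M' M * (q ** p)"
    by (rule braid_nat) (use M' dd s in auto)
  have "hyp_form M M' b p q * braid C S S
      = b * ((q ** p) * braid C S S) + b * (braid C M M' * ((p ** q) * braid C S S))"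
    unfolding hyp_form_def using dims by (simp add: mat_add_mult mat_mult_assoc)
  also have "\<dots> = b * (braid C M M' * (p ** q)) + b * (braid C M M' * braid C M' M) * (q ** p)"
    unfolding n1 n2 using dims by (simp add: mat_mult_assoc)
  also have "\<dots> = b * (braid C M M' * (p ** q)) + b * (q ** p)"
    using wsym_objs_iff[OF M' b] M by simp
  also have "\<dots> = hyp_form M M' b p q"
    unfolding hyp_form_def by (rule comm_add_mat[of _ 1 "d S * d S"]) (use dims in auto)
  finally show ?thesis
    using s(1) c'' is_dualD[OF s(1) c''] by (auto simp: quad_objs_iff)
qed

text \<open>On \<open>M'\<close> the isometry has to be contragredient to \<open>f\<close>: through
  the inverse \<open>g\<close>, \<open>M'\<close> becomes a dual of \<open>N\<close>, and
  \<open>w\<close> is its comparison with \<open>N'\<close>. Then \<open>b' * (w ** f) = b\<close>,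
  and the sum of \<open>f\<close> and \<open>w\<close> carries one form to the other.\<close>

lemma hyp_form_isometry:
  assumes M: "M \<in> wsym_objs C" and N: "N \<in> wsym_objs C" and f: "iso_mor C M N f"
    and b: "is_dual C M M' b c" and b': "is_dual C N N' b' c'"
    and S: "is_direct_sum C M M' S i j p q" and T: "is_direct_sum C N N' T i' j' p' q'"
  shows "((S, hyp_form M M' b p q), (T, hyp_form N N' b' p' q')) \<in> isometry_rel C"
proof -
  note M' = wsym_objs_obj[OF M] and N' = wsym_objs_obj[OF N]
  note dM = is_dualD[OF M' b] and dN = is_dualD[OF N' b'] and s = is_direct_sumD[OF S] and t = is_direct_sumD[OF T]
  obtain g where g: "inverse_mor C M N f g" "f \<in> mor C M N" "g \<in> mor C N M" "g * f = 1\<^sub>m (d M)" "f * g = 1\<^sub>m (d N)"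
    "dim_row f = d N" "dim_col f = d M" "dim_row g = d M" "dim_col g = d N"
    using iso_mor_inverse[OF f] .
  have gi: "inverse_mor C N M g f"
    using g(1) by (simp add: inverse_mor_sym)
  note dMN = is_dual_transport_left[OF M' b N' gi]
  obtain w v where w: "inverse_mor C M' N' w v" "b' * (w ** 1\<^sub>m (d N)) = b * (1\<^sub>m (d M') ** g)"
    using dual_unique[OF N' dMN b'] dual_comparison(2)[OF N' dMN b'] by blast
  have wm: "w \<in> mor C M' N'" "dim_row w = d N'" "dim_col w = d M'" "iso_mor C M' N' w"
    using w(1) mor_dim[of w] by (auto simp: inverse_mor_iff iso_mor_def)
  have bw: "b' * (w ** f) = b"
  proof -
    have "b' * (w ** f) = b' * (w ** 1\<^sub>m (d N)) * (1\<^sub>m (d M') ** f)"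
      using wm g dN by (simp add: mat_mult_assoc tensor_mat_mult)
    also have "\<dots> = b"
      unfolding w(2) using g dM by (simp add: mat_mult_assoc tensor_mat_mult tensor_one_mat)
    finally show ?thesis .
  qed
  obtain h where h: "iso_mor C S T h" "p' * h = f * p" "q' * h = w * q"
    using direct_sum_iso[OF M' dM(1) N' dN(1) S T f wm(4)] .
  have hd: "dim_row h = d T" "dim_col h = d S"
    using h(1) mor_dim by (auto simp: iso_mor_def inverse_mor_iff)
  note br = braid_facts[OF M' dM(1)] braid_facts[OF N' dN(1)]
  note dims = dM(6-9) dN(6-9) s(11-18) t(11-18) br(2,3,5,6) hd wm(2,3) g(6,7)
  have n: "(w ** f) * braid C M M' = braid C N N' * (f ** w)"
    by (rule braid_nat) (use M' N' dM dN wm g in auto)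
  have "hyp_form N N' b' p' q' * (h ** h)
      = b' * ((q' * h) ** (p' * h)) + b' * (braid C N N' * ((p' * h) ** (q' * h)))"
    unfolding hyp_form_def using dims by (simp add: mat_add_mult mat_mult_assoc tensor_mat_mult)
  also have "\<dots> = b' * (w ** f) * (q ** p) + b' * (braid C N N' * (f ** w)) * (p ** q)"
    unfolding h using dims by (simp add: mat_mult_assoc tensor_mat_mult)
  also have "\<dots> = b' * (w ** f) * (q ** p) + (b' * (w ** f)) * (braid C M M' * (p ** q))"
    unfolding n[symmetric] using dims by (simp add: mat_mult_assoc)
  also have "\<dots> = hyp_form M M' b p q"
    by (simp only: bw hyp_form_def)
  finally show ?thesis
    unfolding isometry_rel_iff using h(1) hyp_form_quad[OF M b S] hyp_form_quad[OF N b' T] by blast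
qed

lemma hyperbolic_eq:
  "hyperbolic C M = (dsum C M (dual C M), hyp_form M (dual C M) (ev C M) (dproj1 C M (dual C M)) (dproj2 C M (dual C M)))"
  by (simp add: hyperbolic_def hyp_form_def Let_def)

lemma hyperbolic_cong:
  assumes "(M, N) \<in> wsym_iso_rel C"
  shows "(hyperbolic C M, hyperbolic C N) \<in> isometry_rel C"
proof -
  obtain f where w: "M \<in> wsym_objs C" "N \<in> wsym_objs C" "iso_mor C M N f"
    using assms by (auto simp: wsym_iso_rel_def)
  note o = w(1,2)[THEN wsym_objs_obj]
  note dM = dual_spec[OF o(1)] and dN = dual_spec[OF o(2)]
  obtain i1 i2 where S: "is_direct_sum C M (dual C M) (dsum C M (dual C M)) i1 i2
      (dproj1 C M (dual C M)) (dproj2 C M (dual C M))"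
    using dsum_spec[OF o(1) is_dualD(1)[OF o(1) dM]] .
  obtain j1 j2 where T: "is_direct_sum C N (dual C N) (dsum C N (dual C N)) j1 j2
      (dproj1 C N (dual C N)) (dproj2 C N (dual C N))"
    using dsum_spec[OF o(2) is_dualD(1)[OF o(2) dN]] .
  show ?thesis
    unfolding hyperbolic_eq by (rule hyp_form_isometry[OF w dM dN S T])
qed

end

section \<open>Comparison of the Witt groups\<close>

locale witt_equivalence = C: witt_matcat C d + D: witt_matcat D d' + matcat_equivalence C d D d' F J e
  for C :: "('o, complex mat, complex, 'x) braided_linear_moncat_scheme" and d
    and D :: "('p, complex mat, complex, 'y) braided_linear_moncat_scheme" and d' and F J e +
  assumes J_braid: "\<lbrakk>X \<in> obj C; Y \<in> obj C\<rbrakk> \<Longrightarrow>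
    fmor F (teno C X Y) (teno C Y X) (braid C X Y) * J X Y = J Y X * braid D (fobj F X) (fobj F Y)"
begin

lemma trans_braid:
  assumes obj: "X \<in> obj C" "Y \<in> obj C" and b: "b \<in> mor C (teno C Y X) (unito C)"
  shows "trans X Y (b * braid C X Y) = trans Y X b * braid D (fobj F X) (fobj F Y)"
proof -
  note br = C.braid_facts[OF obj] D.braid_facts[of "fobj F X" "fobj F Y"]
  note dims = fmor_dim[OF _ _ b] fmor_dim[OF _ _ br(1)] J_facts[OF obj] J_facts[OF obj(2,1)] e_facts
  have "fmor F (teno C X Y) (unito C) (b * braid C X Y)
      = fmor F (teno C Y X) (unito C) b * fmor F (teno C X Y) (teno C Y X) (braid C X Y)"
    by (rule fmor_mult) (use obj b br in auto)
  then show ?thesis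
    unfolding trans_def using obj dims br J_braid[OF obj] by (simp add: mat_mult_assoc)
qed

definition quad_map :: "'o \<times> complex mat \<Rightarrow> 'p \<times> complex mat" where
  "quad_map x = (fobj F (fst x), trans (fst x) (fst x) (snd x))"

text \<open>Symmetry is reflected because \<open>trans\<close> is injective and compatible with the
  braidings, self-duality because every copairing on the image comes from \<open>C\<close>.\<close>

lemma quad_map_iff:
  assumes M: "M \<in> obj C" and b: "b \<in> mor C (teno C M M) (unito C)"
  shows "quad_map (M, b) \<in> quad_objs D \<longleftrightarrow> (M, b) \<in> quad_objs C"
proof -
  have bb: "b * braid C M M \<in> mor C (teno C M M) (unito C)"
    using C.mult_mor[OF _ _ _ b C.braid_facts(1)[OF M M]] M by simp
  have "trans M M b * braid D (fobj F M) (fobj F M) = trans M M b \<longleftrightarrow> b * braid C M M = b"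
    using trans_inj[OF M M bb b] trans_braid[OF M M b] by auto
  moreover have "(\<exists>c. is_dual D (fobj F M) (fobj F M) (trans M M b) c) \<longleftrightarrow> (\<exists>c. is_dual C M M b c)"
  proof
    assume "\<exists>c. is_dual D (fobj F M) (fobj F M) (trans M M b) c"
    then obtain c where c: "is_dual D (fobj F M) (fobj F M) (trans M M b) c"
      by blast
    then obtain h where "h \<in> mor C (unito C) (teno C M M)" "cotrans M M h = c"
      using cotrans_surj[OF M M] D.is_dualD(3)[OF _ c] M by auto
    then show "\<exists>c. is_dual C M M b c"
      using is_dual_trans_iff[OF M M b] c by blast
  next
    assume "\<exists>c. is_dual C M M b c"
    then show "\<exists>c. is_dual D (fobj F M) (fobj F M) (trans M M b) c"
      using is_dual_trans_iff[OF M M b] C.is_dualD(3)[OF M] by blast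
  qed
  ultimately show ?thesis
    using M b trans_mor[OF M M b] by (simp add: quad_map_def C.quad_objs_iff D.quad_objs_iff)
qed

lemma quad_map_quad: "x \<in> quad_objs C \<Longrightarrow> quad_map x \<in> quad_objs D"
  using quad_map_iff C.quad_objsD(1,2) by (cases x) blast

text \<open>An isomorphism between the images lifts to one in \<open>C\<close>, and
  \<open>trans_inj\<close> reflects the isometry equation.\<close>

lemma quad_map_isometry_iff:
  assumes "x \<in> quad_objs C" "y \<in> quad_objs C"
  shows "(quad_map x, quad_map y) \<in> isometry_rel D \<longleftrightarrow> (x, y) \<in> isometry_rel C"
proof -
  obtain M b N b' where e: "x = (M, b)" "y = (N, b')"
    by (cases x, cases y)
  note q = C.quad_objsD[OF assms(1)[unfolded e]] C.quad_objsD[OF assms(2)[unfolded e]]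
  have *: "trans N N b' * (fmor F M N f ** fmor F M N f) = trans M M b \<longleftrightarrow> b' * (f ** f) = b"
    if f: "f \<in> mor C M N" for f
  proof -
    have "b' * (f ** f) \<in> mor C (teno C M M) (unito C)"
      using C.mult_mor[OF _ _ _ q(8) C.ten_mor[OF q(1,1,7,7) f f]] q by simp
    then show ?thesis
      using trans_nat[OF q(1,1,7,7) f f q(8)] trans_inj[OF q(1,1) _ q(2), of "b' * (f ** f)"] by metis
  qed
  have "(\<exists>u. iso_mor D (fobj F M) (fobj F N) u \<and> trans N N b' * (u ** u) = trans M M b)
      \<longleftrightarrow> (\<exists>f. iso_mor C M N f \<and> b' * (f ** f) = b)"
  proof
    assume "\<exists>u. iso_mor D (fobj F M) (fobj F N) u \<and> trans N N b' * (u ** u) = trans M M b"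
    then obtain u v where u: "inverse_mor D (fobj F M) (fobj F N) u v" "trans N N b' * (u ** u) = trans M M b"
      by (auto simp: iso_mor_def)
    then obtain f g where f: "inverse_mor C M N f g" "fmor F M N f = u"
      using fmor_iso_reflect[OF q(1,7) u(1)] by blast
    then show "\<exists>f. iso_mor C M N f \<and> b' * (f ** f) = b"
      using *[of f] u f by (auto simp: iso_mor_def C.inverse_mor_iff)
  next
    assume "\<exists>f. iso_mor C M N f \<and> b' * (f ** f) = b"
    then obtain f g where f: "inverse_mor C M N f g" "b' * (f ** f) = b"
      by (auto simp: iso_mor_def)
    then show "\<exists>u. iso_mor D (fobj F M) (fobj F N) u \<and> trans N N b' * (u ** u) = trans M M b"
      using * fmor_inverse[OF q(1,7) f(1)] by (auto simp: iso_mor_def C.inverse_mor_iff)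
  qed
  then show ?thesis
    using assms quad_map_quad[OF assms(1)] quad_map_quad[OF assms(2)]
    by (simp add: e quad_map_def C.isometry_rel_iff D.isometry_rel_iff)
qed

text \<open>The form is first pulled back to an object \<open>fobj F M\<close> isomorphic to
  \<open>N\<close>, where fullness provides a preimage.\<close>

lemma quad_map_surj:
  assumes "y \<in> quad_objs D"
  shows "\<exists>x\<in>quad_objs C. (quad_map x, y) \<in> isometry_rel D"
proof -
  obtain N b where e: "y = (N, b)"
    by (cases y)
  note q = D.quad_objsD[OF assms[unfolded e]]
  obtain M u where M: "M \<in> obj C" "iso_mor D (fobj F M) N u"
    using ess_surj[OF q(1)] .
  have FM: "(fobj F M, b * (u ** u)) \<in> quad_objs D"
    using D.quad_objs_pullback[OF assms[unfolded e] _ M(2)] M(1) by simp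
  obtain h where h: "h \<in> mor C (teno C M M) (unito C)" "trans M M h = b * (u ** u)"
    using trans_surj[OF M(1,1) D.quad_objsD(2)[OF FM]] .
  have m: "quad_map (M, h) = (fobj F M, b * (u ** u))"
    by (simp add: quad_map_def h)
  have "(M, h) \<in> quad_objs C"
    using quad_map_iff[OF M(1) h(1)] m FM by simp
  moreover have "(quad_map (M, h), y) \<in> isometry_rel D"
    using FM M(2) assms unfolding m e D.isometry_rel_iff by blast
  ultimately show ?thesis
    by blast
qed

text \<open>\<open>F\<close> sends the chosen sum to some direct sum carrying the transported forms;
  identities on the summands then give an isometry to the chosen sum in \<open>D\<close>.\<close>

lemma quad_map_orth_sum:
  assumes "x \<in> quad_objs C" "y \<in> quad_objs C"
  shows "(quad_map (orth_sum C x y), orth_sum D (quad_map x) (quad_map y)) \<in> isometry_rel D"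
proof -
  obtain M b N b' where e: "x = (M, b)" "y = (N, b')"
    by (cases x, cases y)
  note q = C.quad_objsD[OF assms(1)[unfolded e]] C.quad_objsD[OF assms(2)[unfolded e]]
  obtain i1 i2 where S: "is_direct_sum C M N (dsum C M N) i1 i2 (dproj1 C M N) (dproj2 C M N)"
    using C.dsum_spec[OF q(1,7)] .
  obtain j1 j2 where T: "is_direct_sum D (fobj F M) (fobj F N) (dsum D (fobj F M) (fobj F N)) j1 j2
      (dproj1 D (fobj F M) (fobj F N)) (dproj2 D (fobj F M) (fobj F N))"
    using D.dsum_spec[of "fobj F M" "fobj F N"] q(1,7) by auto
  note s = C.is_direct_sumD[OF S]
  note FS = fmor_direct_sum[OF q(1,7) S]
  have m: "b * (dproj1 C M N ** dproj1 C M N) \<in> mor C (teno C (dsum C M N) (dsum C M N)) (unito C)"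
    "b' * (dproj2 C M N ** dproj2 C M N) \<in> mor C (teno C (dsum C M N) (dsum C M N)) (unito C)"
    using C.mult_mor[OF _ _ _ q(2) C.ten_mor[OF s(1,1) q(1,1) s(4,4)]]
      C.mult_mor[OF _ _ _ q(8) C.ten_mor[OF s(1,1) q(7,7) s(5,5)]] s q by simp_all
  have "quad_map (orth_sum C x y) = (fobj F (dsum C M N),
      trans M M b * (fmor F (dsum C M N) M (dproj1 C M N) ** fmor F (dsum C M N) M (dproj1 C M N)) +
      trans N N b' * (fmor F (dsum C M N) N (dproj2 C M N) ** fmor F (dsum C M N) N (dproj2 C M N)))"
    using trans_add[OF s(1,1) m] trans_nat[OF s(1,1) q(1,1) s(4,4) q(2)] trans_nat[OF s(1,1) q(7,7) s(5,5) q(8)]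
    by (simp add: quad_map_def e)
  moreover have "(quad_map x, quad_map x) \<in> isometry_rel D" "(quad_map y, quad_map y) \<in> isometry_rel D"
    using D.equiv_isometry_rel quad_map_quad assms by (auto simp: equiv_def refl_on_def)
  ultimately show ?thesis
    using D.isometry_direct_sum[OF _ _ FS T, of "trans M M b" "trans M M b" "trans N N b'" "trans N N b'"]
    by (simp add: e quad_map_def)
qed

lemma dual_trans:
  assumes "M \<in> obj C" "is_dual C M M' b c"
  shows "is_dual D (fobj F M) (fobj F M') (trans M' M b) (cotrans M M' c)"
  using is_dual_trans_iff[OF assms(1) _ _ _] C.is_dualD[OF assms] assms by blast

text \<open>Weak symmetry may be tested on the image of the chosen dual, whose evaluation is
  \<open>trans\<close> of the old one.\<close>

lemma fobj_wsym_iff: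
  assumes M: "M \<in> obj C"
  shows "fobj F M \<in> wsym_objs D \<longleftrightarrow> M \<in> wsym_objs C"
proof -
  note dM = C.dual_spec[OF M]
  note dd = C.is_dualD[OF M dM]
  let ?A = "dual C M" and ?b = "ev C M"
  note br = C.braid_facts[OF M dd(1)] C.braid_facts[OF dd(1) M]
  have m: "?b * braid C M ?A \<in> mor C (teno C M ?A) (unito C)"
    using C.mult_mor[OF _ _ _ dd(2) br(1)] M dd by simp
  then have m2: "?b * braid C M ?A * braid C ?A M \<in> mor C (teno C ?A M) (unito C)"
    using C.mult_mor[OF _ _ _ m br(4)] M dd by simp
  have e: "?b * braid C M ?A * braid C ?A M = ?b * (braid C M ?A * braid C ?A M)"
    using br dd(6-9) by (simp add: mat_mult_assoc)
  have "trans ?A M (?b * braid C M ?A * braid C ?A M)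
      = trans ?A M ?b * braid D (fobj F M) (fobj F ?A) * braid D (fobj F ?A) (fobj F M)"
    using trans_braid[OF dd(1) M m] trans_braid[OF M dd(1) dd(2)] by simp
  also have "\<dots> = trans ?A M ?b * (braid D (fobj F M) (fobj F ?A) * braid D (fobj F ?A) (fobj F M))"
    using D.braid_facts[of "fobj F M" "fobj F ?A"] D.braid_facts[of "fobj F ?A" "fobj F M"] M dd(1)
      D.mor_dim[OF trans_mor[OF dd(1) M dd(2)]] by (simp add: mat_mult_assoc)
  finally show ?thesis
    using D.wsym_objs_iff[OF _ dual_trans[OF M dM]] C.wsym_objs_iff[OF M dM] M e
      trans_inj[OF dd(1) M m2 dd(2)] by auto
qed

text \<open>The image is the hyperbolic form for the transported dual and the transported direct
  sum, and \<open>hyp_form_isometry\<close> replaces both by the chosen ones.\<close>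

lemma fobj_hyperbolic:
  assumes M: "M \<in> wsym_objs C"
  shows "(quad_map (hyperbolic C M), hyperbolic D (fobj F M)) \<in> isometry_rel D"
proof -
  note M' = C.wsym_objs_obj[OF M]
  note dM = C.dual_spec[OF M']
  note dd = C.is_dualD[OF M' dM]
  let ?A = "dual C M" and ?b = "ev C M" and ?S = "dsum C M (dual C M)"
    and ?p = "dproj1 C M (dual C M)" and ?q = "dproj2 C M (dual C M)"
  have FM: "fobj F M \<in> obj D" "fobj F M \<in> wsym_objs D"
    using M M' fobj_wsym_iff by auto
  note dF = D.dual_spec[OF FM(1)]
  obtain i1 i2 where S: "is_direct_sum C M ?A ?S i1 i2 ?p ?q"
    using C.dsum_spec[OF M' dd(1)] .
  obtain j1 j2 where T: "is_direct_sum D (fobj F M) (dual D (fobj F M)) (dsum D (fobj F M) (dual D (fobj F M))) j1 j2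
      (dproj1 D (fobj F M) (dual D (fobj F M))) (dproj2 D (fobj F M) (dual D (fobj F M)))"
    using D.dsum_spec[OF FM(1) D.is_dualD(1)[OF FM(1) dF]] .
  note s = C.is_direct_sumD[OF S]
  note FS = fmor_direct_sum[OF M' dd(1) S]
  note br = C.braid_facts[OF M' dd(1)]
  have mb: "?b * braid C M ?A \<in> mor C (teno C M ?A) (unito C)"
    using C.mult_mor[OF _ _ _ dd(2) br(1)] M' dd by simp
  have m: "?b * (?q ** ?p) \<in> mor C (teno C ?S ?S) (unito C)" "?b * braid C M ?A * (?p ** ?q) \<in> mor C (teno C ?S ?S) (unito C)"
    using C.mult_mor[OF _ _ _ dd(2) C.ten_mor[OF s(1,1) dd(1) M' s(5,4)]]
      C.mult_mor[OF _ _ _ mb C.ten_mor[OF s(1,1) M' dd(1) s(4,5)]] s M' dd by simp_all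
  have e: "C.hyp_form M ?A ?b ?p ?q = ?b * (?q ** ?p) + ?b * braid C M ?A * (?p ** ?q)"
    unfolding C.hyp_form_def using s br dd(6-9) by (simp add: mat_mult_assoc)
  have "trans ?S ?S (C.hyp_form M ?A ?b ?p ?q)
      = trans ?A M ?b * (fmor F ?S ?A ?q ** fmor F ?S M ?p)
        + trans ?A M ?b * braid D (fobj F M) (fobj F ?A) * (fmor F ?S M ?p ** fmor F ?S ?A ?q)"
    unfolding e using trans_add[OF s(1,1) m] trans_nat[OF s(1,1) dd(1) M' s(5,4) dd(2)]
      trans_nat[OF s(1,1) M' dd(1) s(4,5) mb] trans_braid[OF M' dd(1) dd(2)] by simp
  also have "\<dots> = D.hyp_form (fobj F M) (fobj F ?A) (trans ?A M ?b) (fmor F ?S M ?p) (fmor F ?S ?A ?q)"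
    unfolding D.hyp_form_def
    using D.braid_facts[of "fobj F M" "fobj F ?A"] FM(1) dd(1) D.mor_dim[OF trans_mor[OF dd(1) M' dd(2)]]
      fmor_dim[OF s(1) M' s(4)] fmor_dim[OF s(1) dd(1) s(5)] by (simp add: mat_mult_assoc)
  finally have q: "quad_map (hyperbolic C M)
      = (fobj F ?S, D.hyp_form (fobj F M) (fobj F ?A) (trans ?A M ?b) (fmor F ?S M ?p) (fmor F ?S ?A ?q))"
    by (simp add: quad_map_def C.hyperbolic_eq)
  have "iso_mor D (fobj F M) (fobj F M) (1\<^sub>m (d' (fobj F M)))"
    using D.inverse_mor_one[OF FM(1)] by (auto simp: iso_mor_def)
  then show ?thesis
    unfolding q D.hyperbolic_eq using D.hyp_form_isometry[OF FM(2,2) _ dual_trans[OF M' dM] dF FS T] by blast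
qed

lemma fobj_wsym_iso_iff:
  assumes "M \<in> wsym_objs C" "N \<in> wsym_objs C"
  shows "(fobj F M, fobj F N) \<in> wsym_iso_rel D \<longleftrightarrow> (M, N) \<in> wsym_iso_rel C"
proof -
  note o = assms[THEN C.wsym_objs_obj]
  have "(\<exists>u. iso_mor D (fobj F M) (fobj F N) u) \<longleftrightarrow> (\<exists>f. iso_mor C M N f)"
    using fmor_iso_reflect[OF o] fmor_inverse[OF o] unfolding iso_mor_def by metis
  then show ?thesis
    using assms o fobj_wsym_iff by (simp add: wsym_iso_rel_def)
qed

lemma mult_iso_quad_monoid:
  "mult_iso (quad_monoid C) (quad_monoid D) (class_map (isometry_rel D) quad_map)"
  unfolding quad_monoid_def
  by (rule mult_iso_class_monoid[OF C.equiv_isometry_rel D.equiv_isometry_rel];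
      (rule quad_map_quad quad_map_isometry_iff quad_map_surj C.orth_sum_cong D.orth_sum_cong quad_map_orth_sum;
        assumption))

lemma mult_iso_wsym_monoid:
  "mult_iso (wsym_monoid C) (wsym_monoid D) (class_map (wsym_iso_rel D) (fobj F))"
  unfolding wsym_monoid_def
proof (rule mult_iso_class_monoid[OF C.equiv_wsym_iso_rel D.equiv_wsym_iso_rel _ fobj_wsym_iso_iff _ C.dsum_cong D.dsum_cong])
  show "fobj F M \<in> wsym_objs D" if "M \<in> wsym_objs C" for M
    using that fobj_wsym_iff C.wsym_objs_obj by blast
  show "\<exists>M\<in>wsym_objs C. (fobj F M, N) \<in> wsym_iso_rel D" if N: "N \<in> wsym_objs D" for N
  proof -
    obtain M u where M: "M \<in> obj C" "iso_mor D (fobj F M) N u"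
      using ess_surj[OF D.wsym_objs_obj[OF N]] .
    have "fobj F M \<in> wsym_objs D"
      using D.wsym_objs_iso[OF N _ M(2)] M(1) by simp
    then show ?thesis
      using M N fobj_wsym_iff[OF M(1)] by (auto simp: wsym_iso_rel_def)
  qed
  show "(fobj F (dsum C M N), dsum D (fobj F M) (fobj F N)) \<in> wsym_iso_rel D"
    if w: "M \<in> wsym_objs C" "N \<in> wsym_objs C" for M N
  proof -
    note o = w[THEN C.wsym_objs_obj]
    have Fo: "fobj F M \<in> obj D" "fobj F N \<in> obj D" "fobj F M \<in> wsym_objs D" "fobj F N \<in> wsym_objs D"
      using o w fobj_wsym_iff by auto
    obtain i1 i2 where S: "is_direct_sum C M N (dsum C M N) i1 i2 (dproj1 C M N) (dproj2 C M N)"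
      using C.dsum_spec[OF o] .
    obtain j1 j2 where T: "is_direct_sum D (fobj F M) (fobj F N) (dsum D (fobj F M) (fobj F N)) j1 j2
        (dproj1 D (fobj F M) (fobj F N)) (dproj2 D (fobj F M) (fobj F N))"
      using D.dsum_spec[OF Fo(1,2)] .
    note FS = fmor_direct_sum[OF o S]
    have one: "iso_mor D X X (1\<^sub>m (d' X))" if "X \<in> obj D" for X
      using D.inverse_mor_one[OF that] by (auto simp: iso_mor_def)
    obtain h where "iso_mor D (fobj F (dsum C M N)) (dsum D (fobj F M) (fobj F N)) h"
      using D.direct_sum_iso[OF Fo(1,2,1,2) FS T one[OF Fo(1)] one[OF Fo(2)]] .
    then show ?thesis
      using D.wsym_objs_direct_sum[OF Fo(3,4) FS] D.wsym_objs_direct_sum[OF Fo(3,4) T]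
      by (auto simp: wsym_iso_rel_def)
  qed
qed

text \<open>The class monoids correspond by \<open>quad_map\<close> and by \<open>F\<close> on
  objects; what remains is that the hyperbolic maps form a commutative square with these
  correspondences on classes.\<close>

theorem Witt_iso: "Witt C \<cong> Witt D"
  unfolding Witt_def K0_hyperbolic_def
proof (rule K0_quotient_iso[OF mult_iso_quad_monoid mult_iso_wsym_monoid])
  fix a
  assume "a \<in> carrier (wsym_monoid C)"
  then obtain M where M: "M \<in> wsym_objs C" "a = wsym_iso_rel C `` {M}"
    by (auto simp: wsym_monoid_def class_monoid_def quotient_def)
  have FM: "fobj F M \<in> wsym_objs D"
    using M fobj_wsym_iff C.wsym_objs_obj by blast
  have hM: "class_map (isometry_rel C) (hyperbolic C) a = isometry_rel C `` {hyperbolic C M}"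
    unfolding M(2) by (rule class_map_class[OF C.equiv_wsym_iso_rel C.equiv_isometry_rel C.hyperbolic_cong M(1)])
  have hq: "hyperbolic C M \<in> quad_objs C"
    using C.hyperbolic_cong[of M M] C.equiv_wsym_iso_rel C.equiv_isometry_rel M(1)
    by (auto simp: equiv_def refl_on_def)
  then show "class_map (isometry_rel C) (hyperbolic C) a \<in> carrier (quad_monoid C)"
    unfolding hM by (auto simp: quad_monoid_def class_monoid_def quotient_def)
  have rq: "(quad_map x, quad_map y) \<in> isometry_rel D" if "(x, y) \<in> isometry_rel C" for x y
    using that quad_map_isometry_iff by (auto simp: isometry_rel_def)
  have "(fobj F X, fobj F Y) \<in> wsym_iso_rel D" if "(X, Y) \<in> wsym_iso_rel C" for X Y
    using that fobj_wsym_iso_iff by (auto simp: wsym_iso_rel_def)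
  then have fM: "class_map (wsym_iso_rel D) (fobj F) a = wsym_iso_rel D `` {fobj F M}"
    unfolding M(2) by (rule class_map_class[OF C.equiv_wsym_iso_rel D.equiv_wsym_iso_rel _ M(1)])
  have "class_map (isometry_rel D) quad_map (class_map (isometry_rel C) (hyperbolic C) a)
      = isometry_rel D `` {quad_map (hyperbolic C M)}"
    unfolding hM by (rule class_map_class[OF C.equiv_isometry_rel D.equiv_isometry_rel rq hq])
  also have "\<dots> = isometry_rel D `` {hyperbolic D (fobj F M)}"
    by (rule equiv_class_eq[OF D.equiv_isometry_rel fobj_hyperbolic[OF M(1)]])
  also have "\<dots> = class_map (isometry_rel D) (hyperbolic D) (class_map (wsym_iso_rel D) (fobj F) a)"
    unfolding fM by (rule class_map_class[OF D.equiv_wsym_iso_rel D.equiv_isometry_rel D.hyperbolic_cong FM, symmetric])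
  finally show "class_map (isometry_rel D) quad_map (class_map (isometry_rel C) (hyperbolic C) a)
      = class_map (isometry_rel D) (hyperbolic D) (class_map (wsym_iso_rel D) (fobj F) a)" .
qed

end

section \<open>Representations and graded representations\<close>

definition col_mat :: "complex vec \<Rightarrow> complex mat" where
  "col_mat v = mat (dim_vec v) 1 (\<lambda>(i, _). v $ i)"

lemma dim_col_mat [simp]: "dim_row (col_mat v) = dim_vec v" "dim_col (col_mat v) = 1"
  by (simp_all add: col_mat_def)

lemma col_mat_inj: "col_mat v = col_mat w \<longleftrightarrow> v = w"
proof
  assume e: "col_mat v = col_mat w"
  show "v = w"
  proof (rule eq_vecI)
    show d: "dim_vec v = dim_vec w"
      using arg_cong[OF e, of dim_row] by simp
    show "v $ i = w $ i" if "i < dim_vec w" for i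
      using arg_cong[OF e, of "\<lambda>A. A $$ (i, 0)"] that d by (simp add: col_mat_def)
  qed
qed simp

lemma col_mat_mult: "dim_vec v = dim_col A \<Longrightarrow> col_mat (A *\<^sub>v v) = A * col_mat v"
  by (rule eq_matI) (auto simp: col_mat_def scalar_prod_def)

lemma col_mat_tensor: "col_mat (tensor_vec v w) = col_mat v ** col_mat w"
  by (rule eq_matI) (auto simp: col_mat_def tensor_vec_def index_tensor_mat div_less_of_mult mod_less_of_mult)

lemma col_mat_surj:
  assumes "A \<in> carrier_mat n 1"
  shows "\<exists>v\<in>carrier_vec n. A = col_mat v"
  by (rule bexI[of _ "col A 0"]; (rule eq_matI)?) (use assms in \<open>auto simp: col_mat_def\<close>)

lemma dim_tensor_vec [simp]: "dim_vec (tensor_vec v w) = dim_vec v * dim_vec w"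
  by (simp add: tensor_vec_def)

lemma tensor_mat_vec:
  assumes "dim_vec v = dim_col A" "dim_vec w = dim_col B"
  shows "(A ** B) *\<^sub>v tensor_vec v w = tensor_vec (A *\<^sub>v v) (B *\<^sub>v w)"
proof -
  have "(A ** B) * (col_mat v ** col_mat w) = (A * col_mat v) ** (B * col_mat w)"
    by (rule tensor_mat_mult) (use assms in auto)
  then have "col_mat ((A ** B) *\<^sub>v tensor_vec v w) = col_mat (tensor_vec (A *\<^sub>v v) (B *\<^sub>v w))"
    using assms by (simp add: col_mat_mult col_mat_tensor)
  then show ?thesis
    by (simp add: col_mat_inj)
qed

lemma mat_eq_mult_vecI:
  fixes A :: "complex mat"
  assumes d: "dim_row A = dim_row B" "dim_col A = n" "dim_col B = n"
    and eq: "\<And>v. v \<in> carrier_vec n \<Longrightarrow> A *\<^sub>v v = B *\<^sub>v v"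
  shows "A = B"
proof (rule mat_eq_tensorI[of _ _ 1 n])
  fix v w :: "complex mat"
  assume "v \<in> carrier_mat 1 1" "w \<in> carrier_mat n 1"
  then obtain u where "u \<in> carrier_vec (1 * n)" "v ** w = col_mat u"
    using col_mat_surj[of "v ** w" "1 * n"] tensor_mat_carrier[of v 1 1 w n 1] by auto
  then show "A * (v ** w) = B * (v ** w)"
    using eq[of u] d by (simp flip: col_mat_mult)
qed (use d in auto)

lemma mat_eq_mult_tensor_vecI:
  assumes d: "dim_row A = dim_row B" "dim_col A = n * m" "dim_col B = n * m"
    and eq: "\<And>v w. v \<in> carrier_vec n \<Longrightarrow> w \<in> carrier_vec m \<Longrightarrow> A *\<^sub>v tensor_vec v w = B *\<^sub>v tensor_vec v w"
  shows "A = B"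
proof (rule mat_eq_tensorI[OF d])
  fix v w :: "complex mat"
  assume "v \<in> carrier_mat n 1" "w \<in> carrier_mat m 1"
  then obtain x y where xy: "x \<in> carrier_vec n" "v = col_mat x" "y \<in> carrier_vec m" "w = col_mat y"
    using col_mat_surj by meson
  then show "A * (v ** w) = B * (v ** w)"
    using arg_cong[OF eq[OF xy(1,3)], of col_mat] d by (simp add: col_mat_mult col_mat_tensor)
qed

lemma msum_mult_vec:
  assumes "\<And>k. k \<in> I \<Longrightarrow> f k \<in> carrier_mat n m" "v \<in> carrier_vec m" "i < n"
  shows "(msum n m f I *\<^sub>v v) $ i = (\<Sum>k\<in>I. (f k *\<^sub>v v) $ i)"
proof -
  have "msum n m f I * col_mat v = msum n 1 (\<lambda>k. f k * col_mat v) I"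
    using msum_mult[of I f n m "col_mat v"] assms by simp
  then have "col_mat (msum n m f I *\<^sub>v v) $$ (i, 0) = (\<Sum>k\<in>I. (f k * col_mat v) $$ (i, 0))"
    using assms by (simp add: col_mat_mult index_msum)
  also have "\<dots> = (\<Sum>k\<in>I. col_mat (f k *\<^sub>v v) $$ (i, 0))"
    using carrier_matD[OF assms(1)] assms(2) by (intro sum.cong refl) (simp add: col_mat_mult)
  also have "\<dots> = (\<Sum>k\<in>I. (f k *\<^sub>v v) $ i)"
    using carrier_matD[OF assms(1)] assms(3) by (intro sum.cong refl) (simp add: col_mat_def)
  finally show ?thesis
    using assms(3) by (simp add: col_mat_def)
qed

text \<open>Invertibility of \<open>ract V g\<close> comes from the inverse of \<open>g\<close>;
  conversely \<open>ract V \<one>\<close> is an invertible idempotent and hence the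
  identity.\<close>

lemma is_rep_iff:
  fixes G (structure)
  assumes G: "group G"
  shows "is_rep G V \<longleftrightarrow> ract V \<in> extensional (carrier G) \<and>
    (\<forall>g\<in>carrier G. ract V g \<in> carrier_mat (rdim V) (rdim V)) \<and>
    (\<forall>g\<in>carrier G. \<forall>h\<in>carrier G. ract V (g \<otimes>\<^bsub>G\<^esub> h) = ract V g * ract V h) \<and>
    ract V \<one>\<^bsub>G\<^esub> = 1\<^sub>m (rdim V)"
proof -
  interpret group G
    by (rule G)
  let ?n = "rdim V"
  have c: "carrier (GL ?n) = {A \<in> carrier_mat ?n ?n. \<exists>B\<in>carrier_mat ?n ?n. B * A = 1\<^sub>m ?n \<and> A * B = 1\<^sub>m ?n}"
    by (auto simp: GL_def units_of_def Units_def ring_mat_def)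
  have m: "mult (GL ?n) = (*)"
    by (auto simp: GL_def units_of_def ring_mat_def)
  show ?thesis
  proof (intro iffI conjI ballI)
    assume V: "is_rep G V"
    then show "ract V \<in> extensional (carrier G)"
      by (simp add: is_rep_def)
    have V': "ract V \<in> hom G (GL ?n)"
      using V by (simp add: is_rep_def)
    then show "ract V g \<in> carrier_mat ?n ?n" if "g \<in> carrier G" for g
      using that c by (auto simp: hom_def)
    show *: "ract V (g \<otimes> h) = ract V g * ract V h" if "g \<in> carrier G" "h \<in> carrier G" for g h
      using V' that m by (auto simp: hom_def)
    obtain B where B: "B \<in> carrier_mat ?n ?n" "B * ract V \<one> = 1\<^sub>m ?n" "ract V \<one> \<in> carrier_mat ?n ?n"
      using V' c hom_in_carrier[OF V' one_closed] by auto
    have "B * (ract V \<one> * ract V \<one>) = ract V \<one>"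
      by (rule mat_cancel[OF B(2)]) (use B in auto)
    then show "ract V \<one> = 1\<^sub>m ?n"
      using *[of \<one> \<one>] B by simp
  next
    assume r: "ract V \<in> extensional (carrier G) \<and>
      (\<forall>g\<in>carrier G. ract V g \<in> carrier_mat ?n ?n) \<and>
      (\<forall>g\<in>carrier G. \<forall>h\<in>carrier G. ract V (g \<otimes> h) = ract V g * ract V h) \<and> ract V \<one> = 1\<^sub>m ?n"
    have "ract V g \<in> carrier (GL ?n)" if g: "g \<in> carrier G" for g
    proof -
      have "ract V (inv g) * ract V g = 1\<^sub>m ?n" "ract V g * ract V (inv g) = 1\<^sub>m ?n"
        using r g by (metis inv_closed l_inv, metis inv_closed r_inv)
      then show ?thesis
        using r g unfolding c by blast
    qed
    then show "is_rep G V"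
      using r by (auto simp: is_rep_def hom_def m)
  qed
qed

text \<open>For an idempotent matrix this is its image.\<close>

definition fix_space :: "nat \<Rightarrow> complex mat \<Rightarrow> complex vec set" where
  "fix_space n A = {v \<in> carrier_vec n. A *\<^sub>v v = v}"

lemma fix_space_iff: "A \<in> carrier_mat n n \<Longrightarrow> v \<in> fix_space n A \<longleftrightarrow> v \<in> carrier_vec n \<and> A * col_mat v = col_mat v"
  by (auto simp: fix_space_def col_mat_inj simp flip: col_mat_mult)

text \<open>The fixed vectors of the idempotent \<open>P\<close> are the vectors \<open>P v\<close>,
  so the inclusion is the matrix equation evaluated at all \<open>v\<close>.\<close>

lemma maps_fix_space_iff:
  assumes P: "P \<in> carrier_mat n n" "P * P = P" and Q: "Q \<in> carrier_mat m m" and A: "A \<in> carrier_mat m n"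
  shows "(\<forall>v\<in>fix_space n P. A *\<^sub>v v \<in> fix_space m Q) \<longleftrightarrow> Q * (A * P) = A * P"
proof
  assume e: "Q * (A * P) = A * P"
  show "\<forall>v\<in>fix_space n P. A *\<^sub>v v \<in> fix_space m Q"
  proof
    fix v
    assume "v \<in> fix_space n P"
    then have v: "v \<in> carrier_vec n" "P * col_mat v = col_mat v"
      using fix_space_iff[OF P(1)] by auto
    have "Q * (A * (P * col_mat v)) = A * (P * col_mat v)"
      using arg_cong[OF e, of "\<lambda>X. X * col_mat v"] P Q A v(1) by (simp add: mat_mult_assoc)
    then show "A *\<^sub>v v \<in> fix_space m Q"
      using v A Q by (simp add: fix_space_iff[OF Q] col_mat_mult)
  qed
next
  assume f: "\<forall>v\<in>fix_space n P. A *\<^sub>v v \<in> fix_space m Q"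
  show "Q * (A * P) = A * P"
  proof (rule mat_eq_mult_vecI)
    fix v :: "complex vec"
    assume v: "v \<in> carrier_vec n"
    have "P * col_mat (P *\<^sub>v v) = col_mat (P *\<^sub>v v)"
      using v P mat_mult_assoc[of P P "col_mat v"] by (simp add: col_mat_mult)
    then have "P *\<^sub>v v \<in> fix_space n P"
      using fix_space_iff[OF P(1)] P v by auto
    then have "A *\<^sub>v (P *\<^sub>v v) \<in> fix_space m Q"
      using f by blast
    then have "col_mat ((Q * (A * P)) *\<^sub>v v) = col_mat ((A * P) *\<^sub>v v)"
      using v P Q A by (simp add: fix_space_iff[OF Q] col_mat_mult mat_mult_assoc)
    then show "(Q * (A * P)) *\<^sub>v v = (A * P) *\<^sub>v v"
      by (simp add: col_mat_inj)
  qed (use P Q A in auto)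
qed

locale finite_group = group G for G :: "('a, 'c) monoid_scheme" (structure) +
  assumes finite_carrier [simp]: "finite (carrier G)"
begin

lemma is_repD:
  assumes "is_rep G V"
  shows "ract V \<in> extensional (carrier G)"
    "\<And>g. g \<in> carrier G \<Longrightarrow> ract V g \<in> carrier_mat (rdim V) (rdim V)"
    "\<And>g. g \<in> carrier G \<Longrightarrow> dim_row (ract V g) = rdim V"
    "\<And>g. g \<in> carrier G \<Longrightarrow> dim_col (ract V g) = rdim V"
    "\<And>g h. g \<in> carrier G \<Longrightarrow> h \<in> carrier G \<Longrightarrow> ract V (g \<otimes> h) = ract V g * ract V h"
    "ract V \<one> = 1\<^sub>m (rdim V)"
  using assms unfolding is_rep_iff[OF group_axioms] by auto

lemma tensor_rep:
  assumes "is_rep G V" "is_rep G W" "rdim U = rdim V * rdim W"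
    "ract U = (\<lambda>g\<in>carrier G. ract V g ** ract W g)"
  shows "is_rep G U"
  unfolding is_rep_iff[OF group_axioms]
  using is_repD[OF assms(1)] is_repD[OF assms(2)] assms(3,4)
  by (auto simp: tensor_mat_mult tensor_one_mat intro!: tensor_mat_carrier)

lemma unit_rep: "rdim U = 1 \<Longrightarrow> ract U = (\<lambda>g\<in>carrier G. 1\<^sub>m 1) \<Longrightarrow> is_rep G U"
  unfolding is_rep_iff[OF group_axioms] by auto

lemma intertwinersD:
  assumes "A \<in> intertwiners G V W"
  shows "A \<in> carrier_mat (rdim W) (rdim V)" "dim_row A = rdim W" "dim_col A = rdim V"
    "\<And>g. g \<in> carrier G \<Longrightarrow> A * ract V g = ract W g * A"
  using assms by (auto simp: intertwiners_def)

lemma intertwiners_mult: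
  assumes "is_rep G U" "is_rep G V" "is_rep G W" "B \<in> intertwiners G V W" "A \<in> intertwiners G U V"
  shows "B * A \<in> intertwiners G U W"
proof -
  note A = intertwinersD[OF assms(5)] and B = intertwinersD[OF assms(4)]
  note r = is_repD[OF assms(1)] is_repD[OF assms(2)] is_repD[OF assms(3)]
  have "B * A * ract U g = ract W g * (B * A)" if g: "g \<in> carrier G" for g
  proof -
    have "B * A * ract U g = B * (A * ract U g)"
      by (rule mat_mult_assoc) (use g A(2,3) B(2,3) r in auto)
    also have "\<dots> = B * ract V g * A"
      unfolding A(4)[OF g] by (rule mat_mult_assoc[symmetric]) (use g A(2,3) B(2,3) r in auto)
    also have "\<dots> = ract W g * (B * A)"
      unfolding B(4)[OF g] by (rule mat_mult_assoc) (use g A(2,3) B(2,3) r in auto)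
    finally show ?thesis .
  qed
  then show ?thesis
    using A B by (auto simp: intertwiners_def)
qed

lemma intertwiners_tensor:
  assumes "is_rep G V" "is_rep G V'" "is_rep G W" "is_rep G W'" "A \<in> intertwiners G V V'" "B \<in> intertwiners G W W'"
    "rdim U = rdim V * rdim W" "ract U = (\<lambda>g\<in>carrier G. ract V g ** ract W g)"
    "rdim U' = rdim V' * rdim W'" "ract U' = (\<lambda>g\<in>carrier G. ract V' g ** ract W' g)"
  shows "A ** B \<in> intertwiners G U U'"
proof -
  note A = intertwinersD[OF assms(5)] and B = intertwinersD[OF assms(6)]
  note r = is_repD[OF assms(1)] is_repD[OF assms(2)] is_repD[OF assms(3)] is_repD[OF assms(4)]
  have "(A ** B) * (ract V g ** ract W g) = (ract V' g ** ract W' g) * (A ** B)" if "g \<in> carrier G" for g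
    using that A B r by (simp add: tensor_mat_mult)
  then show ?thesis
    using A B assms(7-10) by (auto simp: intertwiners_def)
qed

lemma intertwiners_linear:
  assumes "is_rep G V" "is_rep G W" "A \<in> intertwiners G V W" "B \<in> intertwiners G V W"
  shows "A + B \<in> intertwiners G V W" "c \<cdot>\<^sub>m A \<in> intertwiners G V W"
proof -
  note A = intertwinersD[OF assms(3)] and B = intertwinersD[OF assms(4)]
  note r = is_repD[OF assms(1)] is_repD[OF assms(2)]
  have "(A + B) * ract V g = ract W g * (A + B)" "(c \<cdot>\<^sub>m A) * ract V g = ract W g * (c \<cdot>\<^sub>m A)"
    if "g \<in> carrier G" for g
    using that A B r by (simp_all add: mat_add_mult mat_mult_add mat_smult_mult mat_mult_smult)
  then show "A + B \<in> intertwiners G V W" "c \<cdot>\<^sub>m A \<in> intertwiners G V W"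
    using A B by (auto simp: intertwiners_def)
qed

lemma intertwiners_one: "is_rep G V \<Longrightarrow> 1\<^sub>m (rdim V) \<in> intertwiners G V V"
  using is_repD[of V] by (auto simp: intertwiners_def)

lemma intertwiners_zero: "is_rep G V \<Longrightarrow> is_rep G W \<Longrightarrow> 0\<^sub>m (rdim W) (rdim V) \<in> intertwiners G V W"
  using is_repD[of V] is_repD[of W] by (auto simp: intertwiners_def)

lemma Rep_sel [simp]:
  "obj (Rep G) = {V. is_rep G V}" "mor (Rep G) = intertwiners G" "unito (Rep G) = \<lparr>rdim = 1, ract = (\<lambda>g\<in>carrier G. 1\<^sub>m 1)\<rparr>"
  "teno (Rep G) V W = \<lparr>rdim = rdim V * rdim W, ract = (\<lambda>g\<in>carrier G. ract V g ** ract W g)\<rparr>"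
  by (simp_all add: Rep_def)

lemma matcat_Rep: "matcat (Rep G) rdim"
proof
  fix U V W :: "'a rep" and a and X Y :: "'a rep" and f g
  show "cmp (Rep G) = (*)" "idm (Rep G) V = 1\<^sub>m (rdim V)" "zerom (Rep G) V W = 0\<^sub>m (rdim W) (rdim V)"
    "addm (Rep G) = (+)" "scalem (Rep G) = (\<cdot>\<^sub>m)" "tenm (Rep G) = tensor_mat"
    "assoc (Rep G) U V W = 1\<^sub>m (rdim U * rdim V * rdim W)" "lunit (Rep G) V = 1\<^sub>m (rdim V)"
    "runit (Rep G) V = 1\<^sub>m (rdim V)" "rdim (teno (Rep G) V W) = rdim V * rdim W" "rdim (unito (Rep G)) = 1"
    by (simp_all add: Rep_def)
  show "unito (Rep G) \<in> obj (Rep G)"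
    by (simp add: unit_rep)
  show "teno (Rep G) V W \<in> obj (Rep G)" if "V \<in> obj (Rep G)" "W \<in> obj (Rep G)"
    using that tensor_rep[of V W "teno (Rep G) V W"] by simp
  show "teno (Rep G) (teno (Rep G) U V) W = teno (Rep G) U (teno (Rep G) V W)"
    by (auto simp: mult.assoc tensor_mat_assoc intro!: restrict_ext)
  show "teno (Rep G) (unito (Rep G)) V = V" if "V \<in> obj (Rep G)"
    using is_repD(1)[of V] that by (intro rep.equality) (auto simp: extensional_def fun_eq_iff)
  show "teno (Rep G) V (unito (Rep G)) = V" if "V \<in> obj (Rep G)"
    using is_repD(1)[of V] that by (intro rep.equality) (auto simp: extensional_def fun_eq_iff)
  show "f \<in> carrier_mat (rdim W) (rdim V)" if "f \<in> mor (Rep G) V W"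
    using that intertwinersD by simp
  show "1\<^sub>m (rdim V) \<in> mor (Rep G) V V" if "V \<in> obj (Rep G)"
    using that intertwiners_one by simp
  show "0\<^sub>m (rdim W) (rdim V) \<in> mor (Rep G) V W" if "V \<in> obj (Rep G)" "W \<in> obj (Rep G)"
    using that intertwiners_zero by simp
  show "g * f \<in> mor (Rep G) U W"
    if "U \<in> obj (Rep G)" "V \<in> obj (Rep G)" "W \<in> obj (Rep G)" "g \<in> mor (Rep G) V W" "f \<in> mor (Rep G) U V"
    using that intertwiners_mult[of U V W] by simp
  show "f + g \<in> mor (Rep G) V W"
    if "V \<in> obj (Rep G)" "W \<in> obj (Rep G)" "f \<in> mor (Rep G) V W" "g \<in> mor (Rep G) V W"
    using that intertwiners_linear[of V W] by auto
  show "f ** g \<in> mor (Rep G) (teno (Rep G) V W) (teno (Rep G) X Y)"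
    if "V \<in> obj (Rep G)" "W \<in> obj (Rep G)" "X \<in> obj (Rep G)" "Y \<in> obj (Rep G)" "f \<in> mor (Rep G) V X" "g \<in> mor (Rep G) W Y"
    using that intertwiners_tensor[of V X W Y f g "teno (Rep G) V W" "teno (Rep G) X Y"] by simp
  show "a \<cdot>\<^sub>m f \<in> mor (Rep G) V W"
    if "V \<in> obj (Rep G)" "W \<in> obj (Rep G)" "f \<in> mor (Rep G) V W"
    using that intertwiners_linear[of V W] by auto
qed

subsection \<open>Gradings and families of projections\<close>

text \<open>The projections onto the homogeneous components. They amount to an action of the algebra
  of functions on the group, and together with the last condition, the matrix form of compatibility
  with conjugation, to a module over the Drinfeld double.\<close>

definition proj_family :: "('a, 'x) rep_scheme \<Rightarrow> ('a \<Rightarrow> complex mat) \<Rightarrow> bool" where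
  "proj_family V P \<longleftrightarrow> P \<in> extensional (carrier G) \<and>
     (\<forall>g\<in>carrier G. P g \<in> carrier_mat (rdim V) (rdim V)) \<and>
     (\<forall>g\<in>carrier G. \<forall>h\<in>carrier G. P g * P h = (if g = h then P g else 0\<^sub>m (rdim V) (rdim V))) \<and>
     msum (rdim V) (rdim V) P (carrier G) = 1\<^sub>m (rdim V) \<and>
     (\<forall>g\<in>carrier G. \<forall>h\<in>carrier G. ract V g * P h = P (g \<otimes> h \<otimes> inv g) * ract V g)"

lemma proj_familyD:
  assumes "proj_family V P"
  shows "P \<in> extensional (carrier G)" "\<And>g. g \<in> carrier G \<Longrightarrow> P g \<in> carrier_mat (rdim V) (rdim V)"
    "\<And>g. g \<in> carrier G \<Longrightarrow> dim_row (P g) = rdim V" "\<And>g. g \<in> carrier G \<Longrightarrow> dim_col (P g) = rdim V"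
    "\<And>g h. g \<in> carrier G \<Longrightarrow> h \<in> carrier G \<Longrightarrow> P g * P h = (if g = h then P g else 0\<^sub>m (rdim V) (rdim V))"
    "msum (rdim V) (rdim V) P (carrier G) = 1\<^sub>m (rdim V)"
    "\<And>g h. g \<in> carrier G \<Longrightarrow> h \<in> carrier G \<Longrightarrow> ract V g * P h = P (g \<otimes> h \<otimes> inv g) * ract V g"
  using assms by (auto simp: proj_family_def)

text \<open>\<open>Q (s g) * A\<close> is the sum of all \<open>Q (s g) * (A * P h)\<close>. By
  \<open>e\<close> each term carries a factor \<open>Q (s h)\<close>, and orthogonality with
  injectivity of \<open>s\<close> kills it unless \<open>h = g\<close>. The map \<open>s\<close>
  will be the identity or a conjugation.\<close>

lemma proj_intertwine:
  assumes P: "\<And>g. g \<in> carrier G \<Longrightarrow> P g \<in> carrier_mat n n" "msum n n P (carrier G) = 1\<^sub>m n"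
    and Q: "\<And>g. g \<in> carrier G \<Longrightarrow> Q g \<in> carrier_mat m m"
      "\<And>g h. g \<in> carrier G \<Longrightarrow> h \<in> carrier G \<Longrightarrow> g \<noteq> h \<Longrightarrow> Q g * Q h = 0\<^sub>m m m"
    and s: "s \<in> carrier G \<rightarrow> carrier G" "inj_on s (carrier G)" and A: "A \<in> carrier_mat m n"
    and e: "\<And>g. g \<in> carrier G \<Longrightarrow> Q (s g) * (A * P g) = A * P g" and g: "g \<in> carrier G"
  shows "Q (s g) * A = A * P g"
proof -
  have sg: "s h \<in> carrier G" if "h \<in> carrier G" for h
    using s that by auto
  note dims = carrier_matD[OF P(1)] carrier_matD[OF Q(1)] carrier_matD[OF A]
  have "Q (s g) * A = Q (s g) * (A * msum n n P (carrier G))"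
    using P A by simp
  also have "A * msum n n P (carrier G) = msum m n (\<lambda>h. A * P h) (carrier G)"
    using mult_msum[of "carrier G" P n n A] P A by simp
  also have "Q (s g) * \<dots> = msum m n (\<lambda>h. Q (s g) * (A * P h)) (carrier G)"
    by (subst mult_msum) (use dims sg[OF g] A P(1) in auto)
  also have "\<dots> = Q (s g) * (A * P g)"
  proof (rule msum_delta)
    show "Q (s g) * (A * P g) \<in> carrier_mat m n"
      using dims sg[OF g] g by (intro carrier_matI) auto
    fix h
    assume h: "h \<in> carrier G" "h \<noteq> g"
    then have "s g \<noteq> s h"
      using s(2) g by (auto simp: inj_on_def)
    then have "Q (s g) * (Q (s h) * (A * P h)) = 0\<^sub>m m n"
      using Q(2)[OF sg[OF g] sg[OF h(1)]] dims sg[OF g] sg[OF h(1)] h(1)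
      by (subst mat_mult_assoc[symmetric]) auto
    then show "Q (s g) * (A * P h) = 0\<^sub>m m n"
      using e[OF h(1)] by simp
  qed (use g in auto)
  finally show ?thesis
    using e[OF g] by simp
qed

end

lemma subspace_vec_iff:
  "subspace class_ring W (module_vec TYPE(complex) n) \<longleftrightarrow> W \<subseteq> carrier_vec n \<and> 0\<^sub>v n \<in> W \<and>
    (\<forall>v\<in>W. \<forall>w\<in>W. v + w \<in> W) \<and> (\<forall>c. \<forall>v\<in>W. c \<cdot>\<^sub>v v \<in> W)"
  using vec_vs[of n, where 'a = complex] vec_module[of n, where 'a = complex]
  by (auto simp: subspace_def submodule_def module_vec_simps)

lemma finsum_vec_facts:
  assumes "finite I" "u \<in> I \<rightarrow> carrier_vec n"
  shows "finsum (module_vec TYPE(complex) n) u I \<in> carrier_vec n"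
    "i < n \<Longrightarrow> finsum (module_vec TYPE(complex) n) u I $ i = (\<Sum>k\<in>I. u k $ i)"
proof -
  interpret vec_space "TYPE(complex)" n .
  show "finsum V u I \<in> carrier_vec n"
    using finsum_closed[OF assms(2)] .
  show "finsum V u I $ i = (\<Sum>k\<in>I. u k $ i)" if "i < n"
    using index_finsum_vec[OF assms(1) that assms(2)] by simp
qed

text \<open>The product is a combination of columns, built up by induction on the number
  \<open>k\<close> of coordinates of \<open>v\<close> already switched on.\<close>

lemma mult_vec_in_subspace:
  assumes W: "subspace class_ring W (module_vec TYPE(complex) n)" and A: "A \<in> carrier_mat n m"
    and c: "\<And>j. j < m \<Longrightarrow> col A j \<in> W" and v: "v \<in> carrier_vec m"
  shows "A *\<^sub>v v \<in> W"
proof -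
  note W' = W[unfolded subspace_vec_iff]
  have "A *\<^sub>v vec m (\<lambda>i. if i < k then v $ i else 0) \<in> W" if "k \<le> m" for k
    using that
  proof (induction k)
    case 0
    have "A *\<^sub>v vec m (\<lambda>i. if i < 0 then v $ i else 0) = 0\<^sub>v n"
      using A by (intro eq_vecI) (auto simp: scalar_prod_def)
    then show ?case
      using W' by simp
  next
    case (Suc k)
    have "A *\<^sub>v vec m (\<lambda>i. if i < Suc k then v $ i else 0)
        = A *\<^sub>v vec m (\<lambda>i. if i < k then v $ i else 0) + v $ k \<cdot>\<^sub>v col A k"
    proof (rule eq_vecI)
      fix i
      assume "i < dim_vec (A *\<^sub>v vec m (\<lambda>i. if i < k then v $ i else 0) + v $ k \<cdot>\<^sub>v col A k)"
      then have i: "i < n"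
        using A by simp
      have "(\<Sum>j\<in>{0..<m}. A $$ (i, j) * (if j < Suc k then v $ j else 0))
          = (\<Sum>j\<in>{0..<m}. A $$ (i, j) * (if j < k then v $ j else 0) + (if j = k then A $$ (i, k) * v $ k else 0))"
        by (intro sum.cong) auto
      also have "\<dots> = (\<Sum>j\<in>{0..<m}. A $$ (i, j) * (if j < k then v $ j else 0)) + A $$ (i, k) * v $ k"
        using Suc.prems by (simp add: sum.distrib)
      finally show "(A *\<^sub>v vec m (\<lambda>i. if i < Suc k then v $ i else 0)) $ i
          = (A *\<^sub>v vec m (\<lambda>i. if i < k then v $ i else 0) + v $ k \<cdot>\<^sub>v col A k) $ i"
        using i A Suc.prems by (simp add: scalar_prod_def mult.commute)
    qed (use A in simp)
    then show ?case
      using Suc W' c[of k] by simp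
  qed
  from this[of m] have "A *\<^sub>v vec m (\<lambda>i. if i < m then v $ i else 0) \<in> W"
    by simp
  moreover have "vec m (\<lambda>i. if i < m then v $ i else 0) = v"
    using v by (intro eq_vecI) auto
  ultimately show ?thesis
    by simp
qed

text \<open>The projection to degree \<open>g\<close> is assembled columnwise from the degree
  \<open>g\<close> components of the standard basis vectors. Uniqueness of decompositions shows that
  it acts on every vector as the component map, whence the projections are orthogonal
  idempotents.\<close>

lemma grading_projections:
  assumes I: "finite I" and V: "is_grading I n V"
  obtains P where "P \<in> extensional I" "\<And>g. g \<in> I \<Longrightarrow> P g \<in> carrier_mat n n"
    "\<And>g h. g \<in> I \<Longrightarrow> h \<in> I \<Longrightarrow> P g * P h = (if g = h then P g else 0\<^sub>m n n)"
    "msum n n P I = 1\<^sub>m n" "V = (\<lambda>g\<in>I. fix_space n (P g))"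
proof -
  let ?M = "module_vec TYPE(complex) n"
  have ext: "V \<in> extensional I" and sub: "\<And>g. g \<in> I \<Longrightarrow> subspace class_ring (V g) ?M"
    and dec: "\<And>v. v \<in> carrier_vec n \<Longrightarrow> \<exists>!u. u \<in> (\<Pi>\<^sub>E g\<in>I. V g) \<and> v = finsum ?M u I"
    using V by (auto simp: is_grading_def)
  note sub' = sub[unfolded subspace_vec_iff]
  have VC: "u \<in> I \<rightarrow> carrier_vec n" if "u \<in> (\<Pi>\<^sub>E g\<in>I. V g)" for u
  proof
    fix g
    assume "g \<in> I"
    then show "u g \<in> carrier_vec n"
      using that sub'[of g] by (auto simp: PiE_def Pi_def)
  qed
  have "\<exists>u. \<forall>j\<in>{..<n}. u j \<in> (\<Pi>\<^sub>E g\<in>I. V g) \<and> unit_vec n j = finsum ?M (u j) I"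
    by (rule bchoice) (use dec[OF unit_vec_carrier] in blast)
  then obtain u where u: "\<And>j. j < n \<Longrightarrow> u j \<in> (\<Pi>\<^sub>E g\<in>I. V g)" "\<And>j. j < n \<Longrightarrow> unit_vec n j = finsum ?M (u j) I"
    by auto
  define P where "P = (\<lambda>g\<in>I. mat n n (\<lambda>(i, j). u j g $ i))"
  have Pc: "P g \<in> carrier_mat n n" if "g \<in> I" for g
    using that by (simp add: P_def)
  have "col (P g) j = u j g" if "g \<in> I" "j < n" for g j
    using that VC[OF u(1)[OF that(2)]] by (intro eq_vecI) (auto simp: P_def Pi_def)
  then have PV: "P g *\<^sub>v v \<in> V g" if "g \<in> I" "v \<in> carrier_vec n" for g v
    using that u(1) by (intro mult_vec_in_subspace[OF sub Pc]) (auto simp: PiE_def Pi_def)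
  have P1: "msum n n P I = 1\<^sub>m n"
  proof (rule eq_matI)
    fix i j
    assume "i < dim_row (1\<^sub>m n :: complex mat)" "j < dim_col (1\<^sub>m n :: complex mat)"
    then have ij: "i < n" "j < n"
      by simp_all
    have "(\<Sum>g\<in>I. P g $$ (i, j)) = (\<Sum>g\<in>I. u j g $ i)"
      using ij by (intro sum.cong) (auto simp: P_def)
    also have "\<dots> = unit_vec n j $ i"
      unfolding u(2)[OF ij(2)] using finsum_vec_facts(2)[OF I VC[OF u(1)[OF ij(2)]] ij(1)] by simp
    finally show "msum n n P I $$ (i, j) = 1\<^sub>m n $$ (i, j)"
      using ij by (auto simp: index_msum)
  qed simp_all
  have P_dec: "u' g = P g *\<^sub>v v"
    if "v \<in> carrier_vec n" "u' \<in> (\<Pi>\<^sub>E g\<in>I. V g)" "v = finsum ?M u' I" "g \<in> I" for v u' g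
  proof -
    have w: "(\<lambda>g\<in>I. P g *\<^sub>v v) \<in> (\<Pi>\<^sub>E g\<in>I. V g)"
      using PV that(1) by auto
    have "v = finsum ?M (\<lambda>g\<in>I. P g *\<^sub>v v) I"
    proof (rule eq_vecI)
      show "dim_vec v = dim_vec (finsum ?M (\<lambda>g\<in>I. P g *\<^sub>v v) I)"
        using finsum_vec_facts(1)[OF I VC[OF w]] that(1) by simp
      fix i
      assume "i < dim_vec (finsum ?M (\<lambda>g\<in>I. P g *\<^sub>v v) I)"
      then have i: "i < n"
        using finsum_vec_facts(1)[OF I VC[OF w]] by simp
      have "v $ i = (msum n n P I *\<^sub>v v) $ i"
        using P1 that(1) by simp
      also have "\<dots> = (\<Sum>g\<in>I. (P g *\<^sub>v v) $ i)"
        by (rule msum_mult_vec[OF Pc that(1) i])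
      finally show "v $ i = finsum ?M (\<lambda>g\<in>I. P g *\<^sub>v v) I $ i"
        using finsum_vec_facts(2)[OF I VC[OF w] i] by simp
    qed
    then have "u' = (\<lambda>g\<in>I. P g *\<^sub>v v)"
      using dec[OF that(1)] that(2,3) w by blast
    then show ?thesis
      using that(4) by simp
  qed
  \<comment> \<open>A vector of degree \<open>h\<close> has the decomposition concentrated in
    \<open>h\<close>, and uniqueness leaves no other.\<close>
  have Pv: "P g *\<^sub>v v = (if g = h then v else 0\<^sub>v n)" if "g \<in> I" "h \<in> I" "v \<in> V h" for g h v
  proof -
    have v: "v \<in> carrier_vec n"
      using sub' that by blast
    let ?u = "\<lambda>g\<in>I. if g = h then v else 0\<^sub>v n"
    have w: "?u \<in> (\<Pi>\<^sub>E g\<in>I. V g)"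
      using sub' that by auto
    have "v = finsum ?M ?u I"
    proof (rule eq_vecI)
      show "dim_vec v = dim_vec (finsum ?M ?u I)"
        using finsum_vec_facts(1)[OF I VC[OF w]] v by simp
      fix i
      assume "i < dim_vec (finsum ?M ?u I)"
      then have i: "i < n"
        using finsum_vec_facts(1)[OF I VC[OF w]] by simp
      have "(\<Sum>g\<in>I. ?u g $ i) = (\<Sum>g\<in>I. if g = h then v $ i else 0)"
        using i by (intro sum.cong) auto
      then show "v $ i = finsum ?M ?u I $ i"
        using finsum_vec_facts(2)[OF I VC[OF w] i] that(2) I by simp
    qed
    then show ?thesis
      using P_dec[OF v w _ that(1)] that(1) by simp
  qed
  have "V g = fix_space n (P g)" if g: "g \<in> I" for g
  proof (rule subset_antisym; rule subsetI)
    show "v \<in> fix_space n (P g)" if "v \<in> V g" for v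
      using Pv[OF g g that] sub'[OF g] that by (auto simp: fix_space_def)
    show "v \<in> V g" if "v \<in> fix_space n (P g)" for v
    proof -
      have v: "v \<in> carrier_vec n" "P g *\<^sub>v v = v"
        using that by (auto simp: fix_space_def)
      show ?thesis
        using PV[OF g v(1)] unfolding v(2) .
    qed
  qed
  then have VP: "V = (\<lambda>g\<in>I. fix_space n (P g))"
    using ext by (intro extensionalityI[of _ I]) auto
  have "P g * P h = (if g = h then P g else 0\<^sub>m n n)" if gh: "g \<in> I" "h \<in> I" for g h
  proof (rule mat_eq_mult_vecI)
    fix v :: "complex vec"
    assume v: "v \<in> carrier_vec n"
    have "(P g * P h) *\<^sub>v v = P g *\<^sub>v (P h *\<^sub>v v)"
      using Pc gh v by (intro assoc_mult_mat_vec) auto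
    also have "\<dots> = (if g = h then P g *\<^sub>v v else 0\<^sub>v n)"
      using Pv[OF gh PV[OF gh(2) v]] by simp
    finally show "(P g * P h) *\<^sub>v v = (if g = h then P g else 0\<^sub>m n n) *\<^sub>v v"
      using v by (cases "g = h") (auto intro!: eq_vecI simp: scalar_prod_def)
  qed (use Pc gh in auto)
  then show thesis
    using that[of P] Pc P1 VP by (simp add: P_def)
qed

lemma subspace_fix_space: "A \<in> carrier_mat n n \<Longrightarrow> subspace class_ring (fix_space n A) (module_vec TYPE(complex) n)"
  unfolding subspace_vec_iff fix_space_def
  by (auto simp: mult_add_distrib_mat_vec[of A n n] mult_mat_vec[of A n n])

text \<open>Any decomposition of \<open>v\<close> is recovered by applying \<open>P h\<close>, which
  deletes the components of all degrees other than \<open>h\<close>.\<close>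

lemma projections_grading:
  assumes I: "finite I" and P: "\<And>g. g \<in> I \<Longrightarrow> P g \<in> carrier_mat n n"
    "\<And>g h. g \<in> I \<Longrightarrow> h \<in> I \<Longrightarrow> P g * P h = (if g = h then P g else 0\<^sub>m n n)" "msum n n P I = 1\<^sub>m n"
  shows "is_grading I n (\<lambda>g\<in>I. fix_space n (P g))"
  unfolding is_grading_def
proof (intro conjI ballI)
  let ?M = "module_vec TYPE(complex) n" and ?V = "\<lambda>g\<in>I. fix_space n (P g)"
  show "?V \<in> extensional I"
    by simp
  show "subspace class_ring (?V g) ?M" if "g \<in> I" for g
    using that subspace_fix_space P(1) by simp
  fix v :: "complex vec"
  assume v: "v \<in> carrier_vec n"
  have VC: "u \<in> I \<rightarrow> carrier_vec n" if "u \<in> (\<Pi>\<^sub>E g\<in>I. ?V g)" for u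
    using that by (auto simp: PiE_def Pi_def fix_space_def)
  show "\<exists>!u. u \<in> (\<Pi>\<^sub>E g\<in>I. ?V g) \<and> v = finsum ?M u I"
  proof (rule ex1I)
    have w: "(\<lambda>g\<in>I. P g *\<^sub>v v) \<in> (\<Pi>\<^sub>E g\<in>I. ?V g)"
    proof (rule restrict_PiE_iff[THEN iffD2], intro ballI)
      fix g
      assume g: "g \<in> I"
      have "P g *\<^sub>v (P g *\<^sub>v v) = (P g * P g) *\<^sub>v v"
        using P(1)[OF g] v by (intro assoc_mult_mat_vec[symmetric]) auto
      then show "P g *\<^sub>v v \<in> ?V g"
        using P(1)[OF g] P(2)[OF g g] v g by (auto simp: fix_space_def)
    qed
    have "v = finsum ?M (\<lambda>g\<in>I. P g *\<^sub>v v) I"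
    proof (rule eq_vecI)
      show "dim_vec v = dim_vec (finsum ?M (\<lambda>g\<in>I. P g *\<^sub>v v) I)"
        using finsum_vec_facts(1)[OF I VC[OF w]] v by simp
      fix i
      assume "i < dim_vec (finsum ?M (\<lambda>g\<in>I. P g *\<^sub>v v) I)"
      then have i: "i < n"
        using finsum_vec_facts(1)[OF I VC[OF w]] by simp
      have "v $ i = (msum n n P I *\<^sub>v v) $ i"
        using P(3) v by simp
      then show "v $ i = finsum ?M (\<lambda>g\<in>I. P g *\<^sub>v v) I $ i"
        using finsum_vec_facts(2)[OF I VC[OF w] i] msum_mult_vec[OF P(1) v i] by simp
    qed
    then show "(\<lambda>g\<in>I. P g *\<^sub>v v) \<in> (\<Pi>\<^sub>E g\<in>I. ?V g) \<and> v = finsum ?M (\<lambda>g\<in>I. P g *\<^sub>v v) I"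
      using w by simp
    fix u
    assume u: "u \<in> (\<Pi>\<^sub>E g\<in>I. ?V g) \<and> v = finsum ?M u I"
    have uc: "u g \<in> carrier_vec n" "P g * col_mat (u g) = col_mat (u g)" if "g \<in> I" for g
      using u that fix_space_iff[OF P(1)[OF that]] by (auto simp: PiE_def Pi_def)
    have cv: "col_mat v = msum n 1 (\<lambda>g. col_mat (u g)) I"
    proof (rule eq_matI)
      fix i j
      assume "i < dim_row (msum n 1 (\<lambda>g. col_mat (u g)) I)" "j < dim_col (msum n 1 (\<lambda>g. col_mat (u g)) I)"
      then have i: "i < n" "j = 0"
        by simp_all
      have "(\<Sum>g\<in>I. col_mat (u g) $$ (i, 0)) = (\<Sum>g\<in>I. u g $ i)"
        using i carrier_vecD[OF uc(1)] by (intro sum.cong) (auto simp: col_mat_def)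
      moreover have "v $ i = (\<Sum>g\<in>I. u g $ i)"
        using finsum_vec_facts(2)[OF I VC i(1)] u by blast
      ultimately show "col_mat v $$ (i, j) = msum n 1 (\<lambda>g. col_mat (u g)) I $$ (i, j)"
        using i v by (simp add: index_msum col_mat_def)
    qed (use v in simp_all)
    have "u h = P h *\<^sub>v v" if h: "h \<in> I" for h
    proof -
      have cc: "col_mat (u g) \<in> carrier_mat n 1" if "g \<in> I" for g
        using uc[OF that] by (intro carrier_matI) auto
      have "col_mat (P h *\<^sub>v v) = msum n 1 (\<lambda>g. P h * col_mat (u g)) I"
        using mult_msum[of I "\<lambda>g. col_mat (u g)" n 1 "P h"] cc P(1)[OF h] v by (simp add: col_mat_mult cv)
      also have "\<dots> = P h * col_mat (u h)"
      proof (rule msum_delta[OF I h])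
        show "P h * col_mat (u h) \<in> carrier_mat n 1"
          using cc[OF h] P(1)[OF h] by auto
        fix g
        assume g: "g \<in> I" "g \<noteq> h"
        have "P h * col_mat (u g) = P h * P g * col_mat (u g)"
          using uc[OF g(1)] P(1)[OF h] P(1)[OF g(1)] by (simp add: mat_mult_assoc)
        then show "P h * col_mat (u g) = 0\<^sub>m n 1"
          using P(2)[OF h g(1)] g uc[OF g(1)] by simp
      qed
      finally show ?thesis
        using uc[OF h] by (simp add: col_mat_inj)
    qed
    then show "u = (\<lambda>g\<in>I. P g *\<^sub>v v)"
      using u by (intro extensionalityI[of _ I]) (auto simp: PiE_def)
  qed
qed

context finite_group
begin

text \<open>Replaces subspaces by idempotents. Conjugation by \<open>g\<close> is injective, so
  \<open>proj_intertwine\<close> upgrades the inclusion of a translated component in the conjugate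
  one to a commutation rule.\<close>

lemma is_graded_rep_iff: "is_graded_rep G V \<longleftrightarrow>
    is_rep G V \<and> (\<exists>P. proj_family V P \<and> rgrd V = (\<lambda>g\<in>carrier G. fix_space (rdim V) (P g)))"
proof
  assume V: "is_graded_rep G V"
  then have r: "is_rep G V" "is_grading (carrier G) (rdim V) (rgrd V)"
    and eq: "\<And>g h v. g \<in> carrier G \<Longrightarrow> h \<in> carrier G \<Longrightarrow> v \<in> rgrd V h \<Longrightarrow> ract V g *\<^sub>v v \<in> rgrd V (g \<otimes> h \<otimes> inv g)"
    by (auto simp: is_graded_rep_def)
  obtain P where P: "P \<in> extensional (carrier G)" "\<And>g. g \<in> carrier G \<Longrightarrow> P g \<in> carrier_mat (rdim V) (rdim V)"
    "\<And>g h. g \<in> carrier G \<Longrightarrow> h \<in> carrier G \<Longrightarrow> P g * P h = (if g = h then P g else 0\<^sub>m (rdim V) (rdim V))"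
    "msum (rdim V) (rdim V) P (carrier G) = 1\<^sub>m (rdim V)" "rgrd V = (\<lambda>g\<in>carrier G. fix_space (rdim V) (P g))"
    using grading_projections[OF finite_carrier r(2)] by blast
  have "P (g \<otimes> h \<otimes> inv g) * ract V g = ract V g * P h" if g: "g \<in> carrier G" and h: "h \<in> carrier G" for g h
  proof (rule proj_intertwine[OF P(2) P(4) P(2), where s = "\<lambda>h. g \<otimes> h \<otimes> inv g"])
    show "inj_on (\<lambda>h. g \<otimes> h \<otimes> inv g) (carrier G)"
      using g by (intro inj_onI) simp
    show "P (g \<otimes> k \<otimes> inv g) * (ract V g * P k) = ract V g * P k" if k: "k \<in> carrier G" for k
    proof (rule maps_fix_space_iff[THEN iffD1])
      show "\<forall>v\<in>fix_space (rdim V) (P k). ract V g *\<^sub>v v \<in> fix_space (rdim V) (P (g \<otimes> k \<otimes> inv g))"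
        using eq[OF g k] P(5) g k by simp
    qed (use P g k is_repD[OF r(1)] in auto)
  qed (use P g h is_repD[OF r(1)] in auto)
  then have "proj_family V P"
    using P by (simp add: proj_family_def)
  then show "is_rep G V \<and> (\<exists>P. proj_family V P \<and> rgrd V = (\<lambda>g\<in>carrier G. fix_space (rdim V) (P g)))"
    using r P by blast
next
  assume "is_rep G V \<and> (\<exists>P. proj_family V P \<and> rgrd V = (\<lambda>g\<in>carrier G. fix_space (rdim V) (P g)))"
  then obtain P where r: "is_rep G V" and P: "proj_family V P" "rgrd V = (\<lambda>g\<in>carrier G. fix_space (rdim V) (P g))"
    by blast
  note P' = proj_familyD[OF P(1)]
  have "ract V g *\<^sub>v v \<in> rgrd V (g \<otimes> h \<otimes> inv g)"
    if g: "g \<in> carrier G" and h: "h \<in> carrier G" and v: "v \<in> rgrd V h" for g h v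
  proof -
    have c: "g \<otimes> h \<otimes> inv g \<in> carrier G"
      using g h by simp
    have "P (g \<otimes> h \<otimes> inv g) * (ract V g * P h) = P (g \<otimes> h \<otimes> inv g) * P (g \<otimes> h \<otimes> inv g) * ract V g"
      unfolding P'(7)[OF g h] using P'(3,4)[OF c] is_repD(3,4)[OF r g] by (intro mat_mult_assoc[symmetric]) auto
    also have "\<dots> = ract V g * P h"
      using P'(5)[OF c c] P'(7)[OF g h] by simp
    finally show ?thesis
      using maps_fix_space_iff[of "P h" "rdim V" "P (g \<otimes> h \<otimes> inv g)" "rdim V" "ract V g"]
        P'(2)[OF h] P'(2)[OF c] P'(5)[OF h h] is_repD(2)[OF r g] v h c by (simp add: P(2))
  qed
  then show "is_graded_rep G V"
    using projections_grading[OF finite_carrier P'(2,5,6)] r by (simp add: is_graded_rep_def P(2))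
qed

definition proj :: "'a graded_rep \<Rightarrow> 'a \<Rightarrow> complex mat" where
  "proj V = (SOME P. proj_family V P \<and> rgrd V = (\<lambda>g\<in>carrier G. fix_space (rdim V) (P g)))"

lemma proj_facts:
  assumes "is_graded_rep G V"
  shows "is_rep G V" "proj_family V (proj V)" "rgrd V = (\<lambda>g\<in>carrier G. fix_space (rdim V) (proj V g))"
proof -
  have "proj_family V (proj V) \<and> rgrd V = (\<lambda>g\<in>carrier G. fix_space (rdim V) (proj V g))"
    unfolding proj_def by (rule someI_ex[where P = "\<lambda>P. proj_family V P \<and> rgrd V = (\<lambda>g\<in>carrier G. fix_space (rdim V) (P g))"])
      (use assms is_graded_rep_iff in blast)
  then show "proj_family V (proj V)" "rgrd V = (\<lambda>g\<in>carrier G. fix_space (rdim V) (proj V g))"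
    by auto
  show "is_rep G V"
    using assms by (simp add: is_graded_rep_iff)
qed

lemma maps_grading_iff:
  assumes P: "proj_family V P" and Q: "proj_family W Q" and A: "A \<in> carrier_mat (rdim W) (rdim V)"
  shows "(\<forall>g\<in>carrier G. \<forall>v\<in>fix_space (rdim V) (P g). A *\<^sub>v v \<in> fix_space (rdim W) (Q g))
    \<longleftrightarrow> (\<forall>g\<in>carrier G. A * P g = Q g * A)"
proof -
  note P' = proj_familyD[OF P] and Q' = proj_familyD[OF Q]
  have 1: "(\<forall>v\<in>fix_space (rdim V) (P g). A *\<^sub>v v \<in> fix_space (rdim W) (Q g)) \<longleftrightarrow> Q g * (A * P g) = A * P g"
    if g: "g \<in> carrier G" for g
    by (rule maps_fix_space_iff) (use P' Q' A g in auto)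
  have 2: "Q g * (A * P g) = A * P g" if g: "g \<in> carrier G" and e: "A * P g = Q g * A" for g
    using e Q'(3,4,5)[OF g] g A mat_mult_assoc[of "Q g" "Q g" A] by simp
  have 3: "Q g * A = A * P g" if g: "g \<in> carrier G" and e: "\<And>g. g \<in> carrier G \<Longrightarrow> Q g * (A * P g) = A * P g" for g
    by (rule proj_intertwine[OF P'(2,6) Q'(2), where s = "\<lambda>g. g"]) (use Q' A e g in auto)
  show ?thesis
    using 1 2 3 by (metis (no_types, lifting))
qed

text \<open>The identity matrix maps each component to the equal one, so it intertwines the two
  families.\<close>

lemma proj_family_unique:
  assumes P: "proj_family V P" and Q: "proj_family V Q"
    and e: "\<And>g. g \<in> carrier G \<Longrightarrow> fix_space (rdim V) (P g) = fix_space (rdim V) (Q g)"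
  shows "P = Q"
proof (rule extensionalityI)
  fix g
  assume g: "g \<in> carrier G"
  have "\<forall>g\<in>carrier G. \<forall>v\<in>fix_space (rdim V) (P g). 1\<^sub>m (rdim V) *\<^sub>v v \<in> fix_space (rdim V) (Q g)"
  proof (intro ballI)
    fix h v
    assume h: "h \<in> carrier G" and v: "v \<in> fix_space (rdim V) (P h)"
    then have "1\<^sub>m (rdim V) *\<^sub>v v = v"
      by (simp add: fix_space_def)
    then show "1\<^sub>m (rdim V) *\<^sub>v v \<in> fix_space (rdim V) (Q h)"
      using v e[OF h] by simp
  qed
  then have "1\<^sub>m (rdim V) * P g = Q g * 1\<^sub>m (rdim V)"
    using maps_grading_iff[OF P Q, of "1\<^sub>m (rdim V)"] g by simp
  then show "P g = Q g"
    using proj_familyD(2)[OF P g] proj_familyD(2)[OF Q g] by simp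
qed (use proj_familyD(1)[OF P] proj_familyD(1)[OF Q] in auto)

lemma proj_eq:
  assumes "is_rep G V" "proj_family V P" "rgrd V = (\<lambda>g\<in>carrier G. fix_space (rdim V) (P g))"
  shows "is_graded_rep G V" "proj V = P"
proof -
  show V: "is_graded_rep G V"
    using assms is_graded_rep_iff by blast
  show "proj V = P"
  proof (rule proj_family_unique[OF proj_facts(2)[OF V] assms(2)])
    show "fix_space (rdim V) (proj V g) = fix_space (rdim V) (P g)" if "g \<in> carrier G" for g
      using fun_cong[OF assms(3), of g] fun_cong[OF proj_facts(3)[OF V], of g] that by simp
  qed
qed

lemma mor_RepD_iff:
  assumes "is_graded_rep G V" "is_graded_rep G W"
  shows "A \<in> mor (RepD G) V W \<longleftrightarrow>
    A \<in> intertwiners G V W \<and> (\<forall>g\<in>carrier G. A * proj V g = proj W g * A)"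
  using maps_grading_iff[OF proj_facts(2)[OF assms(1)] proj_facts(2)[OF assms(2)], of A]
    proj_facts(3)[OF assms(1)] proj_facts(3)[OF assms(2)] intertwinersD(1)[of A V W]
  by (auto simp: RepD_def)

end

section \<open>Half-braidings on representations\<close>

lemma mat_eq_tensor_colI:
  assumes d: "dim_row A = dim_row B" "dim_col A = n * m" "dim_col B = n * m"
    and eq: "\<And>w. w \<in> carrier_mat m 1 \<Longrightarrow> A * (1\<^sub>m n ** w) = B * (1\<^sub>m n ** w)"
  shows "A = B"
proof (rule mat_eq_tensorI[OF d])
  fix v w :: "complex mat"
  assume vw: "v \<in> carrier_mat n 1" "w \<in> carrier_mat m 1"
  have "v ** w = (1\<^sub>m n ** w) * (v ** 1\<^sub>m 1)"
    by (subst tensor_mat_mult) (use vw in auto)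
  then have "X * (v ** w) = X * (1\<^sub>m n ** w) * v" if "dim_col X = n * m" for X
    using vw that by (simp add: mat_mult_assoc)
  then show "A * (v ** w) = B * (v ** w)"
    using d eq[OF vw(2)] by simp
qed

context finite_group
begin

lemma inv_cancel: "g \<in> carrier G \<Longrightarrow> h \<in> carrier G \<Longrightarrow> inv g \<otimes> (g \<otimes> h) = h"
  "g \<in> carrier G \<Longrightarrow> h \<in> carrier G \<Longrightarrow> g \<otimes> (inv g \<otimes> h) = h"
  by (simp_all flip: m_assoc)

text \<open>The map sending \<open>v \<otimes> w\<close> to the sum of
  \<open>g w \<otimes> P g v\<close> over all \<open>g\<close>; on vectors \<open>v\<close> of
  degree \<open>g\<close> it is the braiding of the double. \<open>W\<close> may be any record
  extending a representation, so graded ones can be inserted directly.\<close>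

definition hb :: "nat \<Rightarrow> ('a \<Rightarrow> complex mat) \<Rightarrow> ('a, 'x) rep_scheme \<Rightarrow> complex mat" where
  "hb n P W = msum (rdim W * n) (rdim W * n) (\<lambda>g. ract W g ** P g) (carrier G) * swap_mat n (rdim W)"

lemma dim_hb [simp]: "dim_row (hb n P W) = rdim W * n" "dim_col (hb n P W) = n * rdim W"
  by (simp_all add: hb_def)

lemma hb_cong: "rdim W = rdim W' \<Longrightarrow> ract W = ract W' \<Longrightarrow> hb n P W = hb n P W'"
  by (simp add: hb_def)

lemma hb_tensor_cols:
  assumes W: "is_rep G W" and P: "\<And>g. g \<in> carrier G \<Longrightarrow> P g \<in> carrier_mat n n"
    and A: "dim_row A = n" and B: "dim_row B = rdim W"
  shows "hb n P W * (A ** B)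
    = msum (rdim W * n) (dim_col B * dim_col A) (\<lambda>g. (ract W g * B) ** (P g * A)) (carrier G) * swap_mat (dim_col A) (dim_col B)"
    (is "_ = msum _ ?c ?f _ * _")
proof -
  note r = is_repD[OF W] and d = carrier_matD[OF P]
  have "hb n P W * (A ** B)
      = msum (rdim W * n) (rdim W * n) (\<lambda>g. ract W g ** P g) (carrier G) * (swap_mat n (rdim W) * (A ** B))"
    unfolding hb_def by (rule mat_mult_assoc) (use A B in auto)
  also have "swap_mat n (rdim W) * (A ** B) = (B ** A) * swap_mat (dim_col A) (dim_col B)"
    by (rule swap_mat_tensor) (use A B in auto)
  also have "msum (rdim W * n) (rdim W * n) (\<lambda>g. ract W g ** P g) (carrier G) * \<dots>
      = msum (rdim W * n) (rdim W * n) (\<lambda>g. ract W g ** P g) (carrier G) * (B ** A) * swap_mat (dim_col A) (dim_col B)"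
    by (rule mat_mult_assoc[symmetric]) (use A B in auto)
  also have "msum (rdim W * n) (rdim W * n) (\<lambda>g. ract W g ** P g) (carrier G) * (B ** A)
      = msum (rdim W * n) (dim_col B * dim_col A) (\<lambda>g. (ract W g ** P g) * (B ** A)) (carrier G)"
    using msum_mult[of "carrier G" "\<lambda>g. ract W g ** P g" "rdim W * n" "rdim W * n" "B ** A"]
      tensor_mat_carrier[OF r(2) P] A B by simp
  also have "\<dots> = msum (rdim W * n) ?c ?f (carrier G)"
    by (rule msum_cong[OF refl]) (use A B r d in \<open>simp add: tensor_mat_mult\<close>)
  finally show ?thesis .
qed

text \<open>Fixing \<open>w\<close> removes the flip, since flipping past a one-dimensional factor
  is the identity.\<close>

lemma hb_col:
  assumes W: "is_rep G W" and P: "\<And>g. g \<in> carrier G \<Longrightarrow> P g \<in> carrier_mat n n" and w: "w \<in> carrier_mat (rdim W) 1"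
  shows "hb n P W * (1\<^sub>m n ** w) = msum (rdim W * n) n (\<lambda>g. (ract W g * w) ** P g) (carrier G)"
proof -
  have "hb n P W * (1\<^sub>m n ** w) = msum (rdim W * n) (1 * n) (\<lambda>g. (ract W g * w) ** (P g * 1\<^sub>m n)) (carrier G) * swap_mat n 1"
    using hb_tensor_cols[OF W P, where A = "1\<^sub>m n" and B = w] w by simp
  also have "\<dots> = msum (rdim W * n) n (\<lambda>g. (ract W g * w) ** P g) (carrier G)"
    using carrier_matD[OF P] by (simp cong: msum_cong) simp
  finally show ?thesis .
qed

lemma hb_natural:
  assumes W: "is_rep G W" "is_rep G W'" and f: "f \<in> intertwiners G W W'"
    and P: "\<And>g. g \<in> carrier G \<Longrightarrow> P g \<in> carrier_mat n n"
  shows "(f ** 1\<^sub>m n) * hb n P W = hb n P W' * (1\<^sub>m n ** f)"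
proof (rule mat_eq_tensor_colI[of _ _ n "rdim W"])
  note f' = intertwinersD[OF f] and r = is_repD[OF W(1)] is_repD[OF W(2)] and d = carrier_matD[OF P]
  fix w :: "complex mat"
  assume w: "w \<in> carrier_mat (rdim W) 1"
  have "(f ** 1\<^sub>m n) * hb n P W * (1\<^sub>m n ** w) = (f ** 1\<^sub>m n) * (hb n P W * (1\<^sub>m n ** w))"
    by (rule mat_mult_assoc) (use f' w in auto)
  also have "\<dots> = msum (rdim W' * n) n (\<lambda>g. (f ** 1\<^sub>m n) * ((ract W g * w) ** P g)) (carrier G)"
    using mult_msum[of "carrier G" "\<lambda>g. (ract W g * w) ** P g" "rdim W * n" n "f ** 1\<^sub>m n"]
      tensor_mat_carrier[OF mult_carrier_mat[OF r(2) w] P] f' by (simp add: hb_col[OF W(1) P w])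
  also have "\<dots> = msum (rdim W' * n) n (\<lambda>g. (ract W' g * (f * w)) ** P g) (carrier G)"
  proof (rule msum_cong[OF refl])
    fix g
    assume g: "g \<in> carrier G"
    have "f * (ract W g * w) = f * ract W g * w"
      by (rule mat_mult_assoc[symmetric]) (use g f' w r in auto)
    also have "\<dots> = ract W' g * (f * w)"
      unfolding f'(4)[OF g] by (rule mat_mult_assoc) (use g f' w r in auto)
    finally show "(f ** 1\<^sub>m n) * ((ract W g * w) ** P g) = (ract W' g * (f * w)) ** P g"
      using g f' w r d by (simp add: tensor_mat_mult)
  qed
  also have "\<dots> = hb n P W' * (1\<^sub>m n ** (f * w))"
    by (rule hb_col[OF W(2) P, symmetric]) (use f' w in auto)
  also have "\<dots> = hb n P W' * (1\<^sub>m n ** f) * (1\<^sub>m n ** w)"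
    using f' w by (simp add: one_tensor_mult mat_mult_assoc)
  finally show "(f ** 1\<^sub>m n) * hb n P W * (1\<^sub>m n ** w) = hb n P W' * (1\<^sub>m n ** f) * (1\<^sub>m n ** w)" .
qed (use intertwinersD[OF f] in auto)

lemma hb_mor:
  assumes W: "is_rep G W" and A: "A \<in> carrier_mat m n"
    and P: "\<And>g. g \<in> carrier G \<Longrightarrow> P g \<in> carrier_mat n n" and Q: "\<And>g. g \<in> carrier G \<Longrightarrow> Q g \<in> carrier_mat m m"
    and e: "\<And>g. g \<in> carrier G \<Longrightarrow> A * P g = Q g * A"
  shows "(1\<^sub>m (rdim W) ** A) * hb n P W = hb m Q W * (A ** 1\<^sub>m (rdim W))"
proof -
  note r = is_repD[OF W] and d = carrier_matD[OF P] carrier_matD[OF Q] carrier_matD[OF A]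
  let ?w = "rdim W"
  have "(1\<^sub>m ?w ** A) * hb n P W = (1\<^sub>m ?w ** A) * msum (?w * n) (?w * n) (\<lambda>g. ract W g ** P g) (carrier G) * swap_mat n ?w"
    unfolding hb_def using d by (simp add: mat_mult_assoc)
  also have "(1\<^sub>m ?w ** A) * msum (?w * n) (?w * n) (\<lambda>g. ract W g ** P g) (carrier G)
      = msum (?w * m) (?w * n) (\<lambda>g. (1\<^sub>m ?w ** A) * (ract W g ** P g)) (carrier G)"
    by (subst mult_msum) (use r d in \<open>auto intro!: carrier_matI\<close>)
  also have "\<dots> = msum (?w * m) (?w * n) (\<lambda>g. (ract W g * 1\<^sub>m ?w) ** (Q g * A)) (carrier G)"
    using r d e by (intro msum_cong) (auto simp: tensor_mat_mult)
  also have "\<dots> * swap_mat n ?w = hb m Q W * (A ** 1\<^sub>m ?w)"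
    using hb_tensor_cols[OF W Q, where A = A and B = "1\<^sub>m ?w"] d by (simp add: mult.commute)
  finally show ?thesis .
qed

text \<open>Equivariance holds term by term once the sum is reindexed by conjugation with
  \<open>g\<close>: the action on \<open>W\<close> and the projections are conjugated
  simultaneously.\<close>

lemma hb_intertwiner:
  assumes V: "is_rep G V" and W: "is_rep G W" and P: "proj_family V P"
    and U: "rdim U = rdim V * rdim W" "ract U = (\<lambda>g\<in>carrier G. ract V g ** ract W g)"
    and U': "rdim U' = rdim W * rdim V" "ract U' = (\<lambda>g\<in>carrier G. ract W g ** ract V g)"
  shows "hb (rdim V) P W \<in> intertwiners G U U'"
proof -
  note rV = is_repD[OF V] and rW = is_repD[OF W] and P' = proj_familyD[OF P]
  let ?n = "rdim V" and ?w = "rdim W"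
  have "hb ?n P W * (ract V g ** ract W g) = (ract W g ** ract V g) * hb ?n P W" if g: "g \<in> carrier G" for g
  proof -
    have c: "bij_betw (\<lambda>h. g \<otimes> h \<otimes> inv g) (carrier G) (carrier G)"
      by (rule bij_betw_byWitness[where f' = "\<lambda>h. inv g \<otimes> h \<otimes> g"]) (use g inv_cancel in \<open>auto simp: m_assoc\<close>)
    have "(ract W g ** ract V g) * hb ?n P W
        = (ract W g ** ract V g) * msum (?w * ?n) (?w * ?n) (\<lambda>h. ract W h ** P h) (carrier G) * swap_mat ?n ?w"
      unfolding hb_def by (rule mat_mult_assoc[symmetric]) (use g rV rW in auto)
    also have "(ract W g ** ract V g) * msum (?w * ?n) (?w * ?n) (\<lambda>h. ract W h ** P h) (carrier G)
        = msum (?w * ?n) (?w * ?n) (\<lambda>h. (ract W g ** ract V g) * (ract W h ** P h)) (carrier G)"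
      by (subst mult_msum) (use g rV rW P' in \<open>auto intro!: carrier_matI\<close>)
    also have "\<dots> = msum (?w * ?n) (?w * ?n) (\<lambda>h. (ract W (g \<otimes> h \<otimes> inv g) * ract W g) ** (P (g \<otimes> h \<otimes> inv g) * ract V g)) (carrier G)"
    proof (rule msum_cong[OF refl])
      fix h
      assume h: "h \<in> carrier G"
      have "ract W (g \<otimes> h \<otimes> inv g) * ract W g = ract W (g \<otimes> h \<otimes> inv g \<otimes> g)"
        using g h rW(5) by simp
      also have "\<dots> = ract W g * ract W h"
        using g h rW(5) by (simp add: m_assoc)
      finally show "(ract W g ** ract V g) * (ract W h ** P h)
          = (ract W (g \<otimes> h \<otimes> inv g) * ract W g) ** (P (g \<otimes> h \<otimes> inv g) * ract V g)"
        using g h rV rW P' by (simp add: tensor_mat_mult)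
    qed
    also have "\<dots> = msum (?w * ?n) (?w * ?n) (\<lambda>h. (ract W h * ract W g) ** (P h * ract V g)) (carrier G)"
      using msum_reindex[OF c, of "?w * ?n" "?w * ?n" "\<lambda>h. (ract W h * ract W g) ** (P h * ract V g)"] by simp
    also have "\<dots> * swap_mat ?n ?w = hb ?n P W * (ract V g ** ract W g)"
      using hb_tensor_cols[OF W P'(2), where A = "ract V g" and B = "ract W g"] g rV rW by (simp add: mult.commute)
    finally show ?thesis ..
  qed
  then show ?thesis
    using U U' by (auto simp: intertwiners_def)
qed

text \<open>Composing the two half braidings gives a double sum with factors
  \<open>P h * P g\<close>; orthogonality leaves the diagonal terms, in which the same
  \<open>g\<close> acts on both factors.\<close>

lemma hb_tensor:
  assumes W: "is_rep G W" "is_rep G W'" and P: "proj_family V P" and n: "n = rdim V"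
    and U: "rdim U = rdim W * rdim W'" "ract U = (\<lambda>g\<in>carrier G. ract W g ** ract W' g)"
  shows "hb n P U = (1\<^sub>m (rdim W) ** hb n P W') * (hb n P W ** 1\<^sub>m (rdim W'))"
proof (rule mat_eq_tensor3I[of _ _ n "rdim W" "rdim W'"])
  note r = is_repD[OF W(1)] is_repD[OF W(2)] and P' = proj_familyD[OF P, folded n]
  let ?w = "rdim W" and ?x = "rdim W'"
  have rU: "is_rep G U"
    by (rule tensor_rep[OF W U])
  fix u v w :: "complex mat"
  assume c: "u \<in> carrier_mat n 1" "v \<in> carrier_mat ?w 1" "w \<in> carrier_mat ?x 1"
  note cd = carrier_matD[OF c(1)] carrier_matD[OF c(2)] carrier_matD[OF c(3)]
  have hb1: "hb n P X * (a ** b) = msum (rdim X * n) 1 (\<lambda>g. (ract X g * b) ** (P g * a)) (carrier G)"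
    if "is_rep G X" "dim_row a = n" "dim_col a = 1" "dim_row b = rdim X" "dim_col b = 1" for X :: "('a, 'z) rep_scheme" and a b
    using hb_tensor_cols[OF that(1) P'(2), where A = a and B = b] that by simp
  have hb2: "hb n P W * (a ** b) = msum (?w * n) 1 (\<lambda>g. (ract W g * b) ** (P g * a)) (carrier G)"
    if "dim_row a = n" "dim_col a = 1" "dim_row b = ?w" "dim_col b = 1" for a b
    using hb_tensor_cols[OF W(1) P'(2), where A = a and B = b] that by simp
  have hb3: "hb n P W' * (a ** b) = msum (?x * n) 1 (\<lambda>g. (ract W' g * b) ** (P g * a)) (carrier G)"
    if "dim_row a = n" "dim_col a = 1" "dim_row b = ?x" "dim_col b = 1" for a b
    using hb_tensor_cols[OF W(2) P'(2), where A = a and B = b] that by simp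
  have "hb n P U * (u ** (v ** w)) = msum (rdim U * n) 1 (\<lambda>g. (ract U g * (v ** w)) ** (P g * u)) (carrier G)"
    by (rule hb1[OF rU]) (use cd U in auto)
  also have "\<dots> = msum (?w * (?x * n)) 1 (\<lambda>g. (ract W g * v) ** (ract W' g * w) ** (P g * u)) (carrier G)"
    unfolding U(1) mult.assoc
    by (rule msum_cong[OF refl]) (use cd r U(2) in \<open>simp add: tensor_mat_mult tensor_mat_assoc\<close>)
  finally have L: "hb n P U * (u ** (v ** w)) = msum (?w * (?x * n)) 1 (\<lambda>g. (ract W g * v) ** (ract W' g * w) ** (P g * u)) (carrier G)" .
  have "(hb n P W ** 1\<^sub>m ?x) * ((u ** v) ** w) = (hb n P W * (u ** v)) ** w"
    using cd by (subst tensor_mat_mult) auto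
  also have "\<dots> = msum (?w * n * ?x) 1 (\<lambda>g. ((ract W g * v) ** (P g * u)) ** w) (carrier G)"
  proof -
    have "(ract W g * v) ** (P g * u) \<in> carrier_mat (?w * n) 1" if "g \<in> carrier G" for g
      using that cd r P' by (intro carrier_matI) auto
    then show ?thesis
      using hb2[of u v] msum_tensor[of "carrier G" "\<lambda>g. (ract W g * v) ** (P g * u)" "?w * n" 1 w] cd by simp
  qed
  finally have "(1\<^sub>m ?w ** hb n P W') * ((hb n P W ** 1\<^sub>m ?x) * ((u ** v) ** w))
      = (1\<^sub>m ?w ** hb n P W') * msum (?w * n * ?x) 1 (\<lambda>g. ((ract W g * v) ** (P g * u)) ** w) (carrier G)"
    by (rule arg_cong)
  also have "\<dots> = msum (dim_row (1\<^sub>m ?w ** hb n P W')) 1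
      (\<lambda>g. (1\<^sub>m ?w ** hb n P W') * (((ract W g * v) ** (P g * u)) ** w)) (carrier G)"
  proof (rule mult_msum)
    show "((ract W g * v) ** (P g * u)) ** w \<in> carrier_mat (?w * n * ?x) 1" if "g \<in> carrier G" for g
      using that cd r P' by (intro carrier_matI) auto
  qed (simp add: mult.assoc)
  also have "dim_row (1\<^sub>m ?w ** hb n P W') = ?w * (?x * n)"
    by simp
  also have "msum (?w * (?x * n)) 1 (\<lambda>g. (1\<^sub>m ?w ** hb n P W') * (((ract W g * v) ** (P g * u)) ** w)) (carrier G)
      = msum (?w * (?x * n)) 1 (\<lambda>g. (ract W g * v) ** (ract W' g * w) ** (P g * u)) (carrier G)"
  proof (rule msum_cong[OF refl])
    fix g
    assume g: "g \<in> carrier G"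
    have "(1\<^sub>m ?w ** hb n P W') * (((ract W g * v) ** (P g * u)) ** w)
        = (ract W g * v) ** (hb n P W' * ((P g * u) ** w))"
      using g cd r P' by (simp add: tensor_mat_mult tensor_mat_assoc)
    also have "hb n P W' * ((P g * u) ** w) = msum (?x * n) 1 (\<lambda>h. (ract W' h * w) ** (P h * (P g * u))) (carrier G)"
      by (rule hb3) (use g cd r P' in auto)
    also have "\<dots> = (ract W' g * w) ** (P g * (P g * u))"
    proof (rule msum_delta)
      fix h
      assume h: "h \<in> carrier G" "h \<noteq> g"
      have "P h * (P g * u) = P h * P g * u"
        by (rule mat_mult_assoc[symmetric]) (use g h cd P' in auto)
      then show "(ract W' h * w) ** (P h * (P g * u)) = 0\<^sub>m (?x * n) 1"
        using P'(5)[OF h(1) g] g h cd r P'(3,4) by simp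
    qed (use g cd r P' in \<open>auto intro!: carrier_matI\<close>)
    also have "P g * (P g * u) = P g * u"
      using mat_mult_assoc[of "P g" "P g" u] P'(3,4,5) g cd by simp
    finally show "(1\<^sub>m ?w ** hb n P W') * (((ract W g * v) ** (P g * u)) ** w) = (ract W g * v) ** (ract W' g * w) ** (P g * u)" .
  qed
  finally show "hb n P U * (u ** v ** w) = (1\<^sub>m ?w ** hb n P W') * (hb n P W ** 1\<^sub>m ?x) * (u ** v ** w)"
    unfolding L using cd by (simp add: mat_mult_assoc tensor_mat_assoc mult_ac)
qed (use U in \<open>auto simp: mult_ac\<close>)

lemma hb_unit:
  assumes P: "proj_family V P" and n: "n = rdim V" and U: "rdim U = 1" "ract U = (\<lambda>g\<in>carrier G. 1\<^sub>m 1)"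
  shows "hb n P U = 1\<^sub>m n"
proof -
  have "msum n n (\<lambda>g. ract U g ** P g) (carrier G) = msum n n P (carrier G)"
    by (rule msum_cong) (auto simp: U)
  then show ?thesis
    using proj_familyD(6)[OF P] U n by (simp add: hb_def)
qed

text \<open>Apart from the flip, the inverse is the same sum with \<open>inv g\<close> acting on
  \<open>W\<close>; orthogonality reduces the product to the sum of all
  \<open>1 \<otimes> P g\<close>.\<close>

lemma hb_inverse:
  assumes W: "is_rep G W" and P: "proj_family V P" and n: "n = rdim V"
  obtains B where "B \<in> carrier_mat (n * rdim W) (rdim W * n)"
    "B * hb n P W = 1\<^sub>m (n * rdim W)" "hb n P W * B = 1\<^sub>m (rdim W * n)"
proof -
  note r = is_repD[OF W] and P' = proj_familyD[OF P, folded n]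
  let ?w = "rdim W"
  let ?T = "msum (?w * n) (?w * n) (\<lambda>g. ract W g ** P g) (carrier G)"
  let ?S = "msum (?w * n) (?w * n) (\<lambda>g. ract W (inv g) ** P g) (carrier G)"
  have *: "msum (?w * n) (?w * n) (\<lambda>g. f g ** P g) (carrier G) * msum (?w * n) (?w * n) (\<lambda>g. f' g ** P g) (carrier G)
      = 1\<^sub>m (?w * n)"
    if f: "\<And>g. g \<in> carrier G \<Longrightarrow> f g \<in> carrier_mat ?w ?w" "\<And>g. g \<in> carrier G \<Longrightarrow> f' g \<in> carrier_mat ?w ?w"
      "\<And>g. g \<in> carrier G \<Longrightarrow> f g * f' g = 1\<^sub>m ?w" for f f'
  proof -
    note d = carrier_matD[OF f(1)] carrier_matD[OF f(2)] P'(3,4)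
    let ?F = "msum (?w * n) (?w * n) (\<lambda>g. f' g ** P g) (carrier G)"
    have "msum (?w * n) (?w * n) (\<lambda>g. f g ** P g) (carrier G) * ?F
        = msum (?w * n) (?w * n) (\<lambda>g. (f g ** P g) * ?F) (carrier G)"
      by (subst msum_mult) (use d in \<open>auto intro!: carrier_matI\<close>)
    also have "\<dots> = msum (?w * n) (?w * n) (\<lambda>g. 1\<^sub>m ?w ** P g) (carrier G)"
    proof (rule msum_cong[OF refl])
      fix g
      assume g: "g \<in> carrier G"
      have "(f g ** P g) * ?F = msum (?w * n) (?w * n) (\<lambda>h. (f g ** P g) * (f' h ** P h)) (carrier G)"
        by (subst mult_msum) (use d g in \<open>auto intro!: carrier_matI\<close>)
      also have "\<dots> = (f g ** P g) * (f' g ** P g)"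
        by (rule msum_delta) (use d g P'(5) in \<open>auto intro!: carrier_matI simp: tensor_mat_mult\<close>)
      also have "\<dots> = 1\<^sub>m ?w ** P g"
        using d g f(3) P'(5) by (simp add: tensor_mat_mult)
      finally show "(f g ** P g) * ?F = 1\<^sub>m ?w ** P g" .
    qed
    also have "\<dots> = 1\<^sub>m ?w ** msum n n P (carrier G)"
      by (subst tensor_msum) (use P'(2) in auto)
    finally show ?thesis
      using P'(6) by (simp add: tensor_one_mat)
  qed
  have i: "ract W (inv g) * ract W g = 1\<^sub>m ?w" "ract W g * ract W (inv g) = 1\<^sub>m ?w" if "g \<in> carrier G" for g
    using that r(5)[of g "inv g"] r(5)[of "inv g" g] r(6) by simp_all
  have ST: "?S * ?T = 1\<^sub>m (?w * n)" "?T * ?S = 1\<^sub>m (?w * n)"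
    by (rule *; use r i in auto)+
  show thesis
  proof (rule that[of "swap_mat ?w n * ?S"])
    have "swap_mat ?w n * ?S * hb n P W = swap_mat ?w n * (?S * ?T * swap_mat n ?w)"
      unfolding hb_def by (simp add: mat_mult_assoc)
    then show "swap_mat ?w n * ?S * hb n P W = 1\<^sub>m (n * ?w)"
      using ST by (simp add: swap_mat_swap_mat mult.commute)
    have "hb n P W * (swap_mat ?w n * ?S) = ?T * (swap_mat n ?w * swap_mat ?w n * ?S)"
      unfolding hb_def by (simp add: mat_mult_assoc mult.commute)
    then show "hb n P W * (swap_mat ?w n * ?S) = 1\<^sub>m (?w * n)"
      using ST by (simp add: swap_mat_swap_mat)
  qed auto
qed

subsection \<open>The regular representation\<close>

text \<open>An arbitrary ordering of the group, needed to realise the group algebra on coordinate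
  vectors.\<close>

definition enum :: "nat \<Rightarrow> 'a" where
  "enum = (SOME f. bij_betw f {0..<card (carrier G)} (carrier G))"

lemma enum: "bij_betw enum {0..<card (carrier G)} (carrier G)"
  unfolding enum_def by (rule someI_ex[OF ex_bij_betw_nat_finite[OF finite_carrier]])

definition reg :: "'a rep" where
  "reg = \<lparr>rdim = card (carrier G),
     ract = (\<lambda>g\<in>carrier G. mat (card (carrier G)) (card (carrier G)) (\<lambda>(i, j). if enum i = g \<otimes> enum j then 1 else 0))\<rparr>"

definition delta :: "'a \<Rightarrow> complex mat" where
  "delta g = mat (card (carrier G)) 1 (\<lambda>(i, _). if enum i = g then 1 else 0)"

definition codelta :: "'a \<Rightarrow> complex mat" where
  "codelta g = mat 1 (card (carrier G)) (\<lambda>(_, i). if enum i = g then 1 else 0)"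

lemma dim_delta [simp]: "dim_row (delta g) = card (carrier G)" "dim_col (delta g) = 1"
  "dim_row (codelta g) = 1" "dim_col (codelta g) = card (carrier G)"
  by (simp_all add: delta_def codelta_def)

lemma rdim_reg [simp]: "rdim reg = card (carrier G)"
  by (simp add: reg_def)

lemma mult_delta_index:
  assumes "dim_col A = card (carrier G)" "g \<in> carrier G" "i < dim_row A" "j < card (carrier G)" "enum j = g"
  shows "(A * delta g) $$ (i, 0) = A $$ (i, j)"
proof -
  have "enum k = g \<longleftrightarrow> k = j" if "k < card (carrier G)" for k
    using enum assms(4,5) that by (auto simp: bij_betw_def inj_on_def)
  then have "(\<Sum>k\<in>{0..<card (carrier G)}. A $$ (i, k) * (if enum k = g then 1 else 0))
      = (\<Sum>k\<in>{0..<card (carrier G)}. if k = j then A $$ (i, j) else 0)"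
    by (intro sum.cong) auto
  then show ?thesis
    using assms by (simp add: scalar_prod_def delta_def)
qed

lemma enum_ex: "g \<in> carrier G \<Longrightarrow> \<exists>j<card (carrier G). enum j = g"
  by (metis atLeastLessThan_iff bij_betw_imp_surj_on enum image_iff)

lemma enum_closed [simp]: "j < card (carrier G) \<Longrightarrow> enum j \<in> carrier G"
  using enum by (auto simp: bij_betw_def)

lemma mat_eq_deltaI:
  assumes "dim_row A = dim_row B" "dim_col A = card (carrier G)" "dim_col B = card (carrier G)"
    and "\<And>g. g \<in> carrier G \<Longrightarrow> A * delta g = B * delta g"
  shows "A = B"
proof (rule eq_matI)
  fix i j
  assume "i < dim_row B" "j < dim_col B"
  then show "A $$ (i, j) = B $$ (i, j)"
    using assms mult_delta_index[of A "enum j" i j] mult_delta_index[of B "enum j" i j] by simp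
qed (use assms in auto)

lemma reg_delta:
  assumes "g \<in> carrier G" "h \<in> carrier G"
  shows "ract reg g * delta h = delta (g \<otimes> h)"
proof (rule eq_matI)
  fix i j
  assume "i < dim_row (delta (g \<otimes> h))" "j < dim_col (delta (g \<otimes> h))"
  then have i: "i < card (carrier G)" "j = 0"
    by simp_all
  obtain k where k: "k < card (carrier G)" "enum k = h"
    using enum_ex[OF assms(2)] by blast
  have "(ract reg g * delta h) $$ (i, 0) = ract reg g $$ (i, k)"
    by (rule mult_delta_index) (use assms i k in \<open>auto simp: reg_def\<close>)
  then show "(ract reg g * delta h) $$ (i, j) = delta (g \<otimes> h) $$ (i, j)"
    using i k assms by (simp add: reg_def delta_def)
qed (use assms in \<open>auto simp: reg_def\<close>)

lemma reg_rep: "is_rep G reg"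
  unfolding is_rep_iff[OF group_axioms]
proof (intro conjI ballI)
  have d: "dim_row (ract reg g) = card (carrier G)" "dim_col (ract reg g) = card (carrier G)" if "g \<in> carrier G" for g
    using that by (simp_all add: reg_def)
  show "ract reg \<in> extensional (carrier G)" "\<And>g. g \<in> carrier G \<Longrightarrow> ract reg g \<in> carrier_mat (rdim reg) (rdim reg)"
    by (simp_all add: reg_def)
  show "ract reg (g \<otimes> h) = ract reg g * ract reg h" if "g \<in> carrier G" "h \<in> carrier G" for g h
    by (rule mat_eq_deltaI) (use that d in \<open>auto simp: mat_mult_assoc reg_delta m_assoc\<close>)
  show "ract reg \<one> = 1\<^sub>m (rdim reg)"
    by (rule mat_eq_deltaI) (use d in \<open>auto simp: reg_delta\<close>)
qed

lemma codelta_delta: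
  assumes "g \<in> carrier G" "h \<in> carrier G"
  shows "codelta g * delta h = (if g = h then 1\<^sub>m 1 else 0\<^sub>m 1 1)"
proof (rule eq_matI)
  fix i j
  assume "i < dim_row (if g = h then 1\<^sub>m 1 else 0\<^sub>m 1 1 :: complex mat)"
    "j < dim_col (if g = h then 1\<^sub>m 1 else 0\<^sub>m 1 1 :: complex mat)"
  then have i: "i = 0" "j = 0"
    by (auto split: if_splits)
  obtain k where k: "k < card (carrier G)" "enum k = h"
    using enum_ex[OF assms(2)] by blast
  show "(codelta g * delta h) $$ (i, j) = (if g = h then 1\<^sub>m 1 else 0\<^sub>m 1 1) $$ (i, j)"
    using mult_delta_index[of "codelta g" h 0 k] assms i k by (auto simp: codelta_def)
qed auto

lemma msum_delta_codelta: "msum (card (carrier G)) (card (carrier G)) (\<lambda>g. delta g * codelta g) (carrier G) = 1\<^sub>m (card (carrier G))"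
proof (rule mat_eq_deltaI)
  fix h
  assume h: "h \<in> carrier G"
  have "msum (card (carrier G)) (card (carrier G)) (\<lambda>g. delta g * codelta g) (carrier G) * delta h
      = msum (card (carrier G)) 1 (\<lambda>g. delta g * codelta g * delta h) (carrier G)"
    by (subst msum_mult) (auto intro!: carrier_matI)
  also have "\<dots> = delta h * codelta h * delta h"
    by (rule msum_delta) (use h in \<open>auto intro!: carrier_matI simp: mat_mult_assoc codelta_delta\<close>)
  also have "\<dots> = 1\<^sub>m (card (carrier G)) * delta h"
    using h by (simp add: mat_mult_assoc codelta_delta)
  finally show "msum (card (carrier G)) (card (carrier G)) (\<lambda>g. delta g * codelta g) (carrier G) * delta h = 1\<^sub>m (card (carrier G)) * delta h" .
qed auto

text \<open>The regular representation is free on \<open>delta \<one>\<close>: the column belonging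
  to \<open>g\<close> has to be \<open>ract W g * w\<close>.\<close>

lemma reg_intertwiner:
  assumes W: "is_rep G W" and w: "w \<in> carrier_mat (rdim W) 1"
  obtains f where "f \<in> intertwiners G reg W" "\<And>g. g \<in> carrier G \<Longrightarrow> f * delta g = ract W g * w"
proof -
  note r = is_repD[OF W]
  define f where "f = mat (rdim W) (card (carrier G)) (\<lambda>(i, j). (ract W (enum j) * w) $$ (i, 0))"
  have f: "f * delta g = ract W g * w" if g: "g \<in> carrier G" for g
  proof (rule eq_matI)
    fix i j
    assume "i < dim_row (ract W g * w)" "j < dim_col (ract W g * w)"
    then have i: "i < rdim W" "j = 0"
      using g r w by auto
    obtain k where "k < card (carrier G)" "enum k = g"
      using enum_ex[OF g] by blast
    then show "(f * delta g) $$ (i, j) = (ract W g * w) $$ (i, j)"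
      using mult_delta_index[of f g i k] g i by (simp add: f_def)
  qed (use g r w in \<open>auto simp: f_def\<close>)
  have "f * ract reg g = ract W g * f" if g: "g \<in> carrier G" for g
  proof (rule mat_eq_deltaI)
    fix h
    assume h: "h \<in> carrier G"
    have "f * ract reg g * delta h = f * (ract reg g * delta h)"
      by (rule mat_mult_assoc) (use g is_repD[OF reg_rep] in \<open>auto simp: f_def\<close>)
    also have "\<dots> = ract W g * (ract W h * w)"
      using g h f r w by (simp add: reg_delta mat_mult_assoc)
    also have "\<dots> = ract W g * f * delta h"
      using g h f[OF h] r by (simp add: mat_mult_assoc f_def)
    finally show "f * ract reg g * delta h = ract W g * f * delta h" .
  qed (use g r is_repD[OF reg_rep] in \<open>auto simp: f_def\<close>)
  then have "f \<in> intertwiners G reg W"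
    by (simp add: intertwiners_def f_def)
  then show thesis
    using f that by blast
qed

text \<open>On \<open>v \<otimes> delta \<one>\<close> the half braiding is the sum of all
  \<open>delta g \<otimes> P g v\<close>, from which \<open>codelta k\<close> picks one term. So the
  grading can be read off from a single test object.\<close>

lemma hb_extract:
  assumes P: "\<And>g. g \<in> carrier G \<Longrightarrow> P g \<in> carrier_mat n n" and k: "k \<in> carrier G"
  shows "(codelta k ** 1\<^sub>m n) * (hb n P reg * (1\<^sub>m n ** delta \<one>)) = P k"
proof -
  note d = carrier_matD[OF P]
  have "hb n P reg * (1\<^sub>m n ** delta \<one>) = msum (card (carrier G) * n) n (\<lambda>g. (ract reg g * delta \<one>) ** P g) (carrier G)"
    using hb_col[OF reg_rep P, where w = "delta \<one>"] by (simp add: carrier_matI)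
  also have "\<dots> = msum (card (carrier G) * n) n (\<lambda>g. delta g ** P g) (carrier G)"
    by (rule msum_cong) (auto simp: reg_delta)
  also have "(codelta k ** 1\<^sub>m n) * \<dots> = msum n n (\<lambda>g. (codelta k ** 1\<^sub>m n) * (delta g ** P g)) (carrier G)"
    by (subst mult_msum) (use d in \<open>auto intro!: carrier_matI\<close>)
  also have "\<dots> = (codelta k ** 1\<^sub>m n) * (delta k ** P k)"
    by (rule msum_delta) (use d k in \<open>auto intro!: carrier_matI simp: tensor_mat_mult codelta_delta\<close>)
  also have "\<dots> = P k"
    using d k by (simp add: tensor_mat_mult codelta_delta)
  finally show ?thesis .
qed

end

lemma carrier_mat_iff: "A \<in> carrier_mat n m \<longleftrightarrow> dim_row A = n \<and> dim_col A = m"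
  by (metis carrier_matD carrier_matI)

lemma row_tensor: "dim_row e = 1 \<Longrightarrow> e ** Z = Z * (e ** 1\<^sub>m (dim_col Z))"
  using tensor_mat_mult[of "1\<^sub>m 1" e Z "1\<^sub>m (dim_col Z)"] by simp

lemma col_tensor: "dim_col c = 1 \<Longrightarrow> c ** Z = (c ** 1\<^sub>m (dim_row Z)) * Z"
  using tensor_mat_mult[of c "1\<^sub>m 1" "1\<^sub>m (dim_row Z)" Z] by simp

lemma tensor_col: "dim_col c = 1 \<Longrightarrow> Z ** c = (1\<^sub>m (dim_row Z) ** c) * Z"
  using tensor_mat_mult[of "1\<^sub>m (dim_row Z)" Z c "1\<^sub>m 1"] by simp

section \<open>Half braidings and compatible gradings\<close>

context finite_group
begin

definition half_braiding :: "('a, 'x) rep_scheme \<Rightarrow> ('a rep \<Rightarrow> complex mat) \<Rightarrow> bool" where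
  "half_braiding V \<sigma> \<longleftrightarrow>
     (\<forall>W. is_rep G W \<longrightarrow> \<sigma> W \<in> carrier_mat (rdim W * rdim V) (rdim V * rdim W)) \<and>
     (\<forall>W. is_rep G W \<longrightarrow> (\<forall>g\<in>carrier G. \<sigma> W * (ract V g ** ract W g) = (ract W g ** ract V g) * \<sigma> W)) \<and>
     (\<forall>W W' f. is_rep G W \<longrightarrow> is_rep G W' \<longrightarrow> f \<in> intertwiners G W W' \<longrightarrow>
        (f ** 1\<^sub>m (rdim V)) * \<sigma> W = \<sigma> W' * (1\<^sub>m (rdim V) ** f)) \<and>
     (\<forall>W W'. is_rep G W \<longrightarrow> is_rep G W' \<longrightarrow>
        \<sigma> (teno (Rep G) W W') = (1\<^sub>m (rdim W) ** \<sigma> W') * (\<sigma> W ** 1\<^sub>m (rdim W'))) \<and>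
     \<sigma> (unito (Rep G)) = 1\<^sub>m (rdim V)"

lemma hb_intertwine:
  assumes "is_rep G V" "is_rep G W" "proj_family V P" "n = rdim V" "g \<in> carrier G"
  shows "hb n P W * (ract V g ** ract W g) = (ract W g ** ract V g) * hb n P W"
  using hb_intertwiner[OF assms(1-3), of "\<lparr>rdim = rdim V * rdim W, ract = (\<lambda>g\<in>carrier G. ract V g ** ract W g)\<rparr>"
      "\<lparr>rdim = rdim W * rdim V, ract = (\<lambda>g\<in>carrier G. ract W g ** ract V g)\<rparr>"] assms(4,5)
  by (auto simp: intertwiners_def)

lemma half_braiding_hb:
  assumes V: "is_rep G V" and P: "proj_family V P"
  shows "half_braiding V (hb (rdim V) P)"
  unfolding half_braiding_def
proof (intro conjI allI impI ballI)
  note P' = proj_familyD(2)[OF P]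
  show "hb (rdim V) P W \<in> carrier_mat (rdim W * rdim V) (rdim V * rdim W)" for W :: "'a rep"
    by (intro carrier_matI) auto
  show "hb (rdim V) P W * (ract V g ** ract W g) = (ract W g ** ract V g) * hb (rdim V) P W"
    if "is_rep G W" "g \<in> carrier G" for W :: "'a rep" and g
    by (rule hb_intertwine[OF V that(1) P refl that(2)])
  show "(f ** 1\<^sub>m (rdim V)) * hb (rdim V) P W = hb (rdim V) P W' * (1\<^sub>m (rdim V) ** f)"
    if "is_rep G W" "is_rep G W'" "f \<in> intertwiners G W W'" for W W' :: "'a rep" and f
    by (rule hb_natural[OF that P'])
  show "hb (rdim V) P (teno (Rep G) W W') = (1\<^sub>m (rdim W) ** hb (rdim V) P W') * (hb (rdim V) P W ** 1\<^sub>m (rdim W'))"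
    if "is_rep G W" "is_rep G W'" for W W' :: "'a rep"
    by (rule hb_tensor[OF that P refl]) simp_all
  show "hb (rdim V) P (unito (Rep G)) = 1\<^sub>m (rdim V)"
    by (rule hb_unit[OF P refl]) simp_all
qed

lemma codelta_reg:
  assumes "g \<in> carrier G" "h \<in> carrier G"
  shows "codelta (h \<otimes> g) * ract reg h = codelta g"
proof (rule mat_eq_deltaI)
  fix k
  assume k: "k \<in> carrier G"
  have "codelta (h \<otimes> g) * ract reg h * delta k = codelta (h \<otimes> g) * delta (h \<otimes> k)"
    using is_repD(3,4)[OF reg_rep assms(2)] assms k by (simp add: mat_mult_assoc reg_delta)
  then show "codelta (h \<otimes> g) * ract reg h * delta k = codelta g * delta k"
    using assms k by (simp add: codelta_delta)
qed (use is_repD(3,4)[OF reg_rep assms(2)] in auto)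

text \<open>A half-braiding is determined by its value on the unit element of the regular representation,
  since every vector of a representation is the image of that element under an intertwiner.\<close>

theorem half_braiding_proj_family:
  assumes V: "is_rep G V" and \<sigma>: "half_braiding V \<sigma>"
  obtains P where "proj_family V P" "\<And>W. is_rep G W \<Longrightarrow> \<sigma> W = hb (rdim V) P W"
proof -
  let ?n = "rdim V" and ?N = "card (carrier G)"
  have c: "\<And>W. is_rep G W \<Longrightarrow> \<sigma> W \<in> carrier_mat (rdim W * ?n) (?n * rdim W)"
    and eq: "\<And>W g. is_rep G W \<Longrightarrow> g \<in> carrier G \<Longrightarrow> \<sigma> W * (ract V g ** ract W g) = (ract W g ** ract V g) * \<sigma> W"
    and nat: "\<And>W W' f. is_rep G W \<Longrightarrow> is_rep G W' \<Longrightarrow> f \<in> intertwiners G W W' \<Longrightarrow>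
        (f ** 1\<^sub>m ?n) * \<sigma> W = \<sigma> W' * (1\<^sub>m ?n ** f)"
    and ten: "\<And>W W'. is_rep G W \<Longrightarrow> is_rep G W' \<Longrightarrow>
        \<sigma> (teno (Rep G) W W') = (1\<^sub>m (rdim W) ** \<sigma> W') * (\<sigma> W ** 1\<^sub>m (rdim W'))"
    and unit: "\<sigma> (unito (Rep G)) = 1\<^sub>m ?n"
    using \<sigma> by (auto simp: half_braiding_def)
  note rV = is_repD[OF V]
  have dR: "dim_row (\<sigma> reg) = ?N * ?n" "dim_col (\<sigma> reg) = ?n * ?N"
    using c[OF reg_rep] by auto
  \<comment> \<open>\<open>Y\<close> sends \<open>v\<close> to the half braiding of
    \<open>v \<otimes> delta \<one>\<close>; its coordinates in the basis \<open>delta g\<close> are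
    the candidates for the projections.\<close>
  define Y where "Y = \<sigma> reg * (1\<^sub>m ?n ** delta \<one>)"
  have dY: "dim_row Y = ?N * ?n" "dim_col Y = ?n"
    using dR by (auto simp: Y_def)
  define P where "P = (\<lambda>g\<in>carrier G. (codelta g ** 1\<^sub>m ?n) * Y)"
  have Pg: "P g = (codelta g ** 1\<^sub>m ?n) * Y" if "g \<in> carrier G" for g
    using that by (simp add: P_def)
  have Pc: "P g \<in> carrier_mat ?n ?n" if "g \<in> carrier G" for g
    using that dY by (auto simp: Pg intro!: carrier_matI)
  note dP = carrier_matD[OF Pc]
  have Y: "Y = msum (?N * ?n) ?n (\<lambda>g. delta g ** P g) (carrier G)"
  proof -
    have "delta g ** P g = ((delta g * codelta g) ** 1\<^sub>m ?n) * Y" if g: "g \<in> carrier G" for g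
    proof -
      have "delta g ** P g = (delta g ** 1\<^sub>m ?n) * P g"
        using col_tensor[of "delta g" "P g"] dP g by simp
      then show ?thesis
        unfolding Pg[OF g] using dY by (simp add: mult_tensor_one mat_mult_assoc)
    qed
    then have "msum (?N * ?n) ?n (\<lambda>g. delta g ** P g) (carrier G)
        = msum (?N * ?n) ?n (\<lambda>g. ((delta g * codelta g) ** 1\<^sub>m ?n) * Y) (carrier G)"
      by (intro msum_cong) auto
    also have "\<dots> = msum (?N * ?n) (?N * ?n) (\<lambda>g. (delta g * codelta g) ** 1\<^sub>m ?n) (carrier G) * Y"
      using msum_mult[of "carrier G" "\<lambda>g. (delta g * codelta g) ** 1\<^sub>m ?n" "?N * ?n" "?N * ?n" Y] dY
      by (simp add: carrier_mat_iff del: carrier_matD)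
    also have "msum (?N * ?n) (?N * ?n) (\<lambda>g. (delta g * codelta g) ** 1\<^sub>m ?n) (carrier G) = 1\<^sub>m (?N * ?n)"
      using msum_tensor[of "carrier G" "\<lambda>g. delta g * codelta g" ?N ?N "1\<^sub>m ?n"] msum_delta_codelta
      by (simp add: carrier_mat_iff tensor_one_mat del: carrier_matD)
    finally show ?thesis
      using dY by simp
  qed
  \<comment> \<open>Naturality along the intertwiner with \<open>delta \<one> \<mapsto> w\<close>
    determines the half braiding at every representation.\<close>
  have col: "\<sigma> W * (1\<^sub>m ?n ** w) = msum (rdim W * ?n) ?n (\<lambda>g. (ract W g * w) ** P g) (carrier G)"
    if W: "is_rep G W" and w: "w \<in> carrier_mat (rdim W) 1" for W :: "'a rep" and w
  proof -
    obtain f where f: "f \<in> intertwiners G reg W" "\<And>g. g \<in> carrier G \<Longrightarrow> f * delta g = ract W g * w"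
      using reg_intertwiner[OF W w] by blast
    note f' = intertwinersD[OF f(1)]
    have "\<sigma> W * (1\<^sub>m ?n ** w) = \<sigma> W * (1\<^sub>m ?n ** (f * delta \<one>))"
      using f(2)[of \<one>] is_repD(6)[OF W] w by simp
    also have "\<dots> = (f ** 1\<^sub>m ?n) * Y"
      using nat[OF reg_rep W f(1)] f' dR c[OF W]
      by (simp add: one_tensor_mult Y_def flip: mat_mult_assoc)
    also have "\<dots> = msum (rdim W * ?n) ?n (\<lambda>g. (f ** 1\<^sub>m ?n) * (delta g ** P g)) (carrier G)"
      unfolding Y using mult_msum[of "carrier G" "\<lambda>g. delta g ** P g" "?N * ?n" ?n "f ** 1\<^sub>m ?n"] f'
      by (simp add: dP carrier_mat_iff del: carrier_matD)
    also have "\<dots> = msum (rdim W * ?n) ?n (\<lambda>g. (ract W g * w) ** P g) (carrier G)"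
      using f' dP f(2) by (intro msum_cong) (auto simp: tensor_mat_mult)
    finally show ?thesis .
  qed
  have \<sigma>P: "\<sigma> W = hb ?n P W" if W: "is_rep G W" for W :: "'a rep"
  proof (rule mat_eq_tensor_colI[of _ _ ?n "rdim W"])
    show "\<sigma> W * (1\<^sub>m ?n ** w) = hb ?n P W * (1\<^sub>m ?n ** w)" if "w \<in> carrier_mat (rdim W) 1" for w
      using col[OF W that] hb_col[OF W Pc that] by simp
  qed (use c[OF W] in auto)
  \<comment> \<open>The half braiding at the trivial representation is the identity, and there the
    formula reduces to the sum of all projections.\<close>
  have one: "msum ?n ?n P (carrier G) = 1\<^sub>m ?n"
  proof -
    have "is_rep G (unito (Rep G))"
      by (simp add: unit_rep)
    then have "1\<^sub>m ?n = \<sigma> (unito (Rep G)) * (1\<^sub>m ?n ** 1\<^sub>m 1)"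
      using unit by simp
    also have "\<dots> = msum (1 * ?n) ?n (\<lambda>g. (ract (unito (Rep G)) g * 1\<^sub>m 1) ** P g) (carrier G)"
      using col[OF \<open>is_rep G (unito (Rep G))\<close>, of "1\<^sub>m 1"] by simp
    also have "\<dots> = msum ?n ?n P (carrier G)"
      unfolding mult_1 by (rule msum_cong) auto
    finally show ?thesis ..
  qed
  \<comment> \<open>The half braiding at \<open>reg \<otimes> reg\<close> is evaluated on
    \<open>delta \<one> \<otimes> delta \<one>\<close> in two ways: by \<open>col\<close>, which
    yields only diagonal terms \<open>delta g \<otimes> delta g\<close>, and by the tensor
    condition, which yields \<open>P l * P k\<close>.\<close>
  have orth: "P l * P k = (if l = k then P l else 0\<^sub>m ?n ?n)" if k: "k \<in> carrier G" and l: "l \<in> carrier G" for k l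
  proof -
    let ?RR = "teno (Rep G) reg reg"
    have RR: "is_rep G ?RR"
      using tensor_rep[OF reg_rep reg_rep, of ?RR] by simp
    have "\<sigma> ?RR * (1\<^sub>m ?n ** (delta \<one> ** delta \<one>))
        = msum (rdim ?RR * ?n) ?n (\<lambda>g. (ract ?RR g * (delta \<one> ** delta \<one>)) ** P g) (carrier G)"
      by (rule col[OF RR]) (auto intro!: carrier_matI)
    also have "\<dots> = msum (?N * ?N * ?n) ?n (\<lambda>g. delta g ** delta g ** P g) (carrier G)"
      unfolding Rep_sel rep.simps rdim_reg using is_repD(3,4)[OF reg_rep]
      by (intro msum_cong) (auto simp: tensor_mat_mult reg_delta tensor_mat_assoc)
    finally have "(codelta k ** codelta l ** 1\<^sub>m ?n) * (\<sigma> ?RR * (1\<^sub>m ?n ** (delta \<one> ** delta \<one>)))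
        = msum ?n ?n (\<lambda>g. (codelta k ** codelta l ** 1\<^sub>m ?n) * (delta g ** delta g ** P g)) (carrier G)"
      using mult_msum[of "carrier G" "\<lambda>g. delta g ** delta g ** P g" "?N * ?N * ?n" ?n "codelta k ** codelta l ** 1\<^sub>m ?n"]
        by (simp add: dP carrier_mat_iff del: carrier_matD add: tensor_mat_assoc mult.assoc)
    also have "\<dots> = (codelta k ** codelta l ** 1\<^sub>m ?n) * (delta k ** delta k ** P k)"
      by (rule msum_delta) (use k l dP in \<open>auto intro!: carrier_matI simp: tensor_mat_mult codelta_delta\<close>)
    also have "\<dots> = (if l = k then P l else 0\<^sub>m ?n ?n)"
      using k l dP by (simp add: tensor_mat_mult codelta_delta)
    finally have L: "(codelta k ** codelta l ** 1\<^sub>m ?n) * (\<sigma> ?RR * (1\<^sub>m ?n ** (delta \<one> ** delta \<one>)))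
        = (if l = k then P l else 0\<^sub>m ?n ?n)" .
    let ?Z = "(codelta l ** 1\<^sub>m ?n) * \<sigma> reg"
    have dZ: "dim_row ?Z = ?n" "dim_col ?Z = ?n * ?N"
      using dR by auto
    have "\<sigma> ?RR * (1\<^sub>m ?n ** (delta \<one> ** delta \<one>))
        = (1\<^sub>m ?N ** \<sigma> reg) * ((\<sigma> reg ** 1\<^sub>m ?N) * ((1\<^sub>m ?n ** delta \<one>) ** delta \<one>))"
      unfolding ten[OF reg_rep reg_rep] using dR by (simp add: mat_mult_assoc tensor_mat_assoc mult_ac)
    also have "\<dots> = (1\<^sub>m ?N ** \<sigma> reg) * (Y ** delta \<one>)"
      using dR by (simp add: tensor_mat_mult Y_def)
    also have "(codelta k ** codelta l ** 1\<^sub>m ?n) * \<dots> = (codelta k ** ?Z) * (Y ** delta \<one>)"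
      using dR dY by (simp add: tensor_mat_mult flip: mat_mult_assoc)
    also have "codelta k ** ?Z = ?Z * ((codelta k ** 1\<^sub>m ?n) ** 1\<^sub>m ?N)"
      using row_tensor[of "codelta k" ?Z] dZ by (simp add: tensor_mat_assoc tensor_one_mat)
    also have "\<dots> * (Y ** delta \<one>) = ?Z * (P k ** delta \<one>)"
      using dZ dY k by (simp add: mat_mult_assoc tensor_mat_mult Pg)
    also have "P k ** delta \<one> = (1\<^sub>m ?n ** delta \<one>) * P k"
      using tensor_col[of "delta \<one>" "P k"] dP k by simp
    also have "?Z * \<dots> = P l * P k"
      unfolding Pg[OF l] Y_def using dR dP k by (simp add: mat_mult_assoc)
    finally show ?thesis
      using L by simp
  qed
  \<comment> \<open>Equivariance at \<open>v \<otimes> delta \<one>\<close> produces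
    \<open>delta h\<close> on the other side, hence the shifted terms
    \<open>delta (x \<otimes> h) \<otimes> P x\<close>; the coordinate at
    \<open>h \<otimes> g\<close> isolates the conjugate
    \<open>x = h \<otimes> g \<otimes> inv h\<close>.\<close>
  have equiv: "ract V h * P g = P (h \<otimes> g \<otimes> inv h) * ract V h" if g: "g \<in> carrier G" and h: "h \<in> carrier G" for g h
  proof -
    note R = is_repD(3,4)[OF reg_rep]
    have "(ract reg h ** ract V h) * Y = \<sigma> reg * ((ract V h ** ract reg h) * (1\<^sub>m ?n ** delta \<one>))"
      unfolding Y_def using eq[OF reg_rep h] R rV h dR by (simp flip: mat_mult_assoc)
    also have "\<dots> = \<sigma> reg * (1\<^sub>m ?n ** delta h) * ract V h"
      using R rV h dR tensor_col[of "delta h" "ract V h"] by (simp add: tensor_mat_mult reg_delta mat_mult_assoc)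
    also have "\<sigma> reg * (1\<^sub>m ?n ** delta h) = msum (?N * ?n) ?n (\<lambda>x. (ract reg x * delta h) ** P x) (carrier G)"
      using col[OF reg_rep, of "delta h"] by (simp add: carrier_mat_iff del: carrier_matD)
    also have "\<dots> = msum (?N * ?n) ?n (\<lambda>x. delta (x \<otimes> h) ** P x) (carrier G)"
      using h by (intro msum_cong) (auto simp: reg_delta)
    finally have *: "(ract reg h ** ract V h) * Y = msum (?N * ?n) ?n (\<lambda>x. delta (x \<otimes> h) ** P x) (carrier G) * ract V h" .
    have "(codelta (h \<otimes> g) ** 1\<^sub>m ?n) * ((ract reg h ** ract V h) * Y)
        = (codelta (h \<otimes> g) ** 1\<^sub>m ?n) * msum (?N * ?n) ?n (\<lambda>x. delta (x \<otimes> h) ** P x) (carrier G) * ract V h"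
      unfolding * using rV h by (simp add: mat_mult_assoc)
    also have "(codelta (h \<otimes> g) ** 1\<^sub>m ?n) * msum (?N * ?n) ?n (\<lambda>x. delta (x \<otimes> h) ** P x) (carrier G)
        = msum ?n ?n (\<lambda>x. (codelta (h \<otimes> g) ** 1\<^sub>m ?n) * (delta (x \<otimes> h) ** P x)) (carrier G)"
      using mult_msum[of "carrier G" "\<lambda>x. delta (x \<otimes> h) ** P x" "?N * ?n" ?n "codelta (h \<otimes> g) ** 1\<^sub>m ?n"]
        by (simp add: dP carrier_mat_iff del: carrier_matD)
    also have "\<dots> = (codelta (h \<otimes> g) ** 1\<^sub>m ?n) * (delta (h \<otimes> g \<otimes> inv h \<otimes> h) ** P (h \<otimes> g \<otimes> inv h))"
    proof (rule msum_delta)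
      fix x
      assume x: "x \<in> carrier G" "x \<noteq> h \<otimes> g \<otimes> inv h"
      have "x = h \<otimes> g \<otimes> inv h" if "h \<otimes> g = x \<otimes> h"
        using that g h x(1) by (simp add: m_assoc)
      then have "h \<otimes> g \<noteq> x \<otimes> h"
        using x by blast
      then show "(codelta (h \<otimes> g) ** 1\<^sub>m ?n) * (delta (x \<otimes> h) ** P x) = 0\<^sub>m ?n ?n"
        using x g h dP by (simp add: tensor_mat_mult codelta_delta)
    qed (use g h dP in \<open>auto intro!: carrier_matI\<close>)
    also have "\<dots> = P (h \<otimes> g \<otimes> inv h)"
      using g h dP by (simp add: tensor_mat_mult codelta_delta m_assoc)
    also have "(codelta (h \<otimes> g) ** 1\<^sub>m ?n) * ((ract reg h ** ract V h) * Y)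
        = (codelta g ** ract V h) * Y"
      using g h dY R rV codelta_reg[OF g h] by (simp add: tensor_mat_mult flip: mat_mult_assoc)
    also have "\<dots> = ract V h * P g"
      using row_tensor[of "codelta g" "ract V h"] g h dY rV by (simp add: Pg mat_mult_assoc)
    finally show ?thesis .
  qed
  have "proj_family V P"
    unfolding proj_family_def using Pc orth one equiv by (simp add: P_def)
  then show thesis
    using that \<sigma>P by blast
qed

text \<open>The regular representation alone suffices as a test object, because
  \<open>hb_extract\<close> recovers every projection from it.\<close>

lemma hb_mor_reflect:
  assumes A: "A \<in> carrier_mat m n" and P: "\<And>g. g \<in> carrier G \<Longrightarrow> P g \<in> carrier_mat n n"
    and Q: "\<And>g. g \<in> carrier G \<Longrightarrow> Q g \<in> carrier_mat m m"
    and e: "(1\<^sub>m (card (carrier G)) ** A) * hb n P reg = hb m Q reg * (A ** 1\<^sub>m (card (carrier G)))"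
    and g: "g \<in> carrier G"
  shows "A * P g = Q g * A"
proof -
  let ?N = "card (carrier G)"
  have dA: "dim_row A = m" "dim_col A = n"
    using A by auto
  have "A * P g = A * (codelta g ** 1\<^sub>m n) * (hb n P reg * (1\<^sub>m n ** delta \<one>))"
    using hb_extract[where P = P and n = n and k = g, OF P g] dA by (simp add: mat_mult_assoc)
  also have "A * (codelta g ** 1\<^sub>m n) = (codelta g ** 1\<^sub>m m) * (1\<^sub>m ?N ** A)"
    using row_tensor[of "codelta g" A] dA by (simp add: tensor_mat_mult)
  also have "\<dots> * (hb n P reg * (1\<^sub>m n ** delta \<one>))
      = (codelta g ** 1\<^sub>m m) * ((1\<^sub>m ?N ** A) * hb n P reg * (1\<^sub>m n ** delta \<one>))"
    using dA by (simp add: mat_mult_assoc)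
  also have "\<dots> = (codelta g ** 1\<^sub>m m) * (hb m Q reg * ((A ** 1\<^sub>m ?N) * (1\<^sub>m n ** delta \<one>)))"
    unfolding e using dA by (simp add: mat_mult_assoc)
  also have "(A ** 1\<^sub>m ?N) * (1\<^sub>m n ** delta \<one>) = (1\<^sub>m m ** delta \<one>) * A"
    using tensor_col[of "delta \<one>" A] dA by (simp add: tensor_mat_mult)
  also have "(codelta g ** 1\<^sub>m m) * (hb m Q reg * ((1\<^sub>m m ** delta \<one>) * A))
      = (codelta g ** 1\<^sub>m m) * (hb m Q reg * (1\<^sub>m m ** delta \<one>)) * A"
    using dA by (simp add: mat_mult_assoc)
  finally show ?thesis
    using hb_extract[where P = Q and n = m and k = g, OF Q g] by simp
qed

lemma hb_inj:
  assumes "\<And>g. g \<in> carrier G \<Longrightarrow> P g \<in> carrier_mat n n" "\<And>g. g \<in> carrier G \<Longrightarrow> Q g \<in> carrier_mat n n"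
    and "hb n P reg = hb n Q reg" "P \<in> extensional (carrier G)" "Q \<in> extensional (carrier G)"
  shows "P = Q"
proof (rule extensionalityI[OF assms(4,5)])
  show "P g = Q g" if "g \<in> carrier G" for g
    using hb_extract[where P = P and n = n and k = g, OF assms(1) that]
      hb_extract[where P = Q and n = n and k = g, OF assms(2) that] assms(3) by simp
qed

text \<open>On the image of \<open>P k\<close> orthogonality leaves one term of the sum, in which
  \<open>k\<close> acts on \<open>w\<close>.\<close>

lemma hb_proj:
  assumes W: "is_rep G W" and P: "proj_family V P" and n: "n = rdim V" and k: "k \<in> carrier G"
    and w: "w \<in> carrier_mat (rdim W) 1"
  shows "hb n P W * (P k ** w) = (ract W k * w) ** P k"
proof -
  note P' = proj_familyD[OF P, folded n] and r = is_repD[OF W]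
  have "hb n P W * (P k ** w) = hb n P W * (1\<^sub>m n ** w) * P k"
    using tensor_col[of w "P k"] P'(3,4) k w by (simp add: mat_mult_assoc)
  also have "\<dots> = msum (rdim W * n) n (\<lambda>g. (ract W g * w) ** P g) (carrier G) * P k"
    using hb_col[OF W P'(2) w] by simp
  also have "\<dots> = msum (rdim W * n) n (\<lambda>g. ((ract W g * w) ** P g) * P k) (carrier G)"
    using msum_mult[of "carrier G" "\<lambda>g. (ract W g * w) ** P g" "rdim W * n" n "P k"]
      tensor_mat_carrier[OF mult_carrier_mat[OF r(2) w] P'(2)] P'(3,4) k by simp
  also have "\<dots> = msum (rdim W * n) n (\<lambda>g. (ract W g * w) ** (P g * P k)) (carrier G)"
  proof (rule msum_cong[OF refl])
    show "((ract W g * w) ** P g) * P k = (ract W g * w) ** (P g * P k)" if "g \<in> carrier G" for g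
      using tensor_mat_mult[of "ract W g * w" "1\<^sub>m 1" "P g" "P k"] that k w P'(3,4) by simp
  qed
  also have "\<dots> = (ract W k * w) ** (P k * P k)"
    by (rule msum_delta) (use k w P' r in \<open>auto intro!: carrier_matI\<close>)
  finally show ?thesis
    using P'(5) k by simp
qed

text \<open>The composite of the two half braidings is again a half braiding, now on the tensor
  product, so it comes from a grading by \<open>half_braiding_proj_family\<close>. The convolution
  formula for its projections is derived from this afterwards.\<close>

lemma tensor_proj_family:
  assumes V: "is_rep G V" and W: "is_rep G W" and P: "proj_family V P" and Q: "proj_family W Q"
    and U: "rdim U = rdim V * rdim W" "ract U = (\<lambda>g\<in>carrier G. ract V g ** ract W g)"
  obtains R where "proj_family U R"
    "\<And>X :: 'a rep. is_rep G X \<Longrightarrow>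
      hb (rdim U) R X = (hb (rdim V) P X ** 1\<^sub>m (rdim W)) * (1\<^sub>m (rdim V) ** hb (rdim W) Q X)"
proof -
  let ?n = "rdim V" and ?m = "rdim W"
  define \<sigma> where "\<sigma> = (\<lambda>X :: 'a rep. (hb ?n P X ** 1\<^sub>m ?m) * (1\<^sub>m ?n ** hb ?m Q X))"
  note r = is_repD(3,4)[OF V] is_repD(3,4)[OF W]
  have "half_braiding U \<sigma>"
    unfolding half_braiding_def
  proof (intro conjI allI impI ballI)
    fix X :: "'a rep"
    assume X: "is_rep G X"
    show "\<sigma> X \<in> carrier_mat (rdim X * rdim U) (rdim U * rdim X)"
      by (intro carrier_matI) (simp_all add: \<sigma>_def U)
    fix g
    assume g: "g \<in> carrier G"
    note rX = is_repD(3,4)[OF X]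
    have "\<sigma> X * (ract U g ** ract X g)
        = (hb ?n P X ** 1\<^sub>m ?m) * ((1\<^sub>m ?n ** hb ?m Q X) * (ract V g ** (ract W g ** ract X g)))"
      using g r rX by (simp add: \<sigma>_def U mat_mult_assoc tensor_mat_assoc mult_ac)
    also have "(1\<^sub>m ?n ** hb ?m Q X) * (ract V g ** (ract W g ** ract X g)) = ract V g ** ((ract X g ** ract W g) * hb ?m Q X)"
      using g r rX hb_intertwine[OF W X Q refl g] by (subst tensor_mat_mult) auto
    also have "\<dots> = ((ract V g ** ract X g) ** ract W g) * (1\<^sub>m ?n ** hb ?m Q X)"
      using g r rX by (simp add: tensor_mat_mult tensor_mat_assoc)
    also have "(hb ?n P X ** 1\<^sub>m ?m) * \<dots> = (hb ?n P X ** 1\<^sub>m ?m) * ((ract V g ** ract X g) ** ract W g) * (1\<^sub>m ?n ** hb ?m Q X)"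
      using g r rX by (simp add: mat_mult_assoc mult_ac)
    also have "(hb ?n P X ** 1\<^sub>m ?m) * ((ract V g ** ract X g) ** ract W g) = ((ract X g ** ract V g) * hb ?n P X) ** ract W g"
      using g r rX hb_intertwine[OF V X P refl g] by (subst tensor_mat_mult) auto
    also have "\<dots> = ((ract X g ** ract V g) ** ract W g) * (hb ?n P X ** 1\<^sub>m ?m)"
      using g r rX by (subst tensor_mat_mult) auto
    also have "\<dots> * (1\<^sub>m ?n ** hb ?m Q X) = (ract X g ** ract U g) * \<sigma> X"
      using g r rX by (simp add: \<sigma>_def U mat_mult_assoc tensor_mat_assoc mult_ac)
    finally show "\<sigma> X * (ract U g ** ract X g) = (ract X g ** ract U g) * \<sigma> X" .
  next
    fix X X' :: "'a rep" and f
    assume X: "is_rep G X" "is_rep G X'" and f: "f \<in> intertwiners G X X'"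
    note f' = intertwinersD(2,3)[OF f]
    have "(f ** 1\<^sub>m (rdim U)) * \<sigma> X = (((f ** 1\<^sub>m ?n) * hb ?n P X) ** 1\<^sub>m ?m) * (1\<^sub>m ?n ** hb ?m Q X)"
      using f' by (simp add: \<sigma>_def U mult_tensor_one mat_mult_assoc tensor_mat_assoc tensor_one_mat mult_ac)
    also have "\<dots> = (hb ?n P X' ** 1\<^sub>m ?m) * (1\<^sub>m ?n ** ((f ** 1\<^sub>m ?m) * hb ?m Q X))"
      using f' hb_natural[OF X f proj_familyD(2)[OF P]]
      by (simp add: mult_tensor_one one_tensor_mult mat_mult_assoc tensor_mat_assoc mult_ac)
    also have "\<dots> = \<sigma> X' * (1\<^sub>m (rdim U) ** f)"
      using f' hb_natural[OF X f proj_familyD(2)[OF Q]]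
      by (simp add: \<sigma>_def U one_tensor_mult mat_mult_assoc tensor_mat_assoc mult_ac flip: tensor_one_mat)
    finally show "(f ** 1\<^sub>m (rdim U)) * \<sigma> X = \<sigma> X' * (1\<^sub>m (rdim U) ** f)" .
  next
    fix X X' :: "'a rep"
    assume X: "is_rep G X" "is_rep G X'"
    let ?x = "rdim X" and ?y = "rdim X'" and ?XX = "teno (Rep G) X X'"
    have 1: "hb ?n P ?XX = (1\<^sub>m ?x ** hb ?n P X') * (hb ?n P X ** 1\<^sub>m ?y)"
      "hb ?m Q ?XX = (1\<^sub>m ?x ** hb ?m Q X') * (hb ?m Q X ** 1\<^sub>m ?y)"
      by (rule hb_tensor[OF X P refl] hb_tensor[OF X Q refl]; simp)+
    have "(1\<^sub>m ?x ** \<sigma> X') * (\<sigma> X ** 1\<^sub>m ?y)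
        = ((1\<^sub>m ?x ** hb ?n P X') ** 1\<^sub>m ?m) * (((1\<^sub>m ?x ** 1\<^sub>m ?n) ** hb ?m Q X') * (hb ?n P X ** 1\<^sub>m ?m ** 1\<^sub>m ?y) * (1\<^sub>m ?n ** (hb ?m Q X ** 1\<^sub>m ?y)))"
      by (simp add: \<sigma>_def one_tensor_mult mult_tensor_one mat_mult_assoc tensor_mat_assoc mult.assoc)
    \<comment> \<open>For the tensor condition, the half braiding of \<open>V\<close> with
      \<open>X\<close> and that of \<open>W\<close> with \<open>X'\<close> act on disjoint strands
      and change places.\<close>
    also have "((1\<^sub>m ?x ** 1\<^sub>m ?n) ** hb ?m Q X') * (hb ?n P X ** 1\<^sub>m ?m ** 1\<^sub>m ?y)
        = ((hb ?n P X ** 1\<^sub>m ?y) ** 1\<^sub>m ?m) * (1\<^sub>m ?n ** (1\<^sub>m ?x ** hb ?m Q X'))"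
    proof -
      have "(1\<^sub>m (?x * ?n) ** hb ?m Q X') * (hb ?n P X ** 1\<^sub>m (?m * ?y)) = hb ?n P X ** hb ?m Q X'"
        by (subst tensor_mat_mult) auto
      moreover have "(hb ?n P X ** 1\<^sub>m (?y * ?m)) * (1\<^sub>m (?n * ?x) ** hb ?m Q X') = hb ?n P X ** hb ?m Q X'"
        by (subst tensor_mat_mult) auto
      ultimately show ?thesis
        unfolding tensor_mat_assoc[of "hb ?n P X"] tensor_mat_assoc[of "1\<^sub>m ?n" "1\<^sub>m ?x", symmetric] tensor_one_mat
        by simp
    qed
    also have "((1\<^sub>m ?x ** hb ?n P X') ** 1\<^sub>m ?m) * (((hb ?n P X ** 1\<^sub>m ?y) ** 1\<^sub>m ?m) * (1\<^sub>m ?n ** (1\<^sub>m ?x ** hb ?m Q X'))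
          * (1\<^sub>m ?n ** (hb ?m Q X ** 1\<^sub>m ?y))) = \<sigma> ?XX"
      unfolding \<sigma>_def 1 by (simp add: one_tensor_mult mult_tensor_one mat_mult_assoc mult_ac)
    finally show "\<sigma> ?XX = (1\<^sub>m ?x ** \<sigma> X') * (\<sigma> X ** 1\<^sub>m ?y)" ..
  next
    show "\<sigma> (unito (Rep G)) = 1\<^sub>m (rdim U)"
      using hb_unit[OF P refl, of "unito (Rep G)"] hb_unit[OF Q refl, of "unito (Rep G)"]
      by (simp add: \<sigma>_def U tensor_one_mat)
  qed
  then obtain R where "proj_family U R" "\<And>X. is_rep G X \<Longrightarrow> \<sigma> X = hb (rdim U) R X"
    using half_braiding_proj_family[OF tensor_rep[OF V W U]] by blast
  then show thesis
    using that by (simp add: \<sigma>_def)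
qed

text \<open>On components of degrees \<open>h\<close> and \<open>k\<close> the two half braidings
  turn \<open>delta \<one>\<close> into \<open>delta (h \<otimes> k)\<close>, and
  \<open>codelta g\<close> tests whether this is \<open>delta g\<close>.\<close>

lemma tensor_proj_pair:
  assumes V: "is_rep G V" and W: "is_rep G W" and P: "proj_family V P" and Q: "proj_family W Q"
    and R: "\<And>g. g \<in> carrier G \<Longrightarrow> R g \<in> carrier_mat (rdim V * rdim W) (rdim V * rdim W)"
    and hbR: "hb (rdim V * rdim W) R reg = (hb (rdim V) P reg ** 1\<^sub>m (rdim W)) * (1\<^sub>m (rdim V) ** hb (rdim W) Q reg)"
    and g: "g \<in> carrier G" "h \<in> carrier G" "k \<in> carrier G"
  shows "R g * (P h ** Q k) = (if g = h \<otimes> k then P h ** Q k else 0\<^sub>m (rdim V * rdim W) (rdim V * rdim W))"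
proof -
  let ?n = "rdim V" and ?m = "rdim W" and ?N = "card (carrier G)"
  note P' = proj_familyD(3,4)[OF P] and Q' = proj_familyD(3,4)[OF Q]
  have dc: "delta x \<in> carrier_mat (rdim reg) 1" for x
    by (simp add: carrier_mat_iff del: carrier_matD)
  have "R g * (P h ** Q k) = (codelta g ** 1\<^sub>m (?n * ?m)) * (hb (?n * ?m) R reg * ((1\<^sub>m (?n * ?m) ** delta \<one>) * (P h ** Q k)))"
    using hb_extract[where P = R and n = "?n * ?m" and k = g, OF R g(1)] P' Q' g by (simp add: mat_mult_assoc flip: mat_mult_assoc)
  also have "(1\<^sub>m (?n * ?m) ** delta \<one>) * (P h ** Q k) = P h ** (Q k ** delta \<one>)"
    using tensor_col[of "delta \<one>" "P h ** Q k"] P' Q' g by (simp add: tensor_mat_assoc)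
  also have "hb (?n * ?m) R reg * \<dots> = (hb ?n P reg ** 1\<^sub>m ?m) * ((1\<^sub>m ?n ** hb ?m Q reg) * (P h ** (Q k ** delta \<one>)))"
    unfolding hbR using P' Q' g by (simp add: mat_mult_assoc mult_ac)
  also have "(1\<^sub>m ?n ** hb ?m Q reg) * (P h ** (Q k ** delta \<one>)) = P h ** (delta k ** Q k)"
    using hb_proj[OF reg_rep Q refl g(3) dc] P' Q' g by (subst tensor_mat_mult) (auto simp: reg_delta)
  also have "(hb ?n P reg ** 1\<^sub>m ?m) * \<dots> = (delta (h \<otimes> k) ** P h) ** Q k"
    using hb_proj[OF reg_rep P refl g(2) dc] P' Q' g
    by (subst tensor_mat_assoc[symmetric], subst tensor_mat_mult) (auto simp: reg_delta)
  also have "(codelta g ** 1\<^sub>m (?n * ?m)) * \<dots> = (codelta g * delta (h \<otimes> k)) ** (P h ** Q k)"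
    unfolding tensor_mat_assoc by (subst tensor_mat_mult) (use P' Q' g in auto)
  finally show ?thesis
    using g P' Q' by (simp add: codelta_delta)
qed

end

lemma col_tensor_mat:
  assumes "j < dim_col A * dim_col B"
  shows "col (A ** B) j = tensor_vec (col A (j div dim_col B)) (col B (j mod dim_col B))"
  by (rule eq_vecI)
    (use assms in \<open>auto simp: tensor_vec_def index_tensor_mat div_less_of_mult mod_less_of_mult\<close>)

lemma col_msum_in_subspace:
  assumes W: "subspace class_ring W (module_vec TYPE(complex) n)" and I: "finite I"
    and f: "\<And>k. k \<in> I \<Longrightarrow> f k \<in> carrier_mat n m" "\<And>k. k \<in> I \<Longrightarrow> col (f k) j \<in> W" and j: "j < m"
  shows "col (msum n m f I) j \<in> W"
proof -
  note W' = W[unfolded subspace_vec_iff]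
  show ?thesis
    using I f
  proof (induction I rule: finite_induct)
    case empty
    have "col (msum n m f {}) j = 0\<^sub>v n"
      using j by (intro eq_vecI) (auto simp: index_msum)
    then show ?case
      using W' by simp
  next
    case (insert a I)
    have "col (msum n m f (insert a I)) j = col (f a) j + col (msum n m f I) j"
      using j insert.hyps insert.prems(1)[of a] by (intro eq_vecI) (auto simp: index_msum)
    then show ?case
      using W' insert by simp
  qed
qed

section \<open>The tensor structure on graded representations\<close>

context finite_group
begin

text \<open>The forgetful functor on objects: half braidings are tested on plain representations,
  while their carriers have gradings.\<close>

definition trunc :: "('a, 'x) rep_scheme \<Rightarrow> 'a rep" where
  "trunc V = \<lparr>rdim = rdim V, ract = ract V\<rparr>"

lemma trunc_sel [simp]: "rdim (trunc V) = rdim V" "ract (trunc V) = ract V"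
  by (simp_all add: trunc_def)

lemma is_rep_trunc [simp]: "is_rep G (trunc V) \<longleftrightarrow> is_rep G V"
  by (simp add: is_rep_iff[OF group_axioms])

lemma hb_trunc [simp]: "hb n P (trunc V) = hb n P V"
  by (rule hb_cong) simp_all

lemma intertwiners_trunc [simp]: "intertwiners G (trunc V) (trunc W) = intertwiners G V W"
  by (simp add: intertwiners_def)

lemma proj_family_trunc [simp]: "proj_family (trunc V) P \<longleftrightarrow> proj_family V P"
  by (simp add: proj_family_def)

text \<open>The identity is the sum of all \<open>P h ** Q k\<close>, and \<open>R g\<close> keeps
  exactly the terms with \<open>h \<otimes> k = g\<close>.\<close>

lemma tensor_proj_sum:
  assumes V: "is_rep G V" and W: "is_rep G W" and P: "proj_family V P" and Q: "proj_family W Q"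
    and R: "\<And>g. g \<in> carrier G \<Longrightarrow> R g \<in> carrier_mat (rdim V * rdim W) (rdim V * rdim W)"
    and hbR: "hb (rdim V * rdim W) R reg = (hb (rdim V) P reg ** 1\<^sub>m (rdim W)) * (1\<^sub>m (rdim V) ** hb (rdim W) Q reg)"
    and g: "g \<in> carrier G"
  shows "R g = msum (rdim V * rdim W) (rdim V * rdim W) (\<lambda>h. msum (rdim V * rdim W) (rdim V * rdim W)
    (\<lambda>k. if g = h \<otimes> k then P h ** Q k else 0\<^sub>m (rdim V * rdim W) (rdim V * rdim W)) (carrier G)) (carrier G)"
proof -
  let ?n = "rdim V" and ?m = "rdim W"
  note P' = proj_familyD[OF P] and Q' = proj_familyD[OF Q] and dR = carrier_matD[OF R]
  have "1\<^sub>m (?n * ?m) = msum ?n ?n P (carrier G) ** 1\<^sub>m ?m"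
    using P'(6) by (simp add: tensor_one_mat)
  also have "\<dots> = msum (?n * ?m) (?n * ?m) (\<lambda>h. P h ** 1\<^sub>m ?m) (carrier G)"
    using msum_tensor[of "carrier G" P ?n ?n "1\<^sub>m ?m"] P'(2) by simp
  also have "\<dots> = msum (?n * ?m) (?n * ?m) (\<lambda>h. msum (?n * ?m) (?n * ?m) (\<lambda>k. P h ** Q k) (carrier G)) (carrier G)"
  proof (rule msum_cong[OF refl])
    show "P h ** 1\<^sub>m ?m = msum (?n * ?m) (?n * ?m) (\<lambda>k. P h ** Q k) (carrier G)" if "h \<in> carrier G" for h
      using tensor_msum[of "carrier G" Q ?m ?m "P h"] Q'(2,6) P'(3,4)[OF that] by simp
  qed
  finally have one: "1\<^sub>m (?n * ?m) = msum (?n * ?m) (?n * ?m) (\<lambda>h. msum (?n * ?m) (?n * ?m) (\<lambda>k. P h ** Q k) (carrier G)) (carrier G)" .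
  have "R g = R g * 1\<^sub>m (?n * ?m)"
    using dR g by simp
  also have "\<dots> = msum (?n * ?m) (?n * ?m) (\<lambda>h. R g * msum (?n * ?m) (?n * ?m) (\<lambda>k. P h ** Q k) (carrier G)) (carrier G)"
    unfolding one by (subst mult_msum) (use dR g in auto)
  also have "\<dots> = msum (?n * ?m) (?n * ?m) (\<lambda>h. msum (?n * ?m) (?n * ?m) (\<lambda>k. R g * (P h ** Q k)) (carrier G)) (carrier G)"
  proof (rule msum_cong[OF refl])
    show "R g * msum (?n * ?m) (?n * ?m) (\<lambda>k. P h ** Q k) (carrier G) = msum (?n * ?m) (?n * ?m) (\<lambda>k. R g * (P h ** Q k)) (carrier G)"
      if h: "h \<in> carrier G" for h
      using mult_msum[of "carrier G" "\<lambda>k. P h ** Q k" "?n * ?m" "?n * ?m" "R g"]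
        tensor_mat_carrier[OF P'(2)[OF h] Q'(2)] dR g by simp
  qed
  also have "\<dots> = msum (?n * ?m) (?n * ?m) (\<lambda>h. msum (?n * ?m) (?n * ?m)
    (\<lambda>k. if g = h \<otimes> k then P h ** Q k else 0\<^sub>m (?n * ?m) (?n * ?m)) (carrier G)) (carrier G)"
    by (intro msum_cong refl tensor_proj_pair[OF V W P Q R hbR g])
  finally show ?thesis .
qed

text \<open>Pure tensors of degrees \<open>h\<close> and \<open>k\<close> with product
  \<open>g\<close> are fixed by \<open>R g\<close>. Conversely, the image of \<open>R g\<close> is
  spanned by its columns, and by \<open>tensor_proj_sum\<close> these are sums of pure tensors of
  columns of the projections.\<close>

lemma tensor_grading_eq:
  assumes V: "is_graded_rep G V" and W: "is_graded_rep G W"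
    and R: "\<And>g. g \<in> carrier G \<Longrightarrow> R g \<in> carrier_mat (rdim V * rdim W) (rdim V * rdim W)"
    and hbR: "hb (rdim V * rdim W) R reg = (hb (rdim V) (proj V) reg ** 1\<^sub>m (rdim W)) * (1\<^sub>m (rdim V) ** hb (rdim W) (proj W) reg)"
  shows "tensor_grading G V W = (\<lambda>g\<in>carrier G. fix_space (rdim V * rdim W) (R g))"
proof -
  let ?n = "rdim V" and ?m = "rdim W"
  interpret vec_space "TYPE(complex)" "?n * ?m" .
  note fV = proj_facts[OF V] and fW = proj_facts[OF W]
  note P' = proj_familyD[OF fV(2)] and Q' = proj_familyD[OF fW(2)]
  have "span {tensor_vec v w | v w h k. h \<in> carrier G \<and> k \<in> carrier G \<and> h \<otimes> k = g \<and> v \<in> rgrd V h \<and> w \<in> rgrd W k}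
      = fix_space (?n * ?m) (R g)" (is "span ?S = _") if g: "g \<in> carrier G" for g
  proof (rule subset_antisym)
    have gr: "rgrd V h = fix_space ?n (proj V h)" "rgrd W h = fix_space ?m (proj W h)" if "h \<in> carrier G" for h
      using fV(3) fW(3) that by simp_all
    have S: "?S \<subseteq> fix_space (?n * ?m) (R g)"
    proof
      fix x
      assume "x \<in> ?S"
      then obtain v w h k where x: "x = tensor_vec v w" "h \<in> carrier G" "k \<in> carrier G" "g = h \<otimes> k"
        "v \<in> fix_space ?n (proj V h)" "w \<in> fix_space ?m (proj W k)"
        using gr by auto
      then have v: "v \<in> carrier_vec ?n" "proj V h * col_mat v = col_mat v" and w: "w \<in> carrier_vec ?m" "proj W k * col_mat w = col_mat w"
        using fix_space_iff[OF P'(2)[OF x(2)]] fix_space_iff[OF Q'(2)[OF x(3)]] by auto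
      have e: "col_mat x = (proj V h ** proj W k) * (col_mat v ** col_mat w)"
        using v w P'(3,4)[OF x(2)] Q'(3,4)[OF x(3)] by (simp add: tensor_mat_mult col_mat_tensor x(1))
      have "R g * col_mat x = R g * (proj V h ** proj W k) * (col_mat v ** col_mat w)"
        unfolding e using v w carrier_matD[OF R[OF g]] P'(3,4)[OF x(2)] Q'(3,4)[OF x(3)] by (simp add: mat_mult_assoc)
      also have "\<dots> = col_mat x"
        using tensor_proj_pair[OF fV(1) fW(1) fV(2) fW(2) R hbR g x(2,3)] x(4) e by simp
      finally show "x \<in> fix_space (?n * ?m) (R g)"
        using v w fix_space_iff[OF R[OF g]] carrier_vecI[of x "?n * ?m"] by (simp add: x(1))
    qed
    have sub: "subspace class_ring (fix_space (?n * ?m) (R g)) (module_vec TYPE(complex) (?n * ?m))"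
      by (rule subspace_fix_space[OF R[OF g]])
    then show "span ?S \<subseteq> fix_space (?n * ?m) (R g)"
      using span_is_subset[OF S] by (simp add: subspace_def)
    have SC: "?S \<subseteq> carrier_vec (?n * ?m)"
      by (rule subset_trans[OF S]) (auto simp: fix_space_def)
    have spW: "subspace class_ring (span ?S) (module_vec TYPE(complex) (?n * ?m))"
      using span_is_subspace[OF SC] .
    have zero: "0\<^sub>v (?n * ?m) \<in> span ?S"
      using spW subspace_vec_iff by blast
    have Rg: "R g = msum (?n * ?m) (?n * ?m) (\<lambda>h. msum (?n * ?m) (?n * ?m)
        (\<lambda>k. if g = h \<otimes> k then proj V h ** proj W k else 0\<^sub>m (?n * ?m) (?n * ?m)) (carrier G)) (carrier G)"
      by (rule tensor_proj_sum[OF fV(1) fW(1) fV(2) fW(2) R hbR g])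
    have "col (R g) j \<in> span ?S" if j: "j < ?n * ?m" for j
      unfolding Rg
    proof (rule col_msum_in_subspace[OF spW finite_carrier msum_carrier _ j],
        rule col_msum_in_subspace[OF spW finite_carrier _ _ j])
      fix h k
      assume hk: "h \<in> carrier G" "k \<in> carrier G"
      note d = P'(2,3,4,5)[OF hk(1)] Q'(2,3,4,5)[OF hk(2)]
      show "(if g = h \<otimes> k then proj V h ** proj W k else 0\<^sub>m (?n * ?m) (?n * ?m)) \<in> carrier_mat (?n * ?m) (?n * ?m)"
        using tensor_mat_carrier[OF d(1) d(5)] by simp
      have jj: "j div ?m < ?n" "j mod ?m < ?m"
        using div_less_of_mult[OF j] mod_less_of_mult[OF j] by auto
      have cf: "col A i \<in> fix_space r A" if "A \<in> carrier_mat r r" "A * A = A" "i < r" for A r i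
      proof -
        have "A *\<^sub>v col A i = col (A * A) i"
          using that by (intro col_mult2[symmetric]) auto
        then show ?thesis
          using that carrier_vecI[of "col A i" r] by (simp add: fix_space_def)
      qed
      have "col (proj V h) (j div ?m) \<in> rgrd V h" "col (proj W k) (j mod ?m) \<in> rgrd W k"
        using cf[OF d(1) _ jj(1)] cf[OF d(5) _ jj(2)] d(4)[OF hk(1)] d(8)[OF hk(2)] hk by (simp_all add: gr)
      then have "tensor_vec (col (proj V h) (j div ?m)) (col (proj W k) (j mod ?m)) \<in> ?S" if "g = h \<otimes> k"
        using hk that by blast
      then have "tensor_vec (col (proj V h) (j div ?m)) (col (proj W k) (j mod ?m)) \<in> span ?S" if "g = h \<otimes> k"
        using subsetD[OF in_own_span[OF SC]] that by simp
      then show "col (if g = h \<otimes> k then proj V h ** proj W k else 0\<^sub>m (?n * ?m) (?n * ?m)) j \<in> span ?S"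
        using zero j d col_tensor_mat[of j "proj V h" "proj W k"] by simp
    qed
    then have Rx: "R g *\<^sub>v x \<in> span ?S" if "x \<in> carrier_vec (?n * ?m)" for x
      using mult_vec_in_subspace[OF spW R[OF g]] that by simp
    show "fix_space (?n * ?m) (R g) \<subseteq> span ?S"
    proof
      fix x
      assume "x \<in> fix_space (?n * ?m) (R g)"
      then have x: "x \<in> carrier_vec (?n * ?m)" "R g *\<^sub>v x = x"
        by (auto simp: fix_space_def)
      show "x \<in> span ?S"
        using Rx[OF x(1)] unfolding x(2) .
    qed
  qed
  then show ?thesis
    by (simp add: tensor_grading_def cong: restrict_cong)
qed

lemma RepD_sel [simp]:
  "obj (RepD G) = {V. is_graded_rep G V}"
  "rdim (teno (RepD G) V W) = rdim V * rdim W"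
  "ract (teno (RepD G) V W) = (\<lambda>g\<in>carrier G. ract V g ** ract W g)"
  "rdim (unito (RepD G)) = 1" "ract (unito (RepD G)) = (\<lambda>g\<in>carrier G. 1\<^sub>m 1)"
  by (simp_all add: RepD_def)

lemma RepD_tensor:
  assumes V: "is_graded_rep G V" and W: "is_graded_rep G W"
  shows "is_graded_rep G (teno (RepD G) V W)"
    "\<And>X :: ('a, 'x) rep_scheme. is_rep G X \<Longrightarrow> hb (rdim V * rdim W) (proj (teno (RepD G) V W)) X
      = (hb (rdim V) (proj V) X ** 1\<^sub>m (rdim W)) * (1\<^sub>m (rdim V) ** hb (rdim W) (proj W) X)"
proof -
  let ?U = "teno (RepD G) V W"
  note fV = proj_facts[OF V] and fW = proj_facts[OF W]
  obtain R where R: "proj_family ?U R" "\<And>X :: 'a rep. is_rep G X \<Longrightarrow>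
      hb (rdim ?U) R X = (hb (rdim V) (proj V) X ** 1\<^sub>m (rdim W)) * (1\<^sub>m (rdim V) ** hb (rdim W) (proj W) X)"
    using tensor_proj_family[OF fV(1) fW(1) fV(2) fW(2) RepD_sel(2,3)] by blast
  have U: "is_rep G ?U"
    by (rule tensor_rep[OF fV(1) fW(1)]) simp_all
  have "tensor_grading G V W = (\<lambda>g\<in>carrier G. fix_space (rdim V * rdim W) (R g))"
    by (rule tensor_grading_eq[OF V W]) (use proj_familyD(2)[OF R(1)] R(2)[OF reg_rep] in simp_all)
  then have "rgrd ?U = (\<lambda>g\<in>carrier G. fix_space (rdim ?U) (R g))"
    by (simp add: RepD_def)
  note pe = proj_eq[OF U R(1) this]
  show "is_graded_rep G ?U"
    by (rule pe)
  show "hb (rdim V * rdim W) (proj ?U) X = (hb (rdim V) (proj V) X ** 1\<^sub>m (rdim W)) * (1\<^sub>m (rdim V) ** hb (rdim W) (proj W) X)"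
    if "is_rep G X" for X :: "('a, 'x) rep_scheme"
    using R(2)[of "trunc X"] that pe(2) by simp
qed

lemma RepD_unit:
  shows "is_graded_rep G (unito (RepD G))"
    "proj (unito (RepD G)) = (\<lambda>g\<in>carrier G. if g = \<one> then 1\<^sub>m 1 else 0\<^sub>m 1 1)"
proof -
  let ?I = "unito (RepD G)"
  let ?P = "\<lambda>g\<in>carrier G. if g = \<one> then 1\<^sub>m 1 else 0\<^sub>m 1 1 :: complex mat"
  have I: "is_rep G ?I"
    by (rule unit_rep) simp_all
  have "msum 1 1 ?P (carrier G) = ?P \<one>"
    by (rule msum_delta) auto
  then have m: "msum (Suc 0) (Suc 0) ?P (carrier G) = 1\<^sub>m (Suc 0)"
    by simp
  have c: "g \<otimes> h \<otimes> inv g = \<one> \<longleftrightarrow> h = \<one>" if "g \<in> carrier G" "h \<in> carrier G" for g h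
  proof
    assume "g \<otimes> h \<otimes> inv g = \<one>"
    then have "g \<otimes> h = g"
      using that by (metis inv_closed inv_equality inv_inv m_closed)
    then show "h = \<one>"
      using that by simp
  qed (use that in simp)
  have P: "proj_family ?I ?P"
    unfolding proj_family_def using m c by auto
  have "v = 0\<^sub>v (Suc 0)" if "0\<^sub>m (Suc 0) (Suc 0) *\<^sub>v v = v" "v \<in> carrier_vec (Suc 0)" for v :: "complex vec"
  proof -
    have "0\<^sub>m (Suc 0) (Suc 0) *\<^sub>v v = 0\<^sub>v (Suc 0)"
      using that(2) by (auto intro!: eq_vecI simp: scalar_prod_def)
    then show ?thesis
      using that(1) by simp
  qed
  then have f: "fix_space 1 (1\<^sub>m 1) = carrier_vec 1" "fix_space 1 (0\<^sub>m 1 1) = {0\<^sub>v 1}"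
    by (auto simp: fix_space_def intro!: eq_vecI simp: scalar_prod_def)
  have "rgrd ?I = (\<lambda>g\<in>carrier G. fix_space (rdim ?I) (?P g))"
    using f by (auto simp: RepD_def intro!: restrict_ext)
  note pe = proj_eq[OF I P this]
  show "is_graded_rep G ?I" "proj ?I = ?P"
    by (rule pe)+
qed

lemma hb_RepD_unit:
  assumes X: "is_rep G X"
  shows "hb 1 (proj (unito (RepD G))) X = 1\<^sub>m (rdim X)"
proof -
  note r = is_repD[OF X]
  have "msum (rdim X * 1) (rdim X * 1) (\<lambda>g. ract X g ** proj (unito (RepD G)) g) (carrier G)
      = ract X \<one> ** proj (unito (RepD G)) \<one>"
    by (rule msum_delta) (use r in \<open>auto simp: RepD_unit(2)\<close>)
  then show ?thesis
    using r by (simp add: hb_def RepD_unit(2))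
qed

text \<open>The half braiding at the regular representation determines the grading, so equality of
  objects, which strictness requires, becomes an equation between matrices.\<close>

lemma graded_rep_eqI:
  assumes V: "is_graded_rep G V" and W: "is_graded_rep G W" and e: "rdim V = rdim W" "ract V = ract W"
    and h: "hb (rdim V) (proj V) reg = hb (rdim V) (proj W) reg"
  shows "V = W"
proof -
  note fV = proj_facts[OF V] and fW = proj_facts[OF W]
  have "proj V = proj W"
    by (rule hb_inj[where n = "rdim V"]) (use proj_familyD(1,2)[OF fV(2)] proj_familyD(1,2)[OF fW(2)] h e in auto)
  then have "rgrd V = rgrd W"
    using fV(3) fW(3) e by simp
  then show ?thesis
    using e by (intro graded_rep.equality) auto
qed

lemma mor_hb:
  assumes "is_graded_rep G V" "is_graded_rep G W" "A \<in> mor (RepD G) V W" "is_rep G X"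
  shows "(1\<^sub>m (rdim X) ** A) * hb (rdim V) (proj V) X = hb (rdim W) (proj W) X * (A ** 1\<^sub>m (rdim X))"
  using assms(3) unfolding mor_RepD_iff[OF assms(1,2)]
  by (intro hb_mor[OF assms(4)]) (use proj_familyD(2)[OF proj_facts(2)[OF assms(1)]]
      proj_familyD(2)[OF proj_facts(2)[OF assms(2)]] intertwinersD(1) in auto)

text \<open>Together with \<open>mor_hb\<close> this identifies the morphisms of
  \<open>RepD G\<close> with the intertwiners commuting with half braidings, as in the Drinfeld
  centre.\<close>

lemma mor_hbI:
  assumes V: "is_graded_rep G V" and W: "is_graded_rep G W" and A: "A \<in> intertwiners G V W"
    and e: "(1\<^sub>m (card (carrier G)) ** A) * hb (rdim V) (proj V) reg = hb (rdim W) (proj W) reg * (A ** 1\<^sub>m (card (carrier G)))"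
  shows "A \<in> mor (RepD G) V W"
  unfolding mor_RepD_iff[OF V W]
  using A hb_mor_reflect[OF intertwinersD(1)[OF A] proj_familyD(2)[OF proj_facts(2)[OF V]]
      proj_familyD(2)[OF proj_facts(2)[OF W]] e] by blast

lemma mor_intertwiner: "A \<in> mor (RepD G) V W \<Longrightarrow> A \<in> intertwiners G V W"
  by (simp add: RepD_def)

text \<open>For both bracketings the half braiding at \<open>reg\<close> is the composite of the
  three individual ones.\<close>

lemma RepD_tensor_assoc:
  assumes U: "is_graded_rep G U" and V: "is_graded_rep G V" and W: "is_graded_rep G W"
  shows "teno (RepD G) (teno (RepD G) U V) W = teno (RepD G) U (teno (RepD G) V W)"
proof (rule graded_rep_eqI)
  note UV = RepD_tensor[OF U V] and VW = RepD_tensor[OF V W]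
  note UV_W = RepD_tensor[OF UV(1) W] and U_VW = RepD_tensor[OF U VW(1)]
  show "is_graded_rep G (teno (RepD G) (teno (RepD G) U V) W)" "is_graded_rep G (teno (RepD G) U (teno (RepD G) V W))"
    by (fact UV_W(1) U_VW(1))+
  show "ract (teno (RepD G) (teno (RepD G) U V) W) = ract (teno (RepD G) U (teno (RepD G) V W))"
    by (auto simp: tensor_mat_assoc intro!: restrict_ext)
  have "hb (rdim U * rdim V * rdim W) (proj (teno (RepD G) (teno (RepD G) U V) W)) reg
      = (hb (rdim U) (proj U) reg ** 1\<^sub>m (rdim V) ** 1\<^sub>m (rdim W)) * ((1\<^sub>m (rdim U) ** hb (rdim V) (proj V) reg ** 1\<^sub>m (rdim W))
        * (1\<^sub>m (rdim U * rdim V) ** hb (rdim W) (proj W) reg))"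
    using UV_W(2)[OF reg_rep] UV(2)[OF reg_rep] by (simp add: mult_tensor_one mat_mult_assoc tensor_mat_assoc mult.assoc)
  moreover have "hb (rdim U * (rdim V * rdim W)) (proj (teno (RepD G) U (teno (RepD G) V W))) reg
      = (hb (rdim U) (proj U) reg ** 1\<^sub>m (rdim V * rdim W)) * ((1\<^sub>m (rdim U) ** hb (rdim V) (proj V) reg ** 1\<^sub>m (rdim W))
        * (1\<^sub>m (rdim U) ** 1\<^sub>m (rdim V) ** hb (rdim W) (proj W) reg))"
    using U_VW(2)[OF reg_rep] VW(2)[OF reg_rep] by (simp add: one_tensor_mult)
  ultimately show "hb (rdim (teno (RepD G) (teno (RepD G) U V) W)) (proj (teno (RepD G) (teno (RepD G) U V) W)) reg
      = hb (rdim (teno (RepD G) (teno (RepD G) U V) W)) (proj (teno (RepD G) U (teno (RepD G) V W))) reg"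
    by (simp add: mult.assoc tensor_one_mat[symmetric] tensor_mat_assoc)
qed (simp add: mult.assoc)

lemma RepD_tensor_unit:
  assumes V: "is_graded_rep G V"
  shows "teno (RepD G) (unito (RepD G)) V = V" "teno (RepD G) V (unito (RepD G)) = V"
proof -
  note r = is_repD(1)[OF proj_facts(1)[OF V]]
  have x: "(\<lambda>g\<in>carrier G. ract V g) = ract V"
    using r by (simp add: extensional_restrict)
  show "teno (RepD G) (unito (RepD G)) V = V"
  proof (rule graded_rep_eqI[OF RepD_tensor(1)[OF RepD_unit(1) V] V])
    show "ract (teno (RepD G) (unito (RepD G)) V) = ract V"
      using x by (simp cong: restrict_cong)
    show "hb (rdim (teno (RepD G) (unito (RepD G)) V)) (proj (teno (RepD G) (unito (RepD G)) V)) reg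
        = hb (rdim (teno (RepD G) (unito (RepD G)) V)) (proj V) reg"
      using RepD_tensor(2)[OF RepD_unit(1) V reg_rep] hb_RepD_unit[OF reg_rep] by (simp add: tensor_one_mat)
  qed simp
  show "teno (RepD G) V (unito (RepD G)) = V"
  proof (rule graded_rep_eqI[OF RepD_tensor(1)[OF V RepD_unit(1)] V])
    show "ract (teno (RepD G) V (unito (RepD G))) = ract V"
      using x by (simp cong: restrict_cong)
    show "hb (rdim (teno (RepD G) V (unito (RepD G)))) (proj (teno (RepD G) V (unito (RepD G)))) reg
        = hb (rdim (teno (RepD G) V (unito (RepD G)))) (proj V) reg"
      using RepD_tensor(2)[OF V RepD_unit(1) reg_rep] hb_RepD_unit[OF reg_rep] by (simp add: tensor_one_mat)
  qed simp
qed

lemma RepD_mult_mor: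
  assumes U: "is_graded_rep G U" and V: "is_graded_rep G V" and W: "is_graded_rep G W"
    and B: "B \<in> mor (RepD G) V W" and A: "A \<in> mor (RepD G) U V"
  shows "B * A \<in> mor (RepD G) U W"
proof -
  note A' = A[unfolded mor_RepD_iff[OF U V]] and B' = B[unfolded mor_RepD_iff[OF V W]]
  note d = intertwinersD(2,3)[OF conjunct1[OF A']] intertwinersD(2,3)[OF conjunct1[OF B']]
  note dP = proj_familyD(3,4)[OF proj_facts(2)[OF U]] proj_familyD(3,4)[OF proj_facts(2)[OF V]]
    proj_familyD(3,4)[OF proj_facts(2)[OF W]]
  have "B * A * proj U g = proj W g * (B * A)" if g: "g \<in> carrier G" for g
  proof -
    have "B * A * proj U g = B * (A * proj U g)"
      by (rule mat_mult_assoc) (use g d dP in auto)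
    also have "\<dots> = B * proj V g * A"
      using A' g mat_mult_assoc[of B "proj V g" A] d dP by simp
    also have "\<dots> = proj W g * (B * A)"
      using B' g mat_mult_assoc[of "proj W g" B A] d dP by simp
    finally show ?thesis .
  qed
  then show ?thesis
    unfolding mor_RepD_iff[OF U W]
    using intertwiners_mult[OF proj_facts(1)[OF U] proj_facts(1)[OF V] proj_facts(1)[OF W]] A' B' by blast
qed

lemma RepD_linear_mor:
  assumes V: "is_graded_rep G V" and W: "is_graded_rep G W"
  shows "A \<in> mor (RepD G) V W \<Longrightarrow> B \<in> mor (RepD G) V W \<Longrightarrow> A + B \<in> mor (RepD G) V W"
    "A \<in> mor (RepD G) V W \<Longrightarrow> c \<cdot>\<^sub>m A \<in> mor (RepD G) V W"
    "1\<^sub>m (rdim V) \<in> mor (RepD G) V V" "0\<^sub>m (rdim W) (rdim V) \<in> mor (RepD G) V W"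
proof -
  note dP = proj_familyD(3,4)[OF proj_facts(2)[OF V]] proj_familyD(3,4)[OF proj_facts(2)[OF W]]
  note r = proj_facts(1)[OF V] proj_facts(1)[OF W]
  show "A + B \<in> mor (RepD G) V W" if "A \<in> mor (RepD G) V W" "B \<in> mor (RepD G) V W"
    using that intertwiners_linear(1)[OF r] dP intertwinersD(2,3)[of A V W] intertwinersD(2,3)[of B V W]
    unfolding mor_RepD_iff[OF V W] by (auto simp: mat_add_mult mat_mult_add)
  show "c \<cdot>\<^sub>m A \<in> mor (RepD G) V W" if "A \<in> mor (RepD G) V W"
    using that intertwiners_linear(2)[OF r] dP intertwinersD(2,3)[of A V W]
    unfolding mor_RepD_iff[OF V W] by (auto simp: mat_smult_mult mat_mult_smult)
  show "1\<^sub>m (rdim V) \<in> mor (RepD G) V V"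
    using intertwiners_one[OF r(1)] dP unfolding mor_RepD_iff[OF V V] by simp
  show "0\<^sub>m (rdim W) (rdim V) \<in> mor (RepD G) V W"
    using intertwiners_zero[OF r] dP unfolding mor_RepD_iff[OF V W] by simp
qed

lemma RepD_tensor_mor:
  assumes V: "is_graded_rep G V" and W: "is_graded_rep G W" and V': "is_graded_rep G V'" and W': "is_graded_rep G W'"
    and A: "A \<in> mor (RepD G) V V'" and B: "B \<in> mor (RepD G) W W'"
  shows "A ** B \<in> mor (RepD G) (teno (RepD G) V W) (teno (RepD G) V' W')"
proof (rule mor_hbI[OF RepD_tensor(1)[OF V W] RepD_tensor(1)[OF V' W']])
  let ?N = "card (carrier G)"
  let ?h = "\<lambda>V. hb (rdim V) (proj V) reg"
  note dA = intertwinersD(2,3)[OF mor_intertwiner[OF A]] and dB = intertwinersD(2,3)[OF mor_intertwiner[OF B]]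
  show "A ** B \<in> intertwiners G (teno (RepD G) V W) (teno (RepD G) V' W')"
    by (rule intertwiners_tensor[OF proj_facts(1)[OF V] proj_facts(1)[OF V'] proj_facts(1)[OF W] proj_facts(1)[OF W']
          mor_intertwiner[OF A] mor_intertwiner[OF B]]) simp_all
  note hA = mor_hb[OF V V' A reg_rep, simplified] and hB = mor_hb[OF W W' B reg_rep, simplified]
  have "(1\<^sub>m ?N ** (A ** B)) * ?h (teno (RepD G) V W)
      = ((1\<^sub>m ?N ** A) ** B) * (?h V ** 1\<^sub>m (rdim W)) * (1\<^sub>m (rdim V) ** ?h W)"
    using RepD_tensor(2)[OF V W reg_rep] dA dB by (simp add: mat_mult_assoc tensor_mat_assoc mult_ac)
  also have "((1\<^sub>m ?N ** A) ** B) * (?h V ** 1\<^sub>m (rdim W)) = (?h V' * (A ** 1\<^sub>m ?N)) ** B"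
    using dA dB hA by (subst tensor_mat_mult) auto
  also have "\<dots> = (?h V' ** 1\<^sub>m (rdim W')) * (A ** (1\<^sub>m ?N ** B))"
    using dA dB by (simp add: tensor_mat_mult flip: tensor_mat_assoc)
  also have "\<dots> * (1\<^sub>m (rdim V) ** ?h W) = (?h V' ** 1\<^sub>m (rdim W')) * (A ** (?h W' * (B ** 1\<^sub>m ?N)))"
    using dA dB hB by (subst mat_mult_assoc) (auto simp: tensor_mat_mult)
  also have "A ** (?h W' * (B ** 1\<^sub>m ?N)) = (1\<^sub>m (rdim V') ** ?h W') * ((A ** B) ** 1\<^sub>m ?N)"
    using dA dB by (simp add: tensor_mat_mult tensor_mat_assoc)
  also have "(?h V' ** 1\<^sub>m (rdim W')) * \<dots> = ?h (teno (RepD G) V' W') * ((A ** B) ** 1\<^sub>m ?N)"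
    using RepD_tensor(2)[OF V' W' reg_rep] dA dB by (simp add: mat_mult_assoc mult_ac)
  finally show "(1\<^sub>m ?N ** (A ** B)) * ?h (teno (RepD G) V W) = ?h (teno (RepD G) V' W') * ((A ** B) ** 1\<^sub>m ?N)" .
qed

lemma matcat_RepD: "matcat (RepD G) rdim"
proof
  fix U V W X Y :: "'a graded_rep" and a f g
  show "cmp (RepD G) = (*)" "idm (RepD G) V = 1\<^sub>m (rdim V)" "zerom (RepD G) V W = 0\<^sub>m (rdim W) (rdim V)"
    "addm (RepD G) = (+)" "scalem (RepD G) = (\<cdot>\<^sub>m)" "tenm (RepD G) = tensor_mat"
    "assoc (RepD G) U V W = 1\<^sub>m (rdim U * rdim V * rdim W)" "lunit (RepD G) V = 1\<^sub>m (rdim V)"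
    "runit (RepD G) V = 1\<^sub>m (rdim V)"
    by (simp_all add: RepD_def)
  show "rdim (teno (RepD G) V W) = rdim V * rdim W" "rdim (unito (RepD G)) = 1"
    by simp_all
  show "unito (RepD G) \<in> obj (RepD G)"
    by (simp add: RepD_unit)
  show "teno (RepD G) V W \<in> obj (RepD G)" if "V \<in> obj (RepD G)" "W \<in> obj (RepD G)"
    using that RepD_tensor(1) by simp
  show "teno (RepD G) (teno (RepD G) U V) W = teno (RepD G) U (teno (RepD G) V W)"
    if "U \<in> obj (RepD G)" "V \<in> obj (RepD G)" "W \<in> obj (RepD G)"
    using that RepD_tensor_assoc by simp
  show "teno (RepD G) (unito (RepD G)) V = V" "teno (RepD G) V (unito (RepD G)) = V" if "V \<in> obj (RepD G)"
    using that RepD_tensor_unit by simp_all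
  show "f \<in> carrier_mat (rdim W) (rdim V)" if "f \<in> mor (RepD G) V W"
    using intertwinersD(1)[OF mor_intertwiner[OF that]] .
  show "1\<^sub>m (rdim V) \<in> mor (RepD G) V V" if "V \<in> obj (RepD G)"
    using that RepD_linear_mor(3) by simp
  show "0\<^sub>m (rdim W) (rdim V) \<in> mor (RepD G) V W" if "V \<in> obj (RepD G)" "W \<in> obj (RepD G)"
    using that RepD_linear_mor(4) by simp
  show "g * f \<in> mor (RepD G) U W"
    if "U \<in> obj (RepD G)" "V \<in> obj (RepD G)" "W \<in> obj (RepD G)" "g \<in> mor (RepD G) V W" "f \<in> mor (RepD G) U V"
    using that RepD_mult_mor by simp
  show "f + g \<in> mor (RepD G) V W"
    if "V \<in> obj (RepD G)" "W \<in> obj (RepD G)" "f \<in> mor (RepD G) V W" "g \<in> mor (RepD G) V W"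
    using that RepD_linear_mor(1) by simp
  show "f ** g \<in> mor (RepD G) (teno (RepD G) V W) (teno (RepD G) X Y)"
    if "V \<in> obj (RepD G)" "W \<in> obj (RepD G)" "X \<in> obj (RepD G)" "Y \<in> obj (RepD G)" "f \<in> mor (RepD G) V X" "g \<in> mor (RepD G) W Y"
    using that RepD_tensor_mor by simp
  show "a \<cdot>\<^sub>m f \<in> mor (RepD G) V W"
    if "V \<in> obj (RepD G)" "W \<in> obj (RepD G)" "f \<in> mor (RepD G) V W"
    using that RepD_linear_mor(2) by simp
qed

text \<open>The prescribed values determine a matrix on each image of \<open>proj V g ** 1\<close>,
  and these projections add up to the identity; \<open>hb\<close> has the prescribed values by
  \<open>hb_proj\<close>.\<close>

lemma double_braiding_eq:
  assumes V: "is_graded_rep G V" and W: "is_graded_rep G W"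
  shows "double_braiding G V W = hb (rdim V) (proj V) W"
proof -
  let ?n = "rdim V" and ?m = "rdim W"
  note fV = proj_facts[OF V] and fW = proj_facts[OF W]
  note P' = proj_familyD[OF fV(2)] and r = is_repD[OF fW(1)]
  have gr: "rgrd V h = fix_space ?n (proj V h)" if "h \<in> carrier G" for h
    using fV(3) that by simp
  have hb: "hb ?n (proj V) W *\<^sub>v tensor_vec v w = tensor_vec (ract W g *\<^sub>v w) v"
    if g: "g \<in> carrier G" and v: "v \<in> rgrd V g" and w: "w \<in> carrier_vec ?m" for g v w
  proof -
    have v': "v \<in> carrier_vec ?n" "proj V g * col_mat v = col_mat v"
      using v fix_space_iff[OF P'(2)[OF g]] by (auto simp: gr[OF g])
    have cw: "col_mat w \<in> carrier_mat ?m 1"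
      using w by (intro carrier_matI) auto
    have "hb ?n (proj V) W * (col_mat v ** col_mat w) = hb ?n (proj V) W * ((proj V g ** col_mat w) * col_mat v)"
      using v' w g P'(3,4) tensor_mat_mult[of "proj V g" "col_mat v" "col_mat w" "1\<^sub>m 1"] by simp
    also have "\<dots> = ((ract W g * col_mat w) ** proj V g) * col_mat v"
      unfolding hb_proj[OF fW(1) fV(2) refl g cw, symmetric]
      by (rule mat_mult_assoc[symmetric]) (use v' w g P'(3,4) in auto)
    also have "\<dots> = (ract W g * col_mat w) ** col_mat v"
      using v' w g P'(3,4) r(3,4) tensor_mat_mult[of "ract W g * col_mat w" "1\<^sub>m 1" "proj V g" "col_mat v"] by simp
    finally have "col_mat (hb ?n (proj V) W *\<^sub>v tensor_vec v w) = col_mat (tensor_vec (ract W g *\<^sub>v w) v)"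
      using v' w g r by (simp add: col_mat_mult col_mat_tensor)
    then show ?thesis
      by (simp add: col_mat_inj)
  qed
  show ?thesis
    unfolding double_braiding_def
  proof (rule the_equality)
    show "hb ?n (proj V) W \<in> carrier_mat (?m * ?n) (?n * ?m) \<and> (\<forall>g\<in>carrier G. \<forall>v\<in>rgrd V g. \<forall>w\<in>carrier_vec ?m.
        hb ?n (proj V) W *\<^sub>v tensor_vec v w = tensor_vec (ract W g *\<^sub>v w) v)"
      using hb by (auto intro!: carrier_matI)
    fix A
    assume A: "A \<in> carrier_mat (?m * ?n) (?n * ?m) \<and>
      (\<forall>g\<in>carrier G. \<forall>v\<in>rgrd V g. \<forall>w\<in>carrier_vec ?m. A *\<^sub>v tensor_vec v w = tensor_vec (ract W g *\<^sub>v w) v)"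
    have hc: "hb ?n (proj V) W \<in> carrier_mat (?m * ?n) (?n * ?m)"
      by (intro carrier_matI) simp_all
    have *: "A * (proj V g ** 1\<^sub>m ?m) = hb ?n (proj V) W * (proj V g ** 1\<^sub>m ?m)" if g: "g \<in> carrier G" for g
    proof (rule mat_eq_mult_tensor_vecI[of _ _ ?n ?m])
      fix v w :: "complex vec"
      assume v: "v \<in> carrier_vec ?n" and w: "w \<in> carrier_vec ?m"
      have pv: "proj V g *\<^sub>v v \<in> rgrd V g"
      proof -
        have "proj V g *\<^sub>v (proj V g *\<^sub>v v) = proj V g *\<^sub>v v"
          using assoc_mult_mat_vec[OF P'(2)[OF g] P'(2)[OF g] v] P'(5)[OF g g] by simp
        then show ?thesis
          using P'(2)[OF g] v by (auto simp: gr[OF g] fix_space_def)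
      qed
      have c: "proj V g ** 1\<^sub>m ?m \<in> carrier_mat (?n * ?m) (?n * ?m)"
        using tensor_mat_carrier[OF P'(2)[OF g] one_carrier_mat] .
      have tv: "tensor_vec v w \<in> carrier_vec (?n * ?m)"
        using v w by (intro carrier_vecI) simp
      have "X * (proj V g ** 1\<^sub>m ?m) *\<^sub>v tensor_vec v w = X *\<^sub>v tensor_vec (proj V g *\<^sub>v v) w"
        if "X \<in> carrier_mat (?m * ?n) (?n * ?m)" for X
        using assoc_mult_mat_vec[OF that c tv] tensor_mat_vec[of v "proj V g" w "1\<^sub>m ?m"] v w P'(4)[OF g] by simp
      from this[OF conjunct1[OF A]] this[OF hc]
      show "A * (proj V g ** 1\<^sub>m ?m) *\<^sub>v tensor_vec v w = hb ?n (proj V) W * (proj V g ** 1\<^sub>m ?m) *\<^sub>v tensor_vec v w"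
        using A hb[OF g pv w] g pv w by simp
    qed (use A P'(3,4)[OF g] in auto)
    have "X = msum (?m * ?n) (?n * ?m) (\<lambda>g. X * (proj V g ** 1\<^sub>m ?m)) (carrier G)"
      if X: "X \<in> carrier_mat (?m * ?n) (?n * ?m)" for X
    proof -
      have "msum (?n * ?m) (?n * ?m) (\<lambda>g. proj V g ** 1\<^sub>m ?m) (carrier G) = 1\<^sub>m (?n * ?m)"
        using msum_tensor[of "carrier G" "proj V" ?n ?n "1\<^sub>m ?m"] P'(2,6) by (simp add: tensor_one_mat)
      then show ?thesis
        using mult_msum[of "carrier G" "\<lambda>g. proj V g ** 1\<^sub>m ?m" "?n * ?m" "?n * ?m" X] X
          tensor_mat_carrier[OF P'(2) one_carrier_mat] by simp
    qed
    note S = this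
    have "A = msum (?m * ?n) (?n * ?m) (\<lambda>g. A * (proj V g ** 1\<^sub>m ?m)) (carrier G)"
      using S A by blast
    also have "\<dots> = msum (?m * ?n) (?n * ?m) (\<lambda>g. hb ?n (proj V) W * (proj V g ** 1\<^sub>m ?m)) (carrier G)"
      by (rule msum_cong[OF refl *])
    also have "\<dots> = hb ?n (proj V) W"
      using S[OF hc] ..
    finally show "A = hb ?n (proj V) W" .
  qed
qed

end

lemma msum_add:
  assumes "\<And>k. k \<in> I \<Longrightarrow> g k \<in> carrier_mat n m"
  shows "msum n m (\<lambda>k. f k + g k) I = msum n m f I + msum n m g I"
proof (rule eq_matI)
  fix i j
  assume "i < dim_row (msum n m f I + msum n m g I)" "j < dim_col (msum n m f I + msum n m g I)"
  then have ij: "i < n" "j < m"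
    by simp_all
  have "(\<Sum>k\<in>I. (f k + g k) $$ (i, j)) = (\<Sum>k\<in>I. f k $$ (i, j) + g k $$ (i, j))"
    using ij carrier_matD[OF assms] by (intro sum.cong) auto
  then show "msum n m (\<lambda>k. f k + g k) I $$ (i, j) = (msum n m f I + msum n m g I) $$ (i, j)"
    using ij by (simp add: index_msum sum.distrib)
qed simp_all

lemma msum_transpose:
  assumes "\<And>k. k \<in> I \<Longrightarrow> f k \<in> carrier_mat n m"
  shows "msum m n (\<lambda>k. (f k)\<^sup>T) I = (msum n m f I)\<^sup>T"
proof (rule eq_matI)
  fix i j
  assume "i < dim_row (msum n m f I)\<^sup>T" "j < dim_col (msum n m f I)\<^sup>T"
  then have ij: "i < m" "j < n"
    by simp_all
  have "(\<Sum>k\<in>I. (f k)\<^sup>T $$ (i, j)) = (\<Sum>k\<in>I. f k $$ (j, i))"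
    using ij carrier_matD[OF assms] by (intro sum.cong) auto
  then show "msum m n (\<lambda>k. (f k)\<^sup>T) I $$ (i, j) = (msum n m f I)\<^sup>T $$ (i, j)"
    using ij by (simp add: index_msum)
qed simp_all

lemma mat_transpose_mult: "dim_col A = dim_row B \<Longrightarrow> (A * B)\<^sup>T = B\<^sup>T * (A :: complex mat)\<^sup>T"
  by (rule transpose_mult[of _ "dim_row A" "dim_col A" _ "dim_col B"]) auto

lemma transpose_tensor_mat: "(A ** B)\<^sup>T = A\<^sup>T ** B\<^sup>T"
  by (rule eq_matI) (auto simp: index_tensor_mat div_less_of_mult mod_less_of_mult)

subsection \<open>The standard pairing\<close>

text \<open>The functional that is 1 on \<open>e_i \<otimes> e_i\<close> and 0 on the other basis
  tensors; its transpose is the matching copairing.\<close>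

definition pairing :: "nat \<Rightarrow> complex mat" where
  "pairing n = mat 1 (n * n) (\<lambda>(_, l). if l div n = l mod n then 1 else 0)"

lemma dim_pairing [simp]: "dim_row (pairing n) = 1" "dim_col (pairing n) = n * n"
  by (simp_all add: pairing_def)

text \<open>The pairing of \<open>A x\<close> with \<open>B y\<close> is the bilinear form with
  matrix \<open>A\<^sup>T * B\<close>, so invariance and vanishing of the pairing reduce to matrix
  products.\<close>

lemma pairing_tensor_index:
  assumes "dim_row A = n" "dim_row B = n" "l < dim_col A * dim_col B"
  shows "(pairing n * (A ** B)) $$ (0, l) = (A\<^sup>T * B) $$ (l div dim_col B, l mod dim_col B)"
proof -
  have "(pairing n * (A ** B)) $$ (0, l) = (\<Sum>p\<in>{0..<n * n}. if p div n = p mod n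
      then A $$ (p div n, l div dim_col B) * B $$ (p mod n, l mod dim_col B) else 0)"
    using assms by (simp add: scalar_prod_def pairing_def index_tensor_mat) (intro sum.cong, auto)
  also have "\<dots> = (\<Sum>i\<in>{0..<n}. \<Sum>j\<in>{0..<n}. if i = j
      then A $$ (i, l div dim_col B) * B $$ (j, l mod dim_col B) else 0)"
    by (rule sum_div_mod[where f = "\<lambda>i j. if i = j
      then A $$ (i, l div dim_col B) * B $$ (j, l mod dim_col B) else 0"])
  also have "\<dots> = (\<Sum>i\<in>{0..<n}. A $$ (i, l div dim_col B) * B $$ (i, l mod dim_col B))"
    by (intro sum.cong) auto
  also have "\<dots> = (A\<^sup>T * B) $$ (l div dim_col B, l mod dim_col B)"
    using assms div_less_of_mult[OF assms(3)] mod_less_of_mult[OF assms(3)] by (simp add: scalar_prod_def)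
  finally show ?thesis .
qed

lemma pairing_tensor_eq:
  assumes "dim_row A = n" "dim_row B = n" "dim_row A' = n" "dim_row B' = n" "dim_col A = dim_col A'" "dim_col B = dim_col B'"
    and "A\<^sup>T * B = A'\<^sup>T * B'"
  shows "pairing n * (A ** B) = pairing n * (A' ** B')"
proof (rule eq_matI)
  fix i l
  assume "i < dim_row (pairing n * (A' ** B'))" "l < dim_col (pairing n * (A' ** B'))"
  then have "i = 0" "l < dim_col A * dim_col B"
    using assms by simp_all
  then show "(pairing n * (A ** B)) $$ (i, l) = (pairing n * (A' ** B')) $$ (i, l)"
    using assms pairing_tensor_index[of A n B l] pairing_tensor_index[of A' n B' l] by simp
qed (use assms in auto)

lemma pairing_tensor_zero:
  assumes "dim_row A = n" "dim_row B = n" "A\<^sup>T * B = 0\<^sub>m (dim_col A) (dim_col B)"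
  shows "pairing n * (A ** B) = 0\<^sub>m 1 (dim_col A * dim_col B)"
proof -
  have "pairing n * (A ** B) = pairing n * (0\<^sub>m n (dim_col A) ** B)"
    using assms by (intro pairing_tensor_eq) auto
  then show ?thesis
    using assms by simp
qed

lemma pairing_swap: "pairing n * swap_mat n n = pairing n"
proof (rule mat_eq_tensorI[of _ _ n n])
  fix v w :: "complex mat"
  assume c: "v \<in> carrier_mat n 1" "w \<in> carrier_mat n 1"
  have d: "dim_row v = n" "dim_col v = 1" "dim_row w = n" "dim_col w = 1"
    using c by auto
  have "w\<^sup>T * v = v\<^sup>T * w"
    using d by (intro eq_matI) (auto simp: scalar_prod_def mult.commute)
  then have "pairing n * (w ** v) = pairing n * (v ** w)"
    using d by (intro pairing_tensor_eq) auto
  then show "pairing n * swap_mat n n * (v ** w) = pairing n * (v ** w)"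
    using d swap_mat_col[OF c] by (simp add: mat_mult_assoc)
qed simp_all

text \<open>The copairing is the sum of \<open>u i ** u i\<close> over the standard basis, and
  partial evaluation leaves the resolution of the identity by the matrices
  \<open>u i * (u i)\<^sup>T\<close>.\<close>

lemma pairing_zigzag:
  "(1\<^sub>m n ** pairing n) * ((pairing n)\<^sup>T ** 1\<^sub>m n) = 1\<^sub>m n"
  "(pairing n ** 1\<^sub>m n) * (1\<^sub>m n ** (pairing n)\<^sup>T) = 1\<^sub>m n"
proof -
  define u :: "nat \<Rightarrow> complex mat" where "u i = mat n 1 (\<lambda>(k, _). if k = i then 1 else 0)" for i
  have du [simp]: "dim_row (u i) = n" "dim_col (u i) = 1" for i
    by (simp_all add: u_def)
  have co: "(pairing n)\<^sup>T = msum (n * n) 1 (\<lambda>i. u i ** u i) {0..<n}"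
  proof (rule eq_matI)
    fix k j
    assume "k < dim_row (msum (n * n) 1 (\<lambda>i. u i ** u i) {0..<n})" "j < dim_col (msum (n * n) 1 (\<lambda>i. u i ** u i) {0..<n})"
    then have k: "k < n * n" "j = 0"
      by simp_all
    have "(\<Sum>i\<in>{0..<n}. (u i ** u i) $$ (k, 0)) = (\<Sum>i\<in>{0..<n}. if i = k div n then (if k div n = k mod n then 1 else 0) else 0)"
      using k div_less_of_mult[OF k(1)] mod_less_of_mult[OF k(1)]
      by (intro sum.cong) (auto simp: index_tensor_mat u_def)
    then show "(pairing n)\<^sup>T $$ (k, j) = msum (n * n) 1 (\<lambda>i. u i ** u i) {0..<n} $$ (k, j)"
      using k div_less_of_mult[OF k(1)] by (simp add: pairing_def index_msum)
  qed simp_all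
  have pu: "pairing n * (u i ** 1\<^sub>m n) = (u i)\<^sup>T" if "i < n" for i
  proof (rule eq_matI)
    show "(pairing n * (u i ** 1\<^sub>m n)) $$ (k, l) = (u i)\<^sup>T $$ (k, l)" if "k < dim_row (u i)\<^sup>T" "l < dim_col (u i)\<^sup>T" for k l
      using that pairing_tensor_index[of "u i" n "1\<^sub>m n" l] by simp
  qed simp_all
  have pu': "pairing n * (1\<^sub>m n ** u i) = (u i)\<^sup>T" if "i < n" for i
  proof -
    have "pairing n * (1\<^sub>m n ** u i) = pairing n * swap_mat n n * (1\<^sub>m n ** u i)"
      by (simp add: pairing_swap)
    also have "\<dots> = pairing n * (swap_mat n n * (1\<^sub>m n ** u i))"
      by (rule mat_mult_assoc) simp_all
    also have "\<dots> = pairing n * (u i ** 1\<^sub>m n)"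
      by (subst swap_mat_tensor[of n "1\<^sub>m n" n n "u i" 1]) simp_all
    finally show ?thesis
      using pu[OF that] by simp
  qed
  have one: "msum n n (\<lambda>i. u i * (u i)\<^sup>T) {0..<n} = 1\<^sub>m n"
  proof (rule eq_matI)
    fix i j
    assume "i < dim_row (1\<^sub>m n :: complex mat)" "j < dim_col (1\<^sub>m n :: complex mat)"
    then have ij: "i < n" "j < n"
      by simp_all
    have "(\<Sum>k\<in>{0..<n}. (u k * (u k)\<^sup>T) $$ (i, j)) = (\<Sum>k\<in>{0..<n}. if k = i then (if i = j then 1 else 0) else 0)"
      using ij by (intro sum.cong) (auto simp: scalar_prod_def u_def)
    then show "msum n n (\<lambda>i. u i * (u i)\<^sup>T) {0..<n} $$ (i, j) = 1\<^sub>m n $$ (i, j)"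
      using ij by (simp add: index_msum)
  qed simp_all
  have uu: "u i ** (u i)\<^sup>T = u i * (u i)\<^sup>T" "(u i)\<^sup>T ** u i = u i * (u i)\<^sup>T" for i
    using tensor_mat_mult[of "u i" "1\<^sub>m 1" "1\<^sub>m 1" "(u i)\<^sup>T"] tensor_mat_mult[of "1\<^sub>m 1" "(u i)\<^sup>T" "u i" "1\<^sub>m 1"] by simp_all
  have cu: "u i ** u i \<in> carrier_mat (n * n) 1" for i
    by (intro carrier_matI) simp_all
  have "(1\<^sub>m n ** pairing n) * ((pairing n)\<^sup>T ** 1\<^sub>m n)
      = (1\<^sub>m n ** pairing n) * msum (n * n * n) (1 * n) (\<lambda>i. (u i ** u i) ** 1\<^sub>m n) {0..<n}"
    unfolding co using msum_tensor[of "{0..<n}" "\<lambda>i. u i ** u i" "n * n" 1 "1\<^sub>m n"] cu by simp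
  also have "\<dots> = msum n n (\<lambda>i. (1\<^sub>m n ** pairing n) * ((u i ** u i) ** 1\<^sub>m n)) {0..<n}"
    using mult_msum[of "{0..<n}" "\<lambda>i. (u i ** u i) ** 1\<^sub>m n" "n * n * n" "1 * n" "1\<^sub>m n ** pairing n"]
      tensor_mat_carrier[OF cu one_carrier_mat] by (simp add: mult.assoc)
  also have "\<dots> = msum n n (\<lambda>i. u i * (u i)\<^sup>T) {0..<n}"
    using pu uu by (intro msum_cong) (auto simp: tensor_mat_assoc tensor_mat_mult)
  finally show "(1\<^sub>m n ** pairing n) * ((pairing n)\<^sup>T ** 1\<^sub>m n) = 1\<^sub>m n"
    by (simp add: one)
  have "(pairing n ** 1\<^sub>m n) * (1\<^sub>m n ** (pairing n)\<^sup>T)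
      = (pairing n ** 1\<^sub>m n) * msum (n * (n * n)) (n * 1) (\<lambda>i. 1\<^sub>m n ** u i ** u i) {0..<n}"
    unfolding co using tensor_msum[of "{0..<n}" "\<lambda>i. u i ** u i" "n * n" 1 "1\<^sub>m n"] cu by simp
  also have "\<dots> = msum n n (\<lambda>i. (pairing n ** 1\<^sub>m n) * (1\<^sub>m n ** u i ** u i)) {0..<n}"
    using mult_msum[of "{0..<n}" "\<lambda>i. 1\<^sub>m n ** u i ** u i" "n * (n * n)" "n * 1" "pairing n ** 1\<^sub>m n"]
      tensor_mat_carrier[OF one_carrier_mat[of n] cu] by (simp add: mult.assoc)
  also have "\<dots> = msum n n (\<lambda>i. u i * (u i)\<^sup>T) {0..<n}"
  proof (rule msum_cong[OF refl])
    fix i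
    assume "i \<in> {0..<n}"
    then have "((pairing n ** 1\<^sub>m n) * ((1\<^sub>m n ** u i) ** u i)) = (u i)\<^sup>T ** u i"
      using pu'[of i] by (subst tensor_mat_mult) simp_all
    then show "(pairing n ** 1\<^sub>m n) * (1\<^sub>m n ** u i ** u i) = u i * (u i)\<^sup>T"
      by (simp add: tensor_mat_assoc uu)
  qed
  finally show "(pairing n ** 1\<^sub>m n) * (1\<^sub>m n ** (pairing n)\<^sup>T) = 1\<^sub>m n"
    by (simp add: one)
qed

subsection \<open>Biproducts of vector spaces\<close>

lemma biproduct_exists:
  obtains i1 i2 p1 p2 :: "complex mat"
  where "dim_row i1 = n + m" "dim_col i1 = n" "dim_row i2 = n + m" "dim_col i2 = m"
    "dim_row p1 = n" "dim_col p1 = n + m" "dim_row p2 = m" "dim_col p2 = n + m"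
    "p1 * i1 = 1\<^sub>m n" "p2 * i2 = 1\<^sub>m m" "p1 * i2 = 0\<^sub>m n m" "p2 * i1 = 0\<^sub>m m n"
    "i1 * p1 + i2 * p2 = 1\<^sub>m (n + m)"
proof -
  define i1 :: "complex mat" where "i1 = mat (n + m) n (\<lambda>(k, l). if k = l then 1 else 0)"
  define i2 :: "complex mat" where "i2 = mat (n + m) m (\<lambda>(k, l). if k = n + l then 1 else 0)"
  have s: "(\<Sum>k\<in>{0..<n + m}. (if k = x then 1 else 0) * (if k = y then 1 else 0)) = (if x = y then 1 else (0::complex))"
    if "x < n + m" for x y
  proof -
    have "(\<Sum>k\<in>{0..<n + m}. (if k = x then 1 else 0) * (if k = y then 1 else 0))
        = (\<Sum>k\<in>{0..<n + m}. if k = x then if x = y then 1 else (0::complex) else 0)"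
      by (intro sum.cong) auto
    then show ?thesis
      using that by simp
  qed
  show thesis
  proof (rule that[of i1 i2 "i1\<^sup>T" "i2\<^sup>T"])
    show "i1\<^sup>T * i1 = 1\<^sub>m n" "i2\<^sup>T * i2 = 1\<^sub>m m" "i1\<^sup>T * i2 = 0\<^sub>m n m" "i2\<^sup>T * i1 = 0\<^sub>m m n"
      by (rule eq_matI, auto simp: i1_def i2_def scalar_prod_def s)+
    show "i1 * i1\<^sup>T + i2 * i2\<^sup>T = 1\<^sub>m (n + m)"
    proof (rule eq_matI)
      fix i j
      assume "i < dim_row (1\<^sub>m (n + m) :: complex mat)" "j < dim_col (1\<^sub>m (n + m) :: complex mat)"
      then have ij: "i < n + m" "j < n + m"
        by simp_all
      have "(\<Sum>k\<in>{0..<n}. (if i = k then 1 else 0) * (if j = k then 1 else 0))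
          = (\<Sum>k\<in>{0..<n}. if k = i then if i = j then 1 else (0::complex) else 0)"
        by (intro sum.cong) auto
      moreover have "(\<Sum>k\<in>{0..<m}. (if i = n + k then 1 else 0) * (if j = n + k then 1 else 0))
          = (\<Sum>k\<in>{0..<m}. if k = i - n then if i = j \<and> n \<le> i then 1 else (0::complex) else 0)"
        by (intro sum.cong) auto
      ultimately show "(i1 * i1\<^sup>T + i2 * i2\<^sup>T) $$ (i, j) = 1\<^sub>m (n + m) $$ (i, j)"
        using ij by (auto simp: i1_def i2_def scalar_prod_def)
    qed (simp_all add: i1_def i2_def)
  qed (simp_all add: i1_def i2_def)
qed

section \<open>Braiding, direct sums and duals of graded representations\<close>

context finite_group
begin

lemma RepD_braid [simp]: "braid (RepD G) = double_braiding G"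
  by (simp add: RepD_def)

text \<open>Multiplying \<open>A * X = Y * A\<close> by the inverse on both sides gives
  \<open>B * Y = X * B\<close>; this is applied to the action and to every projection.\<close>

lemma inverse_mor_RepD:
  assumes V: "is_graded_rep G V" and W: "is_graded_rep G W" and A: "A \<in> mor (RepD G) V W"
    and B: "B \<in> carrier_mat (rdim V) (rdim W)" "B * A = 1\<^sub>m (rdim V)" "A * B = 1\<^sub>m (rdim W)"
  shows "B \<in> mor (RepD G) W V"
proof -
  note A' = A[unfolded mor_RepD_iff[OF V W]]
  note dA = intertwinersD(2,3)[OF conjunct1[OF A']] and dB = carrier_matD[OF B(1)]
  have *: "B * Y = X * B" if "A * X = Y * A" "X \<in> carrier_mat (rdim V) (rdim V)" "Y \<in> carrier_mat (rdim W) (rdim W)" for X Y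
  proof -
    have "B * Y = B * (Y * A) * B"
      using that(2,3) dA dB B(3) by (simp add: mat_mult_assoc)
    also have "\<dots> = X * B"
      unfolding that(1)[symmetric] using that(2,3) dA dB by (simp add: mat_cancel[OF B(2)])
    finally show ?thesis .
  qed
  show ?thesis
    unfolding mor_RepD_iff[OF W V] intertwiners_def
    using B(1) * A' intertwinersD(4)[OF conjunct1[OF A']] is_repD(2)[OF proj_facts(1)[OF V]] is_repD(2)[OF proj_facts(1)[OF W]]
      proj_familyD(2)[OF proj_facts(2)[OF V]] proj_familyD(2)[OF proj_facts(2)[OF W]] by auto
qed

text \<open>That the braiding preserves the grading is its naturality with respect to the half-braiding
  of the second factor, which is a morphism of representations.\<close>

lemma hb_mor_RepD:
  assumes V: "is_graded_rep G V" and W: "is_graded_rep G W"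
  shows "hb (rdim V) (proj V) W \<in> mor (RepD G) (teno (RepD G) V W) (teno (RepD G) W V)"
proof (rule mor_hbI[OF RepD_tensor(1)[OF V W] RepD_tensor(1)[OF W V]])
  let ?N = "card (carrier G)" and ?n = "rdim V" and ?m = "rdim W"
  let ?hV = "hb ?n (proj V)" and ?hW = "hb ?m (proj W)"
  note fV = proj_facts[OF V] and fW = proj_facts[OF W]
  show "?hV W \<in> intertwiners G (teno (RepD G) V W) (teno (RepD G) W V)"
    by (rule hb_intertwiner[OF fV(1) fW(1) fV(2)]) simp_all
  define WR RW where "WR = teno (Rep G) (trunc W) reg" and "RW = teno (Rep G) reg (trunc W)"
  have r: "is_rep G WR" "is_rep G RW"
    unfolding WR_def RW_def by (rule tensor_rep[of "trunc W" reg] tensor_rep[of reg "trunc W"], use fW reg_rep in simp_all)+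
  have hWi: "?hW reg \<in> intertwiners G WR RW"
    using hb_intertwiner[OF fW(1) reg_rep fW(2), of WR RW] by (simp add: WR_def RW_def)
  have 1: "?hV RW = (1\<^sub>m ?N ** ?hV W) * (?hV reg ** 1\<^sub>m ?m)"
    using hb_tensor[of reg "trunc W" V "proj V" ?n RW] reg_rep fW(1) fV(2) by (simp add: RW_def)
  have 2: "?hV WR = (1\<^sub>m ?m ** ?hV reg) * (?hV W ** 1\<^sub>m ?N)"
    using hb_tensor[of "trunc W" reg V "proj V" ?n WR] reg_rep fW(1) fV(2) by (simp add: WR_def)
  have nat: "(?hW reg ** 1\<^sub>m ?n) * ?hV WR = ?hV RW * (1\<^sub>m ?n ** ?hW reg)"
    by (rule hb_natural[OF r hWi proj_familyD(2)[OF fV(2)]])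
  have "(1\<^sub>m ?N ** ?hV W) * hb (?n * ?m) (proj (teno (RepD G) V W)) reg
      = (1\<^sub>m ?N ** ?hV W) * (?hV reg ** 1\<^sub>m ?m) * (1\<^sub>m ?n ** ?hW reg)"
    unfolding RepD_tensor(2)[OF V W reg_rep] by (simp add: mat_mult_assoc mult_ac)
  also have "\<dots> = (?hW reg ** 1\<^sub>m ?n) * ((1\<^sub>m ?m ** ?hV reg) * (?hV W ** 1\<^sub>m ?N))"
    using nat unfolding 1 2 by simp
  also have "\<dots> = hb (?m * ?n) (proj (teno (RepD G) W V)) reg * (?hV W ** 1\<^sub>m ?N)"
    unfolding RepD_tensor(2)[OF W V reg_rep] by (simp add: mat_mult_assoc mult_ac)
  finally show "(1\<^sub>m ?N ** ?hV W) * hb (rdim (teno (RepD G) V W)) (proj (teno (RepD G) V W)) reg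
      = hb (rdim (teno (RepD G) W V)) (proj (teno (RepD G) W V)) reg * (?hV W ** 1\<^sub>m ?N)"
    by simp
qed

text \<open>With the braiding equal to \<open>hb\<close>, one hexagon is compatibility of a half
  braiding with tensor products of test objects, and the other is the formula for the half braiding
  on a tensor product.\<close>

lemma braided_matcat_RepD: "braided_matcat (RepD G) rdim"
proof -
  interpret matcat "RepD G" rdim
    by (rule matcat_RepD)
  show ?thesis
  proof
    fix X Y Z X' Y' :: "'a graded_rep" and f g
    assume "X \<in> obj (RepD G)" "Y \<in> obj (RepD G)"
    then have X: "is_graded_rep G X" and Y: "is_graded_rep G Y"
      by simp_all
    note fX = proj_facts[OF X] and fY = proj_facts[OF Y]
    obtain B where "B \<in> carrier_mat (rdim X * rdim Y) (rdim Y * rdim X)"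
      "B * hb (rdim X) (proj X) Y = 1\<^sub>m (rdim X * rdim Y)" "hb (rdim X) (proj X) Y * B = 1\<^sub>m (rdim Y * rdim X)"
      using hb_inverse[OF fY(1) fX(2) refl] by blast
    then show "\<exists>g. inverse_mor (RepD G) (teno (RepD G) X Y) (teno (RepD G) Y X) (braid (RepD G) X Y) g"
      using hb_mor_RepD[OF X Y] inverse_mor_RepD[OF RepD_tensor(1)[OF X Y] RepD_tensor(1)[OF Y X] hb_mor_RepD[OF X Y]]
      by (auto simp: inverse_mor_iff double_braiding_eq[OF X Y])
  next
    fix X X' Y Y' :: "'a graded_rep" and f g
    assume "X \<in> obj (RepD G)" "X' \<in> obj (RepD G)" "Y \<in> obj (RepD G)" "Y' \<in> obj (RepD G)"
      and f: "f \<in> mor (RepD G) X X'" and g: "g \<in> mor (RepD G) Y Y'"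
    then have X: "is_graded_rep G X" and X': "is_graded_rep G X'" and Y: "is_graded_rep G Y" and Y': "is_graded_rep G Y'"
      by simp_all
    note fX = proj_facts[OF X] and fX' = proj_facts[OF X'] and fY = proj_facts[OF Y] and fY' = proj_facts[OF Y']
    note d = mor_dim[OF f] mor_dim[OF g]
    have "(g ** f) * hb (rdim X) (proj X) Y = (g ** 1\<^sub>m (rdim X')) * ((1\<^sub>m (rdim Y) ** f) * hb (rdim X) (proj X) Y)"
      using d by (simp add: tensor_mat_mult flip: mat_mult_assoc)
    also have "\<dots> = (g ** 1\<^sub>m (rdim X')) * hb (rdim X') (proj X') Y * (f ** 1\<^sub>m (rdim Y))"
      using mor_hb[OF X X' f fY(1)] d by (simp add: mat_mult_assoc)
    also have "\<dots> = hb (rdim X') (proj X') Y' * ((1\<^sub>m (rdim X') ** g) * (f ** 1\<^sub>m (rdim Y)))"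
      using hb_natural[OF fY(1) fY'(1) mor_intertwiner[OF g] proj_familyD(2)[OF fX'(2)]] d by (simp add: mat_mult_assoc)
    also have "(1\<^sub>m (rdim X') ** g) * (f ** 1\<^sub>m (rdim Y)) = f ** g"
      using d by (simp add: tensor_mat_mult)
    finally show "(g ** f) * braid (RepD G) X Y = braid (RepD G) X' Y' * (f ** g)"
      by (simp add: double_braiding_eq X Y X' Y')
  next
    fix X Y Z :: "'a graded_rep"
    assume "X \<in> obj (RepD G)" "Y \<in> obj (RepD G)" "Z \<in> obj (RepD G)"
    then have X: "is_graded_rep G X" and Y: "is_graded_rep G Y" and Z: "is_graded_rep G Z"
      by simp_all
    note fX = proj_facts[OF X] and fY = proj_facts[OF Y] and fZ = proj_facts[OF Z]
    show "braid (RepD G) X (teno (RepD G) Y Z)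
        = (1\<^sub>m (rdim Y) ** braid (RepD G) X Z) * (braid (RepD G) X Y ** 1\<^sub>m (rdim Z))"
      using hb_tensor[OF fY(1) fZ(1) fX(2) refl, of "teno (RepD G) Y Z"]
      by (simp add: double_braiding_eq X Y Z RepD_tensor(1))
    show "braid (RepD G) (teno (RepD G) X Y) Z
        = (braid (RepD G) X Z ** 1\<^sub>m (rdim Y)) * (1\<^sub>m (rdim X) ** braid (RepD G) Y Z)"
      using RepD_tensor(2)[OF X Y fZ(1)] by (simp add: double_braiding_eq X Y Z RepD_tensor(1))
  next
    fix X :: "'a graded_rep"
    assume "X \<in> obj (RepD G)"
    then have X: "is_graded_rep G X"
      by simp
    show "braid (RepD G) (unito (RepD G)) X = 1\<^sub>m (rdim X)"
      using hb_RepD_unit[OF proj_facts(1)[OF X]] by (simp add: double_braiding_eq X RepD_unit(1))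
    show "braid (RepD G) X (unito (RepD G)) = 1\<^sub>m (rdim X)"
      using hb_unit[OF proj_facts(2)[OF X] refl, of "unito (RepD G)"] by (simp add: double_braiding_eq X RepD_unit(1))
  qed
qed

definition graded :: "nat \<Rightarrow> ('a \<Rightarrow> complex mat) \<Rightarrow> ('a \<Rightarrow> complex mat) \<Rightarrow> 'a graded_rep" where
  "graded n \<rho> P = \<lparr>rdim = n, ract = \<rho>, rgrd = (\<lambda>g\<in>carrier G. fix_space n (P g))\<rparr>"

lemma graded_facts:
  assumes "is_rep G V" "proj_family V P" "rdim V = n" "ract V = \<rho>"
  shows "is_graded_rep G (graded n \<rho> P)" "proj (graded n \<rho> P) = P"
proof -
  have "is_rep G (graded n \<rho> P)" "proj_family (graded n \<rho> P) P"
    using assms unfolding is_rep_iff[OF group_axioms] proj_family_def graded_def by auto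
  from proj_eq[OF this] show "is_graded_rep G (graded n \<rho> P)" "proj (graded n \<rho> P) = P"
    by (auto simp: graded_def)
qed

lemma graded_sel [simp]: "rdim (graded n \<rho> P) = n" "ract (graded n \<rho> P) = \<rho>"
  by (simp_all add: graded_def)

lemma RepD_direct_sum_exists:
  assumes V: "is_graded_rep G V" and W: "is_graded_rep G W"
  shows "\<exists>S i1 i2 p1 p2. is_direct_sum (RepD G) V W S i1 i2 p1 p2"
proof -
  interpret matcat "RepD G" rdim
    by (rule matcat_RepD)
  let ?n = "rdim V" and ?m = "rdim W"
  note fV = proj_facts[OF V] and fW = proj_facts[OF W]
  note rV = is_repD[OF fV(1)] and rW = is_repD[OF fW(1)] and P = proj_familyD[OF fV(2)] and Q = proj_familyD[OF fW(2)]
  obtain i1 i2 p1 p2 :: "complex mat"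
    where d: "dim_row i1 = ?n + ?m" "dim_col i1 = ?n" "dim_row i2 = ?n + ?m" "dim_col i2 = ?m"
    "dim_row p1 = ?n" "dim_col p1 = ?n + ?m" "dim_row p2 = ?m" "dim_col p2 = ?n + ?m"
    and e: "p1 * i1 = 1\<^sub>m ?n" "p2 * i2 = 1\<^sub>m ?m" "p1 * i2 = 0\<^sub>m ?n ?m" "p2 * i1 = 0\<^sub>m ?m ?n"
    and one: "i1 * p1 + i2 * p2 = 1\<^sub>m (?n + ?m)"
    using biproduct_exists[of ?n ?m] .
  \<comment> \<open>The block diagonal matrix with blocks \<open>A\<close> and \<open>B\<close>,
    expressed through injections and projections so that products need no block indices.\<close>
  define ds where "ds A B = i1 * (A * p1) + i2 * (B * p2)" for A B
  have dds: "dim_row (ds A B) = ?n + ?m" "dim_col (ds A B) = ?n + ?m" for A B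
    using d by (simp_all add: ds_def)
  have e': "p1 * (i1 * X) = X" "p1 * (i2 * Y) = 0\<^sub>m ?n (dim_col Y)" "p2 * (i2 * Y) = Y" "p2 * (i1 * X) = 0\<^sub>m ?m (dim_col X)"
    if "dim_row X = ?n" "dim_row Y = ?m" for X Y
    using that d e by (simp_all flip: mat_mult_assoc)
  have ds_mult: "ds A B * ds A' B' = ds (A * A') (B * B')"
    if "A \<in> carrier_mat ?n ?n" "B \<in> carrier_mat ?m ?m" "A' \<in> carrier_mat ?n ?n" "B' \<in> carrier_mat ?m ?m" for A B A' B'
    using carrier_matD[OF that(1)] carrier_matD[OF that(2)] carrier_matD[OF that(3)] carrier_matD[OF that(4)] d
    by (simp add: ds_def mat_add_mult mat_mult_add mat_mult_assoc e')
  have ds_i: "ds A B * i1 = i1 * A" "ds A B * i2 = i2 * B" "p1 * ds A B = A * p1" "p2 * ds A B = B * p2"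
    if "A \<in> carrier_mat ?n ?n" "B \<in> carrier_mat ?m ?m" for A B
    using carrier_matD[OF that(1)] carrier_matD[OF that(2)] d e
    by (simp_all add: ds_def mat_add_mult mat_mult_add mat_mult_assoc e')
  have ds_one: "ds (1\<^sub>m ?n) (1\<^sub>m ?m) = 1\<^sub>m (?n + ?m)"
    using d one by (simp add: ds_def)
  have ds_zero: "ds (0\<^sub>m ?n ?n) (0\<^sub>m ?m ?m) = 0\<^sub>m (?n + ?m) (?n + ?m)"
    using d by (simp add: ds_def)
  define \<rho> R where "\<rho> = (\<lambda>g\<in>carrier G. ds (ract V g) (ract W g))" and "R = (\<lambda>g\<in>carrier G. ds (proj V g) (proj W g))"
  define U :: "'a rep" where "U = \<lparr>rdim = ?n + ?m, ract = \<rho>\<rparr>"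
  have U: "is_rep G U"
    unfolding is_rep_iff[OF group_axioms] U_def \<rho>_def
    using rV rW dds ds_one by (auto simp: ds_mult intro!: carrier_matI)
  have "msum (?n + ?m) (?n + ?m) R (carrier G)
      = msum (?n + ?m) (?n + ?m) (\<lambda>g. i1 * (proj V g * p1) + i2 * (proj W g * p2)) (carrier G)"
    by (rule msum_cong) (auto simp: R_def ds_def)
  also have "\<dots> = msum (?n + ?m) (?n + ?m) (\<lambda>g. i1 * (proj V g * p1)) (carrier G)
      + msum (?n + ?m) (?n + ?m) (\<lambda>g. i2 * (proj W g * p2)) (carrier G)"
    by (rule msum_add) (use d in \<open>auto intro!: carrier_matI\<close>)
  also have "msum (?n + ?m) (?n + ?m) (\<lambda>g. i1 * (proj V g * p1)) (carrier G) = i1 * (msum ?n ?n (proj V) (carrier G) * p1)"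
    using mult_msum[of "carrier G" "\<lambda>g. proj V g * p1" ?n "?n + ?m" i1] msum_mult[of "carrier G" "proj V" ?n ?n p1]
      P(2,3) d by (simp add: carrier_mat_iff del: carrier_matD)
  also have "msum (?n + ?m) (?n + ?m) (\<lambda>g. i2 * (proj W g * p2)) (carrier G) = i2 * (msum ?m ?m (proj W) (carrier G) * p2)"
    using mult_msum[of "carrier G" "\<lambda>g. proj W g * p2" ?m "?n + ?m" i2] msum_mult[of "carrier G" "proj W" ?m ?m p2]
      Q(2,3) d by (simp add: carrier_mat_iff del: carrier_matD)
  finally have R1: "msum (?n + ?m) (?n + ?m) R (carrier G) = 1\<^sub>m (?n + ?m)"
    using P(6) Q(6) d one by simp
  have R: "proj_family U R"
    unfolding proj_family_def U_def rep.simps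
  proof (intro conjI ballI)
    show "R g * R h = (if g = h then R g else 0\<^sub>m (?n + ?m) (?n + ?m))" if "g \<in> carrier G" "h \<in> carrier G" for g h
      using that P(2,5) Q(2,5) ds_zero by (simp add: R_def ds_mult)
    show "\<rho> g * R h = R (g \<otimes> h \<otimes> inv g) * \<rho> g" if "g \<in> carrier G" "h \<in> carrier G" for g h
      using that P(2,7) Q(2,7) rV(2) rW(2) by (simp add: R_def \<rho>_def ds_mult)
  qed (use R1 dds in \<open>auto simp: R_def intro!: carrier_matI\<close>)
  define S where "S = graded (?n + ?m) \<rho> R"
  have S: "is_graded_rep G S" "proj S = R"
    unfolding S_def by (rule graded_facts[OF U R]; simp add: U_def)+
  have "i1 \<in> mor (RepD G) V S" "i2 \<in> mor (RepD G) W S" "p1 \<in> mor (RepD G) S V" "p2 \<in> mor (RepD G) S W"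
    unfolding mor_RepD_iff[OF V S(1)] mor_RepD_iff[OF W S(1)] mor_RepD_iff[OF S(1) V] mor_RepD_iff[OF S(1) W]
      intertwiners_def S(2) using d rV(2) rW(2) P(2) Q(2)
    by (auto simp: S_def R_def \<rho>_def ds_i intro!: carrier_matI)
  then have "is_direct_sum (RepD G) V W S i1 i2 p1 p2"
    using S(1) e one by (simp add: is_direct_sum_iff S_def)
  then show ?thesis
    by blast
qed

text \<open>The contragredient representation, its degree \<open>g\<close> component being dual to
  the component of degree \<open>inv g\<close>. The pairing is homogeneous because components whose
  degrees are not mutually inverse are orthogonal under it.\<close>

lemma RepD_dual_exists:
  assumes V: "is_graded_rep G V"
  shows "\<exists>V' b c. is_dual (RepD G) V V' b c"
proof -
  interpret matcat "RepD G" rdim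
    by (rule matcat_RepD)
  let ?n = "rdim V"
  note fV = proj_facts[OF V]
  note r = is_repD[OF fV(1)] and P = proj_familyD[OF fV(2)]
  define \<rho> Q where "\<rho> = (\<lambda>g\<in>carrier G. (ract V (inv g))\<^sup>T)" and "Q = (\<lambda>g\<in>carrier G. (proj V (inv g))\<^sup>T)"
  define U :: "'a rep" where "U = \<lparr>rdim = ?n, ract = \<rho>\<rparr>"
  have "ract V (inv (g \<otimes> h)) = ract V (inv h) * ract V (inv g)" if "g \<in> carrier G" "h \<in> carrier G" for g h
    using that r(5) by (simp add: inv_mult_group)
  then have U: "is_rep G U"
    unfolding is_rep_iff[OF group_axioms] U_def \<rho>_def
    using r by (auto simp: mat_transpose_mult intro!: carrier_matI)
  have b: "bij_betw (\<lambda>g. inv g) (carrier G) (carrier G)"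
    by (rule bij_betw_byWitness[where f' = "\<lambda>g. inv g"]) auto
  have "msum ?n ?n Q (carrier G) = msum ?n ?n (\<lambda>g. (proj V (inv g))\<^sup>T) (carrier G)"
    by (rule msum_cong) (auto simp: Q_def)
  also have "\<dots> = msum ?n ?n (\<lambda>g. (proj V g)\<^sup>T) (carrier G)"
    using msum_reindex[OF b, of ?n ?n "\<lambda>g. (proj V g)\<^sup>T"] by simp
  also have "\<dots> = 1\<^sub>m ?n"
    using msum_transpose[of "carrier G" "proj V" ?n ?n] P(2,6) by simp
  finally have Q1: "msum ?n ?n Q (carrier G) = 1\<^sub>m ?n" .
  have Q2: "Q g * Q h = (if g = h then Q g else 0\<^sub>m ?n ?n)" if g: "g \<in> carrier G" and h: "h \<in> carrier G" for g h
  proof -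
    have "inv h = inv g \<longleftrightarrow> g = h"
      by (metis g h inv_inv)
    then have "proj V (inv h) * proj V (inv g) = (if g = h then proj V (inv g) else 0\<^sub>m ?n ?n)"
      using P(5)[of "inv h" "inv g"] g h by simp
    then have "(proj V (inv h) * proj V (inv g))\<^sup>T = (if g = h then (proj V (inv g))\<^sup>T else 0\<^sub>m ?n ?n)"
      by simp
    then show ?thesis
      using g h P(3)[of "inv g"] P(4)[of "inv h"] by (simp add: Q_def mat_transpose_mult)
  qed
  have Q3: "\<rho> g * Q h = Q (g \<otimes> h \<otimes> inv g) * \<rho> g" if g: "g \<in> carrier G" and h: "h \<in> carrier G" for g h
  proof -
    have 1: "inv (g \<otimes> h \<otimes> inv g) = g \<otimes> inv h \<otimes> inv g"
      using g h by (simp add: inv_mult_group m_assoc)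
    have "inv g \<otimes> (g \<otimes> inv h \<otimes> inv g) = inv g \<otimes> g \<otimes> inv h \<otimes> inv g"
      using g h m_assoc[of "inv g" g "inv h \<otimes> inv g"] by (simp add: m_assoc)
    then have "inv g \<otimes> (g \<otimes> inv h \<otimes> inv g) \<otimes> inv (inv g) = inv h"
      using g h by (simp add: m_assoc)
    then have 2: "ract V (inv g) * proj V (g \<otimes> inv h \<otimes> inv g) = proj V (inv h) * ract V (inv g)"
      using P(7)[of "inv g" "g \<otimes> inv h \<otimes> inv g"] g h by simp
    have "(ract V (inv g))\<^sup>T * (proj V (inv h))\<^sup>T = (proj V (inv h) * ract V (inv g))\<^sup>T"
      using g h P(4)[of "inv h"] r(3)[of "inv g"] by (simp add: mat_transpose_mult)
    also have "\<dots> = (ract V (inv g) * proj V (g \<otimes> inv h \<otimes> inv g))\<^sup>T"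
      by (simp only: 2)
    also have "\<dots> = (proj V (g \<otimes> inv h \<otimes> inv g))\<^sup>T * (ract V (inv g))\<^sup>T"
      using g h P(3)[of "g \<otimes> inv h \<otimes> inv g"] r(4)[of "inv g"] by (simp add: mat_transpose_mult)
    finally show ?thesis
      using g h 1 by (simp add: \<rho>_def Q_def)
  qed
  have Q: "proj_family U Q"
    unfolding proj_family_def U_def rep.simps
    using Q1 Q2 Q3 P(3,4) by (auto simp: Q_def intro!: carrier_matI)
  define V' where "V' = graded ?n \<rho> Q"
  have V': "is_graded_rep G V'" "proj V' = Q"
    unfolding V'_def by (rule graded_facts[OF U Q]; simp add: U_def)+
  have rV': "rdim V' = ?n" "ract V' = \<rho>"
    by (simp_all add: V'_def)
  note T1 = RepD_tensor[OF V'(1) V] and T2 = RepD_tensor[OF V V'(1)]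
  note f' = proj_facts[OF V'(1)]
  have dQ: "dim_row (Q g) = ?n" "dim_col (Q g) = ?n" if "g \<in> carrier G" for g
    using that P(3,4) by (simp_all add: Q_def)
  have inv: "ract V (inv g) * ract V g = 1\<^sub>m ?n" "ract V g * ract V (inv g) = 1\<^sub>m ?n" if "g \<in> carrier G" for g
    using that r(5)[of g "inv g"] r(5)[of "inv g" g] r(6) by simp_all
  have z: "proj V (inv h) * proj V k = 0\<^sub>m ?n ?n" "proj V k * proj V (inv h) = 0\<^sub>m ?n ?n"
    if "h \<in> carrier G" "k \<in> carrier G" "h \<otimes> k \<noteq> \<one>" for h k
  proof -
    have "inv h \<noteq> k"
      using that by auto
    then show "proj V (inv h) * proj V k = 0\<^sub>m ?n ?n" "proj V k * proj V (inv h) = 0\<^sub>m ?n ?n"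
      using P(5) that by auto
  qed
  let ?nn = "?n * ?n"
  have pc: "proj (teno (RepD G) V' V) g \<in> carrier_mat ?nn ?nn" "proj (teno (RepD G) V V') g \<in> carrier_mat ?nn ?nn"
    if "g \<in> carrier G" for g
    using proj_familyD(2)[OF proj_facts(2)[OF T1(1)] that] proj_familyD(2)[OF proj_facts(2)[OF T2(1)] that] rV' by simp_all
  note dpc = carrier_matD[OF pc(1)] carrier_matD[OF pc(2)]
  have s1: "proj (teno (RepD G) V' V) g = msum ?nn ?nn (\<lambda>h. msum ?nn ?nn
      (\<lambda>k. if g = h \<otimes> k then Q h ** proj V k else 0\<^sub>m ?nn ?nn) (carrier G)) (carrier G)" if "g \<in> carrier G" for g
    using tensor_proj_sum[OF f'(1) fV(1) f'(2) fV(2), of "proj (teno (RepD G) V' V)" g] pc(1) that T1(2)[OF reg_rep] rV' V'(2)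
    by (simp cong: if_cong)
  have s2: "proj (teno (RepD G) V V') g = msum ?nn ?nn (\<lambda>h. msum ?nn ?nn
      (\<lambda>k. if g = h \<otimes> k then proj V h ** Q k else 0\<^sub>m ?nn ?nn) (carrier G)) (carrier G)" if "g \<in> carrier G" for g
    using tensor_proj_sum[OF fV(1) f'(1) fV(2) f'(2), of "proj (teno (RepD G) V V')" g] pc(2) that T2(2)[OF reg_rep] rV' V'(2)
    by (simp cong: if_cong)
  have ms0: "msum a b (\<lambda>_. 0\<^sub>m a b) (carrier G) = 0\<^sub>m a b" for a b
    by (rule eq_matI) (auto simp: index_msum)
  have one_sum: "A = B" if "msum a b f (carrier G) = A" "\<And>g. g \<in> carrier G \<Longrightarrow> g \<noteq> \<one> \<Longrightarrow> f g = 0\<^sub>m a b" "f \<one> = B" "B \<in> carrier_mat a b"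
    for a b f and A B :: "complex mat"
    using msum_delta[OF finite_carrier one_closed, of f a b] that by simp
  \<comment> \<open>For \<open>g\<close> other than the unit, \<open>g = h \<otimes> k\<close>
    forces \<open>inv h \<noteq> k\<close>, so the pairing kills every summand of the
    projection.\<close>
  have p0: "pairing ?n * proj (teno (RepD G) V' V) g = 0\<^sub>m 1 ?nn" if g: "g \<in> carrier G" "g \<noteq> \<one>" for g
  proof -
    have "pairing ?n * proj (teno (RepD G) V' V) g = msum 1 ?nn (\<lambda>h. pairing ?n * msum ?nn ?nn
        (\<lambda>k. if g = h \<otimes> k then Q h ** proj V k else 0\<^sub>m ?nn ?nn) (carrier G)) (carrier G)"
      unfolding s1[OF g(1)] by (subst mult_msum) auto
    also have "\<dots> = msum 1 ?nn (\<lambda>h. msum 1 ?nn (\<lambda>k. 0\<^sub>m 1 ?nn) (carrier G)) (carrier G)"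
    proof (rule msum_cong[OF refl])
      fix h
      assume h: "h \<in> carrier G"
      have "pairing ?n * msum ?nn ?nn (\<lambda>k. if g = h \<otimes> k then Q h ** proj V k else 0\<^sub>m ?nn ?nn) (carrier G)
          = msum 1 ?nn (\<lambda>k. pairing ?n * (if g = h \<otimes> k then Q h ** proj V k else 0\<^sub>m ?nn ?nn)) (carrier G)"
        using mult_msum[of "carrier G" "\<lambda>k. if g = h \<otimes> k then Q h ** proj V k else 0\<^sub>m ?nn ?nn" ?nn ?nn "pairing ?n"]
          dQ[OF h] P(3,4) by (simp add: carrier_mat_iff del: carrier_matD)
      also have "\<dots> = msum 1 ?nn (\<lambda>k. 0\<^sub>m 1 ?nn) (carrier G)"
      proof (rule msum_cong[OF refl])
        show "pairing ?n * (if g = h \<otimes> k then Q h ** proj V k else 0\<^sub>m ?nn ?nn) = 0\<^sub>m 1 ?nn" if k: "k \<in> carrier G" for k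
          using pairing_tensor_zero[of "Q h" ?n "proj V k"] z(1)[OF h k] g h k dQ[OF h] P(3,4)[OF k]
          by (auto simp: Q_def)
      qed
      finally show "pairing ?n * msum ?nn ?nn (\<lambda>k. if g = h \<otimes> k then Q h ** proj V k else 0\<^sub>m ?nn ?nn) (carrier G)
          = msum 1 ?nn (\<lambda>k. 0\<^sub>m 1 ?nn) (carrier G)" .
    qed
    finally show ?thesis
      by (simp only: ms0)
  qed
  \<comment> \<open>The same for the copairing after transposition. The order of the product is now
    reversed, so \<open>k \<otimes> h \<noteq> \<one>\<close> has to be deduced from
    \<open>h \<otimes> k \<noteq> \<one>\<close>.\<close>
  have c0: "proj (teno (RepD G) V V') g * (pairing ?n)\<^sup>T = 0\<^sub>m ?nn 1" if g: "g \<in> carrier G" "g \<noteq> \<one>" for g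
  proof -
    have "proj (teno (RepD G) V V') g * (pairing ?n)\<^sup>T = msum ?nn 1 (\<lambda>h. msum ?nn ?nn
        (\<lambda>k. if g = h \<otimes> k then proj V h ** Q k else 0\<^sub>m ?nn ?nn) (carrier G) * (pairing ?n)\<^sup>T) (carrier G)"
      unfolding s2[OF g(1)] by (subst msum_mult) auto
    also have "\<dots> = msum ?nn 1 (\<lambda>h. msum ?nn 1 (\<lambda>k. 0\<^sub>m ?nn 1) (carrier G)) (carrier G)"
    proof (rule msum_cong[OF refl])
      fix h
      assume h: "h \<in> carrier G"
      have "msum ?nn ?nn (\<lambda>k. if g = h \<otimes> k then proj V h ** Q k else 0\<^sub>m ?nn ?nn) (carrier G) * (pairing ?n)\<^sup>T
          = msum ?nn 1 (\<lambda>k. (if g = h \<otimes> k then proj V h ** Q k else 0\<^sub>m ?nn ?nn) * (pairing ?n)\<^sup>T) (carrier G)"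
        using msum_mult[of "carrier G" "\<lambda>k. if g = h \<otimes> k then proj V h ** Q k else 0\<^sub>m ?nn ?nn" ?nn ?nn "(pairing ?n)\<^sup>T"]
          dQ P(3,4)[OF h] by (simp add: carrier_mat_iff del: carrier_matD)
      also have "\<dots> = msum ?nn 1 (\<lambda>k. 0\<^sub>m ?nn 1) (carrier G)"
      proof (rule msum_cong[OF refl])
        fix k
        assume k: "k \<in> carrier G"
        have "(proj V h ** Q k) * (pairing ?n)\<^sup>T = (pairing ?n * ((proj V h)\<^sup>T ** proj V (inv k)))\<^sup>T"
          using h k P(3,4) by (simp add: mat_transpose_mult transpose_tensor_mat Q_def)
        also have "\<dots> = 0\<^sub>m ?nn 1" if "g = h \<otimes> k"
        proof -
          have "k \<otimes> h \<noteq> \<one>"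
            using inv_comm[of k h] h k that g by blast
          from z(2)[OF k h this] show ?thesis
            using pairing_tensor_zero[of "(proj V h)\<^sup>T" ?n "proj V (inv k)"] h k P(3,4) by simp
        qed
        finally show "(if g = h \<otimes> k then proj V h ** Q k else 0\<^sub>m ?nn ?nn) * (pairing ?n)\<^sup>T = 0\<^sub>m ?nn 1"
          by simp
      qed
      finally show "msum ?nn ?nn (\<lambda>k. if g = h \<otimes> k then proj V h ** Q k else 0\<^sub>m ?nn ?nn) (carrier G) * (pairing ?n)\<^sup>T
          = msum ?nn 1 (\<lambda>k. 0\<^sub>m ?nn 1) (carrier G)" .
    qed
    finally show ?thesis
      by (simp only: ms0)
  qed
  \<comment> \<open>The projections add up to the identity, and all but the one of degree
    \<open>\<one>\<close> contribute zero.\<close>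
  have p1: "pairing ?n * proj (teno (RepD G) V' V) \<one> = pairing ?n"
  proof -
    have s: "msum 1 ?nn (\<lambda>g. pairing ?n * proj (teno (RepD G) V' V) g) (carrier G) = pairing ?n"
      using mult_msum[of "carrier G" "proj (teno (RepD G) V' V)" ?nn ?nn "pairing ?n"] pc(1)
        proj_familyD(6)[OF proj_facts(2)[OF T1(1)]] rV' by simp
    show ?thesis
      by (rule sym, rule one_sum[OF s p0]) (use dpc in \<open>simp_all add: carrier_mat_iff del: carrier_matD\<close>)
  qed
  have c1: "proj (teno (RepD G) V V') \<one> * (pairing ?n)\<^sup>T = (pairing ?n)\<^sup>T"
  proof -
    have s: "msum ?nn 1 (\<lambda>g. proj (teno (RepD G) V V') g * (pairing ?n)\<^sup>T) (carrier G) = (pairing ?n)\<^sup>T"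
      using msum_mult[of "carrier G" "proj (teno (RepD G) V V')" ?nn ?nn "(pairing ?n)\<^sup>T"] pc(2)
        proj_familyD(6)[OF proj_facts(2)[OF T2(1)]] rV' by simp
    show ?thesis
      by (rule sym, rule one_sum[OF s c0]) (use dpc in \<open>simp_all add: carrier_mat_iff del: carrier_matD\<close>)
  qed
  have "pairing ?n * ((ract V (inv g))\<^sup>T ** ract V g) = pairing ?n" if g: "g \<in> carrier G" for g
    using pairing_tensor_eq[of "(ract V (inv g))\<^sup>T" ?n "ract V g" "1\<^sub>m ?n" "1\<^sub>m ?n"] g r(3,4) inv by (simp add: tensor_one_mat)
  then have "pairing ?n \<in> intertwiners G (teno (RepD G) V' V) (unito (RepD G))"
    by (auto simp: intertwiners_def rV' \<rho>_def intro!: carrier_matI)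
  then have ev: "pairing ?n \<in> mor (RepD G) (teno (RepD G) V' V) (unito (RepD G))"
    unfolding mor_RepD_iff[OF T1(1) RepD_unit(1)] using p0 p1 by (auto simp: RepD_unit(2))
  have "(ract V g ** (ract V (inv g))\<^sup>T) * (pairing ?n)\<^sup>T = (pairing ?n)\<^sup>T" if g: "g \<in> carrier G" for g
  proof -
    have "(ract V g ** (ract V (inv g))\<^sup>T) * (pairing ?n)\<^sup>T = (pairing ?n * ((ract V g)\<^sup>T ** ract V (inv g)))\<^sup>T"
      using g r(3,4) by (simp add: mat_transpose_mult transpose_tensor_mat)
    also have "pairing ?n * ((ract V g)\<^sup>T ** ract V (inv g)) = pairing ?n"
      using pairing_tensor_eq[of "(ract V g)\<^sup>T" ?n "ract V (inv g)" "1\<^sub>m ?n" "1\<^sub>m ?n"] g r(3,4) inv by (simp add: tensor_one_mat)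
    finally show ?thesis .
  qed
  then have "(pairing ?n)\<^sup>T \<in> intertwiners G (unito (RepD G)) (teno (RepD G) V V')"
    by (auto simp: intertwiners_def rV' \<rho>_def intro!: carrier_matI)
  then have coev: "(pairing ?n)\<^sup>T \<in> mor (RepD G) (unito (RepD G)) (teno (RepD G) V V')"
    unfolding mor_RepD_iff[OF RepD_unit(1) T2(1)] using c0 c1 by (auto simp: RepD_unit(2))
  have "is_dual (RepD G) V V' (pairing ?n) (pairing ?n)\<^sup>T"
    using V V' ev coev pairing_zigzag[of ?n] by (simp add: is_dual_iff rV')
  then show ?thesis
    by blast
qed

lemma witt_matcat_RepD: "witt_matcat (RepD G) rdim"
proof -
  interpret braided_matcat "RepD G" rdim
    by (rule braided_matcat_RepD)
  show ?thesis
    by unfold_locales (use RepD_dual_exists RepD_direct_sum_exists in auto)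
qed

end

section \<open>Transporting half braidings along a monoidal equivalence\<close>

lemma mat_assoc_eq:
  fixes A :: "'a :: semiring_0 mat"
  assumes "A * B = A' * B'" "dim_col A = dim_row B" "dim_col A' = dim_row B'" "dim_col B = dim_row X" "dim_col B' = dim_row X"
  shows "A * (B * X) = A' * (B' * X)"
proof -
  have "A * (B * X) = (A * B) * X"
    by (rule mat_mult_assoc[symmetric, OF assms(2,4)])
  also have "\<dots> = A' * (B' * X)"
    unfolding assms(1) by (rule mat_mult_assoc[OF assms(3,5)])
  finally show ?thesis .
qed

lemma mat_left_cancel:
  fixes A :: "'a :: semiring_1 mat"
  assumes "A * X = A * Y" "B * A = 1\<^sub>m n" "dim_col B = dim_row A" "dim_col A = dim_row X" "dim_col A = dim_row Y"
  shows "X = Y"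
  using mat_cancel[OF assms(2,3,4)] mat_cancel[OF assms(2,3,5)] unfolding assms(1) by simp

context matcat
begin

text \<open>Half braidings in an arbitrary strict matrix category; for \<open>Rep G\<close> they
  become \<open>half_braiding\<close>.\<close>

definition half_braid :: "'o \<Rightarrow> ('o \<Rightarrow> complex mat) \<Rightarrow> bool" where
  "half_braid X \<sigma> \<longleftrightarrow>
     (\<forall>W\<in>obj C. \<sigma> W \<in> mor C (teno C X W) (teno C W X)) \<and>
     (\<forall>W\<in>obj C. \<forall>W'\<in>obj C. \<forall>f\<in>mor C W W'. (f ** 1\<^sub>m (d X)) * \<sigma> W = \<sigma> W' * (1\<^sub>m (d X) ** f)) \<and>
     (\<forall>W\<in>obj C. \<forall>W'\<in>obj C. \<sigma> (teno C W W') = (1\<^sub>m (d W) ** \<sigma> W') * (\<sigma> W ** 1\<^sub>m (d W'))) \<and>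
     \<sigma> (unito C) = 1\<^sub>m (d X)"

lemma half_braidD:
  assumes "half_braid X \<sigma>"
  shows "\<And>W. W \<in> obj C \<Longrightarrow> \<sigma> W \<in> mor C (teno C X W) (teno C W X)"
    "\<And>W W' f. W \<in> obj C \<Longrightarrow> W' \<in> obj C \<Longrightarrow> f \<in> mor C W W' \<Longrightarrow> (f ** 1\<^sub>m (d X)) * \<sigma> W = \<sigma> W' * (1\<^sub>m (d X) ** f)"
    "\<And>W W'. W \<in> obj C \<Longrightarrow> W' \<in> obj C \<Longrightarrow> \<sigma> (teno C W W') = (1\<^sub>m (d W) ** \<sigma> W') * (\<sigma> W ** 1\<^sub>m (d W'))"
    "\<sigma> (unito C) = 1\<^sub>m (d X)"
    "\<And>W. W \<in> obj C \<Longrightarrow> dim_row (\<sigma> W) = d W * d X" "\<And>W. W \<in> obj C \<Longrightarrow> dim_col (\<sigma> W) = d X * d W"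
  using assms mor_dim[of "\<sigma> _" "teno C X _" "teno C _ X"] by (auto simp: half_braid_def)

end

context matcat_equivalence
begin

text \<open>The threefold structure isomorphism of \<open>F\<close>; by \<open>J_ass\<close> it does
  not depend on the bracketing.\<close>

definition J3 :: "'o \<Rightarrow> 'o \<Rightarrow> 'o \<Rightarrow> complex mat" where
  "J3 X Y Z = J (teno C X Y) Z * (J X Y ** 1\<^sub>m (d' (fobj F Z)))"

definition J3i :: "'o \<Rightarrow> 'o \<Rightarrow> 'o \<Rightarrow> complex mat" where
  "J3i X Y Z = (Ji X Y ** 1\<^sub>m (d' (fobj F Z))) * Ji (teno C X Y) Z"

lemma J3_facts:
  assumes obj: "X \<in> obj C" "Y \<in> obj C" "Z \<in> obj C"
  shows "J3 X Y Z = J X (teno C Y Z) * (1\<^sub>m (d' (fobj F X)) ** J Y Z)"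
    "J3i X Y Z * J3 X Y Z = 1\<^sub>m (d' (fobj F X) * d' (fobj F Y) * d' (fobj F Z))"
    "dim_row (J3 X Y Z) = d' (fobj F (teno C (teno C X Y) Z))"
    "dim_col (J3 X Y Z) = d' (fobj F X) * d' (fobj F Y) * d' (fobj F Z)"
    "dim_row (J3i X Y Z) = d' (fobj F X) * d' (fobj F Y) * d' (fobj F Z)"
    "dim_col (J3i X Y Z) = d' (fobj F (teno C (teno C X Y) Z))"
proof -
  note j = J_facts[OF C.ten_obj[OF obj(1,2)] obj(3)] J_facts[OF obj(1,2)]
  show "J3 X Y Z = J X (teno C Y Z) * (1\<^sub>m (d' (fobj F X)) ** J Y Z)"
    unfolding J3_def by (rule J_ass[OF obj])
  show "J3i X Y Z * J3 X Y Z = 1\<^sub>m (d' (fobj F X) * d' (fobj F Y) * d' (fobj F Z))"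
    using j mat_cancel[OF j(3), of "J X Y ** 1\<^sub>m (d' (fobj F Z))"]
    by (simp add: J3_def J3i_def mat_mult_assoc tensor_mat_mult tensor_one_mat)
  show "dim_row (J3 X Y Z) = d' (fobj F (teno C (teno C X Y) Z))"
    "dim_col (J3 X Y Z) = d' (fobj F X) * d' (fobj F Y) * d' (fobj F Z)"
    "dim_row (J3i X Y Z) = d' (fobj F X) * d' (fobj F Y) * d' (fobj F Z)"
    "dim_col (J3i X Y Z) = d' (fobj F (teno C (teno C X Y) Z))"
    using j by (simp_all add: J3_def J3i_def)
qed

text \<open>The matrix \<open>s\<close> between tensor products of images corresponds to
  \<open>a\<close> under the structure isomorphisms of \<open>F\<close>. A relation serves both
  directions, whether \<open>a\<close> or \<open>s\<close> is given first.\<close>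

definition lifts :: "'o \<Rightarrow> 'o \<Rightarrow> 'o \<Rightarrow> 'o \<Rightarrow> complex mat \<Rightarrow> complex mat \<Rightarrow> bool" where
  "lifts X Y P Q a s \<longleftrightarrow> a \<in> mor C (teno C X Y) (teno C P Q) \<and>
     s \<in> carrier_mat (d' (fobj F P) * d' (fobj F Q)) (d' (fobj F X) * d' (fobj F Y)) \<and>
     fmor F (teno C X Y) (teno C P Q) a * J X Y = J P Q * s"

lemma liftsD:
  assumes "lifts X Y P Q a s" and obj: "X \<in> obj C" "Y \<in> obj C" "P \<in> obj C" "Q \<in> obj C"
  shows "a \<in> mor C (teno C X Y) (teno C P Q)"
    "fmor F (teno C X Y) (teno C P Q) a * J X Y = J P Q * s"
    "dim_row s = d' (fobj F P) * d' (fobj F Q)" "dim_col s = d' (fobj F X) * d' (fobj F Y)"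
    "dim_row a = d P * d Q" "dim_col a = d X * d Y"
    "dim_row (fmor F (teno C X Y) (teno C P Q) a) = d' (fobj F (teno C P Q))"
    "dim_col (fmor F (teno C X Y) (teno C P Q) a) = d' (fobj F (teno C X Y))"
proof -
  show a: "a \<in> mor C (teno C X Y) (teno C P Q)"
    using assms by (simp add: lifts_def)
  show "fmor F (teno C X Y) (teno C P Q) a * J X Y = J P Q * s"
    "dim_row s = d' (fobj F P) * d' (fobj F Q)" "dim_col s = d' (fobj F X) * d' (fobj F Y)"
    "dim_row a = d P * d Q" "dim_col a = d X * d Y"
    "dim_row (fmor F (teno C X Y) (teno C P Q) a) = d' (fobj F (teno C P Q))"
    "dim_col (fmor F (teno C X Y) (teno C P Q) a) = d' (fobj F (teno C X Y))"
    using assms C.mor_dim[OF a] fmor_dim[OF _ _ a] by (auto simp: lifts_def)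
qed

lemma lifts_left:
  assumes l: "lifts X Y P Q a s" and obj: "X \<in> obj C" "Y \<in> obj C" "P \<in> obj C" "Q \<in> obj C" "Z \<in> obj C"
  shows "fmor F (teno C (teno C X Y) Z) (teno C (teno C P Q) Z) (a ** 1\<^sub>m (d Z)) * J3 X Y Z
    = J3 P Q Z * (s ** 1\<^sub>m (d' (fobj F Z)))"
proof -
  note L = liftsD[OF l obj(1-4)]
  note o2 = C.ten_obj[OF obj(1,2)] C.ten_obj[OF obj(3,4)]
  note j = J_facts(5,6)[OF obj(1,2)] J_facts(5,6)[OF obj(3,4)] J_facts(5,6)[OF o2(1) obj(5)] J_facts(5,6)[OF o2(2) obj(5)]
  note t = fmor_dim[OF _ _ C.ten_one_mor[OF o2 obj(5) L(1)]]
  have "fmor F (teno C (teno C X Y) Z) (teno C (teno C P Q) Z) (a ** 1\<^sub>m (d Z)) * J3 X Y Z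
      = J (teno C P Q) Z * ((fmor F (teno C X Y) (teno C P Q) a ** 1\<^sub>m (d' (fobj F Z))) * (J X Y ** 1\<^sub>m (d' (fobj F Z))))"
    unfolding J3_def using L j t obj by (intro mat_assoc_eq[OF J_nat_left[OF o2 obj(5) L(1)]]) auto
  also have "\<dots> = J (teno C P Q) Z * ((J P Q ** 1\<^sub>m (d' (fobj F Z))) * (s ** 1\<^sub>m (d' (fobj F Z))))"
    using L j by (simp add: tensor_mat_mult)
  finally show ?thesis
    unfolding J3_def using L j by (simp add: mat_mult_assoc)
qed

lemma lifts_right:
  assumes l: "lifts X Y P Q a s" and obj: "X \<in> obj C" "Y \<in> obj C" "P \<in> obj C" "Q \<in> obj C" "Z \<in> obj C"
  shows "fmor F (teno C (teno C Z X) Y) (teno C (teno C Z P) Q) (1\<^sub>m (d Z) ** a) * J3 Z X Y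
    = J3 Z P Q * (1\<^sub>m (d' (fobj F Z)) ** s)"
proof -
  note L = liftsD[OF l obj(1-4)]
  note o2 = C.ten_obj[OF obj(1,2)] C.ten_obj[OF obj(3,4)]
  note j = J_facts(5,6)[OF obj(1,2)] J_facts(5,6)[OF obj(3,4)] J_facts(5,6)[OF obj(5) o2(1)] J_facts(5,6)[OF obj(5) o2(2)]
  note t = fmor_dim[OF _ _ C.one_ten_mor[OF o2 obj(5) L(1)]]
  have "fmor F (teno C Z (teno C X Y)) (teno C Z (teno C P Q)) (1\<^sub>m (d Z) ** a) * J3 Z X Y
      = J Z (teno C P Q) * ((1\<^sub>m (d' (fobj F Z)) ** fmor F (teno C X Y) (teno C P Q) a) * (1\<^sub>m (d' (fobj F Z)) ** J X Y))"
    unfolding J3_facts(1)[OF obj(5,1,2)]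
    using L j t obj by (intro mat_assoc_eq[OF J_nat_right[OF obj(5) o2(2,1) L(1)]]) auto
  also have "\<dots> = J Z (teno C P Q) * ((1\<^sub>m (d' (fobj F Z)) ** J P Q) * (1\<^sub>m (d' (fobj F Z)) ** s))"
    using L j by (simp add: tensor_mat_mult)
  finally show ?thesis
    unfolding J3_facts(1)[OF obj(5,3,4)] using L j obj by (simp add: mat_mult_assoc C.ten_assoc)
qed

text \<open>The two crossings are carried through the threefold isomorphism one after the other,
  with \<open>J3 A X B\<close> in between.\<close>

lemma lifts_hexagon:
  assumes a: "lifts X A A X a s" and b: "lifts X B B X b t" and obj: "X \<in> obj C" "A \<in> obj C" "B \<in> obj C"
  shows "fmor F (teno C (teno C X A) B) (teno C (teno C A B) X) ((1\<^sub>m (d A) ** b) * (a ** 1\<^sub>m (d B))) * J3 X A B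
    = J3 A B X * ((1\<^sub>m (d' (fobj F A)) ** t) * (s ** 1\<^sub>m (d' (fobj F B))))"
proof -
  note La = liftsD[OF a obj(1,2,2,1)] and Lb = liftsD[OF b obj(1,3,3,1)]
  let ?Fa = "fmor F (teno C (teno C X A) B) (teno C (teno C A X) B) (a ** 1\<^sub>m (d B))"
  let ?Fb = "fmor F (teno C (teno C A X) B) (teno C (teno C A B) X) (1\<^sub>m (d A) ** b)"
  have m: "a ** 1\<^sub>m (d B) \<in> mor C (teno C (teno C X A) B) (teno C (teno C A X) B)"
    "1\<^sub>m (d A) ** b \<in> mor C (teno C (teno C A X) B) (teno C (teno C A B) X)"
    using C.ten_one_mor[OF _ _ obj(3) La(1)] C.one_ten_mor[OF _ _ obj(2) Lb(1)] obj by (simp_all add: C.ten_assoc)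
  have o: "teno C (teno C X A) B \<in> obj C" "teno C (teno C A X) B \<in> obj C" "teno C (teno C A B) X \<in> obj C"
    using obj by simp_all
  note j = J3_facts(3-6)[OF obj(1,2,3)] J3_facts(3-6)[OF obj(2,1,3)] J3_facts(3-6)[OF obj(2,3,1)]
  note dm = fmor_dim[OF o(1,2) m(1)] fmor_dim[OF o(2,3) m(2)]
  have "fmor F (teno C (teno C X A) B) (teno C (teno C A B) X) ((1\<^sub>m (d A) ** b) * (a ** 1\<^sub>m (d B))) * J3 X A B
      = ?Fb * (?Fa * J3 X A B)"
    using fmor_mult[OF o m] j dm by (simp add: mat_mult_assoc)
  also have "\<dots> = ?Fb * (J3 A X B * (s ** 1\<^sub>m (d' (fobj F B))))"
    using lifts_left[OF a obj(1,2,2,1,3)] by simp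
  also have "\<dots> = J3 A B X * ((1\<^sub>m (d' (fobj F A)) ** t) * (s ** 1\<^sub>m (d' (fobj F B))))"
    by (rule mat_assoc_eq[OF lifts_right[OF b obj(1,3,3,1,2)]]) (use j dm La Lb in auto)
  finally show ?thesis .
qed

lemma lifts_hexagon':
  assumes a: "lifts X A A X a s" and b: "lifts Y A A Y b t" and obj: "X \<in> obj C" "Y \<in> obj C" "A \<in> obj C"
  shows "fmor F (teno C (teno C X Y) A) (teno C A (teno C X Y)) ((a ** 1\<^sub>m (d Y)) * (1\<^sub>m (d X) ** b)) * J3 X Y A
    = J3 A X Y * ((s ** 1\<^sub>m (d' (fobj F Y))) * (1\<^sub>m (d' (fobj F X)) ** t))"
proof -
  note La = liftsD[OF a obj(1,3,3,1)] and Lb = liftsD[OF b obj(2,3,3,2)]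
  let ?Fa = "fmor F (teno C (teno C X A) Y) (teno C (teno C A X) Y) (a ** 1\<^sub>m (d Y))"
  let ?Fb = "fmor F (teno C (teno C X Y) A) (teno C (teno C X A) Y) (1\<^sub>m (d X) ** b)"
  have m: "a ** 1\<^sub>m (d Y) \<in> mor C (teno C (teno C X A) Y) (teno C (teno C A X) Y)"
    "1\<^sub>m (d X) ** b \<in> mor C (teno C (teno C X Y) A) (teno C (teno C X A) Y)"
    using C.ten_one_mor[OF _ _ obj(2) La(1)] C.one_ten_mor[OF _ _ obj(1) Lb(1)] obj by (simp_all add: C.ten_assoc)
  have o: "teno C (teno C X Y) A \<in> obj C" "teno C (teno C X A) Y \<in> obj C" "teno C (teno C A X) Y \<in> obj C"
    using obj by simp_all
  note j = J3_facts(3-6)[OF obj(1,2,3)] J3_facts(3-6)[OF obj(3,1,2)] J3_facts(3-6)[OF obj(1,3,2)]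
  note dm = fmor_dim[OF o(2,3) m(1)] fmor_dim[OF o(1,2) m(2)]
  have "fmor F (teno C (teno C X Y) A) (teno C (teno C A X) Y) ((a ** 1\<^sub>m (d Y)) * (1\<^sub>m (d X) ** b)) * J3 X Y A
      = ?Fa * (?Fb * J3 X Y A)"
    using fmor_mult[OF o m(2,1)] j dm by (simp add: mat_mult_assoc)
  also have "\<dots> = ?Fa * (J3 X A Y * (1\<^sub>m (d' (fobj F X)) ** t))"
    using lifts_right[OF b obj(2,3,3,2,1)] by simp
  also have "\<dots> = J3 A X Y * ((s ** 1\<^sub>m (d' (fobj F Y))) * (1\<^sub>m (d' (fobj F X)) ** t))"
    by (rule mat_assoc_eq[OF lifts_left[OF a obj(1,3,3,1,2)]]) (use j dm La Lb in auto)
  finally show ?thesis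
    using obj by (simp add: C.ten_assoc)
qed

text \<open>Up to composition with \<open>J\<close>, the equation on the right is the image under
  \<open>F\<close> of the one on the left; invertibility of \<open>J\<close> and faithfulness give
  the two directions.\<close>

lemma lifts_mor:
  assumes a: "lifts X A A X a s" and b: "lifts Y A A Y b t" and obj: "X \<in> obj C" "Y \<in> obj C" "A \<in> obj C"
    and f: "f \<in> mor C X Y"
  shows "(1\<^sub>m (d A) ** f) * a = b * (f ** 1\<^sub>m (d A)) \<longleftrightarrow>
    (1\<^sub>m (d' (fobj F A)) ** fmor F X Y f) * s = t * (fmor F X Y f ** 1\<^sub>m (d' (fobj F A)))"
proof -
  note La = liftsD[OF a obj(1,3,3,1)] and Lb = liftsD[OF b obj(2,3,3,2)]
  let ?f = "fmor F X Y f"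
  note df = C.mor_dim[OF f] fmor_dim[OF obj(1,2) f]
  have m: "(1\<^sub>m (d A) ** f) * a \<in> mor C (teno C X A) (teno C A Y)" "b * (f ** 1\<^sub>m (d A)) \<in> mor C (teno C X A) (teno C A Y)"
    using C.mult_mor[OF _ _ _ C.one_ten_mor[OF obj(1,2,3) f] La(1)] C.mult_mor[OF _ _ _ Lb(1) C.ten_one_mor[OF obj f]] obj
    by simp_all
  note j = J_facts[OF obj(1,3)] J_facts[OF obj(2,3)] J_facts[OF obj(3,1)] J_facts[OF obj(3,2)]
  note t = fmor_dim[OF _ _ C.one_ten_mor[OF obj(1,2,3) f]] fmor_dim[OF _ _ C.ten_one_mor[OF obj f]]
  have "fmor F (teno C X A) (teno C A Y) ((1\<^sub>m (d A) ** f) * a) * J X A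
      = fmor F (teno C A X) (teno C A Y) (1\<^sub>m (d A) ** f) * (J A X * s)"
    using fmor_mult[OF _ _ _ La(1) C.one_ten_mor[OF obj(1,2,3) f]] obj La j t by (simp add: mat_mult_assoc)
  also have "\<dots> = J A Y * ((1\<^sub>m (d' (fobj F A)) ** ?f) * s)"
    by (rule mat_assoc_eq[OF J_nat_right[OF obj(3,2,1) f]]) (use j t df La obj in auto)
  finally have 1: "fmor F (teno C X A) (teno C A Y) ((1\<^sub>m (d A) ** f) * a) * J X A = J A Y * ((1\<^sub>m (d' (fobj F A)) ** ?f) * s)" .
  have "fmor F (teno C X A) (teno C A Y) (b * (f ** 1\<^sub>m (d A))) * J X A
      = fmor F (teno C Y A) (teno C A Y) b * (J Y A * (?f ** 1\<^sub>m (d' (fobj F A))))"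
    using fmor_mult[OF _ _ _ C.ten_one_mor[OF obj f] Lb(1)] obj Lb j t J_nat_left[OF obj f] by (simp add: mat_mult_assoc)
  also have "\<dots> = J A Y * (t * (?f ** 1\<^sub>m (d' (fobj F A))))"
    by (rule mat_assoc_eq[OF Lb(2)]) (use j t df Lb obj in auto)
  finally have 2: "fmor F (teno C X A) (teno C A Y) (b * (f ** 1\<^sub>m (d A))) * J X A = J A Y * (t * (?f ** 1\<^sub>m (d' (fobj F A))))" .
  show ?thesis
  proof
    assume "(1\<^sub>m (d A) ** f) * a = b * (f ** 1\<^sub>m (d A))"
    with 1 2 have "J A Y * ((1\<^sub>m (d' (fobj F A)) ** ?f) * s) = J A Y * (t * (?f ** 1\<^sub>m (d' (fobj F A))))"
      by simp
    then show "(1\<^sub>m (d' (fobj F A)) ** ?f) * s = t * (?f ** 1\<^sub>m (d' (fobj F A)))"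
      by (rule mat_left_cancel[OF _ J_facts(3)[OF obj(3,2)]]) (use j df La Lb in auto)
  next
    assume e: "(1\<^sub>m (d' (fobj F A)) ** ?f) * s = t * (?f ** 1\<^sub>m (d' (fobj F A)))"
    show "(1\<^sub>m (d A) ** f) * a = b * (f ** 1\<^sub>m (d A))"
    proof (rule faithful[OF _ _ m])
      have *: "M = N" if "M * J X A = N * J X A" "dim_col M = d' (fobj F (teno C X A))" "dim_col N = d' (fobj F (teno C X A))"
        for M N :: "complex mat"
        using arg_cong[OF that(1), of "\<lambda>M. M * Ji X A"] that(2,3) j by (simp add: mat_mult_assoc)
      show "fmor F (teno C X A) (teno C A Y) ((1\<^sub>m (d A) ** f) * a) = fmor F (teno C X A) (teno C A Y) (b * (f ** 1\<^sub>m (d A)))"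
        by (rule *) (use 1 2 e fmor_dim[OF _ _ m(1)] fmor_dim[OF _ _ m(2)] obj in auto)
    qed (use obj in auto)
  qed
qed

end

context matcat_equivalence
begin

text \<open>On images \<open>F A\<close> the half braiding is conjugated by \<open>J\<close>; an
  arbitrary \<open>W\<close> is isomorphic to some \<open>F A\<close>, and a second conjugation
  extends the family. Consistency needs naturality for all morphisms between images.\<close>

theorem half_braid_transport:
  assumes X: "X \<in> obj C" and \<sigma>: "C.half_braid X \<sigma>"
  obtains \<tau> where "D.half_braid (fobj F X) \<tau>" "\<And>A. A \<in> obj C \<Longrightarrow> lifts X A A X (\<sigma> A) (\<tau> (fobj F A))"
proof -
  note h = C.half_braidD[OF \<sigma>]
  let ?n = "d' (fobj F X)" and ?F = "fobj F"
  define s where "s = (\<lambda>A. Ji A X * (fmor F (teno C X A) (teno C A X) (\<sigma> A) * J X A))"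
  have F\<sigma>: "fmor F (teno C X A) (teno C A X) (\<sigma> A) \<in> mor D (?F (teno C X A)) (?F (teno C A X))" if "A \<in> obj C" for A
    using h(1)[OF that] X that by (intro fmor_closed) auto
  note dF\<sigma> = D.mor_dim[OF F\<sigma>]
  have s_mor: "s A \<in> mor D (teno D (?F X) (?F A)) (teno D (?F A) (?F X))" if "A \<in> obj C" for A
    unfolding s_def
    by (rule D.mult_mor[OF _ _ _ J_facts(2) D.mult_mor[OF _ _ _ F\<sigma> J_facts(1)]]) (use X that in auto)
  have ds: "dim_row (s A) = d' (?F A) * ?n" "dim_col (s A) = ?n * d' (?F A)" if "A \<in> obj C" for A
    using D.mor_dim[OF s_mor[OF that]] by simp_all
  have lift_s: "lifts X A A X (\<sigma> A) (s A)" if A: "A \<in> obj C" for A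
  proof -
    note j = J_facts[OF A X] J_facts[OF X A]
    have "J A X * s A = fmor F (teno C X A) (teno C A X) (\<sigma> A) * J X A"
      unfolding s_def by (rule mat_cancel[OF j(4)]) (use j dF\<sigma>[OF A] in auto)
    then show ?thesis
      using h(1)[OF A] D.mor_carrier[OF s_mor[OF A]] by (simp add: lifts_def)
  qed
  have Js: "J A X * s A = fmor F (teno C X A) (teno C A X) (\<sigma> A) * J X A" if "A \<in> obj C" for A
    using lift_s[OF that] by (simp add: lifts_def)
  \<comment> \<open>Naturality of \<open>\<sigma>\<close> only concerns morphisms of
    \<open>C\<close>; fullness of \<open>F\<close> extends it to every morphism between
    images.\<close>
  have s_nat: "(f ** 1\<^sub>m ?n) * s A = s B * (1\<^sub>m ?n ** f)"
    if A: "A \<in> obj C" and B: "B \<in> obj C" and f: "f \<in> mor D (?F A) (?F B)" for A B f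
  proof -
    obtain g where g: "g \<in> mor C A B" "fmor F A B g = f"
      using full[OF A B f] by blast
    note j = J_facts[OF A X] J_facts[OF X A] J_facts[OF B X] J_facts[OF X B]
    note df = D.mor_dim[OF f]
    note gm = C.ten_one_mor[OF A B X g(1)] C.one_ten_mor[OF A B X g(1)]
    have "J B X * ((f ** 1\<^sub>m ?n) * s A) = fmor F (teno C A X) (teno C B X) (g ** 1\<^sub>m (d X)) * (J A X * s A)"
      by (rule sym, rule mat_assoc_eq[OF J_nat_left[OF A B X g(1), unfolded g(2)]])
        (use j df ds[OF A] fmor_dim[OF _ _ gm(1)] A B X in auto)
    also have "\<dots> = fmor F (teno C X A) (teno C B X) ((g ** 1\<^sub>m (d X)) * \<sigma> A) * J X A"
      unfolding Js[OF A] using fmor_mult[OF _ _ _ h(1)[OF A] gm(1)] j dF\<sigma>[OF A] fmor_dim[OF _ _ gm(1)] A B X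
      by (simp add: mat_mult_assoc)
    also have "\<dots> = fmor F (teno C X A) (teno C B X) (\<sigma> B * (1\<^sub>m (d X) ** g)) * J X A"
      by (simp only: h(2)[OF A B g(1)])
    also have "\<dots> = fmor F (teno C X B) (teno C B X) (\<sigma> B) * (J X B * (1\<^sub>m ?n ** f))"
      using fmor_mult[OF _ _ _ gm(2) h(1)[OF B]] J_nat_right[OF X B A g(1)] j dF\<sigma>[OF B] fmor_dim[OF _ _ gm(2)] A B X g(2)
      by (simp add: mat_mult_assoc)
    also have "\<dots> = J B X * (s B * (1\<^sub>m ?n ** f))"
      by (rule mat_assoc_eq[OF Js[OF B, symmetric]]) (use j df ds[OF B] dF\<sigma>[OF B] in auto)
    finally show ?thesis
      by (rule mat_left_cancel[OF _ J_facts(3)[OF B X]]) (use j df ds[OF A] ds[OF B] in auto)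
  qed
  have s_ten: "(J A B ** 1\<^sub>m ?n) * ((1\<^sub>m (d' (?F A)) ** s B) * (s A ** 1\<^sub>m (d' (?F B)))) = s (teno C A B) * (1\<^sub>m ?n ** J A B)"
    if A: "A \<in> obj C" and B: "B \<in> obj C" for A B
  proof -
    have AB: "teno C A B \<in> obj C"
      using A B by simp
    note j = J_facts[OF AB X] J_facts[OF X AB] J_facts[OF A B]
    have "J (teno C A B) X * ((J A B ** 1\<^sub>m ?n) * ((1\<^sub>m (d' (?F A)) ** s B) * (s A ** 1\<^sub>m (d' (?F B)))))
        = J3 A B X * ((1\<^sub>m (d' (?F A)) ** s B) * (s A ** 1\<^sub>m (d' (?F B))))"
      unfolding J3_def using j ds[OF A] ds[OF B] by (simp add: mat_mult_assoc)
    also have "\<dots> = fmor F (teno C X (teno C A B)) (teno C (teno C A B) X) (\<sigma> (teno C A B)) * (J X (teno C A B) * (1\<^sub>m ?n ** J A B))"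
      using lifts_hexagon[OF lift_s[OF A] lift_s[OF B] X A B] h(3)[OF A B] X A B
      by (simp add: C.ten_assoc J3_facts(1))
    also have "\<dots> = J (teno C A B) X * (s (teno C A B) * (1\<^sub>m ?n ** J A B))"
      by (rule mat_assoc_eq[OF Js[OF AB, symmetric]]) (use j ds[OF AB] dF\<sigma>[OF AB] in auto)
    finally show ?thesis
      by (rule mat_left_cancel[OF _ J_facts(3)[OF AB X]]) (use j ds[OF A] ds[OF B] ds[OF AB] in auto)
  qed
  have "\<forall>W. \<exists>A u v. W \<in> obj D \<longrightarrow> A \<in> obj C \<and> inverse_mor D (?F A) W u v"
    using ess_surj by (metis iso_mor_def)
  then obtain K \<theta> \<kappa> where K: "\<And>W. W \<in> obj D \<Longrightarrow> K W \<in> obj C" "\<And>W. W \<in> obj D \<Longrightarrow> inverse_mor D (?F (K W)) W (\<theta> W) (\<kappa> W)"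
    by metis
  define \<tau> where "\<tau> = (\<lambda>W. (\<theta> W ** 1\<^sub>m ?n) * (s (K W) * (1\<^sub>m ?n ** \<kappa> W)))"
  \<comment> \<open>Any isomorphism from an image may replace the chosen one, because the transition
    \<open>v * \<theta> W\<close> between the two images is covered by \<open>s_nat\<close>.\<close>
  have \<tau>_eq: "\<tau> W = (u ** 1\<^sub>m ?n) * (s A * (1\<^sub>m ?n ** v))"
    if A: "A \<in> obj C" and W: "W \<in> obj D" and uv: "inverse_mor D (?F A) W u v" for A W u v
  proof -
    note i = uv[unfolded D.inverse_mor_iff] and k = K(2)[OF W, unfolded D.inverse_mor_iff]
    note du = D.mor_dim[OF conjunct1[OF i]] D.mor_dim[OF conjunct1[OF conjunct2[OF i]]]
      D.mor_dim[OF conjunct1[OF k]] D.mor_dim[OF conjunct1[OF conjunct2[OF k]]]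
    have m: "v * \<theta> W \<in> mor D (?F (K W)) (?F A)"
      by (rule D.mult_mor[of _ W]) (use i k A W K(1) in auto)
    have "(u ** 1\<^sub>m ?n) * (s A * (1\<^sub>m ?n ** v)) = (u ** 1\<^sub>m ?n) * (s A * ((1\<^sub>m ?n ** (v * \<theta> W)) * (1\<^sub>m ?n ** \<kappa> W)))"
      using i k du by (simp add: tensor_mat_mult mat_mult_assoc)
    also have "\<dots> = (u ** 1\<^sub>m ?n) * (((v * \<theta> W) ** 1\<^sub>m ?n) * (s (K W) * (1\<^sub>m ?n ** \<kappa> W)))"
      using mat_assoc_eq[OF s_nat[OF K(1)[OF W] A m, symmetric], of "1\<^sub>m ?n ** \<kappa> W"] ds[OF A] ds[OF K(1)[OF W]] du by simp
    also have "\<dots> = ((u ** 1\<^sub>m ?n) * ((v * \<theta> W) ** 1\<^sub>m ?n)) * (s (K W) * (1\<^sub>m ?n ** \<kappa> W))"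
      by (rule mat_mult_assoc[symmetric]) (use du ds[OF K(1)[OF W]] in auto)
    also have "(u ** 1\<^sub>m ?n) * ((v * \<theta> W) ** 1\<^sub>m ?n) = \<theta> W ** 1\<^sub>m ?n"
      using mat_cancel[of u v "d' W" "\<theta> W"] i du by (simp add: tensor_mat_mult)
    finally show ?thesis
      by (simp add: \<tau>_def)
  qed
  have \<tau>F: "\<tau> (?F A) = s A" if A: "A \<in> obj C" for A
    using \<tau>_eq[OF A _ D.inverse_mor_one] A ds[OF A] by (simp add: tensor_one_mat)
  have \<tau>_mor: "\<tau> W \<in> mor D (teno D (?F X) W) (teno D W (?F X))" if W: "W \<in> obj D" for W
    unfolding \<tau>_def using K[OF W] W X
    by (intro D.mult_mor[OF _ _ _ D.ten_one_mor D.mult_mor[OF _ _ _ s_mor D.one_ten_mor]]) (auto simp: D.inverse_mor_iff)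
  have d\<tau>: "dim_row (\<tau> W) = d' W * ?n" "dim_col (\<tau> W) = ?n * d' W" if "W \<in> obj D" for W
    using D.mor_dim[OF \<tau>_mor[OF that]] by simp_all
  have \<tau>_nat: "(f ** 1\<^sub>m ?n) * \<tau> W = \<tau> W' * (1\<^sub>m ?n ** f)"
    if W: "W \<in> obj D" and W': "W' \<in> obj D" and f: "f \<in> mor D W W'" for W W' f
  proof -
    note k = K(2)[OF W, unfolded D.inverse_mor_iff] and k' = K(2)[OF W', unfolded D.inverse_mor_iff]
    note du = D.mor_dim[OF conjunct1[OF k']] D.mor_dim[OF conjunct1[OF conjunct2[OF k']]] D.mor_dim[OF f]
      D.mor_dim[OF conjunct1[OF k]] D.mor_dim[OF conjunct1[OF conjunct2[OF k]]] ds[OF K(1)[OF W]] ds[OF K(1)[OF W']]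
    have m: "\<kappa> W' * (f * \<theta> W) \<in> mor D (?F (K W)) (?F (K W'))"
      by (rule D.mult_mor[OF _ _ _ _ D.mult_mor]) (use k k' f W W' K(1) in auto)
    have "(f ** 1\<^sub>m ?n) * \<tau> W = ((f * \<theta> W) ** 1\<^sub>m ?n) * (s (K W) * (1\<^sub>m ?n ** \<kappa> W))"
      unfolding \<tau>_def
      by (subst mat_mult_assoc[symmetric]) (use du in \<open>auto simp: tensor_mat_mult\<close>)
    also have "f * \<theta> W = \<theta> W' * (\<kappa> W' * (f * \<theta> W))"
      by (rule mat_cancel[symmetric, of _ _ "d' W'"]) (use k' du in auto)
    also have "((\<theta> W' * (\<kappa> W' * (f * \<theta> W))) ** 1\<^sub>m ?n) * (s (K W) * (1\<^sub>m ?n ** \<kappa> W))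
        = (\<theta> W' ** 1\<^sub>m ?n) * (((\<kappa> W' * (f * \<theta> W)) ** 1\<^sub>m ?n) * (s (K W) * (1\<^sub>m ?n ** \<kappa> W)))"
      by (subst mat_mult_assoc[symmetric]) (use du in \<open>auto simp: tensor_mat_mult\<close>)
    also have "((\<kappa> W' * (f * \<theta> W)) ** 1\<^sub>m ?n) * (s (K W) * (1\<^sub>m ?n ** \<kappa> W))
        = s (K W') * ((1\<^sub>m ?n ** (\<kappa> W' * (f * \<theta> W))) * (1\<^sub>m ?n ** \<kappa> W))"
      by (rule mat_assoc_eq[OF s_nat[OF K(1)[OF W] K(1)[OF W'] m]]) (use du in auto)
    also have "(1\<^sub>m ?n ** (\<kappa> W' * (f * \<theta> W))) * (1\<^sub>m ?n ** \<kappa> W) = (1\<^sub>m ?n ** \<kappa> W') * (1\<^sub>m ?n ** f)"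
      using k du by (simp add: tensor_mat_mult mat_mult_assoc)
    finally show ?thesis
      unfolding \<tau>_def using du by (simp add: mat_mult_assoc)
  qed
  have \<tau>_ten: "\<tau> (teno D W W') = (1\<^sub>m (d' W) ** \<tau> W') * (\<tau> W ** 1\<^sub>m (d' W'))"
    if W: "W \<in> obj D" and W': "W' \<in> obj D" for W W'
  proof -
    let ?A = "K W" and ?B = "K W'"
    note A = K(1)[OF W] and B = K(1)[OF W']
    have AB: "teno C ?A ?B \<in> obj C"
      using A B by simp
    note k = K(2)[OF W, unfolded D.inverse_mor_iff] and k' = K(2)[OF W', unfolded D.inverse_mor_iff]
    note du = D.mor_dim[OF conjunct1[OF k']] D.mor_dim[OF conjunct1[OF conjunct2[OF k']]]
      D.mor_dim[OF conjunct1[OF k]] D.mor_dim[OF conjunct1[OF conjunct2[OF k]]] ds[OF A] ds[OF B] ds[OF AB]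
    note j = J_facts[OF A B]
    \<comment> \<open>For \<open>W \<otimes> W'\<close> the product of the two chosen preimages is
      used in place of the chosen preimage, so that the hexagon \<open>s_ten\<close>
      applies.\<close>
    have "inverse_mor D (?F (teno C ?A ?B)) (teno D W W') ((\<theta> W ** \<theta> W') * Ji ?A ?B) (J ?A ?B * (\<kappa> W ** \<kappa> W'))"
    proof (rule D.inverse_mor_comp[of _ "teno D (?F ?A) (?F ?B)"])
      show "inverse_mor D (?F (teno C ?A ?B)) (teno D (?F ?A) (?F ?B)) (Ji ?A ?B) (J ?A ?B)"
        using Ji_inverse[OF A B] by (simp add: D.inverse_mor_sym)
      show "inverse_mor D (teno D (?F ?A) (?F ?B)) (teno D W W') (\<theta> W ** \<theta> W') (\<kappa> W ** \<kappa> W')"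
        using k k' du A B W W' by (simp add: D.inverse_mor_iff D.ten_mor tensor_mat_mult tensor_one_mat)
    qed (use A B W W' in auto)
    from \<tau>_eq[OF AB _ this]
    have "\<tau> (teno D W W') = (((\<theta> W ** \<theta> W') * Ji ?A ?B) ** 1\<^sub>m ?n) * (s (teno C ?A ?B) * ((1\<^sub>m ?n ** J ?A ?B) * (1\<^sub>m ?n ** \<kappa> W ** \<kappa> W')))"
      using W W' j du by (simp add: tensor_mat_mult)
    also have "s (teno C ?A ?B) * ((1\<^sub>m ?n ** J ?A ?B) * (1\<^sub>m ?n ** \<kappa> W ** \<kappa> W'))
        = (J ?A ?B ** 1\<^sub>m ?n) * (((1\<^sub>m (d' (?F ?A)) ** s ?B) * (s ?A ** 1\<^sub>m (d' (?F ?B)))) * (1\<^sub>m ?n ** \<kappa> W ** \<kappa> W'))"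
      by (rule mat_assoc_eq[OF s_ten[OF A B, symmetric]]) (use du j in auto)
    also have "(((\<theta> W ** \<theta> W') * Ji ?A ?B) ** 1\<^sub>m ?n) * \<dots>
        = (\<theta> W ** \<theta> W' ** 1\<^sub>m ?n) * (((1\<^sub>m (d' (?F ?A)) ** s ?B) * (s ?A ** 1\<^sub>m (d' (?F ?B)))) * (1\<^sub>m ?n ** \<kappa> W ** \<kappa> W'))"
    proof -
      have "(((\<theta> W ** \<theta> W') * Ji ?A ?B) ** 1\<^sub>m ?n) * (J ?A ?B ** 1\<^sub>m ?n) = \<theta> W ** \<theta> W' ** 1\<^sub>m ?n"
        using j du by (simp add: tensor_mat_mult mat_mult_assoc tensor_mat_assoc)
      then show ?thesis
        by (subst mat_mult_assoc[symmetric]) (use du j in auto)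
    qed
    also have "\<dots> = (1\<^sub>m (d' W) ** \<tau> W') * (\<tau> W ** 1\<^sub>m (d' W'))"
    proof -
      have 1: "1\<^sub>m (d' W) ** \<tau> W' = (1\<^sub>m (d' W) ** \<theta> W' ** 1\<^sub>m ?n) * ((1\<^sub>m (d' W) ** s ?B) * (1\<^sub>m (d' W) ** 1\<^sub>m ?n ** \<kappa> W'))"
        unfolding \<tau>_def using du by (simp add: tensor_mat_mult)
      have 2: "\<tau> W ** 1\<^sub>m (d' W') = (\<theta> W ** 1\<^sub>m ?n ** 1\<^sub>m (d' W')) * ((s ?A ** 1\<^sub>m (d' W')) * (1\<^sub>m ?n ** \<kappa> W ** 1\<^sub>m (d' W')))"
        unfolding \<tau>_def using du by (simp add: tensor_mat_mult flip: tensor_mat_assoc)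
      have 3: "(1\<^sub>m (d' W) ** 1\<^sub>m ?n ** \<kappa> W') * (\<theta> W ** 1\<^sub>m ?n ** 1\<^sub>m (d' W'))
          = (\<theta> W ** 1\<^sub>m (?n * d' (?F ?B))) * (1\<^sub>m (d' (?F ?A) * ?n) ** \<kappa> W')"
        using du by (simp add: tensor_mat_mult tensor_mat_assoc tensor_one_mat[symmetric, of "d' (?F ?A)" ?n])
      have 4: "(1\<^sub>m (d' W) ** s ?B) * (\<theta> W ** 1\<^sub>m (?n * d' (?F ?B))) = (\<theta> W ** 1\<^sub>m (d' (?F ?B) * ?n)) * (1\<^sub>m (d' (?F ?A)) ** s ?B)"
        using du by (simp add: tensor_mat_mult)
      have 5: "(1\<^sub>m (d' (?F ?A) * ?n) ** \<kappa> W') * (s ?A ** 1\<^sub>m (d' W')) = (s ?A ** 1\<^sub>m (d' (?F ?B))) * (1\<^sub>m (?n * d' (?F ?A)) ** \<kappa> W')"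
        using du by (simp add: tensor_mat_mult)
      have 6: "(1\<^sub>m (?n * d' (?F ?A)) ** \<kappa> W') * (1\<^sub>m ?n ** \<kappa> W ** 1\<^sub>m (d' W')) = 1\<^sub>m ?n ** \<kappa> W ** \<kappa> W'"
        using du by (simp add: tensor_mat_mult tensor_mat_assoc flip: tensor_one_mat)
      have 7: "(1\<^sub>m (d' W) ** \<theta> W' ** 1\<^sub>m ?n) * (\<theta> W ** 1\<^sub>m (d' (?F ?B) * ?n)) = \<theta> W ** \<theta> W' ** 1\<^sub>m ?n"
        using du by (simp add: tensor_mat_mult)
      note c3 = mat_assoc_eq[OF 3] and c4 = mat_assoc_eq[OF 4] and c5 = mat_assoc_eq[OF 5]
      have "(1\<^sub>m (d' W) ** \<tau> W') * (\<tau> W ** 1\<^sub>m (d' W'))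
        = (1\<^sub>m (d' W) ** \<theta> W' ** 1\<^sub>m ?n) * ((1\<^sub>m (d' W) ** s ?B) * ((1\<^sub>m (d' W) ** 1\<^sub>m ?n ** \<kappa> W') *
            ((\<theta> W ** 1\<^sub>m ?n ** 1\<^sub>m (d' W')) * ((s ?A ** 1\<^sub>m (d' W')) * (1\<^sub>m ?n ** \<kappa> W ** 1\<^sub>m (d' W'))))))"
        unfolding 1 2 using du by (simp add: mat_mult_assoc)
      also have "\<dots> = (1\<^sub>m (d' W) ** \<theta> W' ** 1\<^sub>m ?n) * ((1\<^sub>m (d' W) ** s ?B) * ((\<theta> W ** 1\<^sub>m (?n * d' (?F ?B))) *
            ((1\<^sub>m (d' (?F ?A) * ?n) ** \<kappa> W') * ((s ?A ** 1\<^sub>m (d' W')) * (1\<^sub>m ?n ** \<kappa> W ** 1\<^sub>m (d' W'))))))"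
        by (subst c3) (use du in auto)
      also have "\<dots> = (1\<^sub>m (d' W) ** \<theta> W' ** 1\<^sub>m ?n) * ((\<theta> W ** 1\<^sub>m (d' (?F ?B) * ?n)) * ((1\<^sub>m (d' (?F ?A)) ** s ?B) *
            ((s ?A ** 1\<^sub>m (d' (?F ?B))) * ((1\<^sub>m (?n * d' (?F ?A)) ** \<kappa> W') * (1\<^sub>m ?n ** \<kappa> W ** 1\<^sub>m (d' W'))))))"
        by (subst c4, (use du in auto)[4], subst c5) (use du in auto)
      also have "\<dots> = (\<theta> W ** \<theta> W' ** 1\<^sub>m ?n) * ((1\<^sub>m (d' (?F ?A)) ** s ?B) *
            ((s ?A ** 1\<^sub>m (d' (?F ?B))) * (1\<^sub>m ?n ** \<kappa> W ** \<kappa> W')))"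
        unfolding 6 by (subst 7[symmetric], rule mat_mult_assoc[symmetric]) (use du in auto)
      finally show ?thesis
        using du by (simp add: mat_mult_assoc)
    qed
    finally show ?thesis .
  qed
  have \<tau>_unit: "\<tau> (unito D) = 1\<^sub>m ?n"
  proof -
    \<comment> \<open>The unit of \<open>C\<close> with the isomorphism \<open>ei\<close> serves as
      preimage; then only \<open>J\<close> at the unit occurs, which \<open>J_unit_left\<close> and
      \<open>J_unit_right\<close> evaluate.\<close>
    have "inverse_mor D (?F (unito C)) (unito D) ei e"
      using ei_inverse by (simp add: D.inverse_mor_sym)
    from \<tau>_eq[OF C.unit_obj D.unit_obj this]
    have "\<tau> (unito D) = (ei ** 1\<^sub>m ?n) * (s (unito C) * (1\<^sub>m ?n ** e))" .
    also have "s (unito C) = Ji (unito C) X * J X (unito C)"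
      unfolding s_def using h(4) J_facts[OF X C.unit_obj] X by simp
    also have "(ei ** 1\<^sub>m ?n) * (Ji (unito C) X * J X (unito C) * (1\<^sub>m ?n ** e)) = 1\<^sub>m ?n"
    proof -
      note j = J_facts[OF C.unit_obj X] J_facts[OF X C.unit_obj] e_facts
      have "Ji (unito C) X * J X (unito C) * (1\<^sub>m ?n ** e) = Ji (unito C) X * (J X (unito C) * (1\<^sub>m ?n ** e))"
        by (rule mat_mult_assoc) (use j X in auto)
      also have "J (unito C) X * \<dots> = J X (unito C) * (1\<^sub>m ?n ** e)"
        by (rule mat_cancel[OF j(4)]) (use j X in auto)
      also have "\<dots> = 1\<^sub>m ?n"
        by (rule J_unit_right(1)[OF X])
      finally show ?thesis
        by (simp only: J_unit_left(2)[OF X])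
    qed
    finally show ?thesis .
  qed
  have "D.half_braid (?F X) \<tau>"
    unfolding D.half_braid_def using \<tau>_mor \<tau>_nat \<tau>_ten \<tau>_unit by auto
  then show thesis
    using that lift_s \<tau>F by auto
qed

text \<open>Fullness produces \<open>\<sigma> A\<close> from the value of \<open>\<tau>\<close> at
  \<open>F A\<close>. Each axiom is checked after applying \<open>F\<close> and composing with the
  invertible \<open>J\<close>, which \<open>epi\<close> and faithfulness undo.\<close>

theorem half_braid_reflect:
  assumes X: "X \<in> obj C" and \<tau>: "D.half_braid (fobj F X) \<tau>"
  obtains \<sigma> where "C.half_braid X \<sigma>" "\<And>A. A \<in> obj C \<Longrightarrow> lifts X A A X (\<sigma> A) (\<tau> (fobj F A))"
proof -
  let ?F = "fobj F" and ?n = "d' (fobj F X)"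
  have FX: "?F X \<in> obj D"
    using X by simp
  note h = D.half_braidD[OF \<tau>]
  have "J A X * (\<tau> (?F A) * Ji X A) \<in> mor D (?F (teno C X A)) (?F (teno C A X))" if A: "A \<in> obj C" for A
    by (rule D.mult_mor[OF _ _ _ J_facts(1) D.mult_mor[OF _ _ _ h(1) J_facts(2)]]) (use X A in auto)
  then have "\<forall>A. \<exists>a. A \<in> obj C \<longrightarrow> a \<in> mor C (teno C X A) (teno C A X) \<and>
      fmor F (teno C X A) (teno C A X) a = J A X * (\<tau> (?F A) * Ji X A)"
    using full[of "teno C X _" "teno C _ X"] X by (metis C.ten_obj)
  then obtain \<sigma> where \<sigma>: "\<And>A. A \<in> obj C \<Longrightarrow> \<sigma> A \<in> mor C (teno C X A) (teno C A X)"
      "\<And>A. A \<in> obj C \<Longrightarrow> fmor F (teno C X A) (teno C A X) (\<sigma> A) = J A X * (\<tau> (?F A) * Ji X A)"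
    by metis
  have l: "lifts X A A X (\<sigma> A) (\<tau> (?F A))" if A: "A \<in> obj C" for A
  proof -
    note j = J_facts[OF A X] J_facts[OF X A]
    have "fmor F (teno C X A) (teno C A X) (\<sigma> A) * J X A = J A X * \<tau> (?F A)"
      unfolding \<sigma>(2)[OF A] using j h(5,6)[of "?F A"] A by (simp add: mat_mult_assoc)
    then show ?thesis
      using \<sigma>(1)[OF A] D.mor_carrier[OF h(1)[of "?F A"]] A by (simp add: lifts_def)
  qed
  have epi: "M = N" if A: "A \<in> obj C" and e: "M * J X A = N * J X A"
      "dim_col M = d' (?F (teno C X A))" "dim_col N = d' (?F (teno C X A))" for A and M N :: "complex mat"
    using arg_cong[OF e(1), of "\<lambda>M. M * Ji X A"] e(2,3) J_facts[OF X A] by (simp add: mat_mult_assoc)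
  have "(f ** 1\<^sub>m (d X)) * \<sigma> W = \<sigma> W' * (1\<^sub>m (d X) ** f)"
    if W: "W \<in> obj C" and W': "W' \<in> obj C" and f: "f \<in> mor C W W'" for W W' f
  proof (rule faithful[of "teno C X W" "teno C W' X"])
    note gm = C.ten_one_mor[OF W W' X f] C.one_ten_mor[OF W W' X f]
    show m: "(f ** 1\<^sub>m (d X)) * \<sigma> W \<in> mor C (teno C X W) (teno C W' X)" "\<sigma> W' * (1\<^sub>m (d X) ** f) \<in> mor C (teno C X W) (teno C W' X)"
      using C.mult_mor[OF _ _ _ gm(1) \<sigma>(1)[OF W]] C.mult_mor[OF _ _ _ \<sigma>(1)[OF W'] gm(2)] X W W' by simp_all
    note L = liftsD[OF l[OF W] X W W X] and L' = liftsD[OF l[OF W'] X W' W' X]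
    note dm = fmor_dim[OF _ _ m(1)] fmor_dim[OF _ _ m(2)] fmor_dim[OF _ _ gm(1)] fmor_dim[OF _ _ gm(2)] fmor_dim[OF W W' f]
    note j = J_facts[OF W X] J_facts[OF X W] J_facts[OF W' X] J_facts[OF X W']
    let ?f = "fmor F W W' f"
    have "fmor F (teno C X W) (teno C W' X) ((f ** 1\<^sub>m (d X)) * \<sigma> W) * J X W
        = fmor F (teno C W X) (teno C W' X) (f ** 1\<^sub>m (d X)) * (J W X * \<tau> (?F W))"
      using fmor_mult[OF _ _ _ \<sigma>(1)[OF W] gm(1)] L dm j X W W' by (simp add: mat_mult_assoc)
    also have "\<dots> = J W' X * ((?f ** 1\<^sub>m ?n) * \<tau> (?F W))"
      by (rule mat_assoc_eq[OF J_nat_left[OF W W' X f]]) (use L dm j X W W' in auto)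
    also have "\<dots> = J W' X * (\<tau> (?F W') * (1\<^sub>m ?n ** ?f))"
      using h(2)[of "?F W" "?F W'" ?f] fmor_closed[OF W W' f] W W' by simp
    also have "\<dots> = fmor F (teno C X W') (teno C W' X) (\<sigma> W') * (J X W' * (1\<^sub>m ?n ** ?f))"
      by (rule mat_assoc_eq[OF L'(2)[symmetric]]) (use L' dm j X W W' in auto)
    also have "\<dots> = fmor F (teno C X W) (teno C W' X) (\<sigma> W' * (1\<^sub>m (d X) ** f)) * J X W"
      using fmor_mult[OF _ _ _ gm(2) \<sigma>(1)[OF W']] J_nat_right[OF X W' W f] L' dm j X W W' by (simp add: mat_mult_assoc)
    finally show "fmor F (teno C X W) (teno C W' X) ((f ** 1\<^sub>m (d X)) * \<sigma> W)
        = fmor F (teno C X W) (teno C W' X) (\<sigma> W' * (1\<^sub>m (d X) ** f))"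
      by (rule epi[OF W]) (use dm X W W' in auto)
  qed (use X W W' in auto)
  moreover have "\<sigma> (teno C A B) = (1\<^sub>m (d A) ** \<sigma> B) * (\<sigma> A ** 1\<^sub>m (d B))" if A: "A \<in> obj C" and B: "B \<in> obj C" for A B
  proof (rule faithful[of "teno C X (teno C A B)" "teno C (teno C A B) X"])
    have AB: "teno C A B \<in> obj C"
      using A B by simp
    note LA = liftsD[OF l[OF A] X A A X] and LB = liftsD[OF l[OF B] X B B X] and L = liftsD[OF l[OF AB] X AB AB X]
    note j = J_facts[OF AB X] J_facts[OF X AB] J_facts[OF A B]
    let ?r = "(1\<^sub>m (d A) ** \<sigma> B) * (\<sigma> A ** 1\<^sub>m (d B))"
    show m1: "\<sigma> (teno C A B) \<in> mor C (teno C X (teno C A B)) (teno C (teno C A B) X)"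
      by (rule L(1))
    show m2: "?r \<in> mor C (teno C X (teno C A B)) (teno C (teno C A B) X)"
      using C.mult_mor[OF _ _ _ C.one_ten_mor[OF _ _ A LB(1)], of "teno C (teno C X A) B" "\<sigma> A ** 1\<^sub>m (d B)"]
        C.ten_one_mor[OF _ _ B LA(1)] X A B by (simp add: C.ten_assoc)
    note dm = fmor_dim[OF _ _ m1] fmor_dim[OF _ _ m2]
    let ?E = "fmor F (teno C X (teno C A B)) (teno C (teno C A B) X)"
    \<comment> \<open>Both candidates are compared on the threefold tensor product: one is evaluated
      by the hexagon for lifts, the other by naturality of \<open>\<tau>\<close> along
      \<open>J A B\<close>.\<close>
    have "?E ?r * (J X (teno C A B) * (1\<^sub>m ?n ** J A B))
        = J (teno C A B) X * ((J A B ** 1\<^sub>m ?n) * ((1\<^sub>m (d' (?F A)) ** \<tau> (?F B)) * (\<tau> (?F A) ** 1\<^sub>m (d' (?F B)))))"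
    proof -
      have "?E ?r * (J X (teno C A B) * (1\<^sub>m ?n ** J A B)) = J3 A B X * ((1\<^sub>m (d' (?F A)) ** \<tau> (?F B)) * (\<tau> (?F A) ** 1\<^sub>m (d' (?F B))))"
        using lifts_hexagon[OF l[OF A] l[OF B] X A B] X A B by (simp add: C.ten_assoc J3_facts(1))
      then show ?thesis
        using j LA LB by (simp add: J3_def mat_mult_assoc)
    qed
    also have "\<dots> = J (teno C A B) X * ((J A B ** 1\<^sub>m ?n) * \<tau> (teno D (?F A) (?F B)))"
      using h(3)[of "?F A" "?F B"] A B by simp
    also have "\<dots> = J (teno C A B) X * (\<tau> (?F (teno C A B)) * (1\<^sub>m ?n ** J A B))"
      using h(2)[of "teno D (?F A) (?F B)" "?F (teno C A B)" "J A B"] j A B by simp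
    also have "\<dots> = ?E (\<sigma> (teno C A B)) * (J X (teno C A B) * (1\<^sub>m ?n ** J A B))"
      by (rule mat_assoc_eq[OF L(2)[symmetric]]) (use j L in auto)
    finally have eq: "?E ?r * (J X (teno C A B) * (1\<^sub>m ?n ** J A B)) = ?E (\<sigma> (teno C A B)) * (J X (teno C A B) * (1\<^sub>m ?n ** J A B))" .
    have c: "M * (J X (teno C A B) * (1\<^sub>m ?n ** J A B)) * (1\<^sub>m ?n ** Ji A B) = M * J X (teno C A B)"
      if "dim_col M = d' (?F (teno C X (teno C A B)))" for M :: "complex mat"
      using j that by (simp add: mat_mult_assoc tensor_mat_mult tensor_one_mat)
    have dE: "dim_col (?E ?r) = d' (?F (teno C X (teno C A B)))" "dim_col (?E (\<sigma> (teno C A B))) = d' (?F (teno C X (teno C A B)))"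
      by (rule dm(4) dm(2); use X AB in simp)+
    have "?E ?r * J X (teno C A B) = ?E ?r * (J X (teno C A B) * (1\<^sub>m ?n ** J A B)) * (1\<^sub>m ?n ** Ji A B)"
      by (rule c[OF dE(1), symmetric])
    also have "\<dots> = ?E (\<sigma> (teno C A B)) * J X (teno C A B)"
      unfolding eq by (rule c[OF dE(2)])
    finally have "?E ?r * J X (teno C A B) = ?E (\<sigma> (teno C A B)) * J X (teno C A B)" .
    then show "?E (\<sigma> (teno C A B)) = ?E ?r"
      by (rule epi[OF AB sym dE(2,1)])
  qed (use X A B in auto)
  moreover have "\<sigma> (unito C) = 1\<^sub>m (d X)"
  proof (rule faithful[OF X X])
    \<comment> \<open>The unit condition on \<open>\<tau>\<close> concerns the unit of
      \<open>D\<close>; naturality along \<open>e\<close> carries it to the image of the unit of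
      \<open>C\<close>.\<close>
    have "\<tau> (?F (unito C)) * (1\<^sub>m ?n ** e) = e ** 1\<^sub>m ?n"
      using h(2)[OF D.unit_obj _ e_facts(1)] h(4) e_facts by simp
    moreover have "\<tau> (?F (unito C)) * (1\<^sub>m ?n ** e) * (1\<^sub>m ?n ** ei) = \<tau> (?F (unito C))"
      using h(5,6)[of "?F (unito C)"] e_facts by (simp add: mat_mult_assoc tensor_mat_mult tensor_one_mat)
    ultimately have "\<tau> (?F (unito C)) = (e ** 1\<^sub>m ?n) * (1\<^sub>m ?n ** ei)"
      by (simp only:)
    also have "\<dots> * Ji X (unito C) = (e ** 1\<^sub>m ?n) * (J X (unito C) * Ji X (unito C))"
      unfolding J_unit_right(2)[OF X] by (rule mat_mult_assoc) (use J_facts[OF X C.unit_obj] e_facts X in auto)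
    finally have "\<tau> (?F (unito C)) * Ji X (unito C) = e ** 1\<^sub>m ?n"
      using J_facts[OF X C.unit_obj] e_facts X by simp
    then have "J (unito C) X * (\<tau> (?F (unito C)) * Ji X (unito C)) = 1\<^sub>m ?n"
      by (simp only: J_unit_left(1)[OF X])
    then show "fmor F X X (\<sigma> (unito C)) = fmor F X X (1\<^sub>m (d X))"
      using \<sigma>(2)[OF C.unit_obj] X by simp
  qed (use \<sigma>(1)[OF C.unit_obj] X in auto)
  ultimately have "C.half_braid X \<sigma>"
    unfolding C.half_braid_def using \<sigma>(1) by blast
  then show thesis
    using that l by blast
qed

end

section \<open>Change of test object and of underlying representation\<close>

context finite_group
begin

lemma half_braiding_iff:
  assumes V: "is_rep G V"
  shows "matcat.half_braid (Rep G) rdim V \<sigma> \<longleftrightarrow> half_braiding V \<sigma>"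
proof -
  interpret matcat "Rep G" rdim
    by (rule matcat_Rep)
  have "\<sigma> W \<in> intertwiners G (teno (Rep G) V W) (teno (Rep G) W V) \<longleftrightarrow>
      \<sigma> W \<in> carrier_mat (rdim W * rdim V) (rdim V * rdim W) \<and>
      (\<forall>g\<in>carrier G. \<sigma> W * (ract V g ** ract W g) = (ract W g ** ract V g) * \<sigma> W)" for W
    by (auto simp: intertwiners_def)
  then show ?thesis
    unfolding half_braid_def half_braiding_def by (auto simp del: Rep_sel(3,4))
qed

lemma trunc_tensor [simp]: "trunc (teno (RepD G) V W) = teno (Rep G) (trunc V) (trunc W)"
  by (simp add: trunc_def)

lemma trunc_unit [simp]: "trunc (unito (RepD G)) = unito (Rep G)"
  by (simp add: trunc_def)

lemma hb_iso:
  assumes R: "is_rep G R" and R': "is_rep G R'" and uv: "inverse_mor (Rep G) R R' u v"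
    and P: "\<And>g. g \<in> carrier G \<Longrightarrow> P g \<in> carrier_mat n n"
  shows "hb n P R' = (u ** 1\<^sub>m n) * (hb n P R * (1\<^sub>m n ** v))"
proof -
  interpret matcat "Rep G" rdim
    by (rule matcat_Rep)
  note i = uv[unfolded inverse_mor_iff]
  have d: "dim_row u = rdim R'" "dim_col u = rdim R" "dim_row v = rdim R" "dim_col v = rdim R'"
    using i mor_dim by blast+
  have "(u ** 1\<^sub>m n) * (hb n P R * (1\<^sub>m n ** v)) = hb n P R' * ((1\<^sub>m n ** u) * (1\<^sub>m n ** v))"
    by (rule mat_assoc_eq[OF hb_natural[OF R R' _ P]]) (use i d in auto)
  also have "(1\<^sub>m n ** u) * (1\<^sub>m n ** v) = 1\<^sub>m (n * rdim R')"
    using i d by (simp add: tensor_mat_mult tensor_one_mat)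
  finally show ?thesis
    by (metis dim_hb(2) right_mult_one_mat')
qed

text \<open>The regular representation of the target group need not be an image \<open>F A\<close>;
  by \<open>hb_iso\<close> an isomorphic \<open>R\<close> is an equally good test object.\<close>

lemma mor_hb_isoI:
  assumes V: "is_graded_rep G V" and W: "is_graded_rep G W" and A: "A \<in> intertwiners G V W"
    and R: "is_rep G R" and uv: "inverse_mor (Rep G) R reg u v"
    and e: "(1\<^sub>m (rdim R) ** A) * hb (rdim V) (proj V) R = hb (rdim W) (proj W) R * (A ** 1\<^sub>m (rdim R))"
  shows "A \<in> mor (RepD G) V W"
proof (rule mor_hbI[OF V W A])
  interpret matcat "Rep G" rdim
    by (rule matcat_Rep)
  let ?n = "rdim V" and ?m = "rdim W" and ?c = "card (carrier G)"
  note i = uv[unfolded inverse_mor_iff]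
  have d: "dim_row u = ?c" "dim_col u = rdim R" "dim_row v = rdim R" "dim_col v = ?c" "dim_row A = ?m" "dim_col A = ?n"
    using i mor_dim[of u R reg] mor_dim[of v reg R] intertwinersD[OF A] by auto
  note P = proj_familyD(2)[OF proj_facts(2)[OF V]] and Q = proj_familyD(2)[OF proj_facts(2)[OF W]]
  have hV: "hb ?n (proj V) reg = (u ** 1\<^sub>m ?n) * (hb ?n (proj V) R * (1\<^sub>m ?n ** v))"
    by (rule hb_iso[OF R reg_rep uv P])
  have hW: "hb ?m (proj W) reg = (u ** 1\<^sub>m ?m) * (hb ?m (proj W) R * (1\<^sub>m ?m ** v))"
    by (rule hb_iso[OF R reg_rep uv Q])
  have "(1\<^sub>m ?c ** A) * ((u ** 1\<^sub>m ?n) * (hb ?n (proj V) R * (1\<^sub>m ?n ** v)))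
      = (u ** 1\<^sub>m ?m) * ((1\<^sub>m (rdim R) ** A) * (hb ?n (proj V) R * (1\<^sub>m ?n ** v)))"
    by (rule mat_assoc_eq) (use d in \<open>auto simp: tensor_mat_mult\<close>)
  also have "(1\<^sub>m (rdim R) ** A) * (hb ?n (proj V) R * (1\<^sub>m ?n ** v)) = hb ?m (proj W) R * ((A ** 1\<^sub>m (rdim R)) * (1\<^sub>m ?n ** v))"
    by (rule mat_assoc_eq[OF e]) (use d in auto)
  also have "(A ** 1\<^sub>m (rdim R)) * (1\<^sub>m ?n ** v) = (1\<^sub>m ?m ** v) * (A ** 1\<^sub>m ?c)"
    using d by (simp add: tensor_mat_mult)
  finally show "(1\<^sub>m ?c ** A) * hb ?n (proj V) reg = hb ?m (proj W) reg * (A ** 1\<^sub>m ?c)"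
    unfolding hV hW using d by (simp add: mat_mult_assoc)
qed

text \<open>Conjugating the projections by \<open>u\<close> makes \<open>u\<close> a graded
  isomorphism, whose source has exactly the underlying representation \<open>X\<close>.\<close>

lemma grading_pullback:
  assumes Y: "is_graded_rep G Y" and X: "is_rep G X" and uv: "inverse_mor (Rep G) X (trunc Y) u v"
  obtains Z where "is_graded_rep G Z" "trunc Z = X" "iso_mor (RepD G) Z Y u"
proof -
  interpret matcat "Rep G" rdim
    by (rule matcat_Rep)
  interpret D: matcat "RepD G" rdim
    by (rule matcat_RepD)
  note fY = proj_facts[OF Y]
  note P = proj_familyD[OF fY(2)] and rX = is_repD[OF X] and rY = is_repD[OF fY(1)]
  let ?n = "rdim X" and ?m = "rdim Y"
  note i = uv[unfolded inverse_mor_iff]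
  have u: "u \<in> intertwiners G X (trunc Y)" and v: "v \<in> intertwiners G (trunc Y) X" and uv1: "v * u = 1\<^sub>m ?n" "u * v = 1\<^sub>m ?m"
    using i by simp_all
  note u' = intertwinersD[OF u, unfolded trunc_sel] and v' = intertwinersD[OF v, unfolded trunc_sel]
  define Q where "Q = (\<lambda>g\<in>carrier G. v * (proj Y g * u))"
  have c: "u * (v * M) = M" if "dim_row M = ?m" for M
    by (rule mat_cancel[OF uv1(2)]) (use u' v' that in auto)
  have "msum ?n ?n Q (carrier G) = msum ?n ?n (\<lambda>g. v * (proj Y g * u)) (carrier G)"
    by (rule msum_cong) (auto simp: Q_def)
  also have "\<dots> = v * (msum ?m ?m (proj Y) (carrier G) * u)"
    using mult_msum[of "carrier G" "\<lambda>g. proj Y g * u" ?m ?n v] msum_mult[of "carrier G" "proj Y" ?m ?m u]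
      P(2,3) u' v' by (simp add: carrier_mat_iff del: carrier_matD)
  finally have Q1: "msum ?n ?n Q (carrier G) = 1\<^sub>m ?n"
    using P(6) uv1 u' by simp
  have Q2: "Q g * Q h = (if g = h then Q g else 0\<^sub>m ?n ?n)" if g: "g \<in> carrier G" and h: "h \<in> carrier G" for g h
  proof -
    note dg = P(3,4)[OF g] P(3,4)[OF h]
    have "Q g * Q h = v * (proj Y g * (u * (v * (proj Y h * u))))"
      using g h dg u' v' by (simp add: Q_def mat_mult_assoc)
    also have "\<dots> = v * ((proj Y g * proj Y h) * u)"
      using dg u' v' by (simp add: c mat_mult_assoc)
    finally show ?thesis
      using P(5)[OF g h] g h u' v' by (simp add: Q_def)
  qed
  have Q3: "ract X g * Q h = Q (g \<otimes> h \<otimes> inv g) * ract X g" if g: "g \<in> carrier G" and h: "h \<in> carrier G" for g h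
  proof -
    have ghg: "g \<otimes> h \<otimes> inv g \<in> carrier G"
      using g h by simp
    note dg = P(3,4)[OF g] P(3,4)[OF h] P(3,4)[OF ghg] rX(3,4)[OF g] rY(3,4)[OF g]
    have "ract X g * Q h = v * (ract Y g * (proj Y h * u))"
      using h dg u' v' mat_assoc_eq[OF v'(4)[OF g, symmetric], of "proj Y h * u"] by (simp add: Q_def)
    also have "ract Y g * (proj Y h * u) = proj Y (g \<otimes> h \<otimes> inv g) * (ract Y g * u)"
      by (rule mat_assoc_eq[OF P(7)[OF g h]]) (use dg u' in auto)
    also have "ract Y g * u = u * ract X g"
      by (rule u'(4)[OF g, symmetric])
    finally show ?thesis
      using ghg dg u' v' by (simp add: Q_def mat_mult_assoc)
  qed
  have Q: "proj_family X Q"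
    unfolding proj_family_def using Q1 Q2 Q3 P(3,4) u' v' by (auto simp: Q_def intro!: carrier_matI)
  define Z where "Z = graded ?n (ract X) Q"
  have Z: "is_graded_rep G Z" "proj Z = Q"
    unfolding Z_def by (rule graded_facts[OF X Q]; simp)+
  have "u \<in> mor (RepD G) Z Y"
    unfolding mor_RepD_iff[OF Z(1) Y] Z(2)
    using u P(3,4) u' v' by (auto simp: Q_def Z_def intertwiners_def c)
  moreover from inverse_mor_RepD[OF Z(1) Y this] have "v \<in> mor (RepD G) Y Z"
    using v' uv1 by (simp add: Z_def)
  ultimately have "iso_mor (RepD G) Z Y u"
    using uv1 by (auto simp: iso_mor_def D.inverse_mor_iff Z_def)
  moreover have "trunc Z = X"
    by (simp add: trunc_def Z_def)
  ultimately show thesis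
    using that Z(1) by blast
qed

end

section \<open>Lifting the equivalence to the doubles\<close>

locale rep_equivalence = G: finite_group G + H: finite_group H + matcat_equivalence "Rep G" rdim "Rep H" rdim F J e
  for G :: "('a, 'c) monoid_scheme" and H :: "('b, 'd) monoid_scheme" and F J e
begin

declare G.Rep_sel [simp del] H.Rep_sel [simp del]

lemma obj_iff [simp]: "X \<in> obj (Rep G) \<longleftrightarrow> is_rep G X" "Y \<in> obj (Rep H) \<longleftrightarrow> is_rep H Y"
  by (simp_all add: G.Rep_sel H.Rep_sel)

lemma mor_eq: "mor (Rep G) = intertwiners G" "mor (Rep H) = intertwiners H"
  by (simp_all add: G.Rep_sel H.Rep_sel)

lemma F_rep [simp]: "is_rep G X \<Longrightarrow> is_rep H (fobj F X)"
  using fobj_closed[of X] by simp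

lemma G_rep [simp]: "is_graded_rep G V \<Longrightarrow> is_rep G V"
  by (rule G.proj_facts(1))

lemma H_rep [simp]: "is_graded_rep H V \<Longrightarrow> is_rep H V"
  by (rule H.proj_facts(1))

text \<open>\<open>V'\<close> is the image of the underlying representation of \<open>V\<close>,
  with the grading whose half braiding corresponds to that of \<open>V\<close>. It stays a relation
  until existence and uniqueness are established.\<close>

definition matches :: "'a graded_rep \<Rightarrow> 'b graded_rep \<Rightarrow> bool" where
  "matches V V' \<longleftrightarrow> is_graded_rep G V \<and> is_graded_rep H V' \<and> H.trunc V' = fobj F (G.trunc V) \<and>
     (\<forall>A. is_rep G A \<longrightarrow> lifts (G.trunc V) A A (G.trunc V) (G.hb (rdim V) (G.proj V) A) (H.hb (rdim V') (H.proj V') (fobj F A)))"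

lemma matchesD:
  assumes "matches V V'"
  shows "is_graded_rep G V" "is_graded_rep H V'" "H.trunc V' = fobj F (G.trunc V)"
    "\<And>A. is_rep G A \<Longrightarrow> lifts (G.trunc V) A A (G.trunc V) (G.hb (rdim V) (G.proj V) A) (H.hb (rdim V') (H.proj V') (fobj F A))"
    "rdim V' = rdim (fobj F (G.trunc V))" "ract V' = ract (fobj F (G.trunc V))"
proof -
  show "is_graded_rep G V" "is_graded_rep H V'" "H.trunc V' = fobj F (G.trunc V)"
    "\<And>A. is_rep G A \<Longrightarrow> lifts (G.trunc V) A A (G.trunc V) (G.hb (rdim V) (G.proj V) A) (H.hb (rdim V') (H.proj V') (fobj F A))"
    using assms by (simp_all add: matches_def)
  then show "rdim V' = rdim (fobj F (G.trunc V))" "ract V' = ract (fobj F (G.trunc V))"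
    by (metis H.trunc_sel)+
qed

lemma reg_iso:
  obtains A u v where "is_rep G A" "inverse_mor (Rep H) (fobj F A) H.reg u v"
proof -
  have "H.reg \<in> obj (Rep H)"
    using H.reg_rep by simp
  then obtain X u where "X \<in> obj (Rep G)" "iso_mor (Rep H) (fobj F X) H.reg u"
    by (rule ess_surj)
  then show thesis
    using that by (auto simp: iso_mor_def)
qed

text \<open>The half braidings of the two candidates agree on every \<open>F A\<close>, in
  particular on one isomorphic to the regular representation, and that one determines the
  grading.\<close>

lemma matches_unique:
  assumes "matches V V'" "matches V V''"
  shows "V' = V''"
proof -
  note m = matchesD[OF assms(1)] and m' = matchesD[OF assms(2)]
  obtain A u v where A: "is_rep G A" and uv: "inverse_mor (Rep H) (fobj F A) H.reg u v"
    by (rule reg_iso)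
  have V: "G.trunc V \<in> obj (Rep G)" and A': "A \<in> obj (Rep G)"
    using m(1) A by simp_all
  note L = liftsD[OF m(4)[OF A] V A' A' V] and L' = liftsD[OF m'(4)[OF A] V A' A' V]
  have "J A (G.trunc V) * H.hb (rdim V') (H.proj V') (fobj F A) = J A (G.trunc V) * H.hb (rdim V'') (H.proj V'') (fobj F A)"
    using L(2) L'(2) by simp
  then have 1: "H.hb (rdim V') (H.proj V') (fobj F A) = H.hb (rdim V'') (H.proj V'') (fobj F A)"
    by (rule mat_left_cancel[OF _ J_facts(3)[OF A' V]]) (use L L' J_facts[OF A' V] in auto)
  note P = H.proj_familyD(2)[OF H.proj_facts(2)[OF m(2)]] and Q = H.proj_familyD(2)[OF H.proj_facts(2)[OF m'(2)]]
  have e: "rdim V' = rdim V''" "ract V' = ract V''"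
    using m(5,6) m'(5,6) by simp_all
  show ?thesis
  proof (rule H.graded_rep_eqI[OF m(2) m'(2) e])
    show "H.hb (rdim V') (H.proj V') H.reg = H.hb (rdim V') (H.proj V'') H.reg"
      using H.hb_iso[OF F_rep[OF A] H.reg_rep uv P] H.hb_iso[OF F_rep[OF A] H.reg_rep uv Q] 1 e by simp
  qed
qed

text \<open>The half braiding is transported to the image, where
  \<open>half_braiding_proj_family\<close> turns it into a grading.\<close>

lemma matches_exists:
  assumes V: "is_graded_rep G V"
  shows "\<exists>V'. matches V V'"
proof -
  let ?X = "G.trunc V" and ?n = "rdim (fobj F (G.trunc V))"
  note fV = G.proj_facts[OF V]
  have X: "?X \<in> obj (Rep G)" "is_rep G ?X"
    using fV(1) by simp_all
  have "G.half_braiding ?X (G.hb (rdim ?X) (G.proj V))"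
    by (rule G.half_braiding_hb[OF X(2)]) (use fV(2) in simp)
  then have "C.half_braid ?X (G.hb (rdim V) (G.proj V))"
    by (simp add: G.half_braiding_iff[OF X(2)])
  then obtain \<tau> where \<tau>: "D.half_braid (fobj F ?X) \<tau>"
      "\<And>A. A \<in> obj (Rep G) \<Longrightarrow> lifts ?X A A ?X (G.hb (rdim V) (G.proj V) A) (\<tau> (fobj F A))"
    using half_braid_transport[OF X(1)] by blast
  have FX: "is_rep H (fobj F ?X)"
    using X by simp
  from \<tau>(1) have "H.half_braiding (fobj F ?X) \<tau>"
    by (simp add: H.half_braiding_iff[OF FX])
  then obtain P where P: "H.proj_family (fobj F ?X) P" "\<And>W. is_rep H W \<Longrightarrow> \<tau> W = H.hb ?n P W"
    using H.half_braiding_proj_family[OF FX] by blast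
  define V' where "V' = H.graded ?n (ract (fobj F ?X)) P"
  have V': "is_graded_rep H V'" "H.proj V' = P"
    unfolding V'_def by (rule H.graded_facts[OF FX P(1)]; simp)+
  have "matches V V'"
    unfolding matches_def V'(2) using V V'(1) \<tau>(2) P(2) by (simp add: V'_def H.trunc_def)
  then show ?thesis
    by blast
qed

text \<open>\<open>Y\<close> is first moved to a graded object whose underlying representation is
  exactly an image under \<open>F\<close>; its half braiding can then be reflected.\<close>

lemma matches_surj:
  assumes Y: "is_graded_rep H Y"
  shows "\<exists>V Y' u. matches V Y' \<and> iso_mor (RepD H) Y' Y u"
proof -
  have "H.trunc Y \<in> obj (Rep H)"
    using Y by simp
  then obtain X u v where X: "X \<in> obj (Rep G)" and uv: "inverse_mor (Rep H) (fobj F X) (H.trunc Y) u v"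
    using ess_surj by (metis iso_mor_def)
  then have rX: "is_rep G X" "is_rep H (fobj F X)"
    by simp_all
  obtain Z where Z: "is_graded_rep H Z" "H.trunc Z = fobj F X" "iso_mor (RepD H) Z Y u"
    using H.grading_pullback[OF Y rX(2) uv] by blast
  have dZ: "rdim Z = rdim (fobj F X)"
    using Z(2) by (metis H.trunc_sel(1))
  have pZ: "H.proj_family (fobj F X) (H.proj Z)"
    using H.proj_facts(2)[OF Z(1)] H.proj_family_trunc[of Z "H.proj Z"] Z(2) by simp
  have "D.half_braid (fobj F X) (H.hb (rdim Z) (H.proj Z))"
    using H.half_braiding_hb[OF rX(2) pZ] by (simp add: H.half_braiding_iff[OF rX(2)] dZ)
  then obtain \<sigma> where \<sigma>: "C.half_braid X \<sigma>"
      "\<And>A. A \<in> obj (Rep G) \<Longrightarrow> lifts X A A X (\<sigma> A) (H.hb (rdim Z) (H.proj Z) (fobj F A))"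
    using half_braid_reflect[OF X] by blast
  from \<sigma>(1) have "G.half_braiding X \<sigma>"
    by (simp add: G.half_braiding_iff[OF rX(1)])
  then obtain Q where Q: "G.proj_family X Q" "\<And>W. is_rep G W \<Longrightarrow> \<sigma> W = G.hb (rdim X) Q W"
    using G.half_braiding_proj_family[OF rX(1)] by blast
  define V where "V = G.graded (rdim X) (ract X) Q"
  have V: "is_graded_rep G V" "G.proj V = Q"
    unfolding V_def by (rule G.graded_facts[OF rX(1) Q(1)]; simp)+
  have tV: "G.trunc V = X" "rdim V = rdim X"
    by (simp_all add: V_def G.trunc_def)
  have "matches V Z"
    unfolding matches_def V(2) tV using V(1) Z \<sigma>(2) Q(2) by simp
  then show ?thesis
    using Z(3) by blast
qed

text \<open>By \<open>lifts_mor\<close>, commuting with half braidings is equivalent on the two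
  sides for each test object \<open>A\<close>. A preimage of the regular representation of
  \<open>H\<close> serves one direction, the regular representation of \<open>G\<close> the
  other.\<close>

lemma matches_mor_iff:
  assumes V: "matches V V'" and W: "matches W W'" and f: "f \<in> intertwiners G V W"
  shows "f \<in> mor (RepD G) V W \<longleftrightarrow> fmor F (G.trunc V) (G.trunc W) f \<in> mor (RepD H) V' W'"
proof -
  note mV = matchesD[OF V] and mW = matchesD[OF W]
  have obj: "G.trunc V \<in> obj (Rep G)" "G.trunc W \<in> obj (Rep G)"
    using mV(1) mW(1) by simp_all
  let ?f = "fmor F (G.trunc V) (G.trunc W) f"
  have f': "f \<in> mor (Rep G) (G.trunc V) (G.trunc W)"
    using f by (simp add: mor_eq)
  have Ff: "?f \<in> intertwiners H V' W'"
    using fmor_closed[OF obj f'] mV(3) mW(3) H.intertwiners_trunc[of V' W'] by (simp add: mor_eq)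
  have key: "(1\<^sub>m (rdim A) ** f) * G.hb (rdim V) (G.proj V) A = G.hb (rdim W) (G.proj W) A * (f ** 1\<^sub>m (rdim A)) \<longleftrightarrow>
      (1\<^sub>m (rdim (fobj F A)) ** ?f) * H.hb (rdim V') (H.proj V') (fobj F A)
        = H.hb (rdim W') (H.proj W') (fobj F A) * (?f ** 1\<^sub>m (rdim (fobj F A)))" if A: "is_rep G A" for A
    by (rule lifts_mor[OF mV(4)[OF A] mW(4)[OF A] obj _ f']) (use A in simp)
  show ?thesis
  proof
    assume m: "f \<in> mor (RepD G) V W"
    obtain A u v where A: "is_rep G A" and uv: "inverse_mor (Rep H) (fobj F A) H.reg u v"
      by (rule reg_iso)
    show "?f \<in> mor (RepD H) V' W'"
      by (rule H.mor_hb_isoI[OF mV(2) mW(2) Ff F_rep[OF A] uv]) (use key[OF A] G.mor_hb[OF mV(1) mW(1) m A] in blast)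
  next
    assume m: "?f \<in> mor (RepD H) V' W'"
    show "f \<in> mor (RepD G) V W"
      by (rule G.mor_hbI[OF mV(1) mW(1) f])
        (use key[OF G.reg_rep] H.mor_hb[OF mV(2) mW(2) m F_rep[OF G.reg_rep]] in simp)
  qed
qed

text \<open>The half braidings on both sides are composites of those of the factors, and
  \<open>lifts_hexagon'\<close> says that \<open>J\<close> carries one composite to the
  other.\<close>

lemma matches_tensor:
  assumes V: "matches V V'" and W: "matches W W'" and U: "matches (teno (RepD G) V W) U"
  shows "J (G.trunc V) (G.trunc W) \<in> mor (RepD H) (teno (RepD H) V' W') U"
proof -
  note mV = matchesD[OF V] and mW = matchesD[OF W] and mU = matchesD[OF U]
  let ?X = "G.trunc V" and ?Y = "G.trunc W"
  let ?J = "J ?X ?Y"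
  have obj: "?X \<in> obj (Rep G)" "?Y \<in> obj (Rep G)"
    using mV(1) mW(1) by simp_all
  note T = H.RepD_tensor[OF mV(2) mW(2)]
  have Ji: "?J \<in> intertwiners H (teno (RepD H) V' W') U"
    using J_facts(1)[OF obj] mU(3) mV(3) mW(3) H.intertwiners_trunc[of "teno (RepD H) V' W'" U] by (simp add: mor_eq)
  obtain A u v where A: "is_rep G A" and uv: "inverse_mor (Rep H) (fobj F A) H.reg u v"
    by (rule reg_iso)
  have A': "A \<in> obj (Rep G)"
    using A by simp
  show ?thesis
  proof (rule H.mor_hb_isoI[OF T(1) mU(2) Ji F_rep[OF A] uv])
    let ?A = "fobj F A"
    let ?s = "H.hb (rdim V') (H.proj V') ?A" and ?t = "H.hb (rdim W') (H.proj W') ?A" and ?r = "H.hb (rdim U) (H.proj U) ?A"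
    let ?T = "(?s ** 1\<^sub>m (rdim W')) * (1\<^sub>m (rdim V') ** ?t)"
    have XY: "teno (Rep G) ?X ?Y \<in> obj (Rep G)"
      using C.ten_obj[OF obj] .
    have lU: "lifts (teno (Rep G) ?X ?Y) A A (teno (Rep G) ?X ?Y) (G.hb (rdim (teno (RepD G) V W)) (G.proj (teno (RepD G) V W)) A) ?r"
      using mU(4)[OF A] by simp
    have GT: "G.hb (rdim (teno (RepD G) V W)) (G.proj (teno (RepD G) V W)) A
        = (G.hb (rdim V) (G.proj V) A ** 1\<^sub>m (rdim ?Y)) * (1\<^sub>m (rdim ?X) ** G.hb (rdim W) (G.proj W) A)"
      using G.RepD_tensor(2)[OF mV(1) mW(1) A] by simp
    note L = liftsD[OF lU XY A' A' XY]
    note j = J_facts[OF A' XY] J_facts[OF XY A'] J_facts[OF obj] mV(5) mW(5)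
    have dr: "rdim U = rdim (fobj F (teno (Rep G) ?X ?Y))"
      using mU(5) by simp
    have "J A (teno (Rep G) ?X ?Y) * ((1\<^sub>m (rdim ?A) ** ?J) * ?T) = J3 A ?X ?Y * ?T"
      using j J3_facts(1)[OF A' obj] by (simp add: mat_mult_assoc)
    also have "\<dots> = fmor F (teno (Rep G) (teno (Rep G) ?X ?Y) A) (teno (Rep G) A (teno (Rep G) ?X ?Y))
        ((G.hb (rdim V) (G.proj V) A ** 1\<^sub>m (rdim ?Y)) * (1\<^sub>m (rdim ?X) ** G.hb (rdim W) (G.proj W) A)) * J3 ?X ?Y A"
      using lifts_hexagon'[OF mV(4)[OF A] mW(4)[OF A] obj A'] j by simp
    also have "\<dots> = J A (teno (Rep G) ?X ?Y) * (?r * (?J ** 1\<^sub>m (rdim ?A)))"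
      unfolding GT[symmetric] J3_def
      by (rule mat_assoc_eq[OF L(2)]) (use j L dr in auto)
    finally have "(1\<^sub>m (rdim ?A) ** ?J) * ?T = ?r * (?J ** 1\<^sub>m (rdim ?A))"
      by (rule mat_left_cancel[OF _ J_facts(3)[OF A' XY]]) (use j dr in auto)
    then show "(1\<^sub>m (rdim ?A) ** ?J) * H.hb (rdim (teno (RepD H) V' W')) (H.proj (teno (RepD H) V' W')) ?A
        = ?r * (?J ** 1\<^sub>m (rdim ?A))"
      using T(2)[OF F_rep[OF A]] by simp
  qed
qed

text \<open>Half braidings on unit objects are identities, so compatibility of \<open>e\<close>
  reduces to the unit axioms of \<open>J\<close>.\<close>

lemma matches_unit:
  assumes I: "matches (unito (RepD G)) I"
  shows "e \<in> mor (RepD H) (unito (RepD H)) I"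
proof -
  note mI = matchesD[OF I]
  have eI: "e \<in> intertwiners H (unito (RepD H)) I"
    using e_facts(1) mI(3) H.intertwiners_trunc[of "unito (RepD H)" I] by (simp add: mor_eq)
  obtain A u v where A: "is_rep G A" and uv: "inverse_mor (Rep H) (fobj F A) H.reg u v"
    by (rule reg_iso)
  have A': "A \<in> obj (Rep G)"
    using A by simp
  show ?thesis
  proof (rule H.mor_hb_isoI[OF H.RepD_unit(1) mI(2) eI F_rep[OF A] uv])
    let ?A = "fobj F A" and ?U = "unito (Rep G)"
    let ?r = "H.hb (rdim I) (H.proj I) ?A"
    have l: "lifts ?U A A ?U (1\<^sub>m (rdim A)) ?r"
      using mI(4)[OF A] G.hb_RepD_unit[OF A] by simp
    note L = liftsD[OF l C.unit_obj A' A' C.unit_obj]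
    note j = J_facts[OF A' C.unit_obj] J_facts[OF C.unit_obj A'] e_facts
    have dr: "rdim I = rdim (fobj F ?U)"
      using mI(5) by simp
    have "J A ?U * (?r * (e ** 1\<^sub>m (rdim ?A))) = fmor F (teno (Rep G) ?U A) (teno (Rep G) A ?U) (1\<^sub>m (rdim A)) * (J ?U A * (e ** 1\<^sub>m (rdim ?A)))"
      by (rule mat_assoc_eq[OF L(2)[symmetric]]) (use L j dr in auto)
    also have "\<dots> = J A ?U * (1\<^sub>m (rdim ?A) ** e)"
      using A' by (simp add: J_unit_left(1)[OF A'] J_unit_right(1)[OF A'] del: obj_iff)
    finally have "?r * (e ** 1\<^sub>m (rdim ?A)) = 1\<^sub>m (rdim ?A) ** e"
      by (rule mat_left_cancel[OF _ J_facts(3)[OF A' C.unit_obj]]) (use j dr in auto)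
    then show "(1\<^sub>m (rdim ?A) ** e) * H.hb (rdim (unito (RepD H))) (H.proj (unito (RepD H))) ?A = ?r * (e ** 1\<^sub>m (rdim ?A))"
      using H.hb_RepD_unit[OF F_rep[OF A]] j by simp
  qed
qed

text \<open>The braiding with \<open>W\<close> is the half braiding tested at the underlying
  representation of \<open>W\<close>, so the equation is an instance of
  \<open>matches\<close>.\<close>

lemma matches_braid:
  assumes V: "matches V V'" and W: "matches W W'"
  shows "fmor F (teno (Rep G) (G.trunc V) (G.trunc W)) (teno (Rep G) (G.trunc W) (G.trunc V)) (double_braiding G V W)
      * J (G.trunc V) (G.trunc W) = J (G.trunc W) (G.trunc V) * double_braiding H V' W'"
proof -
  note mV = matchesD[OF V] and mW = matchesD[OF W]
  have rW: "is_rep G (G.trunc W)"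
    using mW(1) by simp
  have "double_braiding G V W = G.hb (rdim V) (G.proj V) (G.trunc W)"
    using G.double_braiding_eq[OF mV(1) mW(1)] by simp
  moreover have "double_braiding H V' W' = H.hb (rdim V') (H.proj V') (fobj F (G.trunc W))"
    using H.double_braiding_eq[OF mV(2) mW(2)] H.hb_trunc[of _ _ W'] mW(3) by simp
  ultimately show ?thesis
    using mV(4)[OF rW] by (simp add: lifts_def)
qed

text \<open>On morphisms this is literally \<open>F\<close>, so functoriality and coherence are
  inherited; only the grading on objects is new.\<close>

definition \<Phi> :: "('a graded_rep, complex mat, 'b graded_rep, complex mat) funct" where
  "\<Phi> = \<lparr>fobj = (\<lambda>V. SOME V'. matches V V'), fmor = (\<lambda>V W. fmor F (G.trunc V) (G.trunc W))\<rparr>"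

lemma \<Phi>_matches: "is_graded_rep G V \<Longrightarrow> matches V (fobj \<Phi> V)"
  unfolding \<Phi>_def using someI_ex[OF matches_exists] by simp

lemma \<Phi>_fmor [simp]: "fmor \<Phi> V W = fmor F (G.trunc V) (G.trunc W)"
  by (simp add: \<Phi>_def)

definition J\<Phi> :: "'a graded_rep \<Rightarrow> 'a graded_rep \<Rightarrow> complex mat" where
  "J\<Phi> V W = J (G.trunc V) (G.trunc W)"

lemma \<Phi>_braided: "is_linear_braided_functor (RepD G) (RepD H) \<Phi> J\<Phi> e"
proof -
  interpret DG: matcat "RepD G" rdim
    by (rule G.matcat_RepD)
  interpret DH: matcat "RepD H" rdim
    by (rule H.matcat_RepD)
  have gr: "is_graded_rep H (fobj \<Phi> V)" and dm: "rdim (fobj \<Phi> V) = rdim (fobj F (G.trunc V))" if "is_graded_rep G V" for V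
    using matchesD(2,5)[OF \<Phi>_matches[OF that]] by auto
  have mor: "f \<in> mor (Rep G) (G.trunc V) (G.trunc W)" if "f \<in> mor (RepD G) V W" for f V W
    using G.mor_intertwiner[OF that] by (simp add: mor_eq)
  have ob: "G.trunc V \<in> obj (Rep G)" if "is_graded_rep G V" for V
    using that by simp
  have Fc: "fmor F (G.trunc V) (G.trunc W) f \<in> mor (RepD H) (fobj \<Phi> V) (fobj \<Phi> W)"
    if "is_graded_rep G V" "is_graded_rep G W" "f \<in> mor (RepD G) V W" for V W f
    using matches_mor_iff[OF \<Phi>_matches[OF that(1)] \<Phi>_matches[OF that(2)] G.mor_intertwiner[OF that(3)]] that(3) by simp
  have inv: "iso_mor (RepD H) V W A"
    if "is_graded_rep H V" "is_graded_rep H W" "A \<in> mor (RepD H) V W" "dim_row B = rdim V" "dim_col B = rdim W"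
      "B * A = 1\<^sub>m (rdim V)" "A * B = 1\<^sub>m (rdim W)" for V W A B
    using H.inverse_mor_RepD[OF that(1-3), of B] that by (auto simp: iso_mor_def DH.inverse_mor_iff carrier_mat_iff simp del: carrier_matD)
  show ?thesis
  proof (unfold_locales, goal_cases)
    case (1 V)
    then show ?case
      using gr by simp
  next
    case (2 V W f)
    then show ?case
      using Fc by simp
  next
    case (3 V)
    then show ?case
      using fmor_one[of "G.trunc V"] dm by simp
  next
    case (4 U V W f g)
    then show ?case
      using fmor_mult[OF ob ob ob mor mor, of U V W f g] by simp
  next
    case (5 V W f g)
    then show ?case
      using fmor_plus[OF ob ob mor mor, of V W f g] by simp
  next
    case (6 V W f a)
    then show ?case
      using fmor_scale[OF ob ob mor, of V W f a] by simp
  next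
    case (7 V W)
    then have V: "is_graded_rep G V" and W: "is_graded_rep G W"
      by simp_all
    have VW: "is_graded_rep G (teno (RepD G) V W)"
      using G.RepD_tensor(1)[OF V W] .
    show ?case
      unfolding J\<Phi>_def
      by (rule inv[of _ _ _ "Ji (G.trunc V) (G.trunc W)"])
        (use matches_tensor[OF \<Phi>_matches[OF V] \<Phi>_matches[OF W] \<Phi>_matches[OF VW]] H.RepD_tensor(1)[OF gr[OF V] gr[OF W]]
          gr[OF VW] dm[OF V] dm[OF W] dm[OF VW] J_facts[OF ob[OF V] ob[OF W]] in simp_all)
  next
    case 8
    show ?case
      by (rule inv[of _ _ _ ei])
        (use matches_unit[OF \<Phi>_matches[OF G.RepD_unit(1)]] H.RepD_unit(1) gr[OF G.RepD_unit(1)] dm[OF G.RepD_unit(1)] e_facts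
          in simp_all)
  next
    case (9 V V' W W' f g)
    then show ?case
      using J_nat[OF ob ob ob ob mor mor, of V V' W W' f g] by (simp add: J\<Phi>_def)
  next
    case (10 U V W)
    then have U: "is_graded_rep G U" and V: "is_graded_rep G V" and W: "is_graded_rep G W"
      by simp_all
    then show ?case
      using J_assoc[OF ob[OF U] ob[OF V] ob[OF W]] by (simp add: J\<Phi>_def dm)
  next
    case (11 V)
    then show ?case
      using J_lunit[OF ob, of V] by (simp add: J\<Phi>_def dm)
  next
    case (12 V)
    then show ?case
      using J_runit[OF ob, of V] by (simp add: J\<Phi>_def dm)
  next
    case (13 V W)
    then show ?case
      using matches_braid[OF \<Phi>_matches \<Phi>_matches, of V W] by (simp add: J\<Phi>_def)
  qed
qed

text \<open>Faithfulness is that of \<open>F\<close>. For fullness, a lift through \<open>F\<close>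
  respects the gradings by \<open>matches_mor_iff\<close>. For essential surjectivity,
  \<open>matches_unique\<close> recognises the object found by \<open>matches_surj\<close> as a
  value of the functor.\<close>

lemma \<Phi>_equivalence: "equivalence_functor (RepD G) (RepD H) \<Phi>"
proof -
  interpret DG: matcat "RepD G" rdim
    by (rule G.matcat_RepD)
  interpret DH: matcat "RepD H" rdim
    by (rule H.matcat_RepD)
  interpret P: matcat_pair "RepD G" rdim "RepD H" rdim ..
  interpret \<Phi>: is_linear_braided_functor "RepD G" "RepD H" \<Phi> J\<Phi> e
    by (rule \<Phi>_braided)
  have ob: "G.trunc V \<in> obj (Rep G)" if "is_graded_rep G V" for V
    using that by simp
  show ?thesis
  proof (rule P.equivalence_functorI)
    show "is_functor (RepD G) (RepD H) \<Phi>" ..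
    show "f = g" if "V \<in> obj (RepD G)" "W \<in> obj (RepD G)" "f \<in> mor (RepD G) V W" "g \<in> mor (RepD G) V W"
      "fmor \<Phi> V W f = fmor \<Phi> V W g" for V W f g
    proof -
      have V: "is_graded_rep G V" and W: "is_graded_rep G W"
        using that by simp_all
      have "f \<in> mor (Rep G) (G.trunc V) (G.trunc W)" "g \<in> mor (Rep G) (G.trunc V) (G.trunc W)"
        using G.mor_intertwiner[OF that(3)] G.mor_intertwiner[OF that(4)] by (simp_all add: mor_eq)
      from faithful[OF ob[OF V] ob[OF W] this] show ?thesis
        using that(5) by simp
    qed
    show "\<exists>f\<in>mor (RepD G) V W. fmor \<Phi> V W f = g"
      if "V \<in> obj (RepD G)" "W \<in> obj (RepD G)" and g: "g \<in> mor (RepD H) (fobj \<Phi> V) (fobj \<Phi> W)" for V W g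
    proof -
      have V: "is_graded_rep G V" and W: "is_graded_rep G W"
        using that by simp_all
      note mV = \<Phi>_matches[OF V] and mW = \<Phi>_matches[OF W]
      have "g \<in> mor (Rep H) (fobj F (G.trunc V)) (fobj F (G.trunc W))"
        using H.mor_intertwiner[OF g] matchesD(3)[OF mV] matchesD(3)[OF mW]
          H.intertwiners_trunc[of "fobj \<Phi> V" "fobj \<Phi> W"] by (simp add: mor_eq)
      then obtain f where f: "f \<in> mor (Rep G) (G.trunc V) (G.trunc W)" "fmor F (G.trunc V) (G.trunc W) f = g"
        using full[OF ob[OF V] ob[OF W]] by blast
      then have "f \<in> mor (RepD G) V W"
        using matches_mor_iff[OF mV mW, of f] g by (simp add: mor_eq)
      then show ?thesis
        using f(2) by (intro bexI[of _ f]) simp_all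
    qed
    show "\<exists>V\<in>obj (RepD G). \<exists>u. iso_mor (RepD H) (fobj \<Phi> V) Y u" if "Y \<in> obj (RepD H)" for Y
    proof -
      have "is_graded_rep H Y"
        using that by simp
      then obtain V Y' u where m: "matches V Y'" "iso_mor (RepD H) Y' Y u"
        using matches_surj by blast
      then have "fobj \<Phi> V = Y'" "V \<in> obj (RepD G)"
        using matches_unique[OF \<Phi>_matches m(1)] matchesD(1)[OF m(1)] by simp_all
      then show ?thesis
        using m(2) by blast
    qed
  qed
qed

theorem RepD_braided_equivalent: "braided_equivalent (RepD G) (RepD H)"
  unfolding braided_equivalent_def using \<Phi>_braided \<Phi>_equivalence by blast

theorem Witt_RepD_iso: "Witt (RepD G) \<cong> Witt (RepD H)"
proof -
  interpret WG: witt_matcat "RepD G" rdim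
    by (rule G.witt_matcat_RepD)
  interpret WH: witt_matcat "RepD H" rdim
    by (rule H.witt_matcat_RepD)
  interpret \<Phi>: is_linear_braided_functor "RepD G" "RepD H" \<Phi> J\<Phi> e
    by (rule \<Phi>_braided)
  have "witt_equivalence (RepD G) rdim (RepD H) rdim \<Phi> J\<Phi> e"
    by unfold_locales (use \<Phi>_equivalence \<Phi>.J_braid in auto)
  then show ?thesis
    by (rule witt_equivalence.Witt_iso)
qed

end

theorem mainTheorem2:
  fixes G :: "('a, 'c) monoid_scheme" and H :: "('b, 'd) monoid_scheme"
  assumes "group G" and "finite (carrier G)"
    and "group H" and "finite (carrier H)"
    and "isocategorical G H"
  shows "braided_equivalent (RepD G) (RepD H) \<and> Witt (RepD G) \<cong> Witt (RepD H)"
proof -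
  interpret G: finite_group G
    by (rule finite_group.intro) (use assms in \<open>auto simp: finite_group_axioms_def\<close>)
  interpret H: finite_group H
    by (rule finite_group.intro) (use assms in \<open>auto simp: finite_group_axioms_def\<close>)
  obtain F J e where F: "is_linear_monoidal_functor (Rep G) (Rep H) F J e" "equivalence_functor (Rep G) (Rep H) F"
    using assms(5) by (auto simp: isocategorical_def monoidally_equivalent_def)
  interpret is_linear_monoidal_functor "Rep G" "Rep H" F J e
    by (rule F(1))
  interpret CG: matcat "Rep G" rdim
    by (rule G.matcat_Rep)
  interpret CH: matcat "Rep H" rdim
    by (rule H.matcat_Rep)
  interpret rep_equivalence G H F J e
    by unfold_locales (rule F(2))
  show ?thesis
    using RepD_braided_equivalent Witt_RepD_iso by blast
qed

end
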